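(* Let $\Lambda_1$ and $\Lambda_2$ be $\mathbb{Z}$-orders in finite-dimensional commutative semisimple $\mathbb{Q}$-algebras $\mathbb{Q}\Lambda_1$ and $\mathbb{Q}\Lambda_2$, respectively. Suppose that $\Lambda_1$ and $\Lambda_2$ are locally coprime, i.e. for every rational prime $p$, either $\mathbb{Z}_p\Lambda_1$ is a maximal order in $\mathbb{Q}_p\Lambda_1$ or $\mathbb{Z}_p\Lambda_2$ is a maximal order in $\mathbb{Q}_p\Lambda_2$. For $i=1,2$ let $\Gamma_i = \bigoplus_{j=1}^{h_i} R_{ij}$ be the maximal order of $\mathbb{Q}\Lambda_i$ containing $\Lambda_i$, where $R_{ij}$ is the ring of integers of the number field $F_{ij}$ that is the $j$-th simple component of $\mathbb{Q}\Lambda_i$. For a rational prime $p$, let $\mathcal{P}_{ij1},\dots,\mathcal{P}_{ijg_{ij}}$ be the distinct primes of $F_{ij}$ lying above $p$ and let $R_{ijk}$ be the completion of $R_{ij}$ at $\mathcal{P}_{ijk}$, for $k=1,\dots,g_{ij}$ (so $g_{ij}$ and $R_{ijk}$ depend on $p$). Let $B_i$ be the set of rational primes $p$ for which $\mathbb{Z}_p\Lambda_i \neq \mathbb{Z}_p\Gamma_i$, for $i=1,2$. Then $$ \zeta_{\Lambda_1 \otimes_{\mathbb{Z}} \Lambda_2}(s) = \zeta_{\Gamma_1 \otimes_{\mathbb{Z}} \Gamma_2}(s)\, \delta_{B_1}(s)\, \delta_{B_2}(s), $$ where $$ \delta_{B_1}(s) = \prod_{p \in B_1} \prod_{j=1}^{h_2}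 \prod_{k=1}^{g_{2j}} \frac{\zeta_{R_{2jk}\Lambda_1}(s)}{\zeta_{R_{2jk}\Gamma_1}(s)} \quad\text{and}\quad \delta_{B_2}(s) = \prod_{p \in B_2} \prod_{j=1}^{h_1} \prod_{k=1}^{g_{1j}} \frac{\zeta_{R_{1jk}\Lambda_2}(s)}{\zeta_{R_{1jk}\Gamma_2}(s)}. $$
   Context: For a ring $\Lambda$ that is an order over $\mathbb{Z}$, or over the ring of integers of a $p$-adic field (finite extension of $\mathbb{Q}_p$), the (Solomon) zeta function of $\Lambda$ is $$\zeta_\Lambda(s)=\sum_{I}\,(\Lambda:I)^{-s},$$ where $I$ runs over all left ideals of $\Lambda$ of finite index $(\Lambda:I)$ (equivalently, full $\Lambda$-sublattices of the regular left module). Equivalently $\zeta_\Lambda(s)=\sum_{n\ge 1}a_n n^{-s}$, with $a_n$ the number of left ideals of index $n$. Identities between zeta functions are understood for complex $s$ with sufficiently large real part, where the series converge. Notation: for a $\mathbb{Z}$-order $\Lambda$ and a commutative ring $\mathcal{R}$, $\mathcal{R}\Lambda$ denotes $\mathcal{R}\otimes_{\mathbb{Z}}\Lambda$. In particular $\mathbb{Z}_p\Lambda=\mathbb{Z}_p\otimes_{\mathbb{Z}}\Lambda$ with $\mathbb{Z}_p$ the ring of $p$-adic integers, and $\mathbb{Q}_p\Lambda=\mathbb{Q}_p\otimes_{\mathbb{Z}}\Lambda$. *)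

theory Defs
  imports
    "HOL-Algebra.Module"
    "HOL-Algebra.QuotRing"
    "HOL-Algebra.Ideal_Product"
    "HOL-Algebra.Subrings"
    "HOL-Algebra.IntRing"
    "HOL-Algebra.Algebraic_Closure_Type"
    "HOL-Library.Poly_Mapping"
    "HOL-Computational_Algebra.Polynomial"
    "HOL-Computational_Algebra.Primes"
    "HOL-Analysis.Complex_Transcendental"
    "HOL-Analysis.Infinite_Sum"
begin

section \<open>Zeta functions\<close>

text \<open>
  Only commutative rings occur below, so left ideals are the same as ideals.
  The sum is unordered; for complex-valued families summability is absolute summability.
\<close>

definition finite_index_ideals :: "('a, 'm) ring_scheme \<Rightarrow> 'a set set" where
  "finite_index_ideals R = {I. ideal I R \<and> finite (a_rcosets\<^bsub>R\<^esub> I)}"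

definition zeta_term :: "('a, 'm) ring_scheme \<Rightarrow> complex \<Rightarrow> 'a set \<Rightarrow> complex" where
  "zeta_term R s I = of_nat (card (a_rcosets\<^bsub>R\<^esub> I)) powr (- s)"

definition zeta_converges :: "('a, 'm) ring_scheme \<Rightarrow> complex \<Rightarrow> bool" where
  "zeta_converges R s \<longleftrightarrow> zeta_term R s summable_on finite_index_ideals R"

definition zeta :: "('a, 'm) ring_scheme \<Rightarrow> complex \<Rightarrow> complex" where
  "zeta R s = infsum (zeta_term R s) (finite_index_ideals R)"

section \<open>Tensor products over the integers\<close>

text \<open>
  The monoid ring over the integers of the multiplicative monoid of pairs in
  \<open>R \<times> S\<close>. The relations below are permuted, up to relations, by multiplication with pairs,
  so the ideal they generate is the additive subgroup they generate, and the quotient is the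
  usual tensor product of abelian groups with \<open>(r \<otimes> s)(r' \<otimes> s') = rr' \<otimes> ss'\<close>.
\<close>

definition pair_monoid_ring ::
    "('a, 'm) ring_scheme \<Rightarrow> ('b, 'n) ring_scheme \<Rightarrow> ('a \<times> 'b \<Rightarrow>\<^sub>0 int) ring" where
  "pair_monoid_ring R S =
    \<lparr>carrier = {x. Poly_Mapping.keys x \<subseteq> carrier R \<times> carrier S},
     monoid.mult = (\<lambda>x y. frag_extend (\<lambda>(a, b).
       frag_extend (\<lambda>(c, d). frag_of (a \<otimes>\<^bsub>R\<^esub> c, b \<otimes>\<^bsub>S\<^esub> d)) y) x),
     one = frag_of (\<one>\<^bsub>R\<^esub>, \<one>\<^bsub>S\<^esub>), zero = 0, add = (+)\<rparr>"

definition tensor_relations ::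
    "('a, 'm) ring_scheme \<Rightarrow> ('b, 'n) ring_scheme \<Rightarrow> ('a \<times> 'b \<Rightarrow>\<^sub>0 int) set" where
  "tensor_relations R S =
    {frag_of (a \<oplus>\<^bsub>R\<^esub> a', b) - frag_of (a, b) - frag_of (a', b) | a a' b.
       a \<in> carrier R \<and> a' \<in> carrier R \<and> b \<in> carrier S} \<union>
    {frag_of (a, b \<oplus>\<^bsub>S\<^esub> b') - frag_of (a, b) - frag_of (a, b') | a b b'.
       a \<in> carrier R \<and> b \<in> carrier S \<and> b' \<in> carrier S}"

definition tensor_ideal ::
    "('a, 'm) ring_scheme \<Rightarrow> ('b, 'n) ring_scheme \<Rightarrow> ('a \<times> 'b \<Rightarrow>\<^sub>0 int) set" where
  "tensor_ideal R S = Idl\<^bsub>pair_monoid_ring R S\<^esub> (tensor_relations R S)"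

definition tensor ::
    "('a, 'm) ring_scheme \<Rightarrow> ('b, 'n) ring_scheme \<Rightarrow> ('a \<times> 'b \<Rightarrow>\<^sub>0 int) set ring" where
  "tensor R S = pair_monoid_ring R S Quot tensor_ideal R S"

definition pure_tensor ::
    "('a, 'm) ring_scheme \<Rightarrow> ('b, 'n) ring_scheme \<Rightarrow> 'a \<Rightarrow> 'b \<Rightarrow> ('a \<times> 'b \<Rightarrow>\<^sub>0 int) set" where
  "pure_tensor R S a b = tensor_ideal R S +>\<^bsub>pair_monoid_ring R S\<^esub> frag_of (a, b)"

text \<open>The tensor product \<open>K \<otimes> S\<close>, regarded as a \<open>K\<close>-algebra.\<close>

definition base_change ::
    "('k, 'm) ring_scheme \<Rightarrow> ('b, 'n) ring_scheme \<Rightarrow> ('k, ('k \<times> 'b \<Rightarrow>\<^sub>0 int) set) module" where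
  "base_change K S =
    \<lparr>carrier = carrier (tensor K S), monoid.mult = monoid.mult (tensor K S), one = one (tensor K S),
     zero = zero (tensor K S), add = add (tensor K S),
     module.smult = (\<lambda>k x. pure_tensor K S k \<one>\<^bsub>S\<^esub> \<otimes>\<^bsub>tensor K S\<^esub> x)\<rparr>"

section \<open>Orders\<close>

definition lin_span ::
    "('k, 'm) ring_scheme \<Rightarrow> ('k, 'a, 'n) module_scheme \<Rightarrow> 'a set \<Rightarrow> 'a set" where
  "lin_span R V S = \<Inter>{N. submodule N R V \<and> S \<subseteq> N}"

text \<open>\<open>D\<close> is a subring of the field \<open>K\<close> with fraction field \<open>K\<close>, and \<open>V\<close> is a \<open>K\<close>-algebra.\<close>

definition is_order ::
    "('k, 'm) ring_scheme \<Rightarrow> 'k set \<Rightarrow> ('k, 'a, 'n) module_scheme \<Rightarrow> 'a set \<Rightarrow> bool" where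
  "is_order K D V L \<longleftrightarrow>
     subring L V \<and>
     (\<exists>S. finite S \<and> S \<subseteq> carrier V \<and> lin_span (K\<lparr>carrier := D\<rparr>) V S = L) \<and>
     lin_span K V L = carrier V"

definition is_maximal_order ::
    "('k, 'm) ring_scheme \<Rightarrow> 'k set \<Rightarrow> ('k, 'a, 'n) module_scheme \<Rightarrow> 'a set \<Rightarrow> bool" where
  "is_maximal_order K D V L \<longleftrightarrow>
     is_order K D V L \<and> (\<forall>L'. is_order K D V L' \<and> L \<subseteq> L' \<longrightarrow> L' = L)"

abbreviation rat_ring :: "rat ring" where
  "rat_ring \<equiv> ring_of_type_algebra"

definition semisimple_comm_rat_algebra :: "(rat, 'a, 'm) module_scheme \<Rightarrow> bool" where
  "semisimple_comm_rat_algebra A \<longleftrightarrow>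
     Module.algebra rat_ring A \<and>
     (\<exists>S. finite S \<and> S \<subseteq> carrier A \<and> lin_span rat_ring A S = carrier A) \<and>
     (\<forall>I. ideal I A \<longrightarrow> (\<exists>J. ideal J A \<and> I \<inter> J = {\<zero>\<^bsub>A\<^esub>} \<and> I <+>\<^bsub>A\<^esub> J = carrier A))"

definition is_int_order :: "(rat, 'a, 'm) module_scheme \<Rightarrow> 'a set \<Rightarrow> bool" where
  "is_int_order A L \<longleftrightarrow> is_order rat_ring \<int> A L"

definition is_maximal_int_order :: "(rat, 'a, 'm) module_scheme \<Rightarrow> 'a set \<Rightarrow> bool" where
  "is_maximal_int_order A L \<longleftrightarrow> is_maximal_order rat_ring \<int> A L"

section \<open>Completions and \<open>p\<close>-adic numbers\<close>

text \<open>
  The inverse limit of the rings \<open>R / I^n\<close>. Compatibility of two cosets under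
  \<open>R / I^(n+1) \<rightarrow> R / I^n\<close> means that the first is contained in the second.
\<close>

definition ideal_power :: "('a, 'm) ring_scheme \<Rightarrow> 'a set \<Rightarrow> nat \<Rightarrow> 'a set" where
  "ideal_power R I n = (ideal_prod R I ^^ n) (carrier R)"

definition adic_completion :: "('a, 'm) ring_scheme \<Rightarrow> 'a set \<Rightarrow> (nat \<Rightarrow> 'a set) ring" where
  "adic_completion R I =
    \<lparr>carrier = {f. (\<forall>n. f n \<in> carrier (R Quot ideal_power R I n)) \<and> (\<forall>n. f (Suc n) \<subseteq> f n)},
     monoid.mult = (\<lambda>f g n. f n \<otimes>\<^bsub>R Quot ideal_power R I n\<^esub> g n),
     one = (\<lambda>n. \<one>\<^bsub>R Quot ideal_power R I n\<^esub>),
     zero = (\<lambda>n. \<zero>\<^bsub>R Quot ideal_power R I n\<^esub>),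
     add = (\<lambda>f g n. f n \<oplus>\<^bsub>R Quot ideal_power R I n\<^esub> g n)\<rparr>"

definition frac_class :: "('a, 'm) ring_scheme \<Rightarrow> 'a \<Rightarrow> 'a \<Rightarrow> ('a \<times> 'a) set" where
  "frac_class R a b =
     {(c, d). c \<in> carrier R \<and> d \<in> carrier R - {\<zero>\<^bsub>R\<^esub>} \<and> a \<otimes>\<^bsub>R\<^esub> d = c \<otimes>\<^bsub>R\<^esub> b}"

definition fraction_field :: "('a, 'm) ring_scheme \<Rightarrow> ('a \<times> 'a) set ring" where
  "fraction_field R =
    \<lparr>carrier = {frac_class R a b | a b. a \<in> carrier R \<and> b \<in> carrier R - {\<zero>\<^bsub>R\<^esub>}},
     monoid.mult = (\<lambda>x y. \<Union>(a, b)\<in>x. \<Union>(c, d)\<in>y. frac_class R (a \<otimes>\<^bsub>R\<^esub> c) (b \<otimes>\<^bsub>R\<^esub> d)),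
     one = frac_class R \<one>\<^bsub>R\<^esub> \<one>\<^bsub>R\<^esub>,
     zero = frac_class R \<zero>\<^bsub>R\<^esub> \<one>\<^bsub>R\<^esub>,
     add = (\<lambda>x y. \<Union>(a, b)\<in>x. \<Union>(c, d)\<in>y.
       frac_class R (a \<otimes>\<^bsub>R\<^esub> d \<oplus>\<^bsub>R\<^esub> c \<otimes>\<^bsub>R\<^esub> b) (b \<otimes>\<^bsub>R\<^esub> d))\<rparr>"

definition padic_int_ring :: "nat \<Rightarrow> (nat \<Rightarrow> int set) ring" where
  "padic_int_ring p = adic_completion \<Z> (Idl\<^bsub>\<Z>\<^esub> {int p})"

definition padic_field :: "nat \<Rightarrow> ((nat \<Rightarrow> int set) \<times> (nat \<Rightarrow> int set)) set ring" where
  "padic_field p = fraction_field (padic_int_ring p)"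

definition padic_integers :: "nat \<Rightarrow> ((nat \<Rightarrow> int set) \<times> (nat \<Rightarrow> int set)) set set" where
  "padic_integers p =
     (\<lambda>a. frac_class (padic_int_ring p) a \<one>\<^bsub>padic_int_ring p\<^esub>) ` carrier (padic_int_ring p)"

text \<open>
  For a subring \<open>L\<close> of a torsion-free ring \<open>M\<close>, the image of the (injective) natural map from
  \<open>\<int>\<^sub>p \<otimes> L\<close> to \<open>\<rat>\<^sub>p \<otimes> M\<close>, that is, the \<open>\<int>\<^sub>p\<close>-span of \<open>1 \<otimes> L\<close>. This is where
  \<open>\<int>\<^sub>pL\<close> is compared with other subrings of the \<open>p\<close>-adic algebra.
\<close>

definition padic_span ::
    "nat \<Rightarrow> ('a, 'm) ring_scheme \<Rightarrow> 'a set \<Rightarrow>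
     (((nat \<Rightarrow> int set) \<times> (nat \<Rightarrow> int set)) set \<times> 'a \<Rightarrow>\<^sub>0 int) set set" where
  "padic_span p M L =
     lin_span ((padic_field p)\<lparr>carrier := padic_integers p\<rparr>) (base_change (padic_field p) M)
       (pure_tensor (padic_field p) M \<one>\<^bsub>padic_field p\<^esub> ` L)"

definition padically_maximal :: "nat \<Rightarrow> ('a, 'm) ring_scheme \<Rightarrow> bool" where
  "padically_maximal p L \<longleftrightarrow>
     is_maximal_order (padic_field p) (padic_integers p) (base_change (padic_field p) L)
       (padic_span p L (carrier L))"

definition locally_coprime :: "('a, 'm) ring_scheme \<Rightarrow> ('b, 'n) ring_scheme \<Rightarrow> bool" where
  "locally_coprime L1 L2 \<longleftrightarrow>
     (\<forall>p. Factorial_Ring.prime p \<longrightarrow> padically_maximal p L1 \<or> padically_maximal p L2)"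

text \<open>The primes \<open>p\<close> with \<open>\<int>\<^sub>pL \<noteq> \<int>\<^sub>pG\<close>, compared inside \<open>\<rat>\<^sub>pG\<close>, for a subring \<open>L\<close> of \<open>G\<close>.\<close>

definition bad_primes :: "('a, 'm) ring_scheme \<Rightarrow> 'a set \<Rightarrow> nat set" where
  "bad_primes G L =
     {p. Factorial_Ring.prime p \<and> padic_span p G L \<noteq> padic_span p G (carrier G)}"

section \<open>Simple components and their rings of integers\<close>

text \<open>
  The simple components of a commutative semisimple algebra are its minimal nonzero ideals. As
  rings they have their own identity element, and they are fields.
\<close>

definition simple_components :: "('a, 'm) ring_scheme \<Rightarrow> 'a set set" where
  "simple_components A =
     {C. ideal C A \<and> C \<noteq> {\<zero>\<^bsub>A\<^esub>} \<and> (\<forall>I. ideal I A \<and> I \<subseteq> C \<longrightarrow> I = {\<zero>\<^bsub>A\<^esub>} \<or> I = C)}"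

definition component_ring :: "('a, 'm) ring_scheme \<Rightarrow> 'a set \<Rightarrow> ('a, 'm) ring_scheme" where
  "component_ring A C =
     A\<lparr>carrier := C, one := (THE e. e \<in> C \<and> (\<forall>x\<in>C. e \<otimes>\<^bsub>A\<^esub> x = x))\<rparr>"

definition integral_closure :: "('a, 'm) ring_scheme \<Rightarrow> 'a set" where
  "integral_closure R =
     {x \<in> carrier R. \<exists>f :: int poly. Polynomial.lead_coeff f = 1 \<and>
        (\<Oplus>\<^bsub>R\<^esub>i\<in>{..Polynomial.degree f}. [Polynomial.coeff f i] \<cdot>\<^bsub>R\<^esub> (x [^]\<^bsub>R\<^esub> i)) = \<zero>\<^bsub>R\<^esub>}"

definition component_integers :: "('a, 'm) ring_scheme \<Rightarrow> 'a set \<Rightarrow> ('a, 'm) ring_scheme" where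
  "component_integers A C =
     (component_ring A C)\<lparr>carrier := integral_closure (component_ring A C)\<rparr>"

definition primes_above :: "('a, 'm) ring_scheme \<Rightarrow> nat \<Rightarrow> 'a set set" where
  "primes_above R p =
     {P. primeideal P R \<and> {n :: int. [n] \<cdot>\<^bsub>R\<^esub> \<one>\<^bsub>R\<^esub> \<in> P} = {n. int p dvd n}}"

definition completed_component ::
    "('a, 'm) ring_scheme \<Rightarrow> 'a set \<Rightarrow> 'a set \<Rightarrow> (nat \<Rightarrow> 'a set) ring" where
  "completed_component A C P = adic_completion (component_integers A C) P"

section \<open>The correction factors\<close>

text \<open>
  \<open>L \<subseteq> G\<close> are orders in one algebra, and the local rings come from the components of
  the other algebra \<open>A\<close>. The index sets of the products are finite.
\<close>

definition zeta_delta ::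
    "('a, 'm) ring_scheme \<Rightarrow> 'a set \<Rightarrow> ('b, 'n) ring_scheme \<Rightarrow> complex \<Rightarrow> complex" where
  "zeta_delta G L A s =
     (\<Prod>p\<in>bad_primes G L. \<Prod>C\<in>simple_components A. \<Prod>P\<in>primes_above (component_integers A C) p.
        zeta (tensor (completed_component A C P) (G\<lparr>carrier := L\<rparr>)) s /
        zeta (tensor (completed_component A C P) G) s)"

definition zeta_delta_converges ::
    "('a, 'm) ring_scheme \<Rightarrow> 'a set \<Rightarrow> ('b, 'n) ring_scheme \<Rightarrow> complex \<Rightarrow> bool" where
  "zeta_delta_converges G L A s \<longleftrightarrow>
     (\<forall>p\<in>bad_primes G L. \<forall>C\<in>simple_components A. \<forall>P\<in>primes_above (component_integers A C) p.
        zeta_converges (tensor (completed_component A C P) (G\<lparr>carrier := L\<rparr>)) s \<and>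
        zeta_converges (tensor (completed_component A C P) G) s)"

end

theory Submission
  imports Defs "HOL-Algebra.Free_Abelian_Groups"
begin

text \<open>
  In a ring whose additive group is finitely generated, the ideals of finite index are the ideals
  containing a positive integer, and splitting that integer into coprime factors splits the zeta
  function of \<open>\<Lambda>\<^sub>1 \<otimes> \<Lambda>\<^sub>2\<close> into finitely many Euler factors and a factor counting the ideals whose
  integer is prime to all bad primes. A ring homomorphism that is invertible up to an integer \<open>m\<close>
  does not change the factors at integers prime to \<open>m\<close>. Hence, at a bad prime \<open>p\<close> of \<open>\<Lambda>\<^sub>1\<close>, the
  order \<open>\<Lambda>\<^sub>2\<close> may be replaced by \<open>\<Gamma>\<^sub>2\<close>; modulo powers of \<open>p\<close> the latter is the product of its
  completions \<open>R\<^sub>2\<^sub>j\<^sub>k\<close>, and the Euler factor is the product of the zeta functions of the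
  \<open>R\<^sub>2\<^sub>j\<^sub>k\<Lambda>\<^sub>1\<close>. The same holds with \<open>\<Gamma>\<^sub>1\<close> in place of \<open>\<Lambda>\<^sub>1\<close>, and the factor prime to the bad
  primes is the same for all four orders, so that the quotient of the two zeta functions is
  \<open>\<delta>\<^sub>B\<^sub>1\<delta>\<^sub>B\<^sub>2\<close>.

  The bad primes of \<open>\<Lambda>\<close> are the prime divisors of the least \<open>m > 0\<close> with \<open>m\<Gamma> \<subseteq> \<Lambda>\<close>: if \<open>p\<close> divides
  \<open>m\<close>, some functional \<open>\<Gamma> \<rightarrow> \<int>\<close> is divisible by \<open>p\<close> on \<open>\<Lambda>\<close> but not on \<open>\<Gamma>\<close>, and its extension to
  \<open>\<rat>\<^sub>p\<Gamma>\<close> shows that \<open>\<int>\<^sub>p\<Lambda> \<noteq> \<int>\<^sub>p\<Gamma>\<close> and that \<open>\<int>\<^sub>p\<Lambda>\<close> is not maximal. By local coprimality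
  the two sets of bad primes are therefore disjoint.
\<close>

text \<open>No exactness of tensor products is used. Each inclusion of orders comes with an additive
  map back such that both composites are multiplication by an integer, and this survives tensoring.
  For the same reason the splitting of \<Gamma> modulo p^a into completions is expressed by
  approximate sections instead of an isomorphism. The completions are not finitely generated over
  the integers, so the convergence of their zeta functions cannot be read off from a count of
  generators; it is inherited from the global tensor product, of whose zeta function they are
  factors. All primes outside the two finite bad sets stay together in one factor, so that no
  infinite product occurs and this factor is never evaluated. Dividing by the local zeta functions
  of the maximal orders needs their nonvanishing, which holds far to the right: the unit ideal
  contributes 1 and the sum of the other terms tends to 0. The abscissa in the theorem is the
  maximum of a convergence bound and of common bounds for these finitely many factors.\<close>

abbreviation imul :: "('a, 'm) ring_scheme \<Rightarrow> int \<Rightarrow> 'a \<Rightarrow> 'a" where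
  "imul R k x \<equiv> add_pow R k x"

section \<open>Integer multiples in additive groups\<close>

context abelian_group
begin

lemma imul_closed [intro, simp]: "x \<in> carrier G \<Longrightarrow> imul G k x \<in> carrier G"
  using group.int_pow_closed[OF a_group] by (simp add: add_pow_def)

lemma imul_0 [simp]: "imul G 0 x = \<zero>\<^bsub>G\<^esub>"
  by (simp add: add_pow_def int_pow_0)

lemma imul_1 [simp]: "x \<in> carrier G \<Longrightarrow> imul G 1 x = x"
  using group.int_pow_1[OF a_group] by (simp add: add_pow_def)

lemma imul_add: "x \<in> carrier G \<Longrightarrow> imul G (k + l) x = imul G k x \<oplus>\<^bsub>G\<^esub> imul G l x"
  using group.int_pow_mult[OF a_group] by (simp add: add_pow_def)

lemma imul_neg: "x \<in> carrier G \<Longrightarrow> imul G (- k) x = \<ominus>\<^bsub>G\<^esub> (imul G k x)"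
  using group.int_pow_neg[OF a_group] by (simp add: add_pow_def a_inv_def)

lemma imul_diff: "x \<in> carrier G \<Longrightarrow> imul G (k - l) x = imul G k x \<ominus>\<^bsub>G\<^esub> imul G l x"
  by (simp add: diff_conv_add_uminus imul_add imul_neg a_minus_def del: add_uminus_conv_diff)

lemma imul_mult: "x \<in> carrier G \<Longrightarrow> imul G (k * l) x = imul G k (imul G l x)"
  using group.int_pow_pow[OF a_group, of x l k] by (simp add: add_pow_def mult.commute)

lemma imul_distrib:
  "x \<in> carrier G \<Longrightarrow> y \<in> carrier G \<Longrightarrow>
    imul G k (x \<oplus>\<^bsub>G\<^esub> y) = imul G k x \<oplus>\<^bsub>G\<^esub> imul G k y"
  using group.int_pow_mult_distrib[OF a_group, of x y] by (simp add: add_pow_def a_comm)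

lemma imul_zero [simp]: "imul G k \<zero>\<^bsub>G\<^esub> = \<zero>\<^bsub>G\<^esub>"
  using group.int_pow_one[OF a_group] by (simp add: add_pow_def)

lemma imul_minus: "x \<in> carrier G \<Longrightarrow> imul G k (\<ominus>\<^bsub>G\<^esub> x) = \<ominus>\<^bsub>G\<^esub> (imul G k x)"
  using imul_mult[of x k "-1"] imul_mult[of x "-1" k] by (simp add: imul_neg)

end

context ring
begin

lemma imul_ldistr: "x \<in> carrier R \<Longrightarrow> y \<in> carrier R \<Longrightarrow> (imul R k x) \<otimes> y = imul R k (x \<otimes> y)"
  by (rule add_pow_ldistr_int)

lemma imul_rdistr: "x \<in> carrier R \<Longrightarrow> y \<in> carrier R \<Longrightarrow> x \<otimes> (imul R k y) = imul R k (x \<otimes> y)"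
  by (rule add_pow_rdistr_int)

lemma imul_one: "x \<in> carrier R \<Longrightarrow> (imul R k \<one>) \<otimes> x = imul R k x"
  by (simp add: imul_ldistr)

end

lemma additive_imul:
  assumes "abelian_group G" "abelian_group H" "h \<in> carrier G \<rightarrow> carrier H"
    and add: "\<And>x y. x \<in> carrier G \<Longrightarrow> y \<in> carrier G \<Longrightarrow> h (x \<oplus>\<^bsub>G\<^esub> y) = h x \<oplus>\<^bsub>H\<^esub> h y"
    and x: "x \<in> carrier G"
  shows "h (imul G k x) = imul H k (h x)"
proof -
  interpret G: abelian_group G by fact
  interpret H: abelian_group H by fact
  have "group_hom (add_monoid G) (add_monoid H) h"
    using assms by (auto simp: group_hom_def group_hom_axioms_def hom_def G.a_group H.a_group)
  from group_hom.hom_int_pow[OF this, of x k] x show ?thesis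
    by (simp add: add_pow_def)
qed

lemma ring_hom_imul:
  assumes "ring R" "ring S" "h \<in> ring_hom R S" "x \<in> carrier R"
  shows "h (imul R k x) = imul S k (h x)"
  by (rule additive_imul)
    (use assms in \<open>auto simp: ring_hom_def ring_def\<close>)

lemma ring_hom_minus:
  assumes "ring R" "ring S" "h \<in> ring_hom R S" "x \<in> carrier R" "y \<in> carrier R"
  shows "h (x \<ominus>\<^bsub>R\<^esub> y) = h x \<ominus>\<^bsub>S\<^esub> h y"
proof -
  interpret ring_hom_ring R S h using assms by (auto intro: ring_hom_ringI2)
  show ?thesis using assms by (simp add: a_minus_def)
qed

subsection \<open>Ideals containing an integer\<close>

definition multiples :: "('a, 'm) ring_scheme \<Rightarrow> int \<Rightarrow> 'a set" where
  "multiples R n = (\<lambda>x. imul R n x) ` carrier R"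

text \<open>If the additive group is finitely generated, the positive integers as \<open>E\<close>
  give all ideals of finite index; \<open>powers p\<close> and \<open>coprime_to B\<close> as
  \<open>E\<close> give the ideals that belong to single factors of the zeta function.\<close>

definition ideals_over :: "('a, 'm) ring_scheme \<Rightarrow> int set \<Rightarrow> 'a set set" where
  "ideals_over R E = {I. ideal I R \<and> (\<exists>n\<in>E. imul R n \<one>\<^bsub>R\<^esub> \<in> I)}"

lemma multiplesI [intro]: "x \<in> carrier R \<Longrightarrow> imul R n x \<in> multiples R n"
  by (auto simp: multiples_def)

lemma (in ideal) minus_closed_ideal: "x \<in> I \<Longrightarrow> y \<in> I \<Longrightarrow> x \<ominus> y \<in> I"
  by (simp add: a_minus_def)

lemma (in ring) ideal_criterion:
  assumes "I \<subseteq> carrier R" "\<zero> \<in> I" "\<And>x y. x \<in> I \<Longrightarrow> y \<in> I \<Longrightarrow> x \<oplus> y \<in> I"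
    "\<And>x r. x \<in> I \<Longrightarrow> r \<in> carrier R \<Longrightarrow> r \<otimes> x \<in> I"
    "\<And>x r. x \<in> I \<Longrightarrow> r \<in> carrier R \<Longrightarrow> x \<otimes> r \<in> I"
  shows "ideal I R"
proof (rule idealI)
  show "ring R" by (rule ring_axioms)
  show "subgroup I (add_monoid R)"
  proof (rule group.subgroupI[OF a_group])
    fix a assume "a \<in> I"
    then have "\<ominus> a = (\<ominus> \<one>) \<otimes> a" using assms(1) by (simp add: l_minus subset_iff)
    then show "inv\<^bsub>add_monoid R\<^esub> a \<in> I"
      using assms(4)[of a "\<ominus> \<one>"] \<open>a \<in> I\<close> by (simp add: a_inv_def)
  qed (use assms in auto)
qed (use assms in auto)

lemma (in cring) cideal_criterion:
  assumes "I \<subseteq> carrier R" "\<zero> \<in> I" "\<And>x y. x \<in> I \<Longrightarrow> y \<in> I \<Longrightarrow> x \<oplus> y \<in> I"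
    "\<And>x r. x \<in> I \<Longrightarrow> r \<in> carrier R \<Longrightarrow> r \<otimes> x \<in> I"
  shows "ideal I R"
  by (rule ideal_criterion) (use assms in \<open>auto simp: m_comm subset_iff\<close>)

lemma (in cring) multiples_ideal: "ideal (multiples R n) R"
proof (rule cideal_criterion)
  show "\<zero> \<in> multiples R n" using multiplesI[of \<zero> R n] by simp
  fix x y assume "x \<in> multiples R n" "y \<in> multiples R n"
  then show "x \<oplus> y \<in> multiples R n"
    unfolding multiples_def by (auto simp: imul_distrib[symmetric])
next
  fix x r assume "x \<in> multiples R n" "r \<in> carrier R"
  then show "r \<otimes> x \<in> multiples R n"
    unfolding multiples_def by (auto simp: imul_rdistr)
qed (auto simp: multiples_def)

lemma (in cring) multiples_mult_subset: "multiples R (n * m) \<subseteq> multiples R n"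
  by (auto simp: multiples_def imul_mult)

lemma (in ideal) multiples_subset:
  assumes "imul R n \<one> \<in> I" shows "multiples R n \<subseteq> I"
proof
  fix x assume "x \<in> multiples R n"
  then obtain y where "y \<in> carrier R" "x = imul R n y" by (auto simp: multiples_def)
  then show "x \<in> I" using I_r_closed[OF assms, of y] by (simp add: imul_one)
qed

lemma (in cring) coset_eq_iff:
  assumes "ideal I R" "x \<in> carrier R" "y \<in> carrier R"
  shows "I +> x = I +> y \<longleftrightarrow> x \<ominus> y \<in> I"
proof -
  interpret ideal I R by fact
  show ?thesis
    by (metis a_coset_join2 a_repr_independence' a_rcos_self a_rcos_module_minus
        assms(2,3) ring_axioms)
qed

lemma (in cring) a_rcosets_image: "a_rcosets I = (\<lambda>x. I +> x) ` carrier R"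
  by (auto simp: A_RCOSETS_def')

text \<open>The set-theoretic part of the first isomorphism theorem: \<open>f\<close> need not be a
  homomorphism, only its fibres must be the cosets of \<open>I\<close>. The target can thus be a
  plain product of coset spaces.\<close>

lemma (in cring) bij_betw_a_rcosets:
  assumes "ideal I R" and "f ` carrier R = W"
    and "\<And>x y. x \<in> carrier R \<Longrightarrow> y \<in> carrier R \<Longrightarrow> f x = f y \<longleftrightarrow> x \<ominus> y \<in> I"
  shows "\<exists>g. bij_betw g (a_rcosets I) W"
proof -
  have eq: "I +> x = I +> y \<longleftrightarrow> f x = f y" if "x \<in> carrier R" "y \<in> carrier R" for x y
    using assms that coset_eq_iff by blast
  have "bij_betw (\<lambda>c. f (SOME x. x \<in> carrier R \<and> I +> x = c)) (a_rcosets I) W"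
  proof (rule bij_betwI')
    have s: "f (SOME z. z \<in> carrier R \<and> I +> z = I +> x) = f x" if "x \<in> carrier R" for x
      by (rule someI2[of _ x]) (use that eq in auto)
    fix c d assume "c \<in> a_rcosets I" "d \<in> a_rcosets I"
    then obtain x y where "x \<in> carrier R" "y \<in> carrier R" "c = I +> x" "d = I +> y"
      by (auto simp: a_rcosets_image)
    then show "(f (SOME z. z \<in> carrier R \<and> I +> z = c) = f (SOME z. z \<in> carrier R \<and> I +> z = d)) = (c = d)"
      using s[of x] s[of y] eq[of x y] by simp
  next
    have s: "f (SOME z. z \<in> carrier R \<and> I +> z = I +> x) = f x" if "x \<in> carrier R" for x
      by (rule someI2[of _ x]) (use that eq in auto)
    show "f (SOME z. z \<in> carrier R \<and> I +> z = c) \<in> W" if "c \<in> a_rcosets I" for c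
      using that s assms(2) by (auto simp: a_rcosets_image)
    show "\<exists>c\<in>a_rcosets I. y = f (SOME z. z \<in> carrier R \<and> I +> z = c)" if "y \<in> W" for y
      using that s assms(2) by (auto simp: a_rcosets_image)
  qed
  then show ?thesis by blast
qed

text \<open>
  A Chinese remainder theorem modulo the integers in \<open>E i\<close>: contraction along the \<open>\<phi> i\<close> is a
  bijection from families of ideals of the rings \<open>S i\<close> to ideals of \<open>T\<close>, and the index is multiplicative.
\<close>

locale ideal_decomposition = T?: cring T
  for T :: "('t, 'm) ring_scheme" (structure)
    and S :: "'i \<Rightarrow> ('s, 'n) ring_scheme" and \<phi> :: "'i \<Rightarrow> 't \<Rightarrow> 's"
    and A :: "'i set" and E :: "'i \<Rightarrow> int set" and D :: "int set" +
  assumes finite_A: "finite A"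
    and cring_S: "i \<in> A \<Longrightarrow> cring (S i)"
    and hom: "i \<in> A \<Longrightarrow> \<phi> i \<in> ring_hom T (S i)"
    and one_E: "i \<in> A \<Longrightarrow> 1 \<in> E i"
    and mult_E: "i \<in> A \<Longrightarrow> n \<in> E i \<Longrightarrow> m \<in> E i \<Longrightarrow> n * m \<in> E i"
    and dense: "i \<in> A \<Longrightarrow> n \<in> E i \<Longrightarrow> y \<in> carrier (S i) \<Longrightarrow>
      \<exists>t\<in>carrier T. y \<ominus>\<^bsub>S i\<^esub> \<phi> i t \<in> multiples (S i) n"
    and comaximal: "i \<in> A \<Longrightarrow> j \<in> A \<Longrightarrow> i \<noteq> j \<Longrightarrow> n \<in> E i \<Longrightarrow> m \<in> E j \<Longrightarrow>
      \<exists>u\<in>carrier T. \<phi> i u \<in> multiples (S i) n \<and> \<phi> j (\<one> \<ominus> u) \<in> multiples (S j) m"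
    and separating: "n \<in> D \<Longrightarrow> \<exists>k. (\<forall>i\<in>A. k i \<in> E i) \<and>
      (\<forall>x\<in>carrier T. (\<forall>i\<in>A. \<phi> i x \<in> multiples (S i) (k i)) \<longrightarrow> x \<in> multiples T n)"
    and prod_D: "(\<And>i. i \<in> A \<Longrightarrow> k i \<in> E i) \<Longrightarrow> (\<Prod>i\<in>A. k i) \<in> D"
begin

lemma hom_ring: "i \<in> A \<Longrightarrow> ring_hom_ring T (S i) (\<phi> i)"
  using cring_S hom by (auto intro: ring_hom_ringI2 simp: cring.axioms(1) ring_axioms)

text \<open>The kernel of the map from \<open>T\<close> to \<open>S i\<close> modulo
  \<open>n\<close>. It keeps the Chinese remainder argument inside \<open>T\<close>, as the rings
  \<open>S i\<close> are reached only up to approximation.\<close>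

definition kr :: "'i \<Rightarrow> int \<Rightarrow> 't set" where
  "kr i n = {x \<in> carrier T. \<phi> i x \<in> multiples (S i) n}"

lemma kr_ideal: "i \<in> A \<Longrightarrow> ideal (kr i n) T"
  using ring_hom_ring.ideal_vimage[OF hom_ring cring.multiples_ideal[OF cring_S], of i n]
  by (simp add: kr_def)

lemma hom_minus: "i \<in> A \<Longrightarrow> x \<in> carrier T \<Longrightarrow> y \<in> carrier T \<Longrightarrow> \<phi> i (x \<ominus> y) = \<phi> i x \<ominus>\<^bsub>S i\<^esub> \<phi> i y"
  using ring_hom_minus[OF ring_axioms cring.axioms(1)[OF cring_S] hom] by blast

text \<open>The product of the pairwise witnesses works: 1 - uw = (1 - u) + u(1 - w) keeps it
  congruent to 1 at \<open>i\<close>.\<close>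

lemma crt_unit:
  assumes i: "i \<in> A" and k: "\<And>i. i \<in> A \<Longrightarrow> k i \<in> E i" and J: "J \<subseteq> A" "i \<notin> J"
  shows "\<exists>u\<in>carrier T. \<one> \<ominus> u \<in> kr i (k i) \<and> (\<forall>j\<in>J. u \<in> kr j (k j))"
proof -
  interpret i: ideal "kr i (k i)" T using kr_ideal i by blast
  have "finite J" using J finite_A finite_subset by blast
  then show ?thesis using J
  proof (induction J)
    case empty
    have "\<one> \<ominus> \<one> = \<zero>" by (simp add: r_neg a_minus_def)
    then have "\<one> \<ominus> \<one> \<in> kr i (k i)" using i.zero_closed by metis
    then show ?case by (intro bexI[of _ \<one>]) auto
  next
    case (insert j J)
    then obtain u where u: "u \<in> carrier T" "\<one> \<ominus> u \<in> kr i (k i)" "\<forall>j\<in>J. u \<in> kr j (k j)" by auto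
    obtain w where w: "w \<in> carrier T" "w \<in> kr j (k j)" "\<one> \<ominus> w \<in> kr i (k i)"
      using comaximal[of j i "k j" "k i"] k[of i] k[of j] insert.prems i minus_closed[OF one_closed]
      unfolding kr_def by blast
    have "\<one> \<ominus> u \<otimes> w = (\<one> \<ominus> u) \<oplus> u \<otimes> (\<one> \<ominus> w)"
      using u(1) w(1) by algebra
    then have 1: "\<one> \<ominus> u \<otimes> w \<in> kr i (k i)"
      using u w i.I_l_closed i.a_closed by auto
    have "u \<otimes> w \<in> kr l (k l)" if "l \<in> insert j J" for l
      using that u w ideal.I_l_closed[OF kr_ideal] ideal.I_r_closed[OF kr_ideal] insert.prems by blast
    with 1 u w show ?case by (intro bexI[of _ "u \<otimes> w"]) auto
  qed
qed

text \<open>Every correction is a multiple of a difference of elements of \<open>I\<close>, so the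
  solution stays in \<open>I\<close>. The whole ring as \<open>I\<close> gives approximation; a
  general \<open>I\<close> is what the surjectivity of contraction requires.\<close>

lemma crt:
  assumes k: "\<And>i. i \<in> A \<Longrightarrow> k i \<in> E i" and I: "ideal I T" and t: "\<And>i. i \<in> A \<Longrightarrow> t i \<in> I" 
  shows "\<exists>x\<in>I. \<forall>i\<in>A. x \<ominus> t i \<in> kr i (k i)"
proof -
  interpret I: ideal I T by fact
  have "\<exists>x\<in>I. \<forall>i\<in>J. x \<ominus> t i \<in> kr i (k i)" if "J \<subseteq> A" for J
  proof -
    have "finite J" using that finite_A finite_subset by blast
    then show ?thesis using that
    proof (induction J)
      case empty
      show ?case using I.zero_closed by blast
    next
      case (insert j J)
      then obtain x where x: "x \<in> I" "\<forall>i\<in>J. x \<ominus> t i \<in> kr i (k i)" by auto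
      obtain u where u: "u \<in> carrier T" "\<one> \<ominus> u \<in> kr j (k j)" "\<forall>i\<in>J. u \<in> kr i (k i)"
        using crt_unit[of j k J] k insert by auto
      have tj: "t j \<in> I" using t insert.prems by auto
      \<comment> \<open>Since \<open>u\<close> is 1 at \<open>j\<close> and 0 at the indices already
        treated, this moves \<open>x\<close> to \<open>t j\<close> at \<open>j\<close> and changes
        nothing elsewhere.\<close>
      define y where "y = x \<oplus> u \<otimes> (t j \<ominus> x)"
      have y: "y \<in> I" using x(1) u(1) tj by (simp add: y_def I.I_l_closed I.minus_closed_ideal)
      have "y \<ominus> t l \<in> kr l (k l)" if "l \<in> insert j J" for l
      proof -
        have l: "l \<in> A" using that insert.prems by auto
        interpret Ml: ideal "kr l (k l)" T using kr_ideal l by blast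
        have c: "t l \<in> carrier T" "t j \<in> carrier T" "x \<in> carrier T" using t l tj x by auto
        show ?thesis
        proof (cases "l = j")
          case True
          have "y \<ominus> t j = (\<one> \<ominus> u) \<otimes> (x \<ominus> t j)"
            unfolding y_def using u(1) c by algebra
          moreover have "(\<one> \<ominus> u) \<otimes> (x \<ominus> t j) \<in> kr l (k l)"
            using True u c by (intro Ml.I_r_closed) auto
          ultimately show ?thesis using True by simp
        next
          case False
          have "y \<ominus> t l = (x \<ominus> t l) \<oplus> u \<otimes> (t j \<ominus> x)"
            unfolding y_def using u(1) c by algebra
          moreover have "(x \<ominus> t l) \<oplus> u \<otimes> (t j \<ominus> x) \<in> kr l (k l)"
            using False that u x c by (intro Ml.a_closed Ml.I_r_closed) auto
          ultimately show ?thesis by simp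
        qed
      qed
      with y show ?case by blast
    qed
  qed
  then show ?thesis by blast
qed

lemma simultaneous_approximation:
  assumes k: "\<And>i. i \<in> A \<Longrightarrow> k i \<in> E i" and y: "\<And>i. i \<in> A \<Longrightarrow> y i \<in> carrier (S i)" 
  shows "\<exists>x\<in>carrier T. \<forall>i\<in>A. \<phi> i x \<ominus>\<^bsub>S i\<^esub> y i \<in> multiples (S i) (k i)"
proof -
  have "\<forall>i\<in>A. \<exists>t\<in>carrier T. y i \<ominus>\<^bsub>S i\<^esub> \<phi> i t \<in> multiples (S i) (k i)"
    using dense k y by blast
  then obtain t where t: "\<And>i. i \<in> A \<Longrightarrow> t i \<in> carrier T"
     "\<And>i. i \<in> A \<Longrightarrow> y i \<ominus>\<^bsub>S i\<^esub> \<phi> i (t i) \<in> multiples (S i) (k i)" by metis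
  obtain x where x: "x \<in> carrier T" "\<And>i. i \<in> A \<Longrightarrow> x \<ominus> t i \<in> kr i (k i)"
    using crt[of k "carrier T" t] k t oneideal by blast
  have "\<phi> l x \<ominus>\<^bsub>S l\<^esub> y l \<in> multiples (S l) (k l)" if l: "l \<in> A" for l
  proof -
    interpret Sl: cring "S l" using cring_S l by blast
    interpret Ml: ideal "multiples (S l) (k l)" "S l" using cring_S cring.multiples_ideal l by blast
    have c: "\<phi> l x \<in> carrier (S l)" "\<phi> l (t l) \<in> carrier (S l)" "y l \<in> carrier (S l)"
      using ring_hom_closed[OF hom[OF l]] x t l y by auto
    have "\<phi> l x \<ominus>\<^bsub>S l\<^esub> \<phi> l (t l) \<in> multiples (S l) (k l)"
      using x(2)[OF l] hom_minus[OF l x(1) t(1)[OF l]] by (simp add: kr_def)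
    moreover have "\<phi> l x \<ominus>\<^bsub>S l\<^esub> y l = (\<phi> l x \<ominus>\<^bsub>S l\<^esub> \<phi> l (t l)) \<ominus>\<^bsub>S l\<^esub> (y l \<ominus>\<^bsub>S l\<^esub> \<phi> l (t l))"
      using c by algebra
    ultimately show ?thesis
      using Ml.minus_closed_ideal t(2)[OF l] by metis
  qed
  with x show ?thesis by blast
qed

definition contract :: "('i \<Rightarrow> 's set) \<Rightarrow> 't set" where
  "contract J = {x \<in> carrier T. \<forall>i\<in>A. \<phi> i x \<in> J i}"

abbreviation families :: "('i \<Rightarrow> 's set) set" where
  "families \<equiv> PiE A (\<lambda>i. ideals_over (S i) (E i))"

lemma familiesD:
  assumes "J \<in> families"
  shows "i \<in> A \<Longrightarrow> ideal (J i) (S i)" 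
    "\<exists>k. \<forall>i\<in>A. k i \<in> E i \<and> multiples (S i) (k i) \<subseteq> J i"
proof -
  show *: "ideal (J i) (S i)" if "i \<in> A" for i
    using assms that by (auto simp: ideals_over_def)
  show "\<exists>k. \<forall>i\<in>A. k i \<in> E i \<and> multiples (S i) (k i) \<subseteq> J i"
  proof (rule bchoice, rule ballI)
    fix i assume "i \<in> A"
    then show "\<exists>n. n \<in> E i \<and> multiples (S i) n \<subseteq> J i"
      using PiE_mem[OF assms \<open>i \<in> A\<close>] *[of i] ideal.multiples_subset[of "J i" "S i"]
      unfolding ideals_over_def by blast
  qed
qed

lemma contract_ideal:
  assumes J: "\<And>i. i \<in> A \<Longrightarrow> ideal (J i) (S i)" 
  shows "ideal (contract J) T"
proof -
  have *: "ideal {x \<in> carrier T. \<phi> i x \<in> J i} T" if "i \<in> A" for i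
    using ring_hom_ring.ideal_vimage[OF hom_ring J] that by blast
  show ?thesis
  proof (rule cideal_criterion)
    show "\<zero> \<in> contract J"
      using additive_subgroup.zero_closed[OF ideal.axioms(1)[OF *]] by (auto simp: contract_def)
    fix x y assume "x \<in> contract J" "y \<in> contract J"
    then show "x \<oplus> y \<in> contract J"
      using additive_subgroup.a_closed[OF ideal.axioms(1)[OF *]] by (auto simp: contract_def)
  next
    fix x r assume "x \<in> contract J" "r \<in> carrier T"
    then show "r \<otimes> x \<in> contract J"
      using ideal.I_l_closed[OF *] by (auto simp: contract_def)
  qed (auto simp: contract_def)
qed

lemma imul_in_multiples_mult:
  assumes "cring R" "x \<in> carrier R"
  shows "imul R (a * b) x \<in> multiples R a"
  using cring.multiples_mult_subset[OF assms(1), of a b] multiplesI[OF assms(2), of "a * b"] by blast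

lemma contract_mem: 
  assumes J: "J \<in> families"
  shows "contract J \<in> ideals_over T D"
proof -
  obtain k where k: "\<And>i. i \<in> A \<Longrightarrow> k i \<in> E i" "\<And>i. i \<in> A \<Longrightarrow> multiples (S i) (k i) \<subseteq> J i"
    using familiesD(2)[OF J] by blast
  define n where "n = (\<Prod>i\<in>A. k i)"
  have "n \<in> D" using prod_D k n_def by auto
  moreover have "imul T n \<one> \<in> contract J"
    unfolding contract_def
  proof (clarsimp)
    fix i assume i: "i \<in> A"
    interpret i: ring_hom_ring T "S i" "\<phi> i" using hom_ring i by blast
    obtain m where "n = k i * m" using dvd_prodI[OF finite_A i, of k] by (auto simp: n_def)
    then have "imul (S i) n \<one>\<^bsub>S i\<^esub> \<in> J i"
      using imul_in_multiples_mult[OF cring_S[OF i], of "\<one>\<^bsub>S i\<^esub>" "k i" m] k i by auto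
    then show "\<phi> i (imul T n \<one>) \<in> J i"
      using ring_hom_imul[OF ring_axioms cring.axioms(1)[OF cring_S[OF i]] hom[OF i], of \<one> n] by simp
  qed
  ultimately show ?thesis
    using contract_ideal familiesD(1)[OF J] by (auto simp: ideals_over_def)
qed

lemma approximation_in_family:
  assumes J: "J \<in> families" and y: "\<And>i. i \<in> A \<Longrightarrow> y i \<in> carrier (S i)" 
  shows "\<exists>x\<in>carrier T. \<forall>i\<in>A. \<phi> i x \<ominus>\<^bsub>S i\<^esub> y i \<in> J i"
proof -
  obtain k where "\<And>i. i \<in> A \<Longrightarrow> k i \<in> E i" "\<And>i. i \<in> A \<Longrightarrow> multiples (S i) (k i) \<subseteq> J i"
    using familiesD(2)[OF J] by blast
  then show ?thesis using simultaneous_approximation[of k y] y by blast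
qed

lemma (in ideal) mem_of_minus:
  assumes "x \<ominus> y \<in> I" "x \<in> I" "y \<in> carrier R" shows "y \<in> I"
proof -
  have "y = x \<ominus> (x \<ominus> y)" using assms Icarr[OF assms(2)] by algebra
  then show ?thesis using assms minus_closed_ideal by metis
qed

lemma (in ideal) mem_of_minus2:
  assumes "x \<ominus> y \<in> I" "y \<in> I" "x \<in> carrier R" shows "x \<in> I"
proof -
  have "x = (x \<ominus> y) \<oplus> y" using assms Icarr[OF assms(2)] by algebra
  moreover have "(x \<ominus> y) \<oplus> y \<in> I" using assms by simp
  ultimately show ?thesis by simp
qed

text \<open>Approximate the family that is \<open>x\<close> at \<open>i\<close> and 0 elsewhere by
  one element of \<open>T\<close>. It lies in \<open>contract J\<close>, hence in
  \<open>contract J'\<close>, and its image at \<open>i\<close> differs from \<open>x\<close> by an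
  element of \<open>J' i\<close>.\<close>

lemma contract_subset_imp:
  assumes J: "J \<in> families" and J': "J' \<in> families" and sub: "contract J \<subseteq> contract J'" and i: "i \<in> A"
  shows "J i \<subseteq> J' i"
proof
  fix x assume x: "x \<in> J i"
  obtain k where k: "\<And>i. i \<in> A \<Longrightarrow> k i \<in> E i" "\<And>i. i \<in> A \<Longrightarrow> multiples (S i) (k i) \<subseteq> J i"
    using familiesD(2)[OF J] by blast
  obtain k' where k': "\<And>i. i \<in> A \<Longrightarrow> k' i \<in> E i" "\<And>i. i \<in> A \<Longrightarrow> multiples (S i) (k' i) \<subseteq> J' i"
    using familiesD(2)[OF J'] by blast
  define y where "y = (\<lambda>j. if j = i then x else \<zero>\<^bsub>S j\<^esub>)"
  have yJ: "y j \<in> J j" if "j \<in> A" for j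
    using familiesD(1)[OF J that] x by (auto simp: y_def additive_subgroup.zero_closed ideal.axioms(1))
  then have yc: "y j \<in> carrier (S j)" if "j \<in> A" for j
    using familiesD(1)[OF J that] that by (simp add: ideal.Icarr)
  \<comment> \<open>The product of the two integers as modulus puts the error of the approximation
    into \<open>J j\<close> and \<open>J' j\<close> at once.\<close>
  have kk: "k j * k' j \<in> E j" if "j \<in> A" for j using that mult_E k k' by blast
  obtain t where t: "t \<in> carrier T" "\<And>j. j \<in> A \<Longrightarrow> \<phi> j t \<ominus>\<^bsub>S j\<^esub> y j \<in> multiples (S j) (k j * k' j)"
    using simultaneous_approximation[of "\<lambda>j. k j * k' j" y, OF kk yc] by auto
  have m1: "multiples (S j) (k j * k' j) \<subseteq> J j" if "j \<in> A" for j
    using cring.multiples_mult_subset[OF cring_S[OF that]] k(2)[OF that] by blast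
  have m2: "multiples (S j) (k j * k' j) \<subseteq> J' j" if "j \<in> A" for j
    using cring.multiples_mult_subset[OF cring_S[OF that], of "k' j" "k j"] k'(2)[OF that]
    by (simp add: mult.commute)
  have "\<phi> j t \<in> J j" if "j \<in> A" for j
    using ideal.mem_of_minus2[OF familiesD(1)[OF J that], of "\<phi> j t" "y j"] t m1 yJ that
      ring_hom_closed[OF hom[OF that]] by blast
  then have "t \<in> contract J" using t by (auto simp: contract_def)
  then have "\<phi> i t \<in> J' i" using sub i by (auto simp: contract_def)
  moreover have "\<phi> i t \<ominus>\<^bsub>S i\<^esub> x \<in> J' i" using t(2)[OF i] m2 i by (auto simp: y_def)
  ultimately show "x \<in> J' i"
    using ideal.mem_of_minus[OF familiesD(1)[OF J' i]] x ideal.Icarr[OF familiesD(1)[OF J i]] by blast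
qed

text \<open>The family is \<phi>(I) + k S in each component, with \<open>k\<close> supplied by
  \<open>separating\<close>. As \<open>\<phi> i\<close> is not surjective, its image of
  \<open>I\<close> alone is no ideal; adding the multiples of \<open>k i\<close> repairs this
  because every scalar is approximated from \<open>T\<close>. An element of the contraction agrees
  with some element of \<open>I\<close> modulo all \<open>k i\<close>, so the difference is a
  multiple of \<open>n\<close> and lies in \<open>I\<close>.\<close>

lemma contract_surj:
  assumes I: "I \<in> ideals_over T D"
  shows "\<exists>J\<in>families. contract J = I"
proof -
  from I obtain n where n: "n \<in> D" "imul T n \<one> \<in> I" and id: "ideal I T" by (auto simp: ideals_over_def)
  interpret I: ideal I T by fact
  obtain k where k: "\<And>i. i \<in> A \<Longrightarrow> k i \<in> E i" and sep:
     "\<And>x. x \<in> carrier T \<Longrightarrow> (\<forall>i\<in>A. \<phi> i x \<in> multiples (S i) (k i)) \<Longrightarrow> x \<in> multiples T n"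
    using separating[OF n(1)] by blast
  define J where "J = restrict (\<lambda>i. {y \<in> carrier (S i). \<exists>t\<in>I. y \<ominus>\<^bsub>S i\<^esub> \<phi> i t \<in> multiples (S i) (k i)}) A"
  have J_ideal: "ideal (J i) (S i) \<and> imul (S i) (k i) \<one>\<^bsub>S i\<^esub> \<in> J i" if i: "i \<in> A" for i
  proof -
    interpret Si: cring "S i" using cring_S i by blast
    interpret i: ring_hom_ring T "S i" "\<phi> i" using hom_ring i by blast
    interpret M: ideal "multiples (S i) (k i)" "S i" using Si.multiples_ideal .
    have Ji: "J i = {y \<in> carrier (S i). \<exists>t\<in>I. y \<ominus>\<^bsub>S i\<^esub> \<phi> i t \<in> multiples (S i) (k i)}"
      using i by (simp add: J_def)
    have mJ: "multiples (S i) (k i) \<subseteq> J i"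
      by (auto simp: Ji intro!: bexI[of _ \<zero>] simp: Si.minus_eq) 
    have "ideal (J i) (S i)"
    proof (rule Si.cideal_criterion)
      show "\<zero>\<^bsub>S i\<^esub> \<in> J i" using mJ M.zero_closed by blast
      fix x y assume "x \<in> J i" "y \<in> J i"
      then obtain s t where st: "s \<in> I" "t \<in> I" "x \<ominus>\<^bsub>S i\<^esub> \<phi> i s \<in> multiples (S i) (k i)"
         "y \<ominus>\<^bsub>S i\<^esub> \<phi> i t \<in> multiples (S i) (k i)" "x \<in> carrier (S i)" "y \<in> carrier (S i)"
        by (auto simp: Ji)
      have c: "\<phi> i s \<in> carrier (S i)" "\<phi> i t \<in> carrier (S i)" using st by auto
      have "(x \<oplus>\<^bsub>S i\<^esub> y) \<ominus>\<^bsub>S i\<^esub> (\<phi> i s \<oplus>\<^bsub>S i\<^esub> \<phi> i t) =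
         (x \<ominus>\<^bsub>S i\<^esub> \<phi> i s) \<oplus>\<^bsub>S i\<^esub> (y \<ominus>\<^bsub>S i\<^esub> \<phi> i t)"
        using st(5,6) c by algebra
      then show "x \<oplus>\<^bsub>S i\<^esub> y \<in> J i"
        using st by (auto simp: Ji intro!: bexI[of _ "s \<oplus> t"])
    next
      fix x r assume "x \<in> J i" and r: "r \<in> carrier (S i)"
      then obtain s where s: "s \<in> I" "x \<ominus>\<^bsub>S i\<^esub> \<phi> i s \<in> multiples (S i) (k i)" "x \<in> carrier (S i)"
        by (auto simp: Ji)
      obtain t where t: "t \<in> carrier T" "r \<ominus>\<^bsub>S i\<^esub> \<phi> i t \<in> multiples (S i) (k i)"
        using dense[OF i k[OF i] r] by blast
      have c: "\<phi> i s \<in> carrier (S i)" "\<phi> i t \<in> carrier (S i)" using s t by auto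
      have "r \<otimes>\<^bsub>S i\<^esub> x \<ominus>\<^bsub>S i\<^esub> \<phi> i t \<otimes>\<^bsub>S i\<^esub> \<phi> i s =
         r \<otimes>\<^bsub>S i\<^esub> (x \<ominus>\<^bsub>S i\<^esub> \<phi> i s) \<oplus>\<^bsub>S i\<^esub> (r \<ominus>\<^bsub>S i\<^esub> \<phi> i t) \<otimes>\<^bsub>S i\<^esub> \<phi> i s"
        using s(3) r c by algebra
      then have "r \<otimes>\<^bsub>S i\<^esub> x \<ominus>\<^bsub>S i\<^esub> \<phi> i (t \<otimes> s) \<in> multiples (S i) (k i)"
        using s t r c by (simp add: M.I_l_closed M.I_r_closed)
      then show "r \<otimes>\<^bsub>S i\<^esub> x \<in> J i"
        using s t r I.I_l_closed by (auto simp: Ji intro!: bexI[of _ "t \<otimes> s"])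
    qed (auto simp: Ji)
    moreover have "imul (S i) (k i) \<one>\<^bsub>S i\<^esub> \<in> J i" using mJ by auto
    ultimately show ?thesis by blast
  qed
  then have "J i \<in> ideals_over (S i) (E i)" if "i \<in> A" for i
    using k that unfolding ideals_over_def by blast
  then have fam: "J \<in> families" by (intro PiE_I) (auto simp: J_def)
  have "contract J = I"
  proof
    show "I \<subseteq> contract J"
    proof
      fix x assume x: "x \<in> I"
      have "\<phi> i x \<in> J i" if i: "i \<in> A" for i
      proof -
        interpret Si: cring "S i" using cring_S i by blast
        interpret i: ring_hom_ring T "S i" "\<phi> i" using hom_ring i by blast
        interpret M: ideal "multiples (S i) (k i)" "S i" using Si.multiples_ideal .
        have "\<phi> i x \<ominus>\<^bsub>S i\<^esub> \<phi> i x \<in> multiples (S i) (k i)" using x by (simp add: Si.r_neg Si.minus_eq)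
        then show ?thesis using x i by (auto simp: J_def)
      qed
      then show "x \<in> contract J" using x by (auto simp: contract_def)
    qed
    show "contract J \<subseteq> I"
    proof
      fix x assume "x \<in> contract J"
      then have x: "x \<in> carrier T" "\<forall>i\<in>A. \<exists>t\<in>I. \<phi> i x \<ominus>\<^bsub>S i\<^esub> \<phi> i t \<in> multiples (S i) (k i)"
        by (auto simp: contract_def J_def)
      then obtain t where t: "\<And>i. i \<in> A \<Longrightarrow> t i \<in> I"
        "\<And>i. i \<in> A \<Longrightarrow> \<phi> i x \<ominus>\<^bsub>S i\<^esub> \<phi> i (t i) \<in> multiples (S i) (k i)" by metis
      obtain y where y: "y \<in> I" "\<And>i. i \<in> A \<Longrightarrow> y \<ominus> t i \<in> kr i (k i)"
        using crt[of k I t] k id t(1) by blast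
      have "\<phi> i (x \<ominus> y) \<in> multiples (S i) (k i)" if i: "i \<in> A" for i
      proof -
        interpret Si: cring "S i" using cring_S i by blast
        interpret i: ring_hom_ring T "S i" "\<phi> i" using hom_ring i by blast
        interpret M: ideal "multiples (S i) (k i)" "S i" using Si.multiples_ideal .
        have c: "\<phi> i x \<in> carrier (S i)" "\<phi> i y \<in> carrier (S i)" "\<phi> i (t i) \<in> carrier (S i)"
          "x \<in> carrier T" "y \<in> carrier T" "t i \<in> carrier T"
          using x y t i by auto
        have "\<phi> i x \<ominus>\<^bsub>S i\<^esub> \<phi> i y = (\<phi> i x \<ominus>\<^bsub>S i\<^esub> \<phi> i (t i)) \<ominus>\<^bsub>S i\<^esub> (\<phi> i y \<ominus>\<^bsub>S i\<^esub> \<phi> i (t i))"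
          using c(1,2,3) by algebra
        moreover have "\<phi> i y \<ominus>\<^bsub>S i\<^esub> \<phi> i (t i) \<in> multiples (S i) (k i)"
          using y(2)[OF i] hom_minus[OF i c(5,6)] by (simp add: kr_def)
        ultimately show ?thesis using t i hom_minus[OF i c(4,5)] by (metis M.minus_closed_ideal)
      qed
      then have "x \<ominus> y \<in> multiples T n" using sep x y by auto
      then have "x \<ominus> y \<in> I" using I.multiples_subset n by blast
      then show "x \<in> I" using I.mem_of_minus2 x y by blast
    qed
  qed
  with fam show ?thesis by blast
qed

lemma bij_betw_contract: "bij_betw contract families (ideals_over T D)"
proof (rule bij_betwI')
  fix J J' assume JJ: "J \<in> families" "J' \<in> families"
  show "contract J = contract J' \<longleftrightarrow> J = J'"
  proof
    assume eq: "contract J = contract J'"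
    have "J i = J' i" if "i \<in> A" for i
      using contract_subset_imp[OF JJ] contract_subset_imp[OF JJ(2,1)] eq that by blast
    then show "J = J'" using JJ by (auto intro: PiE_ext)
  qed auto
qed (use contract_mem contract_surj in auto)

text \<open>The map from \<open>T\<close> to the product of the quotients is onto by approximation,
  and its fibres are the cosets of the contraction. For the second claim, a finite product of
  nonempty sets has only finite factors.\<close>

lemma contract_index:
  assumes J: "J \<in> families"
  shows "card (a_rcosets (contract J)) = (\<Prod>i\<in>A. card (a_rcosets\<^bsub>S i\<^esub> (J i)))"
    and "finite (a_rcosets (contract J)) \<Longrightarrow> i \<in> A \<Longrightarrow> finite (a_rcosets\<^bsub>S i\<^esub> (J i))"
proof -
  define f where "f = (\<lambda>x. \<lambda>i\<in>A. J i +>\<^bsub>S i\<^esub> \<phi> i x)"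
  define W where "W = PiE A (\<lambda>i. a_rcosets\<^bsub>S i\<^esub> (J i))"
  have eq: "J i +>\<^bsub>S i\<^esub> x = J i +>\<^bsub>S i\<^esub> y \<longleftrightarrow> x \<ominus>\<^bsub>S i\<^esub> y \<in> J i" 
    if "i \<in> A" "x \<in> carrier (S i)" "y \<in> carrier (S i)" for i x y
    using cring.coset_eq_iff[OF cring_S familiesD(1)[OF J]] that by blast
  have "f ` carrier T = W"
  proof (intro equalityI subsetI)
    fix w assume "w \<in> f ` carrier T"
    then show "w \<in> W" 
      using ring_hom_closed[OF hom] by (auto simp: f_def W_def cring.a_rcosets_image[OF cring_S])
  next
    fix w assume w: "w \<in> W"
    have "\<exists>y\<in>carrier (S i). w i = J i +>\<^bsub>S i\<^esub> y" if "i \<in> A" for i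
      using PiE_mem[OF w[unfolded W_def] that] cring.a_rcosets_image[OF cring_S[OF that], of "J i"] by auto
    then obtain y where y: "\<And>i. i \<in> A \<Longrightarrow> y i \<in> carrier (S i)" "\<And>i. i \<in> A \<Longrightarrow> w i = J i +>\<^bsub>S i\<^esub> y i"
      by metis
    obtain x where x: "x \<in> carrier T" "\<And>i. i \<in> A \<Longrightarrow> \<phi> i x \<ominus>\<^bsub>S i\<^esub> y i \<in> J i"
      using approximation_in_family[OF J, of y] y by blast
    have "f x = w"
    proof (rule PiE_ext)
      show "f x \<in> PiE A (\<lambda>_. UNIV)" "w \<in> PiE A (\<lambda>_. UNIV)" using w by (auto simp: f_def W_def)
      show "f x i = w i" if "i \<in> A" for i
        using that x y eq[OF that ring_hom_closed[OF hom[OF that] x(1)] y(1)] by (simp add: f_def)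
    qed
    with x show "w \<in> f ` carrier T" by blast
  qed
  moreover have "f x = f y \<longleftrightarrow> x \<ominus> y \<in> contract J" if "x \<in> carrier T" "y \<in> carrier T" for x y
  proof -
    have "f x = f y \<longleftrightarrow> (\<forall>i\<in>A. J i +>\<^bsub>S i\<^esub> \<phi> i x = J i +>\<^bsub>S i\<^esub> \<phi> i y)"
      by (auto simp: f_def restrict_def fun_eq_iff)
    also have "\<dots> \<longleftrightarrow> (\<forall>i\<in>A. \<phi> i (x \<ominus> y) \<in> J i)"
      using that eq ring_hom_closed[OF hom]
        ring_hom_minus[OF ring_axioms cring.axioms(1)[OF cring_S] hom] by simp
    finally show ?thesis using that by (simp add: contract_def)
  qed
  ultimately obtain g where g: "bij_betw g (a_rcosets (contract J)) W"
    using bij_betw_a_rcosets[OF contract_ideal, of J f W] familiesD(1)[OF J] by blast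
  then show "card (a_rcosets (contract J)) = (\<Prod>i\<in>A. card (a_rcosets\<^bsub>S i\<^esub> (J i)))"
    using finite_A by (simp add: bij_betw_same_card W_def card_PiE)
  assume "finite (a_rcosets (contract J))" and i: "i \<in> A"
  then have "finite W" using g bij_betw_finite by blast
  moreover have "W \<noteq> {}"
    unfolding W_def PiE_eq_empty_iff 
    using cring.a_rcosets_image[OF cring_S] abelian_monoid.zero_closed[OF abelian_group.axioms(1)[OF ring.is_abelian_group[OF cring.axioms(1)[OF cring_S]]]]
    by blast
  ultimately show "finite (a_rcosets\<^bsub>S i\<^esub> (J i))"
    using i finite_A by (auto simp: W_def finite_PiE_iff)
qed

end

text \<open>Pigeonhole on the cosets of 0, 1, ..., c, where c is the index. The bound of the integer
  by the index is what later makes the number of ideals of given index polynomial.\<close>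

lemma (in ring) one_int_pigeonhole:
  assumes "ideal I R" "finite (a_rcosets I)"
  shows "\<exists>n::int. n > 0 \<and> n \<le> int (card (a_rcosets I)) \<and> imul R n \<one> \<in> I"
proof -
  let ?c = "card (a_rcosets I)" and ?f = "\<lambda>n::nat. I +> (imul R (int n) \<one>)"
  have sub: "?f ` {..?c} \<subseteq> a_rcosets I"
    unfolding A_RCOSETS_def' by blast
  have "\<not> inj_on ?f {..?c}"
  proof
    assume "inj_on ?f {..?c}"
    then have "card {..?c} \<le> ?c" using sub assms(2) by (metis card_image card_mono)
    then show False by simp
  qed
  then obtain m n :: nat where "m < n" "n \<le> ?c" "?f n = ?f m"
    unfolding inj_on_def by (metis atMost_iff linorder_neqE_nat)
  moreover interpret ideal I R by fact
  have "x \<ominus> y \<in> I" if "I +> x = I +> y" "x \<in> carrier R" "y \<in> carrier R" for x y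
    using that a_rcos_module_minus[OF ring_axioms, of y x] a_rcos_self[of x] by metis
  ultimately have "imul R (int n - int m) \<one> \<in> I" by (simp add: imul_diff)
  with \<open>m < n\<close> \<open>n \<le> ?c\<close> show ?thesis by (intro exI[of _ "int n - int m"]) auto
qed

subsection \<open>Subgroups of finitely generated abelian groups\<close>

lemma int_subgroup_imul:
  assumes "(\<lambda>_. 0) \<in> H" "\<And>a b. a \<in> H \<Longrightarrow> b \<in> H \<Longrightarrow> (\<lambda>i. a i - b i) \<in> H" "a \<in> H"
  shows "(\<lambda>i. (k::int) * a i) \<in> (H :: (nat \<Rightarrow> int) set)"
proof -
  have neg: "(\<lambda>i. - b i) \<in> H" if "b \<in> H" for b using assms(2)[OF assms(1) that] by simp
  have add: "(\<lambda>i. b i + c i) \<in> H" if "b \<in> H" "c \<in> H" for b c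
    using assms(2)[OF that(1) neg[OF that(2)]] by simp
  have nat: "(\<lambda>i. int n * a i) \<in> H" for n
  proof (induction n)
    case (Suc n)
    show ?case using add[OF assms(3) Suc] by (simp add: algebra_simps)
  qed (use assms in auto)
  show ?thesis
    by (cases k rule: int_cases2) (use nat neg[OF nat] in auto)
qed

text \<open>Hermite normal form; \<open>m = 0\<close> covers the case of infinite index.\<close>

lemma int_subgroup_generators:
  fixes H :: "(nat \<Rightarrow> int) set"
  assumes "H \<subseteq> {c. \<forall>i\<ge>N. c i = 0}" "(\<lambda>_. 0) \<in> H"
    "\<And>a b. a \<in> H \<Longrightarrow> b \<in> H \<Longrightarrow> (\<lambda>i. a i - b i) \<in> H"
    "m \<ge> 0" "\<And>c. (\<forall>i\<ge>N. c i = 0) \<Longrightarrow> (\<lambda>i. m * c i) \<in> H"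
  shows "\<exists>v. (\<forall>j<N. v j \<in> H \<and> (m > 0 \<longrightarrow> (\<forall>i. v j i \<in> {0..m}))) \<and>
    (\<forall>h\<in>H. \<exists>a::nat \<Rightarrow> int. h = (\<lambda>i. \<Sum>j<N. a j * v j i))"
  using assms
proof (induction N arbitrary: H)
  case 0
  then show ?case by auto
next
  case (Suc N)
  note H = Suc.prems
  have mulH: "(\<lambda>i. k * a i) \<in> H" if "a \<in> H" for k a
    using int_subgroup_imul[OF H(2,3) that] by blast
  define H' where "H' = {h \<in> H. h N = 0}"
  have "\<exists>v. (\<forall>j<N. v j \<in> H' \<and> (m > 0 \<longrightarrow> (\<forall>i. v j i \<in> {0..m}))) \<and>
    (\<forall>h\<in>H'. \<exists>a::nat \<Rightarrow> int. h = (\<lambda>i. \<Sum>j<N. a j * v j i))"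
  proof (rule Suc.IH)
    show "H' \<subseteq> {c. \<forall>i\<ge>N. c i = 0}"
      using H(1) by (auto simp: H'_def) (metis (mono_tags, lifting) CollectD le_antisym not_less_eq_eq subsetD)
    show "(\<lambda>i. m * c i) \<in> H'" if "\<forall>i\<ge>N. c i = 0" for c
      using H(5)[of c] that by (auto simp: H'_def)
  qed (use H in \<open>auto simp: H'_def\<close>)
  then obtain v where v: "\<And>j. j < N \<Longrightarrow> v j \<in> H'" "\<And>j i. j < N \<Longrightarrow> m > 0 \<Longrightarrow> v j i \<in> {0..m}"
    "\<And>h. h \<in> H' \<Longrightarrow> \<exists>a::nat \<Rightarrow> int. h = (\<lambda>i. \<Sum>j<N. a j * v j i)" by blast
  have "\<exists>w\<in>H. (m > 0 \<longrightarrow> (\<forall>i. w i \<in> {0..m})) \<and> (\<forall>h\<in>H. \<exists>q. h N = q * w N)"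
  proof (cases "\<exists>h\<in>H. h N > 0")
    case False
    have "h N = 0" if "h \<in> H" for h
      using False that mulH[OF that, of "-1"] by force
    then show ?thesis using H(2,4) by (intro bexI[of _ "\<lambda>_. 0"]) auto
  next
    case True
    \<comment> \<open>The positive generator of the group of last coordinates; it is found by
      division with remainder.\<close>
    define d where "d = (LEAST d. \<exists>h\<in>H. h N = int d \<and> d > 0)"
    from True have ex: "\<exists>d. \<exists>h\<in>H. h N = int d \<and> d > 0" by (metis of_nat_0_less_iff pos_int_cases)
    obtain h0 where h0: "h0 \<in> H" "h0 N = int d" "d > 0"
      using LeastI_ex[OF ex] by (auto simp: d_def)
    have least: "d \<le> e" if "h \<in> H" "h N = int e" "e > 0" for h e
      using that by (auto simp: d_def intro!: Least_le)
    have dm: "int d \<le> m" if "m > 0"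
    proof -
      have "(\<lambda>i. m * (if i = N then 1 else 0)) \<in> H" by (rule H(5)) auto
      then show ?thesis using least[of _ "nat m"] that by force
    qed
    \<comment> \<open>The multiples of \<open>m\<close> in the coordinates below \<open>N\<close>
      lie in \<open>H\<close>, so these coordinates may be reduced. The coordinate \<open>N\<close>
      must keep its value \<open>d\<close>, which is at most \<open>m\<close> anyway.\<close>
    define w where "w = (\<lambda>i. if i < N \<and> m > 0 then h0 i mod m else h0 i)"
    have "(\<lambda>i. h0 i - m * (if i < N \<and> m > 0 then h0 i div m else 0)) \<in> H"
      by (rule H(3)[OF h0(1) H(5)]) auto
    moreover have "(\<lambda>i. h0 i - m * (if i < N \<and> m > 0 then h0 i div m else 0)) = w"
      by (auto simp: w_def fun_eq_iff minus_mult_div_eq_mod)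
    ultimately have w: "w \<in> H" by simp
    have wN: "w N = int d" using h0 by (simp add: w_def)
    have "\<exists>q. h N = q * w N" if h: "h \<in> H" for h
    proof -
      have "(\<lambda>i. h i - (h N div int d) * w i) \<in> H"
        by (rule H(3)[OF h mulH[OF w]])
      moreover have "h N - (h N div int d) * w N = h N mod int d"
        by (simp add: wN minus_div_mult_eq_mod)
      moreover have "0 \<le> h N mod int d" "h N mod int d < int d" using h0(3) by auto
      ultimately have "h N mod int d = 0"
        using least[of "\<lambda>i. h i - (h N div int d) * w i" "nat (h N mod int d)"]
        by (cases "h N mod int d = 0") auto
      then show ?thesis unfolding wN by (metis dvd_div_mult_self mod_0_imp_dvd)
    qed
    moreover have "w i \<in> {0..m}" if "m > 0" for i
    proof -
      consider "i < N" | "i = N" | "i \<ge> Suc N" by linarith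
      then show ?thesis
      proof cases
        case 1
        then show ?thesis using that pos_mod_bound[OF that, of "h0 i"] by (auto simp: w_def less_imp_le)
      next
        case 2
        then show ?thesis using wN dm that by auto
      next
        case 3
        then show ?thesis using w H(1) that by auto
      qed
    qed
    ultimately show ?thesis using w by blast
  qed
  then obtain w where w: "w \<in> H" "\<And>i. m > 0 \<Longrightarrow> w i \<in> {0..m}" "\<And>h. h \<in> H \<Longrightarrow> \<exists>q. h N = q * w N" by blast
  show ?case
  proof (intro exI[of _ "v(N := w)"] conjI allI impI ballI)
    fix j assume "j < Suc N"
    then show "(v(N := w)) j \<in> H" using v w by (auto simp: H'_def less_Suc_eq)
    fix i assume "m > 0"
    then show "(v(N := w)) j i \<in> {0..m}" using v w \<open>j < Suc N\<close> by (auto simp: less_Suc_eq)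
  next
    fix h assume h: "h \<in> H"
    obtain q where q: "h N = q * w N" using w(3)[OF h] by blast
    have "(\<lambda>i. h i - q * w i) \<in> H'"
      using H(3)[OF h mulH[OF w(1), of q]] q by (auto simp: H'_def)
    then obtain a where "(\<lambda>i. h i - q * w i) = (\<lambda>i. \<Sum>j<N. a j * v j i)" using v(3) by blast
    then have "h = (\<lambda>i. \<Sum>j<Suc N. (a(N := q)) j * (v(N := w)) j i)"
      by (auto simp: fun_eq_iff algebra_simps)
    then show "\<exists>a. h = (\<lambda>i. \<Sum>j<Suc N. a j * (v(N := w)) j i)" by blast
  qed
qed

text \<open>Recursion on the number of generators makes sense for every ring record and lets all
  rules be proved by induction. Values of \<open>g\<close> and \<open>c\<close> from
  \<open>n\<close> on do not matter.\<close>

primrec lincomb :: "('a, 'm) ring_scheme \<Rightarrow> (nat \<Rightarrow> 'a) \<Rightarrow> nat \<Rightarrow> (nat \<Rightarrow> int) \<Rightarrow> 'a" where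
  "lincomb R g 0 c = \<zero>\<^bsub>R\<^esub>"
| "lincomb R g (Suc n) c = lincomb R g n c \<oplus>\<^bsub>R\<^esub> imul R (c n) (g n)"

definition generated_by :: "('a, 'm) ring_scheme \<Rightarrow> (nat \<Rightarrow> 'a) \<Rightarrow> nat \<Rightarrow> bool" where
  "generated_by R g n \<longleftrightarrow> (\<forall>i<n. g i \<in> carrier R) \<and> (\<forall>x\<in>carrier R. \<exists>c. x = lincomb R g n c)"

context abelian_group
begin

lemma lincomb_closed [simp, intro]: "(\<And>i. i < n \<Longrightarrow> g i \<in> carrier G) \<Longrightarrow> lincomb G g n c \<in> carrier G"
  by (induction n) auto

lemma lincomb_cong: "(\<And>i. i < n \<Longrightarrow> c i = d i) \<Longrightarrow> lincomb G g n c = lincomb G g n d"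
  by (induction n) auto

lemma lincomb_0: "(\<And>i. i < n \<Longrightarrow> c i = 0) \<Longrightarrow> lincomb G g n c = \<zero>"
  by (induction n) auto

lemma lincomb_add:
  "(\<And>i. i < n \<Longrightarrow> g i \<in> carrier G) \<Longrightarrow>
    lincomb G g n (\<lambda>i. c i + d i) = lincomb G g n c \<oplus> lincomb G g n d"
  by (induction n) (simp_all add: imul_add a_ac)

lemma lincomb_imul:
  "(\<And>i. i < n \<Longrightarrow> g i \<in> carrier G) \<Longrightarrow> lincomb G g n (\<lambda>i. k * c i) = imul G k (lincomb G g n c)"
  by (induction n) (simp_all add: imul_mult imul_distrib)

lemma lincomb_diff:
  assumes "\<And>i. i < n \<Longrightarrow> g i \<in> carrier G"
  shows "lincomb G g n (\<lambda>i. c i - d i) = lincomb G g n c \<ominus> lincomb G g n d"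
proof -
  have "lincomb G g n (\<lambda>i. c i - d i) = lincomb G g n (\<lambda>i. c i + (-1) * d i)" by simp
  also have "\<dots> = lincomb G g n c \<oplus> imul G (-1) (lincomb G g n d)"
    using assms lincomb_add[of n g c "\<lambda>i. -1 * d i"] lincomb_imul[of n g "-1" d] by simp
  finally show ?thesis using assms by (simp add: imul_neg minus_eq)
qed

lemma lincomb_sum:
  assumes "\<And>i. i < n \<Longrightarrow> g i \<in> carrier G"
  shows "lincomb G g n (\<lambda>i. \<Sum>j<N. a j * v j i) = lincomb G (\<lambda>j. lincomb G g n (v j)) N a"
proof (induction N)
  case 0
  then show ?case by (simp add: lincomb_0)
next
  case (Suc N)
  then show ?case
    using assms lincomb_add[of n g "\<lambda>i. \<Sum>j<N. a j * v j i" "\<lambda>i. a N * v N i"] by (simp add: lincomb_imul)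
qed

lemma lincomb_unit:
  assumes "\<And>i. i < n \<Longrightarrow> g i \<in> carrier G" "j < n"
  shows "lincomb G g n (\<lambda>i. if i = j then 1 else 0) = g j"
  using assms
proof (induction n)
  case (Suc n)
  show ?case
  proof (cases "j = n")
    case True
    have "lincomb G g n (\<lambda>i. if i = j then 1 else 0) = \<zero>" using True by (intro lincomb_0) auto
    then show ?thesis using Suc.prems True by simp
  next
    case False
    then show ?thesis using Suc by simp
  qed
qed auto

lemma lincomb_in_subgroup:
  assumes "additive_subgroup H G" "\<And>j. j < N \<Longrightarrow> g j \<in> H"
  shows "lincomb G g N a \<in> H"
proof -
  interpret additive_subgroup H G by fact
  have "imul G k x \<in> H" if "x \<in> H" for k x
    using add.subgroup_int_pow_closed[OF a_subgroup that, of k] by (simp add: add_pow_def)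
  then show ?thesis using assms(2) by (induction N) auto
qed

text \<open>Pull \<open>H\<close> back to coefficient vectors and use the normal form there. The
  choice m = 0 is always admissible and shows that \<open>H\<close> is finitely generated; a
  positive \<open>m\<close> bounds the coefficients and so the number of possible subgroups
  \<open>H\<close>.\<close>

lemma subgroup_generators:
  assumes g: "generated_by G g n" and H: "additive_subgroup H G"
    and m: "m \<ge> 0" "\<And>x. x \<in> carrier G \<Longrightarrow> imul G m x \<in> H"
  shows "\<exists>v. (\<forall>j<n. lincomb G g n (v j) \<in> H \<and> (\<forall>i\<ge>n. v j i = 0) \<and> (m > 0 \<longrightarrow> (\<forall>i. v j i \<in> {0..m}))) \<and>
     (\<forall>h\<in>H. \<exists>a. h = lincomb G (\<lambda>j. lincomb G g n (v j)) n a)"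
proof -
  interpret H: additive_subgroup H G by fact
  have gc: "g i \<in> carrier G" if "i < n" for i using g that by (simp add: generated_by_def)
  define H' where "H' = {c. (\<forall>i\<ge>n. c i = 0) \<and> lincomb G g n c \<in> H}"
  obtain v where v: "\<And>j. j < n \<Longrightarrow> v j \<in> H'" "\<And>j i. j < n \<Longrightarrow> m > 0 \<Longrightarrow> v j i \<in> {0..m}"
    "\<And>h. h \<in> H' \<Longrightarrow> \<exists>a::nat \<Rightarrow> int. h = (\<lambda>i. \<Sum>j<n. a j * v j i)"
  proof -
    have "\<exists>v. (\<forall>j<n. v j \<in> H' \<and> (m > 0 \<longrightarrow> (\<forall>i. v j i \<in> {0..m}))) \<and>
      (\<forall>h\<in>H'. \<exists>a::nat \<Rightarrow> int. h = (\<lambda>i. \<Sum>j<n. a j * v j i))"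
    proof (rule int_subgroup_generators)
      show "(\<lambda>i. a i - b i) \<in> H'" if "a \<in> H'" "b \<in> H'" for a b
        using that gc by (auto simp: H'_def lincomb_diff minus_eq)
      show "(\<lambda>i. m * c i) \<in> H'" if "\<forall>i\<ge>n. c i = 0" for c
        using that gc m(2) by (auto simp: H'_def lincomb_imul)
      show "(\<lambda>_. 0) \<in> H'" using lincomb_0[of n "\<lambda>_. 0" g] by (auto simp: H'_def)
    qed (use m in \<open>auto simp: H'_def\<close>)
    then show ?thesis using that by blast
  qed
  have "\<exists>a. h = lincomb G (\<lambda>j. lincomb G g n (v j)) n a" if h: "h \<in> H" for h
  proof -
    obtain c where c: "h = lincomb G g n c"
      using g H.a_subset h unfolding generated_by_def by blast
    define c' where "c' = (\<lambda>i. if i < n then c i else 0)"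
    have c': "h = lincomb G g n c'" using lincomb_cong[of n c c' g] c by (simp add: c'_def)
    then have "c' \<in> H'" using h by (auto simp: H'_def c'_def)
    then obtain a where "c' = (\<lambda>i. \<Sum>j<n. a j * v j i)" using v(3) by blast
    then show ?thesis using c' lincomb_sum[OF gc, where N = n and a = a and v = v] by auto
  qed
  moreover have "lincomb G g n (v j) \<in> H" "\<forall>i\<ge>n. v j i = 0" if "j < n" for j
    using v(1)[OF that] by (auto simp: H'_def)
  ultimately show ?thesis using v(2) by (intro exI[of _ v] conjI allI impI ballI) auto
qed

end

subsection \<open>Counting ideals\<close>

text \<open>Reducing the coefficients modulo \<open>m\<close> leaves finitely many coset
  representatives.\<close>

lemma (in cring) finite_index_of_int:
  assumes g: "generated_by R g n" and I: "ideal I R" and m: "m > 0" "imul R m \<one> \<in> I"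
  shows "finite (a_rcosets I)"
proof -
  interpret I: ideal I R by fact
  have gc: "g i \<in> carrier R" if "i < n" for i using g that by (simp add: generated_by_def)
  have "a_rcosets I \<subseteq> (\<lambda>c. I +> lincomb R g n c) ` (PiE {..<n} (\<lambda>_. {0..<m}))"
  proof
    fix Z assume "Z \<in> a_rcosets I"
    then obtain x where x: "x \<in> carrier R" "Z = I +> x" by (auto simp: a_rcosets_image)
    then obtain c where c: "x = lincomb R g n c" using g by (auto simp: generated_by_def)
    define d where "d = (\<lambda>i\<in>{..<n}. c i mod m)"
    have "x = lincomb R g n (\<lambda>i. m * (c i div m) + d i)"
      unfolding c by (rule lincomb_cong) (auto simp: d_def)
    also have "\<dots> = imul R m (lincomb R g n (\<lambda>i. c i div m)) \<oplus> lincomb R g n d"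
      using gc by (simp add: lincomb_add lincomb_imul)
    finally have "x \<ominus> lincomb R g n d = imul R m (lincomb R g n (\<lambda>i. c i div m))"
      using gc by (simp add: minus_eq a_assoc r_neg)
    then have "x \<ominus> lincomb R g n d \<in> I"
      using I.multiples_subset[OF m(2)] gc multiplesI by (metis lincomb_closed subsetD)
    then have "Z = I +> lincomb R g n d"
      using x coset_eq_iff[OF I x(1), of "lincomb R g n d"] gc by simp
    moreover have "d \<in> PiE {..<n} (\<lambda>_. {0..<m})" using m by (auto simp: d_def)
    ultimately show "Z \<in> (\<lambda>c. I +> lincomb R g n c) ` (PiE {..<n} (\<lambda>_. {0..<m}))" by blast
  qed
  then show ?thesis by (rule finite_subset) (auto intro: finite_PiE)
qed

lemma (in cring) finite_index_ideals_eq: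
  assumes "generated_by R g n"
  shows "finite_index_ideals R = ideals_over R {0<..}"
  using finite_index_of_int[OF assms] one_int_pigeonhole
  unfolding finite_index_ideals_def ideals_over_def by fastforce

text \<open>Such an ideal is spanned over the integers by \<open>n\<close> combinations of the
  generators with coefficients between 0 and \<open>m\<close>. It is determined by an n x n matrix
  with m + 1 choices for each entry.\<close>

lemma (in cring) card_ideals_containing:
  assumes g: "generated_by R g n" and m: "m > 0"
  shows "finite {I. ideal I R \<and> imul R m \<one> \<in> I}"
    "card {I. ideal I R \<and> imul R m \<one> \<in> I} \<le> (nat m + 1) ^ (n * n)"
proof -
  have gc: "g i \<in> carrier R" if "i < n" for i using g that by (simp add: generated_by_def)
  define W where "W = PiE {..<n} (\<lambda>_. PiE {..<n} (\<lambda>_. {0..m}))"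
  have fin: "finite W" by (auto simp: W_def intro!: finite_PiE)
  have card: "card W = (nat m + 1) ^ (n * n)"
    using m by (simp add: W_def card_PiE power_mult nat_add_distrib)
  have "{I. ideal I R \<and> imul R m \<one> \<in> I} \<subseteq> (\<lambda>v. range (lincomb R (\<lambda>j. lincomb R g n (v j)) n)) ` W"
  proof
    fix I assume "I \<in> {I. ideal I R \<and> imul R m \<one> \<in> I}"
    then interpret I: ideal I R by auto
    have "imul R m x \<in> I" if "x \<in> carrier R" for x
      using I.multiples_subset \<open>I \<in> _\<close> that by auto
    then obtain v where v: "\<And>j. j < n \<Longrightarrow> lincomb R g n (v j) \<in> I" "\<And>j i. j < n \<Longrightarrow> v j i \<in> {0..m}"
      "\<And>h. h \<in> I \<Longrightarrow> \<exists>a. h = lincomb R (\<lambda>j. lincomb R g n (v j)) n a"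
      using subgroup_generators[OF g I.is_additive_subgroup, of m] m by (metis less_imp_le)
    \<comment> \<open>Only the entries below \<open>n\<close> matter; truncating the rest makes the
      matrix an element of the finite set \<open>W\<close>.\<close>
    define w where "w = (\<lambda>j\<in>{..<n}. restrict (v j) {..<n})"
    have eq: "lincomb R g n (w j) = lincomb R g n (v j)" if "j < n" for j
      using that by (auto simp: w_def intro!: lincomb_cong)
    have eq2: "lincomb R (\<lambda>j. lincomb R g n (w j)) N a = lincomb R (\<lambda>j. lincomb R g n (v j)) N a" if "N \<le> n" for N a
      using that by (induction N) (auto simp: eq)
    have "w \<in> W" using v(2) by (auto simp: w_def W_def)
    moreover have "I = range (lincomb R (\<lambda>j. lincomb R g n (w j)) n)"
    proof (intro equalityI subsetI)
      fix x assume "x \<in> I"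
      then show "x \<in> range (lincomb R (\<lambda>j. lincomb R g n (w j)) n)" using v(3)[of x] eq2 by auto
    next
      fix x assume "x \<in> range (lincomb R (\<lambda>j. lincomb R g n (w j)) n)"
      then show "x \<in> I" using v(1) lincomb_in_subgroup[OF I.is_additive_subgroup] eq2 by auto
    qed
    ultimately show "I \<in> (\<lambda>v. range (lincomb R (\<lambda>j. lincomb R g n (v j)) n)) ` W" by blast
  qed
  from finite_subset[OF this finite_imageI[OF fin]] surj_card_le[OF fin this] card
  show "finite {I. ideal I R \<and> imul R m \<one> \<in> I}"
    "card {I. ideal I R \<and> imul R m \<one> \<in> I} \<le> (nat m + 1) ^ (n * n)" by simp_all
qed

text \<open>An ideal of index \<open>m\<close> contains an integer between 1 and \<open>m\<close>.
  Each of these \<open>m\<close> integers lies in at most (2m)^(n*n) ideals, which gives the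
  constant and the exponent.\<close>

lemma (in cring) card_ideals_index:
  assumes g: "generated_by R g n"
  shows "finite {I \<in> finite_index_ideals R. card (a_rcosets I) = m}"
    "card {I \<in> finite_index_ideals R. card (a_rcosets I) = m} \<le> 2 ^ (n * n) * m ^ (n * n + 1)"
proof -
  let ?X = "\<lambda>k. {I. ideal I R \<and> imul R (int k) \<one> \<in> I}"
  have sub: "{I \<in> finite_index_ideals R. card (a_rcosets I) = m} \<subseteq> (\<Union>k\<in>{1..m}. ?X k)"
  proof
    fix I assume I: "I \<in> {I \<in> finite_index_ideals R. card (a_rcosets I) = m}"
    then obtain k where "k > 0" "k \<le> int m" "imul R k \<one> \<in> I"
      using one_int_pigeonhole[of I] by (auto simp: finite_index_ideals_def)
    then show "I \<in> (\<Union>k\<in>{1..m}. ?X k)"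
      using I by (auto simp: finite_index_ideals_def intro!: bexI[of _ "nat k"])
  qed
  have fin: "finite (\<Union>k\<in>{1..m}. ?X k)" using card_ideals_containing(1)[OF g] by auto
  show "finite {I \<in> finite_index_ideals R. card (a_rcosets I) = m}"
    using finite_subset[OF sub fin] .
  have "card {I \<in> finite_index_ideals R. card (a_rcosets I) = m} \<le> card (\<Union>k\<in>{1..m}. ?X k)"
    using sub fin by (rule card_mono[rotated])
  also have "\<dots> \<le> (\<Sum>k\<in>{1..m}. card (?X k))" by (rule card_UN_le) auto
  also have "\<dots> \<le> (\<Sum>k\<in>{1..m}. (2 * m) ^ (n * n))"
  proof (rule sum_mono)
    fix k assume k: "k \<in> {1..m}"
    then have "card (?X k) \<le> (k + 1) ^ (n * n)" using card_ideals_containing(2)[OF g, of "int k"] by auto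
    also have "\<dots> \<le> (2 * m) ^ (n * n)" using k by (intro power_mono) auto
    finally show "card (?X k) \<le> (2 * m) ^ (n * n)" .
  qed
  finally show "card {I \<in> finite_index_ideals R. card (a_rcosets I) = m} \<le> 2 ^ (n * n) * m ^ (n * n + 1)"
    by (simp add: power_mult_distrib algebra_simps)
qed

text \<open>Grouped by the value m of \<open>f\<close>, the partial sums are bounded by
  \<open>C\<close> times the sum of 1/m^2. The value 0 is harmless because \<open>0 powr\<close>
  anything is 0.\<close>

lemma summable_on_of_polynomial_count:
  fixes f :: "'a \<Rightarrow> nat"
  assumes fin: "\<And>m. finite {x \<in> A. f x = m}" and card: "\<And>m. card {x \<in> A. f x = m} \<le> C * m ^ K"
    and t: "t \<ge> real K + 2"
  shows "(\<lambda>x. real (f x) powr (- t)) summable_on A"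
proof (rule nonneg_bdd_above_summable_on)
  define B where "B = real C * suminf (\<lambda>m. inverse ((real m)\<^sup>2))"
  have summ: "summable (\<lambda>m. inverse ((real m)\<^sup>2))" by (rule inverse_power_summable) simp
  have "sum (\<lambda>x. real (f x) powr (- t)) F \<le> B" if F: "F \<subseteq> A" "finite F" for F
  proof -
    have "sum (\<lambda>x. real (f x) powr (- t)) F = (\<Sum>m\<in>f ` F. \<Sum>x\<in>{x \<in> F. f x = m}. real (f x) powr (- t))"
      using F by (intro sum.image_gen)
    also have "\<dots> \<le> (\<Sum>m\<in>f ` F. real C * inverse ((real m)\<^sup>2))"
    proof (rule sum_mono)
      fix m assume "m \<in> f ` F"
      have "card {x \<in> F. f x = m} \<le> card {x \<in> A. f x = m}"
        using F(1) by (intro card_mono[OF fin]) auto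
      then have "card {x \<in> F. f x = m} \<le> C * m ^ K" using card[of m] by linarith
      then have c: "real (card {x \<in> F. f x = m}) \<le> real C * real m ^ K"
        by (metis of_nat_le_iff of_nat_mult of_nat_power)
      have "(\<Sum>x\<in>{x \<in> F. f x = m}. real (f x) powr (- t)) = real (card {x \<in> F. f x = m}) * real m powr (- t)"
        by simp
      also have "\<dots> \<le> real C * inverse ((real m)\<^sup>2)"
      proof (cases "m = 0")
        case False
        have "real (card {x \<in> F. f x = m}) * real m powr (- t) \<le> (real C * real m ^ K) * real m powr (- (real K + 2))"
          using c False t by (intro mult_mono powr_mono) auto
        also have "\<dots> = real C * (real m powr real K * real m powr (- (real K + 2)))"
          using False by (simp add: powr_realpow)
        also have "real m powr real K * real m powr (- (real K + 2)) = real m powr (-2)"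
          by (simp flip: powr_add)
        also have "\<dots> = inverse ((real m)\<^sup>2)" using False by (simp add: powr_minus powr_numeral)
        finally show ?thesis .
      qed simp
      finally show "(\<Sum>x\<in>{x \<in> F. f x = m}. real (f x) powr (- t)) \<le> real C * inverse ((real m)\<^sup>2)" .
    qed
    also have "\<dots> = real C * (\<Sum>m\<in>f ` F. inverse ((real m)\<^sup>2))" by (simp add: sum_distrib_left)
    also have "\<dots> \<le> B"
      unfolding B_def using F by (intro mult_left_mono sum_le_suminf[OF summ]) auto
    finally show ?thesis .
  qed
  then show "bdd_above (sum (\<lambda>x. real (f x) powr - t) ` {F. F \<subseteq> A \<and> finite F})"
    by (intro bdd_aboveI[of _ B]) auto
qed auto

lemma norm_zeta_term: "norm (zeta_term R s I) = real (card (a_rcosets\<^bsub>R\<^esub> I)) powr (- Re s)"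
  unfolding zeta_term_def by (subst norm_powr_real_powr) auto

text \<open>The bound is the exponent n*n + 1 of the count of ideals plus the 2 of the comparison
  with 1/m^2.\<close>

lemma (in cring) zeta_converges_of_generated:
  assumes "generated_by R g n" "Re s \<ge> real (n * n) + 3"
  shows "zeta_converges R s"
  unfolding zeta_converges_def
proof (rule abs_summable_summable)
  show "zeta_term R s abs_summable_on finite_index_ideals R"
    unfolding norm_zeta_term
    by (rule summable_on_of_polynomial_count[OF card_ideals_index[OF assms(1)]]) (use assms(2) in auto)
qed

lemma (in cring) card_a_rcosets_pos: "finite (a_rcosets I) \<Longrightarrow> card (a_rcosets I) > 0"
  by (auto simp: card_gt_0_iff a_rcosets_image)

lemma (in cring) card_a_rcosets_carrier [simp]: "card (a_rcosets (carrier R)) = 1"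
proof -
  have "carrier R +> x = carrier R +> \<zero>" if "x \<in> carrier R" for x
    using coset_eq_iff[OF oneideal that zero_closed] that by simp
  then have "(\<lambda>x. carrier R +> x) ` carrier R = {carrier R +> \<zero>}" by blast
  then show ?thesis by (simp add: a_rcosets_image)
qed

lemma (in cring) card_a_rcosets_eq_1:
  assumes "ideal I R" "card (a_rcosets I) = 1"
  shows "I = carrier R"
proof -
  interpret I: ideal I R by fact
  have "I +> \<one> = I +> \<zero>"
    using assms(2) imageI[OF one_closed, of "\<lambda>x. I +> x"] imageI[OF zero_closed, of "\<lambda>x. I +> x"]
    unfolding a_rcosets_image by (metis card_1_singletonE singletonD)
  then have "\<one> \<in> I" using coset_eq_iff[OF assms(1), of \<one> \<zero>] by (simp add: minus_eq)
  then show ?thesis by (rule I.one_imp_carrier)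
qed

text \<open>The unit ideal contributes 1 and every other ideal has index at least 2. Moving to the
  right of \<open>s0\<close> by \<open>N\<close> therefore multiplies the absolute sum
  \<open>C\<close> of the other terms by at most 2^(-N), and it drops below 1. Convergence at a
  single real point is all that is known for the completed rings.\<close>

lemma (in cring) zeta_nonzero:
  assumes "zeta_converges R (of_real s0)"
  shows "\<exists>t. \<forall>s. t < Re s \<longrightarrow> zeta_converges R s \<and> zeta R s \<noteq> 0"
proof -
  let ?X = "finite_index_ideals R - {carrier R}" and ?f = "\<lambda>I. real (card (a_rcosets I))"
  have F: "finite_index_ideals R = insert (carrier R) ?X"
  proof -
    have "finite (a_rcosets (carrier R))"
      using card_a_rcosets_carrier by (metis card.infinite zero_neq_one)
    then have "carrier R \<in> finite_index_ideals R"
      using oneideal by (simp add: finite_index_ideals_def)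
    then show ?thesis by blast
  qed
  have "(\<lambda>I. norm (zeta_term R (of_real s0) I)) summable_on finite_index_ideals R"
    using assms unfolding zeta_converges_def summable_on_iff_abs_summable_on_complex .
  then have sum0: "(\<lambda>I. ?f I powr (- s0)) summable_on ?X"
    unfolding norm_zeta_term by (auto intro: summable_on_subset_banach)
  define C where "C = infsum (\<lambda>I. ?f I powr (- s0)) ?X"
  have C0: "C \<ge> 0" unfolding C_def by (rule infsum_nonneg) auto
  \<comment> \<open>It suffices because N < 2^N, so that C < 2^N.\<close>
  obtain N :: nat where N: "real N > C" using reals_Archimedean2 by blast
  show ?thesis
  proof (intro exI[of _ "s0 + real N"] allI impI)
    fix s :: complex assume s: "s0 + real N < Re s"
    have ge2: "?f I \<ge> 2" if "I \<in> ?X" for I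
    proof -
      have I: "ideal I R" "finite (a_rcosets I)" "I \<noteq> carrier R"
        using that by (simp_all add: finite_index_ideals_def)
      have "card (a_rcosets I) \<noteq> 0" "card (a_rcosets I) \<noteq> 1"
        using card_a_rcosets_pos[OF I(2)] card_a_rcosets_eq_1[OF I(1)] I(3) by auto
      then show ?thesis by simp
    qed
    have bound: "norm (zeta_term R s I) \<le> ?f I powr (- s0) * 2 powr (- real N)" if I: "I \<in> ?X" for I
    proof -
      have "?f I powr (- Re s) \<le> ?f I powr (- (s0 + real N))"
        using ge2[OF I] s by (intro powr_mono) auto
      also have "\<dots> = ?f I powr (- s0) * ?f I powr (- real N)" by (simp flip: powr_add)
      also have "\<dots> \<le> ?f I powr (- s0) * 2 powr (- real N)"
        using ge2[OF I] by (intro mult_left_mono powr_mono2') auto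
      finally show ?thesis by (simp add: norm_zeta_term)
    qed
    have sum1: "(\<lambda>I. ?f I powr (- s0) * 2 powr (- real N)) summable_on ?X"
      using sum0 by (rule summable_on_cmult_left)
    have abs: "zeta_term R s abs_summable_on ?X"
      by (rule summable_on_comparison_test[OF sum1]) (use bound in auto)
    then have X: "zeta_term R s summable_on ?X" by (rule abs_summable_summable)
    then show "zeta_converges R s \<and> zeta R s \<noteq> 0"
    proof (intro conjI)
      show "zeta_converges R s" unfolding zeta_converges_def using X by (subst F, subst summable_on_insert_iff) 
      have "norm (infsum (zeta_term R s) ?X) \<le> infsum (\<lambda>I. norm (zeta_term R s I)) ?X"
        using abs by (rule norm_infsum_bound)
      also have "\<dots> \<le> infsum (\<lambda>I. ?f I powr (- s0) * 2 powr (- real N)) ?X"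
        using abs sum1 bound by (rule infsum_mono)
      also have "\<dots> = C * 2 powr (- real N)" by (simp add: infsum_cmult_left' C_def)
      also have "\<dots> < 1"
      proof -
        have "C < 2 ^ N" using N of_nat_less_two_power[of N] by (metis less_trans of_nat_numeral of_nat_power of_nat_less_iff)
        then show ?thesis by (simp add: powr_minus powr_realpow field_simps)
      qed
      finally have lt: "norm (infsum (zeta_term R s) ?X) < 1" .
      have "zeta R s = infsum (zeta_term R s) ({carrier R} \<union> ?X)"
        unfolding zeta_def by (subst F) simp
      also have "\<dots> = zeta_term R s (carrier R) + infsum (zeta_term R s) ?X"
        using X by (subst infsum_Un_disjoint) auto
      also have "zeta_term R s (carrier R) = 1" by (simp add: zeta_term_def)
      finally show "zeta R s \<noteq> 0"
        using lt by (metis add_eq_0_iff less_irrefl norm_minus_cancel norm_one)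
    qed
  qed
qed

section \<open>Zeta functions under a Chinese remainder decomposition\<close>

lemma coprime_bezout: "coprime a b \<Longrightarrow> \<exists>u v :: int. u * a + v * b = 1"
  using bezout_int[of a b] by simp

context ideal_decomposition
begin

lemma zeta_term_contract:
  assumes "J \<in> families"
  shows "zeta_term T s (contract J) = (\<Prod>i\<in>A. zeta_term (S i) s (J i))"
proof -
  have *: "of_nat (\<Prod>i\<in>B. f i) powr z = (\<Prod>i\<in>B. of_nat (f i) powr z)" if "finite B"
    for B :: "'i set" and f :: "'i \<Rightarrow> nat" and z :: complex
    using that
  proof (induction B)
    case (insert x F)
    have "(of_nat (f x) * of_nat (prod f F)) powr z = of_nat (f x) powr z * of_nat (prod f F) powr z"
      by (rule powr_times_real) (simp_all del: of_nat_prod)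
    then show ?case using insert by simp
  qed auto
  show ?thesis
    unfolding zeta_term_def contract_index(1)[OF assms] using *[OF finite_A] by blast
qed

lemma carrier_mem: "i \<in> A \<Longrightarrow> carrier (S i) \<in> ideals_over (S i) (E i)"
proof -
  assume i: "i \<in> A"
  interpret cring "S i" using cring_S i by blast
  show ?thesis using one_E[OF i] oneideal by (auto simp: ideals_over_def)
qed

text \<open>Contraction is a bijection and the terms are multiplicative, so the sum over families is
  a sum of products and factors. Summability is assumed only for \<open>T\<close>: each factor
  reappears as a subfamily of its terms. This is the source of convergence for the completed
  rings.\<close>

lemma zeta_decomposition:
  assumes sum: "zeta_term T s summable_on ideals_over T D"
  shows "i \<in> A \<Longrightarrow> zeta_term (S i) s summable_on ideals_over (S i) (E i)"
    and "infsum (zeta_term T s) (ideals_over T D) =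
      (\<Prod>i\<in>A. infsum (zeta_term (S i) s) (ideals_over (S i) (E i)))"
proof -
  let ?f = "\<lambda>J. \<Prod>i\<in>A. zeta_term (S i) s (J i)"
  have "(\<lambda>J. zeta_term T s (contract J)) summable_on families"
    using sum summable_on_reindex_bij_betw[OF bij_betw_contract] by blast
  then have sum2: "?f summable_on families"
    using zeta_term_contract by (subst summable_on_cong[where g = "\<lambda>J. zeta_term T s (contract J)"]) auto
  have *: "zeta_term (S i) s summable_on ideals_over (S i) (E i)" if i: "i \<in> A" for i
  proof -
    \<comment> \<open>Ideals of \<open>S i\<close> embed into the families with the unit ideal at
      all other places; those places contribute the factor 1.\<close>
    let ?h = "\<lambda>I. (\<lambda>j\<in>A. if j = i then I else carrier (S j))"
    have inj: "inj_on ?h (ideals_over (S i) (E i))"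
      using i by (intro inj_onI) (auto simp: fun_eq_iff split: if_splits)
    have "?h ` ideals_over (S i) (E i) \<subseteq> families" using carrier_mem by auto
    then have "?f summable_on ?h ` ideals_over (S i) (E i)"
      using sum2 summable_on_subset_banach by blast
    then have "(?f \<circ> ?h) summable_on ideals_over (S i) (E i)"
      using summable_on_reindex[OF inj] by blast
    moreover have "(?f \<circ> ?h) I = zeta_term (S i) s I" for I
    proof -
      have "(?f \<circ> ?h) I = (\<Prod>j\<in>A. if j = i then zeta_term (S i) s I else 1)"
        unfolding o_def using cring.card_a_rcosets_carrier[OF cring_S]
        by (intro prod.cong) (auto simp: zeta_term_def)
      then show ?thesis using finite_A i by simp
    qed
    ultimately show ?thesis by (simp add: o_def)
  qed
  then show "i \<in> A \<Longrightarrow> zeta_term (S i) s summable_on ideals_over (S i) (E i)" .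
  have "infsum (zeta_term T s) (ideals_over T D) = infsum (\<lambda>J. zeta_term T s (contract J)) families"
    using infsum_reindex_bij_betw[OF bij_betw_contract, of "zeta_term T s"] by simp
  also have "\<dots> = infsum ?f families"
    by (rule infsum_cong) (rule zeta_term_contract)
  also have "\<dots> = (\<Prod>i\<in>A. infsum (zeta_term (S i) s) (ideals_over (S i) (E i)))"
    by (rule infsum_prod_PiE) (use finite_A * sum2 in auto)
  finally show "infsum (zeta_term T s) (ideals_over T D) =
      (\<Prod>i\<in>A. infsum (zeta_term (S i) s) (ideals_over (S i) (E i)))" .
qed

end

subsection \<open>Euler products\<close>

text \<open>The decomposition is applied to two copies of the ring itself with identity maps; the
  two places differ only in their sets of integers. Bezout provides comaximality as well as
  separation.\<close>

lemma (in cring) zeta_split_coprime: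
  assumes one: "1 \<in> E1" "1 \<in> E2"
    and mult: "\<And>n m. n \<in> E1 \<Longrightarrow> m \<in> E1 \<Longrightarrow> n * m \<in> E1" "\<And>n m. n \<in> E2 \<Longrightarrow> m \<in> E2 \<Longrightarrow> n * m \<in> E2"
    and cop: "\<And>n m. n \<in> E1 \<Longrightarrow> m \<in> E2 \<Longrightarrow> coprime n m"
    and D: "D = {n * m | n m. n \<in> E1 \<and> m \<in> E2}"
    and sum: "zeta_term R s summable_on ideals_over R D"
  shows "zeta_term R s summable_on ideals_over R E1" "zeta_term R s summable_on ideals_over R E2"
    "infsum (zeta_term R s) (ideals_over R D) =
      infsum (zeta_term R s) (ideals_over R E1) * infsum (zeta_term R s) (ideals_over R E2)"
proof -
  let ?E = "\<lambda>b. if b then E1 else E2"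
  interpret ideal_decomposition R "\<lambda>_::bool. R" "\<lambda>_ x. x" UNIV ?E D
  proof
    fix i j :: bool and n m assume ij: "i \<noteq> j" "n \<in> ?E i" "m \<in> ?E j"
    then have "coprime n m" using cop[of n m] cop[of m n] by (cases i; cases j) (auto simp: coprime_commute)
    then obtain x y where xy: "x * n + y * m = 1" using coprime_bezout by blast
    have "\<one> \<ominus> imul R (n * x) \<one> = imul R (m * y) \<one>"
    proof -
      have "1 - n * x = m * y" using xy by (simp add: algebra_simps)
      then show ?thesis using imul_diff[of \<one> 1 "n * x"] by simp
    qed
    then show "\<exists>u\<in>carrier R. u \<in> multiples R n \<and> \<one> \<ominus> u \<in> multiples R m"
      by (intro bexI[of _ "imul R (n * x) \<one>"]) (auto simp: imul_mult)
  next
    fix n assume "n \<in> D"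
    then obtain a b where ab: "n = a * b" "a \<in> E1" "b \<in> E2" by (auto simp: D)
    then obtain u v where uv: "u * a + v * b = 1" using coprime_bezout[OF cop[of a b]] by blast
    have "x \<in> multiples R n" if x: "x \<in> carrier R" "x \<in> multiples R a" "x \<in> multiples R b" for x
    proof -
      obtain y z where yz: "y \<in> carrier R" "z \<in> carrier R" "x = imul R a y" "x = imul R b z"
        using x by (auto simp: multiples_def)
      have "x = imul R (u * a + v * b) x" using uv x by simp
      also have "\<dots> = imul R (u * a) x \<oplus> imul R (v * b) x" using x by (simp add: imul_add)
      also have "imul R (u * a) x = imul R n (imul R u z)"
        unfolding yz(4) using yz(1,2) by (simp flip: imul_mult add: ab ac_simps)
      also have "imul R (v * b) x = imul R n (imul R v y)"
        unfolding yz(3) using yz(1,2) by (simp flip: imul_mult add: ab ac_simps)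
      finally have "x = imul R n (imul R u z \<oplus> imul R v y)" using yz by (simp add: imul_distrib)
      then show ?thesis using yz by (metis a_closed imul_closed multiplesI)
    qed
    then show "\<exists>k. (\<forall>i\<in>UNIV. k i \<in> ?E i) \<and>
        (\<forall>x\<in>carrier R. (\<forall>i\<in>UNIV. x \<in> multiples R (k i)) \<longrightarrow> x \<in> multiples R n)"
      using ab by (intro exI[of _ "\<lambda>i. if i then a else b"]) (auto simp: all_bool_eq)
  next
    fix k assume "\<And>i::bool. i \<in> UNIV \<Longrightarrow> k i \<in> ?E i"
    from this[of True] this[of False] have "k True * k False \<in> D" unfolding D by auto
    then show "(\<Prod>i\<in>UNIV. k i) \<in> D" by (simp add: UNIV_bool mult.commute)
  next
    fix i and n y assume "n \<in> ?E i" "y \<in> carrier R"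
    then show "\<exists>t\<in>carrier R. y \<ominus> t \<in> multiples R n"
      using multiplesI[of \<zero> R n] by (intro bexI[of _ y]) (auto simp: minus_eq r_neg)
  qed (use one mult is_cring in \<open>auto simp: ring_hom_def split: if_splits\<close>)
  show "zeta_term R s summable_on ideals_over R E1" "zeta_term R s summable_on ideals_over R E2"
    "infsum (zeta_term R s) (ideals_over R D) =
      infsum (zeta_term R s) (ideals_over R E1) * infsum (zeta_term R s) (ideals_over R E2)"
    using zeta_decomposition(1)[OF sum, of True] zeta_decomposition(1)[OF sum, of False]
      zeta_decomposition(2)[OF sum]
    by (simp_all add: UNIV_bool mult.commute)
qed

definition powers :: "nat \<Rightarrow> int set" where
  "powers p = range (\<lambda>a. int p ^ a)"

definition coprime_to :: "nat set \<Rightarrow> int set" where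
  "coprime_to B = {n. n > 0 \<and> (\<forall>p\<in>B. coprime n (int p))}"

lemma coprime_to_insert:
  assumes p: "Factorial_Ring.prime p" "p \<notin> B" and B: "\<And>q. q \<in> B \<Longrightarrow> Factorial_Ring.prime q"
  shows "coprime_to B = {n * m | n m. n \<in> powers p \<and> m \<in> coprime_to (insert p B)}"
proof (intro equalityI subsetI)
  fix n assume n: "n \<in> coprime_to B"
  have pp: "Factorial_Ring.prime (int p)" using p by simp
  have n0: "n \<noteq> 0" "\<not> is_unit (int p)" using n pp by (auto simp: coprime_to_def)
  then obtain m where m: "n = int p ^ multiplicity (int p) n * m" "\<not> int p dvd m"
    using multiplicity_decompose' by metis
  have "0 < int p ^ multiplicity (int p) n" using p prime_gt_0_nat by simp
  then have "m > 0" using m(1) n unfolding coprime_to_def by (metis (mono_tags, lifting) mem_Collect_eq zero_less_mult_pos)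
  moreover have "coprime m (int p)" using prime_imp_coprime[OF pp m(2)] by (simp add: coprime_commute)
  moreover have "coprime m (int q)" if "q \<in> B" for q
    using n m(1) that unfolding coprime_to_def by (metis (mono_tags, lifting) coprime_mult_left_iff mem_Collect_eq)
  ultimately show "n \<in> {n * m | n m. n \<in> powers p \<and> m \<in> coprime_to (insert p B)}"
    using m(1) by (auto simp: powers_def coprime_to_def)
next
  fix n assume "n \<in> {n * m | n m. n \<in> powers p \<and> m \<in> coprime_to (insert p B)}"
  then obtain a m where am: "n = int p ^ a * m" "m \<in> coprime_to (insert p B)" by (auto simp: powers_def)
  moreover have "coprime (int p) (int q)" if "q \<in> B" for q
    using p B[OF that] that primes_coprime by (metis coprime_int_iff)
  ultimately show "n \<in> coprime_to B"
    using p by (auto simp: coprime_to_def prime_gt_0_nat)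
qed

lemma coprime_to_mult: "n \<in> coprime_to B \<Longrightarrow> m \<in> coprime_to B \<Longrightarrow> n * m \<in> coprime_to B"
  by (auto simp: coprime_to_def)

lemma powers_mult: "n \<in> powers p \<Longrightarrow> m \<in> powers p \<Longrightarrow> n * m \<in> powers p"
  by (auto simp: powers_def simp flip: power_add)

text \<open>One prime is split off at a time. The induction starts because
  \<open>coprime_to {}\<close> consists of all positive integers.\<close>

lemma (in cring) zeta_euler:
  assumes "finite B" "\<And>p. p \<in> B \<Longrightarrow> Factorial_Ring.prime p" "zeta_term R s summable_on ideals_over R {0<..}"
  shows "zeta_term R s summable_on ideals_over R (coprime_to B)"
    "\<And>p. p \<in> B \<Longrightarrow> zeta_term R s summable_on ideals_over R (powers p)"
    "infsum (zeta_term R s) (ideals_over R {0<..}) =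
      (\<Prod>p\<in>B. infsum (zeta_term R s) (ideals_over R (powers p))) *
      infsum (zeta_term R s) (ideals_over R (coprime_to B))"
proof -
  have "zeta_term R s summable_on ideals_over R (coprime_to B) \<and>
    (\<forall>p\<in>B. zeta_term R s summable_on ideals_over R (powers p)) \<and>
    infsum (zeta_term R s) (ideals_over R {0<..}) =
      (\<Prod>p\<in>B. infsum (zeta_term R s) (ideals_over R (powers p))) *
      infsum (zeta_term R s) (ideals_over R (coprime_to B))"
    using assms(1,2)
  proof (induction B)
    case empty
    have "coprime_to {} = {0<..}" by (auto simp: coprime_to_def)
    then show ?case using assms(3) by simp
  next
    case (insert p B)
    have IH: "zeta_term R s summable_on ideals_over R (coprime_to B)"
      "\<forall>p\<in>B. zeta_term R s summable_on ideals_over R (powers p)"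
      "infsum (zeta_term R s) (ideals_over R {0<..}) =
      (\<Prod>p\<in>B. infsum (zeta_term R s) (ideals_over R (powers p))) *
      infsum (zeta_term R s) (ideals_over R (coprime_to B))"
      using insert by blast+
    have "1 \<in> powers p" by (auto simp: powers_def intro: range_eqI[of _ _ 0])
    moreover have "1 \<in> coprime_to (insert p B)" by (auto simp: coprime_to_def)
    moreover have "coprime n m" if "n \<in> powers p" "m \<in> coprime_to (insert p B)" for n m
      using that by (auto simp: powers_def coprime_to_def coprime_commute)
    moreover have "coprime_to B = {n * m | n m. n \<in> powers p \<and> m \<in> coprime_to (insert p B)}"
      using insert by (intro coprime_to_insert) auto
    ultimately have "zeta_term R s summable_on ideals_over R (powers p)"
      "zeta_term R s summable_on ideals_over R (coprime_to (insert p B))"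
      "infsum (zeta_term R s) (ideals_over R (coprime_to B)) =
       infsum (zeta_term R s) (ideals_over R (powers p)) * infsum (zeta_term R s) (ideals_over R (coprime_to (insert p B)))"
      using zeta_split_coprime[of "powers p" "coprime_to (insert p B)" "coprime_to B" s,
          OF _ _ powers_mult coprime_to_mult _ _ IH(1)] by simp_all
    then show ?case using IH insert(1,2) by simp
  qed
  then show "zeta_term R s summable_on ideals_over R (coprime_to B)"
    "\<And>p. p \<in> B \<Longrightarrow> zeta_term R s summable_on ideals_over R (powers p)"
    "infsum (zeta_term R s) (ideals_over R {0<..}) =
      (\<Prod>p\<in>B. infsum (zeta_term R s) (ideals_over R (powers p))) *
      infsum (zeta_term R s) (ideals_over R (coprime_to B))"
    by blast+
qed

text \<open>A decomposition with a single place. If um + vn = 1 then \<open>m\<close> is invertible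
  modulo \<open>n\<close>, so \<open>surj\<close> yields density and \<open>inj\<close> yields
  separation although \<open>\<phi>\<close> need be neither surjective nor injective.\<close>

lemma zeta_comparison:
  fixes \<phi> :: "'t \<Rightarrow> 's"
  assumes "cring T" "cring S" and \<phi>: "\<phi> \<in> ring_hom T S"
    and one: "1 \<in> E" and mult: "\<And>n m. n \<in> E \<Longrightarrow> m \<in> E \<Longrightarrow> n * m \<in> E"
    and cop: "\<And>n. n \<in> E \<Longrightarrow> coprime m n"
    and surj: "\<And>y. y \<in> carrier S \<Longrightarrow> \<exists>x\<in>carrier T. \<phi> x = imul S m y"
    and inj: "\<And>n x y. n \<in> E \<Longrightarrow> x \<in> carrier T \<Longrightarrow> y \<in> carrier S \<Longrightarrow> \<phi> x = imul S n y \<Longrightarrow>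
      imul T m x \<in> multiples T n"
    and sum: "zeta_term T s summable_on ideals_over T E"
  shows "infsum (zeta_term T s) (ideals_over T E) = infsum (zeta_term S s) (ideals_over S E)"
    "zeta_term S s summable_on ideals_over S E"
proof -
  interpret T: cring T by fact
  interpret S: cring S by fact
  interpret ideal_decomposition T "\<lambda>_::unit. S" "\<lambda>_. \<phi>" UNIV "\<lambda>_. E" E
  proof
    fix n y assume n: "n \<in> E" and y: "y \<in> carrier S"
    obtain u v where uv: "u * m + v * n = 1" using coprime_bezout[OF cop[OF n]] by blast
    obtain x where x: "x \<in> carrier T" "\<phi> x = imul S m y" using surj[OF y] by blast
    have "\<phi> (imul T u x) = imul S (u * m) y"
      using ring_hom_imul[OF T.ring_axioms S.ring_axioms \<phi> x(1), of u] x y by (simp add: S.imul_mult)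
    then have "y \<ominus>\<^bsub>S\<^esub> \<phi> (imul T u x) = imul S (1 - u * m) y" using y by (simp add: S.imul_diff)
    also have "1 - u * m = n * v" using uv by (simp add: algebra_simps)
    finally have "y \<ominus>\<^bsub>S\<^esub> \<phi> (imul T u x) \<in> multiples S n" using y by (simp add: S.imul_mult multiplesI)
    then show "\<exists>t\<in>carrier T. y \<ominus>\<^bsub>S\<^esub> \<phi> t \<in> multiples S n" using x(1) by blast
  next
    fix n assume n: "n \<in> E"
    obtain u v where uv: "u * m + v * n = 1" using coprime_bezout[OF cop[OF n]] by blast
    have "x \<in> multiples T n" if x: "x \<in> carrier T" "\<phi> x \<in> multiples S n" for x
    proof -
      obtain z where z: "z \<in> carrier T" "imul T m x = imul T n z"
        using inj[OF n x(1)] x(2) by (auto simp: multiples_def)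
      have "x = imul T (u * m + v * n) x" using uv x by simp
      also have "\<dots> = imul T u (imul T m x) \<oplus>\<^bsub>T\<^esub> imul T (n * v) x"
        using x by (simp add: T.imul_add mult.commute[of v] flip: T.imul_mult)
      also have "imul T u (imul T m x) = imul T n (imul T u z)"
        unfolding z(2) using z by (simp flip: T.imul_mult add: mult.commute)
      finally have "x = imul T n (imul T u z \<oplus>\<^bsub>T\<^esub> imul T v x)" using z x by (simp add: T.imul_distrib T.imul_mult)
      then show ?thesis using z x by (metis T.a_closed T.imul_closed multiplesI)
    qed
    then show "\<exists>k. (\<forall>i\<in>UNIV. k i \<in> E) \<and>
        (\<forall>x\<in>carrier T. (\<forall>i\<in>UNIV. \<phi> x \<in> multiples S (k i)) \<longrightarrow> x \<in> multiples T n)"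
      using n by (intro exI[of _ "\<lambda>_. n"]) auto
  qed (use assms in \<open>auto simp: UNIV_unit\<close>)
  show "infsum (zeta_term T s) (ideals_over T E) = infsum (zeta_term S s) (ideals_over S E)"
    "zeta_term S s summable_on ideals_over S E"
    using zeta_decomposition(1)[OF sum, of "()"] zeta_decomposition(2)[OF sum] by (auto simp: UNIV_unit)
qed

subsection \<open>Tensor products\<close>

lemma frag_extend_pointwise_add:
  "frag_extend (\<lambda>p. f p + g p) x = frag_extend f x + frag_extend g x"
  by (simp add: frag_extend_def frag_cmul_distrib2 sum.distrib)

locale tensor_pair = R: cring R + S: cring S
  for R :: "('a, 'm) ring_scheme" and S :: "('b, 'n) ring_scheme"
begin

abbreviation PM :: "('a \<times> 'b \<Rightarrow>\<^sub>0 int) ring" where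
  "PM \<equiv> pair_monoid_ring R S"

text \<open>A named copy of the multiplication of \<open>PM\<close>. Biadditivity holds for it
  without any condition on carriers, and ring laws are then checked on the basis elements
  \<open>frag_of (a, b)\<close>.\<close>

definition pm_mult :: "('a \<times> 'b \<Rightarrow>\<^sub>0 int) \<Rightarrow> ('a \<times> 'b \<Rightarrow>\<^sub>0 int) \<Rightarrow> ('a \<times> 'b \<Rightarrow>\<^sub>0 int)" where
  "pm_mult x y = x \<otimes>\<^bsub>PM\<^esub> y"

lemma carrier_PM: "carrier PM = {x. Poly_Mapping.keys x \<subseteq> carrier R \<times> carrier S}"
  and mult_PM: "x \<otimes>\<^bsub>PM\<^esub> y = pm_mult x y"
  and one_PM: "\<one>\<^bsub>PM\<^esub> = frag_of (\<one>\<^bsub>R\<^esub>, \<one>\<^bsub>S\<^esub>)"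
  and zero_PM: "\<zero>\<^bsub>PM\<^esub> = 0"
  and add_PM: "x \<oplus>\<^bsub>PM\<^esub> y = x + y"
  by (simp_all add: pair_monoid_ring_def pm_mult_def)

lemma frag_of_PM: "a \<in> carrier R \<Longrightarrow> b \<in> carrier S \<Longrightarrow> frag_of (a, b) \<in> carrier PM"
  by (simp add: carrier_PM keys_frag_of)

lemma pm_mult_add_left: "pm_mult (x + y) z = pm_mult x z + pm_mult y z"
  by (simp add: pm_mult_def pair_monoid_ring_def frag_extend_add)

lemma pm_mult_add_right: "pm_mult z (x + y) = pm_mult z x + pm_mult z y"
  by (simp add: pm_mult_def pair_monoid_ring_def frag_extend_add case_prod_beta' frag_extend_pointwise_add)

lemma pm_mult_frag: "pm_mult (frag_of (a, b)) (frag_of (c, d)) = frag_of (a \<otimes>\<^bsub>R\<^esub> c, b \<otimes>\<^bsub>S\<^esub> d)"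
  by (simp add: pm_mult_def pair_monoid_ring_def)

lemma pm_mult_0 [simp]: "pm_mult 0 x = 0" "pm_mult x 0 = 0"
  using pm_mult_add_left[of 0 0 x] pm_mult_add_right[of x 0 0] by simp_all

lemma pm_mult_diff_left: "pm_mult (x - y) z = pm_mult x z - pm_mult y z"
  using pm_mult_add_left[of "x - y" y z] by simp

lemma pm_mult_diff_right: "pm_mult z (x - y) = pm_mult z x - pm_mult z y"
  using pm_mult_add_right[of z "x - y" y] by simp

lemma diff_PM_closed: "x \<in> carrier PM \<Longrightarrow> y \<in> carrier PM \<Longrightarrow> x - y \<in> carrier PM"
  unfolding carrier_PM using keys_diff[of x y] by auto

lemma zero_in_PM: "0 \<in> carrier PM"
  by (simp add: carrier_PM)

lemma add_PM_closed: "x \<in> carrier PM \<Longrightarrow> y \<in> carrier PM \<Longrightarrow> x + y \<in> carrier PM"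
  using diff_PM_closed[of x "0 - y"] diff_PM_closed[OF zero_in_PM, of y] by simp

lemma PM_induct [consumes 1, case_names zero one diff]:
  assumes "x \<in> carrier PM" "P 0" "\<And>a b. a \<in> carrier R \<Longrightarrow> b \<in> carrier S \<Longrightarrow> P (frag_of (a, b))"
    "\<And>x y. x \<in> carrier PM \<Longrightarrow> y \<in> carrier PM \<Longrightarrow> P x \<Longrightarrow> P y \<Longrightarrow> P (x - y)"
  shows "P x"
  by (rule free_Abelian_group_induct[of x "carrier R \<times> carrier S"])
    (use assms in \<open>auto simp: carrier_PM\<close>)

lemma pm_mult_closed: "x \<in> carrier PM \<Longrightarrow> y \<in> carrier PM \<Longrightarrow> pm_mult x y \<in> carrier PM"
proof (induction x rule: PM_induct)
  case (one a b)
  from one(3) show ?case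
    by (induction y rule: PM_induct)
      (use one in \<open>auto simp: pm_mult_frag zero_in_PM pm_mult_diff_right intro: frag_of_PM diff_PM_closed\<close>)
qed (auto simp: zero_in_PM pm_mult_diff_left intro: diff_PM_closed)

lemma pm_mult_comm: "x \<in> carrier PM \<Longrightarrow> y \<in> carrier PM \<Longrightarrow> pm_mult x y = pm_mult y x"
proof (induction x rule: PM_induct)
  case (one a b)
  from one(3) show ?case
    by (induction y rule: PM_induct)
      (use one in \<open>auto simp: pm_mult_frag pm_mult_diff_right pm_mult_diff_left R.m_comm S.m_comm\<close>)
qed (auto simp: pm_mult_diff_left pm_mult_diff_right)

lemma pm_mult_assoc:
  "x \<in> carrier PM \<Longrightarrow> y \<in> carrier PM \<Longrightarrow> z \<in> carrier PM \<Longrightarrow> pm_mult (pm_mult x y) z = pm_mult x (pm_mult y z)"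
proof (induction x rule: PM_induct)
  case (one a b)
  from one(3,4) show ?case
  proof (induction y rule: PM_induct)
    case (one c d)
    from one(3) show ?case
      by (induction z rule: PM_induct)
        (use one \<open>a \<in> carrier R\<close> \<open>b \<in> carrier S\<close> in
          \<open>auto simp: pm_mult_frag pm_mult_diff_right R.m_assoc S.m_assoc\<close>)
  qed (auto simp: pm_mult_diff_left pm_mult_diff_right)
qed (auto simp: pm_mult_diff_left)

lemma pm_mult_one: "x \<in> carrier PM \<Longrightarrow> pm_mult (frag_of (\<one>\<^bsub>R\<^esub>, \<one>\<^bsub>S\<^esub>)) x = x"
  by (induction x rule: PM_induct) (auto simp: pm_mult_frag pm_mult_diff_right)

lemma cring_PM: "cring PM"
proof (rule cringI)
  show "abelian_group PM"
  proof (rule abelian_groupI)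
    fix x assume "x \<in> carrier PM"
    then show "\<exists>y\<in>carrier PM. y \<oplus>\<^bsub>PM\<^esub> x = \<zero>\<^bsub>PM\<^esub>"
      using diff_PM_closed[OF zero_in_PM, of x] by (intro bexI[of _ "0 - x"]) (auto simp: add_PM zero_PM)
  qed (auto simp: add_PM zero_PM zero_in_PM add_PM_closed ac_simps)
  show "Group.comm_monoid PM"
    by (rule comm_monoidI)
      (simp_all add: mult_PM one_PM pm_mult_closed pm_mult_assoc pm_mult_one frag_of_PM, rule pm_mult_comm)
qed (auto simp: mult_PM add_PM pm_mult_add_left)

sublocale PM: cring PM by (rule cring_PM)

lemma uminus_PM: "x \<in> carrier PM \<Longrightarrow> \<ominus>\<^bsub>PM\<^esub> x = - x"
  using PM.minus_equality[of "0 - x" x] diff_PM_closed[OF zero_in_PM, of x]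
  by (simp add: add_PM zero_PM)

lemma minus_PM: "x \<in> carrier PM \<Longrightarrow> y \<in> carrier PM \<Longrightarrow> x \<ominus>\<^bsub>PM\<^esub> y = x - y"
  by (simp add: a_minus_def uminus_PM add_PM)

lemma relations_subset: "tensor_relations R S \<subseteq> carrier PM"
  unfolding tensor_relations_def by (auto intro!: diff_PM_closed frag_of_PM)

lemma tensor_ideal_ideal: "ideal (tensor_ideal R S) PM"
  unfolding tensor_ideal_def by (rule PM.genideal_ideal[OF relations_subset])

sublocale TI: ideal "tensor_ideal R S" PM by (rule tensor_ideal_ideal)

lemma cring_tensor: "cring (tensor R S)"
  unfolding tensor_def by (rule TI.quotient_is_cring[OF cring_PM])

sublocale T: cring "tensor R S" by (rule cring_tensor)

abbreviation cl :: "('a \<times> 'b \<Rightarrow>\<^sub>0 int) \<Rightarrow> ('a \<times> 'b \<Rightarrow>\<^sub>0 int) set" where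
  "cl x \<equiv> tensor_ideal R S +>\<^bsub>PM\<^esub> x"

lemma cl_hom: "cl \<in> ring_hom PM (tensor R S)"
  unfolding tensor_def by (rule TI.rcos_ring_hom)

lemma cl_eq_iff: "x \<in> carrier PM \<Longrightarrow> y \<in> carrier PM \<Longrightarrow> cl x = cl y \<longleftrightarrow> x - y \<in> tensor_ideal R S"
  using PM.coset_eq_iff[OF tensor_ideal_ideal] by (simp add: minus_PM)

lemma cl_closed: "x \<in> carrier PM \<Longrightarrow> cl x \<in> carrier (tensor R S)"
  by (rule ring_hom_closed[OF cl_hom])

lemma cl_diff: "x \<in> carrier PM \<Longrightarrow> y \<in> carrier PM \<Longrightarrow> cl (x - y) = cl x \<ominus>\<^bsub>tensor R S\<^esub> cl y"
  using ring_hom_minus[OF PM.ring_axioms T.ring_axioms cl_hom, of x y] by (simp add: minus_PM)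

lemma carrier_tensorE:
  assumes "U \<in> carrier (tensor R S)"
  obtains x where "x \<in> carrier PM" "U = cl x"
  using assms unfolding tensor_def FactRing_def PM.a_rcosets_image by auto

lemma pure_closed [simp, intro]:
  "a \<in> carrier R \<Longrightarrow> b \<in> carrier S \<Longrightarrow> pure_tensor R S a b \<in> carrier (tensor R S)"
  unfolding pure_tensor_def by (intro cl_closed frag_of_PM)

lemma pure_mult:
  "a \<in> carrier R \<Longrightarrow> b \<in> carrier S \<Longrightarrow> c \<in> carrier R \<Longrightarrow> d \<in> carrier S \<Longrightarrow>
    pure_tensor R S a b \<otimes>\<^bsub>tensor R S\<^esub> pure_tensor R S c d = pure_tensor R S (a \<otimes>\<^bsub>R\<^esub> c) (b \<otimes>\<^bsub>S\<^esub> d)"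
  unfolding pure_tensor_def
  using ring_hom_mult[OF cl_hom, of "frag_of (a, b)" "frag_of (c, d)"]
  by (simp add: frag_of_PM mult_PM pm_mult_frag)

lemma pure_one: "pure_tensor R S \<one>\<^bsub>R\<^esub> \<one>\<^bsub>S\<^esub> = \<one>\<^bsub>tensor R S\<^esub>"
  unfolding pure_tensor_def using ring_hom_one[OF cl_hom] by (simp add: one_PM)

lemma pure_add_left:
  assumes "a \<in> carrier R" "a' \<in> carrier R" "b \<in> carrier S"
  shows "pure_tensor R S (a \<oplus>\<^bsub>R\<^esub> a') b = pure_tensor R S a b \<oplus>\<^bsub>tensor R S\<^esub> pure_tensor R S a' b"
proof -
  have "frag_of (a \<oplus>\<^bsub>R\<^esub> a', b) - frag_of (a, b) - frag_of (a', b) \<in> tensor_relations R S"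
    unfolding tensor_relations_def using assms by blast
  then have "frag_of (a \<oplus>\<^bsub>R\<^esub> a', b) - frag_of (a, b) - frag_of (a', b) \<in> tensor_ideal R S"
    unfolding tensor_ideal_def using PM.genideal_self[OF relations_subset] by blast
  then have "cl (frag_of (a \<oplus>\<^bsub>R\<^esub> a', b)) = cl (frag_of (a, b) + frag_of (a', b))"
    using assms by (subst cl_eq_iff) (auto simp: frag_of_PM add_PM_closed algebra_simps)
  then show ?thesis
    unfolding pure_tensor_def using ring_hom_add[OF cl_hom, of "frag_of (a, b)" "frag_of (a', b)"] assms
    by (simp add: frag_of_PM add_PM)
qed

lemma pure_add_right:
  assumes "a \<in> carrier R" "b \<in> carrier S" "b' \<in> carrier S"
  shows "pure_tensor R S a (b \<oplus>\<^bsub>S\<^esub> b') = pure_tensor R S a b \<oplus>\<^bsub>tensor R S\<^esub> pure_tensor R S a b'"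
proof -
  have "frag_of (a, b \<oplus>\<^bsub>S\<^esub> b') - frag_of (a, b) - frag_of (a, b') \<in> tensor_relations R S"
    unfolding tensor_relations_def using assms by blast
  then have "frag_of (a, b \<oplus>\<^bsub>S\<^esub> b') - frag_of (a, b) - frag_of (a, b') \<in> tensor_ideal R S"
    unfolding tensor_ideal_def using PM.genideal_self[OF relations_subset] by blast
  then have "cl (frag_of (a, b \<oplus>\<^bsub>S\<^esub> b')) = cl (frag_of (a, b) + frag_of (a, b'))"
    using assms by (subst cl_eq_iff) (auto simp: frag_of_PM add_PM_closed algebra_simps)
  then show ?thesis
    unfolding pure_tensor_def using ring_hom_add[OF cl_hom, of "frag_of (a, b)" "frag_of (a, b')"] assms
    by (simp add: frag_of_PM add_PM)
qed

lemma pure_imul_left: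
  assumes "a \<in> carrier R" "b \<in> carrier S"
  shows "pure_tensor R S (imul R k a) b = imul (tensor R S) k (pure_tensor R S a b)"
  by (rule additive_imul[where h = "\<lambda>a. pure_tensor R S a b"])
    (use assms in \<open>auto simp: pure_add_left R.abelian_group_axioms T.abelian_group_axioms\<close>)

lemma pure_imul_right:
  assumes "a \<in> carrier R" "b \<in> carrier S"
  shows "pure_tensor R S a (imul S k b) = imul (tensor R S) k (pure_tensor R S a b)"
  by (rule additive_imul[where h = "\<lambda>b. pure_tensor R S a b"])
    (use assms in \<open>auto simp: pure_add_right S.abelian_group_axioms T.abelian_group_axioms\<close>)

lemma tensor_induct [consumes 1, case_names pure diff]:
  assumes "x \<in> carrier (tensor R S)"
    and pure: "\<And>a b. a \<in> carrier R \<Longrightarrow> b \<in> carrier S \<Longrightarrow> P (pure_tensor R S a b)"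
    and diff: "\<And>x y. x \<in> carrier (tensor R S) \<Longrightarrow> y \<in> carrier (tensor R S) \<Longrightarrow> P x \<Longrightarrow> P y \<Longrightarrow>
      P (x \<ominus>\<^bsub>tensor R S\<^esub> y)"
  shows "P x"
proof -
  obtain y where y: "y \<in> carrier PM" "x = cl y" using carrier_tensorE[OF assms(1)] .
  have "P (cl y)" using y(1)
  proof (induction y rule: PM_induct)
    case zero
    \<comment> \<open>The induction rule has no case for zero, so zero is produced as the difference
      of a pure tensor with itself.\<close>
    let ?p = "pure_tensor R S \<zero>\<^bsub>R\<^esub> \<zero>\<^bsub>S\<^esub>"
    have "P (?p \<ominus>\<^bsub>tensor R S\<^esub> ?p)" by (intro diff pure) auto
    moreover have "?p \<ominus>\<^bsub>tensor R S\<^esub> ?p = cl 0"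
      using cl_diff[of "frag_of (\<zero>\<^bsub>R\<^esub>, \<zero>\<^bsub>S\<^esub>)" "frag_of (\<zero>\<^bsub>R\<^esub>, \<zero>\<^bsub>S\<^esub>)"] frag_of_PM
      by (simp add: pure_tensor_def)
    ultimately show ?case by simp
  next
    case (one a b)
    then show ?case using pure by (simp add: pure_tensor_def)
  next
    case (diff x y)
    then show ?case using assms(3) by (simp add: cl_diff cl_closed)
  qed
  with y show ?thesis by simp
qed

text \<open>The target is only a group, while the tensor product is a quotient by an ideal. It is
  therefore not enough that the extension \<open>h0\<close> kills the relations; it must kill all
  their multiples. It does, since a relation multiplied by a pair is again such a relation.\<close>

lemma tensor_universal:
  assumes G: "abelian_group G"
    and f: "\<And>a b. a \<in> carrier R \<Longrightarrow> b \<in> carrier S \<Longrightarrow> f a b \<in> carrier G"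
    and add1: "\<And>a a' b. a \<in> carrier R \<Longrightarrow> a' \<in> carrier R \<Longrightarrow> b \<in> carrier S \<Longrightarrow>
      f (a \<oplus>\<^bsub>R\<^esub> a') b = f a b \<oplus>\<^bsub>G\<^esub> f a' b"
    and add2: "\<And>a b b'. a \<in> carrier R \<Longrightarrow> b \<in> carrier S \<Longrightarrow> b' \<in> carrier S \<Longrightarrow>
      f a (b \<oplus>\<^bsub>S\<^esub> b') = f a b \<oplus>\<^bsub>G\<^esub> f a b'"
  obtains h where "h \<in> carrier (tensor R S) \<rightarrow> carrier G"
    "\<And>x y. x \<in> carrier (tensor R S) \<Longrightarrow> y \<in> carrier (tensor R S) \<Longrightarrow> h (x \<oplus>\<^bsub>tensor R S\<^esub> y) = h x \<oplus>\<^bsub>G\<^esub> h y"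
    "\<And>a b. a \<in> carrier R \<Longrightarrow> b \<in> carrier S \<Longrightarrow> h (pure_tensor R S a b) = f a b"
proof -
  interpret G: abelian_group G by fact
  have "(\<lambda>(a, b). f a b) ` (carrier R \<times> carrier S) \<subseteq> carrier (add_monoid G)" using f by auto
  then obtain h0 where h0: "h0 \<in> hom (free_Abelian_group (carrier R \<times> carrier S)) (add_monoid G)"
    "\<And>p. p \<in> carrier R \<times> carrier S \<Longrightarrow> h0 (frag_of p) = (\<lambda>(a, b). f a b) p"
    using comm_group.free_Abelian_group_universal[OF G.a_comm_group] by metis
  have closed: "h0 x \<in> carrier G" if "x \<in> carrier PM" for x
    using hom_in_carrier[OF h0(1), of x] that by (simp add: carrier_PM)
  have add: "h0 (x + y) = h0 x \<oplus>\<^bsub>G\<^esub> h0 y" if "x \<in> carrier PM" "y \<in> carrier PM" for x y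
    using hom_mult[OF h0(1), of x y] that by (simp add: carrier_PM)
  have frag: "h0 (frag_of (a, b)) = f a b" if "a \<in> carrier R" "b \<in> carrier S" for a b
    using h0(2)[of "(a, b)"] that by simp
  have zero: "h0 0 = \<zero>\<^bsub>G\<^esub>" using add[OF zero_in_PM zero_in_PM] closed[OF zero_in_PM] by simp
  have diff: "h0 (x - y) = h0 x \<ominus>\<^bsub>G\<^esub> h0 y" if "x \<in> carrier PM" "y \<in> carrier PM" for x y
  proof -
    have "h0 x = h0 (x - y) \<oplus>\<^bsub>G\<^esub> h0 y" using add[OF diff_PM_closed[OF that] that(2)] by simp
    then show ?thesis using closed that diff_PM_closed[OF that]
      by (simp add: a_minus_def G.a_assoc G.r_neg)
  qed
  \<comment> \<open>The largest set on which \<open>h0\<close> vanishes together with all multiples.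
    It is an ideal by construction, so it contains \<open>tensor_ideal\<close> once it contains the
    relations.\<close>
  define K where "K = {x \<in> carrier PM. \<forall>a\<in>carrier R. \<forall>c\<in>carrier S. h0 (pm_mult (frag_of (a, c)) x) = \<zero>\<^bsub>G\<^esub>}"
  have Kall: "h0 (pm_mult r x) = \<zero>\<^bsub>G\<^esub>" if "x \<in> K" "r \<in> carrier PM" for x r
    using that(2)
    by (induction r rule: PM_induct)
      (use that(1) in \<open>auto simp: K_def zero pm_mult_diff_left diff pm_mult_closed a_minus_def\<close>)
  have "ideal K PM"
  proof (rule PM.cideal_criterion)
    show "\<zero>\<^bsub>PM\<^esub> \<in> K" by (auto simp: K_def zero_PM zero zero_in_PM)
    show "x \<oplus>\<^bsub>PM\<^esub> y \<in> K" if "x \<in> K" "y \<in> K" for x y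
      using that by (auto simp: K_def add_PM add_PM_closed pm_mult_add_right add pm_mult_closed frag_of_PM)
    show "r \<otimes>\<^bsub>PM\<^esub> x \<in> K" if "x \<in> K" "r \<in> carrier PM" for x r
      using that Kall[OF that(1)]
      by (auto simp: K_def mult_PM pm_mult_closed frag_of_PM simp flip: pm_mult_assoc)
  qed (auto simp: K_def)
  moreover have "tensor_relations R S \<subseteq> K"
  proof
    fix x assume x: "x \<in> tensor_relations R S"
    have cancel: "u \<oplus>\<^bsub>G\<^esub> v \<ominus>\<^bsub>G\<^esub> u \<ominus>\<^bsub>G\<^esub> v = \<zero>\<^bsub>G\<^esub>" if "u \<in> carrier G" "v \<in> carrier G" for u v
      using that by (simp add: a_minus_def G.a_comm[of u v] G.a_assoc G.r_neg)
    have "h0 (pm_mult (frag_of (a, c)) x) = \<zero>\<^bsub>G\<^esub>" if ac: "a \<in> carrier R" "c \<in> carrier S" for a c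
      using x ac unfolding tensor_relations_def
      by (auto simp: pm_mult_diff_right pm_mult_frag diff diff_PM_closed frag_of_PM frag f
          R.r_distr S.r_distr add1 add2 cancel)
    then show "x \<in> K" using relations_subset x by (auto simp: K_def)
  qed
  ultimately have TIK: "tensor_ideal R S \<subseteq> K"
    unfolding tensor_ideal_def by (rule PM.genideal_minimal)
  have TI0: "h0 x = \<zero>\<^bsub>G\<^esub>" if "x \<in> tensor_ideal R S" for x
    using Kall[of x "frag_of (\<one>\<^bsub>R\<^esub>, \<one>\<^bsub>S\<^esub>)"] TIK that frag_of_PM[of "\<one>\<^bsub>R\<^esub>" "\<one>\<^bsub>S\<^esub>"] pm_mult_one[of x]
    by (auto simp: K_def)
  define h where "h U = h0 (SOME x. x \<in> carrier PM \<and> U = cl x)" for U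
  have h: "h (cl x) = h0 x" if x: "x \<in> carrier PM" for x
  proof -
    define y where "y = (SOME y. y \<in> carrier PM \<and> cl x = cl y)"
    have y: "y \<in> carrier PM" "cl x = cl y"
      using someI_ex[of "\<lambda>y. y \<in> carrier PM \<and> cl x = cl y"] x by (auto simp: y_def)
    then have "h0 (x - y) = \<zero>\<^bsub>G\<^esub>" using TI0 cl_eq_iff x by blast
    then have "h0 x = h0 y" using add[OF diff_PM_closed[OF x y(1)] y(1)] closed y by simp
    then show ?thesis by (simp add: h_def y_def)
  qed
  show ?thesis
  proof
    show "h \<in> carrier (tensor R S) \<rightarrow> carrier G"
      using h closed by (auto elim!: carrier_tensorE)
    show "h (pure_tensor R S a b) = f a b" if "a \<in> carrier R" "b \<in> carrier S" for a b
      using that by (simp add: pure_tensor_def h frag_of_PM frag)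
    fix U V assume "U \<in> carrier (tensor R S)" "V \<in> carrier (tensor R S)"
    then obtain x y where xy: "x \<in> carrier PM" "U = cl x" "y \<in> carrier PM" "V = cl y"
      by (metis carrier_tensorE)
    then have "U \<oplus>\<^bsub>tensor R S\<^esub> V = cl (x + y)" using ring_hom_add[OF cl_hom, of x y] by (simp add: add_PM)
    then show "h (U \<oplus>\<^bsub>tensor R S\<^esub> V) = h U \<oplus>\<^bsub>G\<^esub> h V"
      using xy by (simp add: h add add_PM_closed)
  qed
qed

text \<open>The additive map comes from the universal property; multiplicativity spreads from pairs
  of pure tensors to all elements by induction in each argument.\<close>

lemma tensor_ring_hom:
  assumes Q: "cring Q"
    and f: "\<And>a b. a \<in> carrier R \<Longrightarrow> b \<in> carrier S \<Longrightarrow> f a b \<in> carrier Q"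
    and add1: "\<And>a a' b. a \<in> carrier R \<Longrightarrow> a' \<in> carrier R \<Longrightarrow> b \<in> carrier S \<Longrightarrow>
      f (a \<oplus>\<^bsub>R\<^esub> a') b = f a b \<oplus>\<^bsub>Q\<^esub> f a' b"
    and add2: "\<And>a b b'. a \<in> carrier R \<Longrightarrow> b \<in> carrier S \<Longrightarrow> b' \<in> carrier S \<Longrightarrow>
      f a (b \<oplus>\<^bsub>S\<^esub> b') = f a b \<oplus>\<^bsub>Q\<^esub> f a b'"
    and mult: "\<And>a b c d. a \<in> carrier R \<Longrightarrow> b \<in> carrier S \<Longrightarrow> c \<in> carrier R \<Longrightarrow> d \<in> carrier S \<Longrightarrow>
      f (a \<otimes>\<^bsub>R\<^esub> c) (b \<otimes>\<^bsub>S\<^esub> d) = f a b \<otimes>\<^bsub>Q\<^esub> f c d"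
    and one: "f \<one>\<^bsub>R\<^esub> \<one>\<^bsub>S\<^esub> = \<one>\<^bsub>Q\<^esub>"
  obtains h where "h \<in> ring_hom (tensor R S) Q"
    "\<And>a b. a \<in> carrier R \<Longrightarrow> b \<in> carrier S \<Longrightarrow> h (pure_tensor R S a b) = f a b"
proof -
  interpret Q: cring Q by fact
  obtain h where h: "h \<in> carrier (tensor R S) \<rightarrow> carrier Q"
    "\<And>x y. x \<in> carrier (tensor R S) \<Longrightarrow> y \<in> carrier (tensor R S) \<Longrightarrow> h (x \<oplus>\<^bsub>tensor R S\<^esub> y) = h x \<oplus>\<^bsub>Q\<^esub> h y"
    "\<And>a b. a \<in> carrier R \<Longrightarrow> b \<in> carrier S \<Longrightarrow> h (pure_tensor R S a b) = f a b"
    using tensor_universal[OF Q.abelian_group_axioms f add1 add2] by blast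
  have hc: "h x \<in> carrier Q" if "x \<in> carrier (tensor R S)" for x using h(1) that by auto
  have hdiff: "h (x \<ominus>\<^bsub>tensor R S\<^esub> y) = h x \<ominus>\<^bsub>Q\<^esub> h y"
    if "x \<in> carrier (tensor R S)" "y \<in> carrier (tensor R S)" for x y
  proof -
    have "h x = h (x \<ominus>\<^bsub>tensor R S\<^esub> y) \<oplus>\<^bsub>Q\<^esub> h y"
      using h(2)[of "x \<ominus>\<^bsub>tensor R S\<^esub> y" y] that by (simp add: a_minus_def T.a_assoc T.l_neg)
    then show ?thesis using hc that by (simp add: a_minus_def Q.a_assoc Q.r_neg)
  qed
  have hm: "h (x \<otimes>\<^bsub>tensor R S\<^esub> y) = h x \<otimes>\<^bsub>Q\<^esub> h y"
    if "x \<in> carrier (tensor R S)" "y \<in> carrier (tensor R S)" for x y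
    using that
  proof (induction x rule: tensor_induct)
    case (pure a b)
    from pure(3) show ?case
    proof (induction y rule: tensor_induct)
      case (pure c d)
      then show ?case using \<open>a \<in> carrier R\<close> \<open>b \<in> carrier S\<close> by (simp add: pure_mult h(3) mult)
    next
      case (diff y z)
      have "pure_tensor R S a b \<otimes>\<^bsub>tensor R S\<^esub> (y \<ominus>\<^bsub>tensor R S\<^esub> z) =
        pure_tensor R S a b \<otimes>\<^bsub>tensor R S\<^esub> y \<ominus>\<^bsub>tensor R S\<^esub> pure_tensor R S a b \<otimes>\<^bsub>tensor R S\<^esub> z"
        using diff(1,2) pure_closed[OF pure(1,2)] by algebra
      moreover have "h (pure_tensor R S a b) \<otimes>\<^bsub>Q\<^esub> (h y \<ominus>\<^bsub>Q\<^esub> h z) =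
        h (pure_tensor R S a b) \<otimes>\<^bsub>Q\<^esub> h y \<ominus>\<^bsub>Q\<^esub> h (pure_tensor R S a b) \<otimes>\<^bsub>Q\<^esub> h z"
        using hc[OF diff(1)] hc[OF diff(2)] hc[OF pure_closed[OF pure(1,2)]] by algebra
      ultimately show ?case using diff pure_closed[OF pure(1,2)] by (simp add: hdiff)
    qed
  next
    case (diff x z)
    have "(x \<ominus>\<^bsub>tensor R S\<^esub> z) \<otimes>\<^bsub>tensor R S\<^esub> y = x \<otimes>\<^bsub>tensor R S\<^esub> y \<ominus>\<^bsub>tensor R S\<^esub> z \<otimes>\<^bsub>tensor R S\<^esub> y"
      using diff(1,2,5) by algebra
    moreover have "(h x \<ominus>\<^bsub>Q\<^esub> h z) \<otimes>\<^bsub>Q\<^esub> h y = h x \<otimes>\<^bsub>Q\<^esub> h y \<ominus>\<^bsub>Q\<^esub> h z \<otimes>\<^bsub>Q\<^esub> h y"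
      using hc[OF diff(1)] hc[OF diff(2)] hc[OF diff(5)] by algebra
    ultimately show ?case using diff by (simp add: hdiff)
  qed
  have "h \<one>\<^bsub>tensor R S\<^esub> = \<one>\<^bsub>Q\<^esub>" using h(3)[of "\<one>\<^bsub>R\<^esub>" "\<one>\<^bsub>S\<^esub>"] one pure_one by simp
  then have "h \<in> ring_hom (tensor R S) Q" using hc h(2) hm by (auto simp: ring_hom_def)
  then show ?thesis using that h(3) by blast
qed

lemma additive_eqI:
  assumes G: "abelian_group G"
    and hh: "h \<in> carrier (tensor R S) \<rightarrow> carrier G" "h' \<in> carrier (tensor R S) \<rightarrow> carrier G"
    and add: "\<And>x y. x \<in> carrier (tensor R S) \<Longrightarrow> y \<in> carrier (tensor R S) \<Longrightarrow> h (x \<oplus>\<^bsub>tensor R S\<^esub> y) = h x \<oplus>\<^bsub>G\<^esub> h y"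
      "\<And>x y. x \<in> carrier (tensor R S) \<Longrightarrow> y \<in> carrier (tensor R S) \<Longrightarrow> h' (x \<oplus>\<^bsub>tensor R S\<^esub> y) = h' x \<oplus>\<^bsub>G\<^esub> h' y"
    and eq: "\<And>a b. a \<in> carrier R \<Longrightarrow> b \<in> carrier S \<Longrightarrow> h (pure_tensor R S a b) = h' (pure_tensor R S a b)"
    and x: "x \<in> carrier (tensor R S)"
  shows "h x = h' x"
  using x
proof (induction x rule: tensor_induct)
  case (diff x y)
  interpret G: abelian_group G by fact
  have c: "h x \<in> carrier G" "h y \<in> carrier G" "h' x \<in> carrier G" "h' y \<in> carrier G"
    "h (x \<ominus>\<^bsub>tensor R S\<^esub> y) \<in> carrier G" "h' (x \<ominus>\<^bsub>tensor R S\<^esub> y) \<in> carrier G" using hh diff(1,2) by auto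
  have e: "(x \<ominus>\<^bsub>tensor R S\<^esub> y) \<oplus>\<^bsub>tensor R S\<^esub> y = x" using diff(1,2) by (simp add: a_minus_def T.a_assoc T.l_neg)
  have "h (x \<ominus>\<^bsub>tensor R S\<^esub> y) \<oplus>\<^bsub>G\<^esub> h y = h' (x \<ominus>\<^bsub>tensor R S\<^esub> y) \<oplus>\<^bsub>G\<^esub> h y"
    using add(1)[of "x \<ominus>\<^bsub>tensor R S\<^esub> y" y] add(2)[of "x \<ominus>\<^bsub>tensor R S\<^esub> y" y] diff e by simp
  then show ?case using c by (metis G.add.r_cancel)
qed (use eq in auto)

text \<open>The products of generators are listed row by row: the index k = i * m + j stands for the
  pair (i, j).\<close>

lemma generated_tensor:
  assumes "generated_by R g n" "generated_by S h m"
  shows "generated_by (tensor R S) (\<lambda>k. pure_tensor R S (g (k div m)) (h (k mod m))) (n * m)"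
proof -
  let ?k = "\<lambda>k. pure_tensor R S (g (k div m)) (h (k mod m))"
  have gc: "\<And>i. i < n \<Longrightarrow> g i \<in> carrier R" and hc: "\<And>i. i < m \<Longrightarrow> h i \<in> carrier S"
    using assms by (auto simp: generated_by_def)
  have kc: "?k k \<in> carrier (tensor R S)" if k: "k < n * m" for k
  proof -
    have "m > 0" using k by (cases m) auto
    then show ?thesis using k by (intro pure_closed gc hc) (auto simp: less_mult_imp_div_less)
  qed
  have pure: "\<exists>c. pure_tensor R S a b = lincomb (tensor R S) ?k (n * m) c" if "a \<in> carrier R" "b \<in> carrier S" for a b
  proof -
    have "\<exists>c. a = lincomb R g n c" "\<exists>d. b = lincomb S h m d"
      using assms that by (simp_all add: generated_by_def)
    then obtain c d where cd: "a = lincomb R g n c" "b = lincomb S h m d" by (elim exE)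
    have rows: "pure_tensor R S (g i) (lincomb S h m' d) =
      lincomb (tensor R S) (\<lambda>j. pure_tensor R S (g i) (h j)) m' d" if "i < n" "m' \<le> m" for i m'
      using that(2)
    proof (induction m')
      case 0
      have "pure_tensor R S (g i) \<zero>\<^bsub>S\<^esub> = \<zero>\<^bsub>tensor R S\<^esub>"
        using pure_imul_right[OF gc[OF that(1)], of "\<zero>\<^bsub>S\<^esub>" 0] by simp
      then show ?case by simp
    next
      case (Suc k)
      then show ?case using gc[OF that(1)] hc by (simp add: pure_add_right pure_imul_right)
    qed
    have "\<exists>e. pure_tensor R S (lincomb R g n' c) b = lincomb (tensor R S) ?k (n' * m) e" if "n' \<le> n" for n'
      using that
    proof (induction n')
      case 0
      have "pure_tensor R S \<zero>\<^bsub>R\<^esub> b = \<zero>\<^bsub>tensor R S\<^esub>"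
        using pure_imul_left[of "\<zero>\<^bsub>R\<^esub>" b 0] \<open>b \<in> carrier S\<close> by simp
      then show ?case by simp
    next
      case (Suc k)
      then obtain e where e: "pure_tensor R S (lincomb R g k c) b = lincomb (tensor R S) ?k (k * m) e" by auto
      \<comment> \<open>The coefficients of the first \<open>k\<close> rows, continued by the
        products \<open>c k * d j\<close> in row \<open>k\<close>.\<close>
      define e' where "e' = (\<lambda>j. if j < k * m then e j else c k * d (j - k * m))"
      have split: "lincomb (tensor R S) ?k (k * m + m') e' =
          lincomb (tensor R S) ?k (k * m) e \<oplus>\<^bsub>tensor R S\<^esub>
          imul (tensor R S) (c k) (lincomb (tensor R S) (\<lambda>j. pure_tensor R S (g k) (h j)) m' d)" if "m' \<le> m" for m'
        using that
      proof (induction m')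
        case 0
        have "lincomb (tensor R S) ?k (k * m) e' = lincomb (tensor R S) ?k (k * m) e"
          by (rule T.lincomb_cong) (simp add: e'_def)
        moreover have "lincomb (tensor R S) ?k (k * m) e \<in> carrier (tensor R S)"
          using Suc.prems by (intro T.lincomb_closed kc) (meson Suc_leD less_le_trans mult_le_mono1)
        ultimately show ?case by simp
      next
        case (Suc j)
        have kn: "k < n" using \<open>Suc k \<le> n\<close> by simp
        have c1: "lincomb (tensor R S) ?k (k * m) e \<in> carrier (tensor R S)"
          using \<open>Suc k \<le> n\<close> by (intro T.lincomb_closed kc) (meson Suc_leD less_le_trans mult_le_mono1)
        have c2: "lincomb (tensor R S) (\<lambda>j. pure_tensor R S (g k) (h j)) j d \<in> carrier (tensor R S)"
          using Suc.prems gc[OF kn] hc by (intro T.lincomb_closed) auto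
        have "(k * m + j) div m = k" "(k * m + j) mod m = j" using Suc.prems by auto
        then show ?case using Suc gc[OF kn] hc c1 c2
          by (simp add: e'_def T.imul_distrib T.imul_mult T.a_assoc)
      qed
      have kn: "k < n" using Suc.prems by simp
      have "pure_tensor R S (lincomb R g (Suc k) c) b =
        pure_tensor R S (lincomb R g k c) b \<oplus>\<^bsub>tensor R S\<^esub> imul (tensor R S) (c k) (pure_tensor R S (g k) b)"
        using gc[OF kn] \<open>b \<in> carrier S\<close> gc Suc.prems by (simp add: pure_add_left pure_imul_left)
      also have "pure_tensor R S (g k) b = lincomb (tensor R S) (\<lambda>j. pure_tensor R S (g k) (h j)) m d"
        using rows[OF kn order_refl] cd by simp
      finally show ?case using split[OF order_refl] e by (metis add.commute mult_Suc)
    qed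
    from this[of n] cd show ?thesis by blast
  qed
  have "\<exists>c. x = lincomb (tensor R S) ?k (n * m) c" if "x \<in> carrier (tensor R S)" for x
    using that
  proof (induction x rule: tensor_induct)
    case (diff x y)
    then obtain c d where "x = lincomb (tensor R S) ?k (n * m) c" "y = lincomb (tensor R S) ?k (n * m) d"
      by (elim exE)
    then have "x \<ominus>\<^bsub>tensor R S\<^esub> y = lincomb (tensor R S) ?k (n * m) (\<lambda>i. c i - d i)"
      using T.lincomb_diff[of "n * m" ?k c d, OF kc] by simp
    then show ?case by (intro exI[of _ "\<lambda>i. c i - d i"])
  qed (use pure in auto)
  then show ?thesis using kc by (simp add: generated_by_def)
qed

end

section \<open>Functoriality of tensor products and zeta functions\<close>

lemma additive_ring_hom:
  assumes "h \<in> ring_hom R S"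
  shows "h \<in> carrier R \<rightarrow> carrier S"
    "\<And>x y. x \<in> carrier R \<Longrightarrow> y \<in> carrier R \<Longrightarrow> h (x \<oplus>\<^bsub>R\<^esub> y) = h x \<oplus>\<^bsub>S\<^esub> h y"
  using assms by (auto simp: ring_hom_def)

text \<open>The tensor products of the ring maps and of the maps back compose in both orders to
  multiplication by m1 * m2. The maps back are only additive, so the universal property for groups
  provides their tensor product. Applying it to \<phi>(x) = ny shows that m1 * m2 * x is divisible
  by \<open>n\<close>.\<close>

lemma zeta_tensor_change:
  assumes L: "tensor_pair L1 L2" and G: "tensor_pair G1 G2"
    and f1: "f1 \<in> ring_hom L1 G1" and f2: "f2 \<in> ring_hom L2 G2"
    and t1: "t1 \<in> carrier G1 \<rightarrow> carrier L1" "\<And>x y. x \<in> carrier G1 \<Longrightarrow> y \<in> carrier G1 \<Longrightarrow> t1 (x \<oplus>\<^bsub>G1\<^esub> y) = t1 x \<oplus>\<^bsub>L1\<^esub> t1 y"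
      "\<And>x. x \<in> carrier L1 \<Longrightarrow> t1 (f1 x) = imul L1 m1 x" "\<And>x. x \<in> carrier G1 \<Longrightarrow> f1 (t1 x) = imul G1 m1 x"
    and t2: "t2 \<in> carrier G2 \<rightarrow> carrier L2" "\<And>x y. x \<in> carrier G2 \<Longrightarrow> y \<in> carrier G2 \<Longrightarrow> t2 (x \<oplus>\<^bsub>G2\<^esub> y) = t2 x \<oplus>\<^bsub>L2\<^esub> t2 y"
      "\<And>x. x \<in> carrier L2 \<Longrightarrow> t2 (f2 x) = imul L2 m2 x" "\<And>x. x \<in> carrier G2 \<Longrightarrow> f2 (t2 x) = imul G2 m2 x"
    and one: "1 \<in> E" and mult: "\<And>n m. n \<in> E \<Longrightarrow> m \<in> E \<Longrightarrow> n * m \<in> E"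
    and cop: "\<And>n. n \<in> E \<Longrightarrow> coprime (m1 * m2) n"
    and sum: "zeta_term (tensor L1 L2) s summable_on ideals_over (tensor L1 L2) E"
  shows "infsum (zeta_term (tensor L1 L2) s) (ideals_over (tensor L1 L2) E) =
      infsum (zeta_term (tensor G1 G2) s) (ideals_over (tensor G1 G2) E)"
    "zeta_term (tensor G1 G2) s summable_on ideals_over (tensor G1 G2) E"
proof -
  interpret L: tensor_pair L1 L2 by fact
  interpret G: tensor_pair G1 G2 by fact
  note f1' = additive_ring_hom[OF f1] ring_hom_mult[OF f1] ring_hom_one[OF f1]
  note f2' = additive_ring_hom[OF f2] ring_hom_mult[OF f2] ring_hom_one[OF f2]
  have c: "\<And>x. x \<in> carrier L1 \<Longrightarrow> f1 x \<in> carrier G1" "\<And>x. x \<in> carrier L2 \<Longrightarrow> f2 x \<in> carrier G2"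
    "\<And>x. x \<in> carrier G1 \<Longrightarrow> t1 x \<in> carrier L1" "\<And>x. x \<in> carrier G2 \<Longrightarrow> t2 x \<in> carrier L2"
    using f1'(1) f2'(1) t1(1) t2(1) by auto
  obtain \<phi> where \<phi>: "\<phi> \<in> ring_hom (tensor L1 L2) (tensor G1 G2)"
    "\<And>a b. a \<in> carrier L1 \<Longrightarrow> b \<in> carrier L2 \<Longrightarrow> \<phi> (pure_tensor L1 L2 a b) = pure_tensor G1 G2 (f1 a) (f2 b)"
    by (rule L.tensor_ring_hom[OF G.cring_tensor, of "\<lambda>a b. pure_tensor G1 G2 (f1 a) (f2 b)"])
      (auto simp: c f1' f2' G.pure_add_left G.pure_add_right G.pure_mult G.pure_one)
  obtain \<theta> where \<theta>: "\<theta> \<in> carrier (tensor G1 G2) \<rightarrow> carrier (tensor L1 L2)"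
    "\<And>x y. x \<in> carrier (tensor G1 G2) \<Longrightarrow> y \<in> carrier (tensor G1 G2) \<Longrightarrow> \<theta> (x \<oplus>\<^bsub>tensor G1 G2\<^esub> y) = \<theta> x \<oplus>\<^bsub>tensor L1 L2\<^esub> \<theta> y"
    "\<And>a b. a \<in> carrier G1 \<Longrightarrow> b \<in> carrier G2 \<Longrightarrow> \<theta> (pure_tensor G1 G2 a b) = pure_tensor L1 L2 (t1 a) (t2 b)"
    by (rule G.tensor_universal[OF L.T.abelian_group_axioms, of "\<lambda>a b. pure_tensor L1 L2 (t1 a) (t2 b)"])
      (auto simp: c t1(2) t2(2) L.pure_add_left L.pure_add_right)
  note \<phi>' = additive_ring_hom[OF \<phi>(1)]
  have \<phi>\<theta>: "\<phi> (\<theta> y) = imul (tensor G1 G2) (m1 * m2) y" if y: "y \<in> carrier (tensor G1 G2)" for y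
  proof (rule G.additive_eqI[OF G.T.abelian_group_axioms _ _ _ _ _ y, where h = "\<lambda>y. \<phi> (\<theta> y)" and h' = "imul (tensor G1 G2) (m1 * m2)"])
    show "(\<lambda>y. \<phi> (\<theta> y)) \<in> carrier (tensor G1 G2) \<rightarrow> carrier (tensor G1 G2)"
      using \<theta>(1) \<phi>'(1) by auto
    show "\<phi> (\<theta> (x \<oplus>\<^bsub>tensor G1 G2\<^esub> y)) = \<phi> (\<theta> x) \<oplus>\<^bsub>tensor G1 G2\<^esub> \<phi> (\<theta> y)"
      if "x \<in> carrier (tensor G1 G2)" "y \<in> carrier (tensor G1 G2)" for x y
      using that \<theta>(1) \<phi>'(1) by (simp add: \<theta>(2) \<phi>'(2) Pi_iff)
    fix a b assume ab: "a \<in> carrier G1" "b \<in> carrier G2"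
    have "\<phi> (\<theta> (pure_tensor G1 G2 a b)) = pure_tensor G1 G2 (imul G1 m1 a) (imul G2 m2 b)"
      using ab c by (simp add: \<theta>(3) \<phi>(2) t1(4) t2(4))
    also have "\<dots> = imul (tensor G1 G2) m2 (imul (tensor G1 G2) m1 (pure_tensor G1 G2 a b))"
      using ab by (simp add: G.pure_imul_left G.pure_imul_right)
    also have "\<dots> = imul (tensor G1 G2) (m1 * m2) (pure_tensor G1 G2 a b)"
      using ab by (simp only: G.T.imul_mult[symmetric] G.pure_closed mult.commute)
    finally show "\<phi> (\<theta> (pure_tensor G1 G2 a b)) = imul (tensor G1 G2) (m1 * m2) (pure_tensor G1 G2 a b)" .
  qed (auto simp: G.T.imul_distrib)
  have \<theta>\<phi>: "\<theta> (\<phi> y) = imul (tensor L1 L2) (m1 * m2) y" if y: "y \<in> carrier (tensor L1 L2)" for y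
  proof (rule L.additive_eqI[OF L.T.abelian_group_axioms _ _ _ _ _ y, where h = "\<lambda>y. \<theta> (\<phi> y)" and h' = "imul (tensor L1 L2) (m1 * m2)"])
    show "(\<lambda>y. \<theta> (\<phi> y)) \<in> carrier (tensor L1 L2) \<rightarrow> carrier (tensor L1 L2)"
      using \<theta>(1) \<phi>'(1) by auto
    show "\<theta> (\<phi> (x \<oplus>\<^bsub>tensor L1 L2\<^esub> y)) = \<theta> (\<phi> x) \<oplus>\<^bsub>tensor L1 L2\<^esub> \<theta> (\<phi> y)"
      if "x \<in> carrier (tensor L1 L2)" "y \<in> carrier (tensor L1 L2)" for x y
      using that \<theta>(1) \<phi>'(1) by (simp add: \<theta>(2) \<phi>'(2) Pi_iff)
    fix a b assume ab: "a \<in> carrier L1" "b \<in> carrier L2"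
    have "\<theta> (\<phi> (pure_tensor L1 L2 a b)) = pure_tensor L1 L2 (imul L1 m1 a) (imul L2 m2 b)"
      using ab c by (simp add: \<theta>(3) \<phi>(2) t1(3) t2(3))
    also have "\<dots> = imul (tensor L1 L2) m2 (imul (tensor L1 L2) m1 (pure_tensor L1 L2 a b))"
      using ab by (simp add: L.pure_imul_left L.pure_imul_right)
    also have "\<dots> = imul (tensor L1 L2) (m1 * m2) (pure_tensor L1 L2 a b)"
      using ab by (simp only: L.T.imul_mult[symmetric] L.pure_closed mult.commute)
    finally show "\<theta> (\<phi> (pure_tensor L1 L2 a b)) = imul (tensor L1 L2) (m1 * m2) (pure_tensor L1 L2 a b)" .
  qed (auto simp: L.T.imul_distrib)
  have inj: "imul (tensor L1 L2) (m1 * m2) x \<in> multiples (tensor L1 L2) n"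
    if "n \<in> E" "x \<in> carrier (tensor L1 L2)" "y \<in> carrier (tensor G1 G2)" "\<phi> x = imul (tensor G1 G2) n y" for n x y
  proof -
    have "\<theta> (\<phi> x) = imul (tensor L1 L2) n (\<theta> y)"
      using additive_imul[OF G.T.abelian_group_axioms L.T.abelian_group_axioms \<theta>(1,2) that(3)] that(4) by simp
    then show ?thesis using \<theta>\<phi>[OF that(2)] \<theta>(1) that(3) by (metis multiplesI funcset_mem)
  qed
  have surj: "\<exists>x\<in>carrier (tensor L1 L2). \<phi> x = imul (tensor G1 G2) (m1 * m2) y"
    if "y \<in> carrier (tensor G1 G2)" for y
    using \<phi>\<theta>[OF that] \<theta>(1) that by blast
  show "infsum (zeta_term (tensor L1 L2) s) (ideals_over (tensor L1 L2) E) =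
      infsum (zeta_term (tensor G1 G2) s) (ideals_over (tensor G1 G2) E)"
    "zeta_term (tensor G1 G2) s summable_on ideals_over (tensor G1 G2) E"
    by (rule zeta_comparison[where \<phi> = \<phi> and m = "m1 * m2"],
      (rule L.cring_tensor G.cring_tensor \<phi>(1) one mult cop surj inj sum | assumption)+)+
qed

text \<open>The comparison with m = 1 for the flip of factors. It is needed because a local
  presentation always replaces the left factor.\<close>

lemma zeta_tensor_swap:
  assumes L: "tensor_pair L1 L2"
    and one: "1 \<in> E" and mult: "\<And>n m. n \<in> E \<Longrightarrow> m \<in> E \<Longrightarrow> n * m \<in> E"
    and sum: "zeta_term (tensor L1 L2) s summable_on ideals_over (tensor L1 L2) E"
  shows "infsum (zeta_term (tensor L1 L2) s) (ideals_over (tensor L1 L2) E) =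
      infsum (zeta_term (tensor L2 L1) s) (ideals_over (tensor L2 L1) E)"
    "zeta_term (tensor L2 L1) s summable_on ideals_over (tensor L2 L1) E"
proof -
  interpret L: tensor_pair L1 L2 by fact
  interpret G: tensor_pair L2 L1 by unfold_locales
  obtain \<phi> where \<phi>: "\<phi> \<in> ring_hom (tensor L1 L2) (tensor L2 L1)"
    "\<And>a b. a \<in> carrier L1 \<Longrightarrow> b \<in> carrier L2 \<Longrightarrow> \<phi> (pure_tensor L1 L2 a b) = pure_tensor L2 L1 b a"
    by (rule L.tensor_ring_hom[OF G.cring_tensor, of "\<lambda>a b. pure_tensor L2 L1 b a"])
      (auto simp: G.pure_add_left G.pure_add_right G.pure_mult G.pure_one)
  obtain \<theta> where \<theta>: "\<theta> \<in> ring_hom (tensor L2 L1) (tensor L1 L2)"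
    "\<And>a b. a \<in> carrier L2 \<Longrightarrow> b \<in> carrier L1 \<Longrightarrow> \<theta> (pure_tensor L2 L1 a b) = pure_tensor L1 L2 b a"
    by (rule G.tensor_ring_hom[OF L.cring_tensor, of "\<lambda>a b. pure_tensor L1 L2 b a"])
      (auto simp: L.pure_add_left L.pure_add_right L.pure_mult L.pure_one)
  note \<phi>' = additive_ring_hom[OF \<phi>(1)]
  note \<theta>' = additive_ring_hom[OF \<theta>(1)]
  have \<phi>\<theta>: "\<phi> (\<theta> y) = y" if "y \<in> carrier (tensor L2 L1)" for y
    by (rule G.additive_eqI[OF G.T.abelian_group_axioms, where h = "\<lambda>y. \<phi> (\<theta> y)" and h' = "\<lambda>y. y"])
      (use that \<theta>'(1) \<phi>'(1) in \<open>auto simp: \<theta>(2) \<phi>'(2) \<theta>'(2) \<phi>(2) funcset_mem\<close>)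
  have \<theta>\<phi>: "\<theta> (\<phi> y) = y" if "y \<in> carrier (tensor L1 L2)" for y
    by (rule L.additive_eqI[OF L.T.abelian_group_axioms, where h = "\<lambda>y. \<theta> (\<phi> y)" and h' = "\<lambda>y. y"])
      (use that \<theta>'(1) \<phi>'(1) in \<open>auto simp: \<theta>(2) \<phi>'(2) \<theta>'(2) \<phi>(2) funcset_mem\<close>)
  have inj: "imul (tensor L1 L2) 1 x \<in> multiples (tensor L1 L2) n"
    if "x \<in> carrier (tensor L1 L2)" "y \<in> carrier (tensor L2 L1)" "\<phi> x = imul (tensor L2 L1) n y" for n x y
  proof -
    have "\<theta> (\<phi> x) = imul (tensor L1 L2) n (\<theta> y)"
      using additive_imul[OF G.T.abelian_group_axioms L.T.abelian_group_axioms \<theta>' that(2)] that(3) by simp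
    then show ?thesis using \<theta>\<phi>[OF that(1)] \<theta>'(1) that by (metis L.T.imul_1 multiplesI funcset_mem)
  qed
  have surj: "\<exists>x\<in>carrier (tensor L1 L2). \<phi> x = imul (tensor L2 L1) 1 y" if "y \<in> carrier (tensor L2 L1)" for y
    using \<phi>\<theta>[OF that] \<theta>'(1) that by (auto intro!: bexI[of _ "\<theta> y"])
  show "infsum (zeta_term (tensor L1 L2) s) (ideals_over (tensor L1 L2) E) =
      infsum (zeta_term (tensor L2 L1) s) (ideals_over (tensor L2 L1) E)"
    "zeta_term (tensor L2 L1) s summable_on ideals_over (tensor L2 L1) E"
    using zeta_comparison[OF L.cring_tensor G.cring_tensor \<phi>(1) one mult _ surj inj sum] by auto
qed

text \<open>\<open>Q i\<close> plays the role of the completions of \<open>L\<close> at the primes above \<open>p\<close>.  The maps \<open>\<tau> i\<close> are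
  approximate sections: modulo \<open>p^a\<close> they invert \<open>\<rho> i\<close> up to the factor \<open>e i\<close>.\<close>

locale local_presentation = L: cring L
  for L :: "('a, 'm) ring_scheme" and Q :: "'i \<Rightarrow> ('q, 'n) ring_scheme" and \<rho> :: "'i \<Rightarrow> 'a \<Rightarrow> 'q"
    and A :: "'i set" and p :: nat +
  assumes p: "Factorial_Ring.prime p" and fin: "finite A"
    and cring_Q: "i \<in> A \<Longrightarrow> cring (Q i)" and rho: "i \<in> A \<Longrightarrow> \<rho> i \<in> ring_hom L (Q i)"
    and approx: "i \<in> A \<Longrightarrow> r \<in> carrier (Q i) \<Longrightarrow> \<exists>b\<in>carrier L. r \<ominus>\<^bsub>Q i\<^esub> \<rho> i b \<in> multiples (Q i) (int p ^ a)"
    and comax: "i \<in> A \<Longrightarrow> j \<in> A \<Longrightarrow> i \<noteq> j \<Longrightarrow>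
      \<exists>u\<in>carrier L. \<rho> i u \<in> multiples (Q i) (int p ^ a) \<and> \<rho> j (\<one>\<^bsub>L\<^esub> \<ominus>\<^bsub>L\<^esub> u) \<in> multiples (Q j) (int p ^ b)"
    and sections: "\<exists>e \<tau>. (\<forall>i\<in>A. e i \<in> carrier L \<and> \<tau> i \<in> carrier (Q i) \<rightarrow> carrier L \<and>
        (\<forall>r\<in>carrier (Q i). \<forall>r'\<in>carrier (Q i). \<tau> i (r \<oplus>\<^bsub>Q i\<^esub> r') \<ominus>\<^bsub>L\<^esub> (\<tau> i r \<oplus>\<^bsub>L\<^esub> \<tau> i r') \<in> multiples L (int p ^ a)) \<and>
        (\<forall>b\<in>carrier L. \<tau> i (\<rho> i b) \<ominus>\<^bsub>L\<^esub> e i \<otimes>\<^bsub>L\<^esub> b \<in> multiples L (int p ^ a))) \<and>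
      (\<forall>I. ideal I L \<longrightarrow> (\<forall>i\<in>A. e i \<in> I) \<longrightarrow> imul L (int p ^ a) \<one>\<^bsub>L\<^esub> \<in> I \<longrightarrow> \<one>\<^bsub>L\<^esub> \<in> I)"
    and units: "i \<in> A \<Longrightarrow> coprime k (int p) \<Longrightarrow> \<exists>r\<in>carrier (Q i). imul (Q i) k r = \<one>\<^bsub>Q i\<^esub>"
begin

text \<open>Density and comaximality pass from \<open>L\<close> to the tensor products through pure
  tensors. Separation is the difficult part: tensoring with \<open>M\<close> could destroy it. The
  approximate sections prevent this: if \<open>\<phi> i x\<close> is divisible by \<open>n\<close>,
  the section at \<open>i\<close> shows that e i times \<open>x\<close> is divisible by
  \<open>n\<close>, and the elements \<open>e i\<close> together with \<open>n\<close> generate the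
  unit ideal.\<close>

lemma decomposition:
  fixes M :: "('b, 'c) ring_scheme"
  assumes M: "cring M"
  obtains \<phi> where "ideal_decomposition (tensor L M) (\<lambda>i. tensor (Q i) M) \<phi> A (\<lambda>_. powers p) (powers p)"
proof -
  interpret M: cring M by fact
  interpret LM: tensor_pair L M by unfold_locales
  have QM: "tensor_pair (Q i) M" if "i \<in> A" for i
    using cring_Q[OF that] M by (simp add: tensor_pair_def)
  let ?T = "tensor L M" and ?S = "\<lambda>i. tensor (Q i) M"
  note rho_closed = ring_hom_closed[OF rho]
  have "\<exists>\<phi>. \<phi> \<in> ring_hom ?T (?S i) \<and>
    (\<forall>a\<in>carrier L. \<forall>b\<in>carrier M. \<phi> (pure_tensor L M a b) = pure_tensor (Q i) M (\<rho> i a) b)" if i: "i \<in> A" for i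
  proof -
    interpret QM: tensor_pair "Q i" M using QM[OF i] .
    show ?thesis
      by (rule LM.tensor_ring_hom[OF QM.cring_tensor, of "\<lambda>a b. pure_tensor (Q i) M (\<rho> i a) b"])
        (auto simp: rho_closed i ring_hom_add[OF rho[OF i]] ring_hom_mult[OF rho[OF i]] ring_hom_one[OF rho[OF i]]
          QM.pure_add_left QM.pure_add_right QM.pure_mult QM.pure_one)
  qed
  then obtain \<phi> where \<phi>: "\<And>i. i \<in> A \<Longrightarrow> \<phi> i \<in> ring_hom ?T (?S i)"
    "\<And>i a b. i \<in> A \<Longrightarrow> a \<in> carrier L \<Longrightarrow> b \<in> carrier M \<Longrightarrow> \<phi> i (pure_tensor L M a b) = pure_tensor (Q i) M (\<rho> i a) b"
    by metis
  have dense: "\<exists>t\<in>carrier ?T. y \<ominus>\<^bsub>?S i\<^esub> \<phi> i t \<in> multiples (?S i) n"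
    if i: "i \<in> A" and n: "n \<in> powers p" and y: "y \<in> carrier (?S i)" for i n y
  proof -
    interpret QM: tensor_pair "Q i" M using QM[OF i] .
    interpret I: ideal "multiples (?S i) n" "?S i" by (rule QM.T.multiples_ideal)
    from y show ?thesis
    proof (induction y rule: QM.tensor_induct)
      case (pure r m)
      obtain a where a: "n = int p ^ a" using n by (auto simp: powers_def)
      obtain b z where b: "b \<in> carrier L" "z \<in> carrier (Q i)" "r \<ominus>\<^bsub>Q i\<^esub> \<rho> i b = imul (Q i) n z"
        using approx[OF i pure(1), of a] a by (auto simp: multiples_def)
      have rb: "\<rho> i b \<in> carrier (Q i)" using rho_closed[OF i b(1)] .
      have "r = imul (Q i) n z \<oplus>\<^bsub>Q i\<^esub> \<rho> i b" using b(3) pure(1) rb by (metis QM.R.add.inv_solve_right QM.R.imul_closed QM.R.minus_closed a_minus_def b(2))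
      then have "pure_tensor (Q i) M r m = imul (?S i) n (pure_tensor (Q i) M z m) \<oplus>\<^bsub>?S i\<^esub> pure_tensor (Q i) M (\<rho> i b) m"
        using b pure rb by (simp add: QM.pure_add_left QM.pure_imul_left)
      then have "pure_tensor (Q i) M r m \<ominus>\<^bsub>?S i\<^esub> \<phi> i (pure_tensor L M b m) = imul (?S i) n (pure_tensor (Q i) M z m)"
        using b pure rb by (simp add: \<phi>(2)[OF i] a_minus_def QM.T.a_assoc QM.T.r_neg)
      then show ?case using b pure by (intro bexI[of _ "pure_tensor L M b m"]) auto
    next
      case (diff x y)
      then obtain s t where st: "s \<in> carrier ?T" "t \<in> carrier ?T" "x \<ominus>\<^bsub>?S i\<^esub> \<phi> i s \<in> multiples (?S i) n"
        "y \<ominus>\<^bsub>?S i\<^esub> \<phi> i t \<in> multiples (?S i) n" by blast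
      have c: "\<phi> i s \<in> carrier (?S i)" "\<phi> i t \<in> carrier (?S i)"
        using st ring_hom_closed[OF \<phi>(1)[OF i]] by auto
      have "(x \<ominus>\<^bsub>?S i\<^esub> y) \<ominus>\<^bsub>?S i\<^esub> \<phi> i (s \<ominus>\<^bsub>?T\<^esub> t) =
        (x \<ominus>\<^bsub>?S i\<^esub> \<phi> i s) \<ominus>\<^bsub>?S i\<^esub> (y \<ominus>\<^bsub>?S i\<^esub> \<phi> i t)"
        unfolding ring_hom_minus[OF LM.T.ring_axioms QM.T.ring_axioms \<phi>(1)[OF i] st(1,2)]
        using diff(1,2) c by algebra
      then show ?case using st I.minus_closed_ideal by (intro bexI[of _ "s \<ominus>\<^bsub>?T\<^esub> t"]) auto
    qed
  qed
  have mult_pure: "\<phi> i (pure_tensor L M u \<one>\<^bsub>M\<^esub>) \<in> multiples (?S i) n"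
    if i: "i \<in> A" and u: "u \<in> carrier L" and m: "\<rho> i u \<in> multiples (Q i) n" for i u n
  proof -
    interpret QM: tensor_pair "Q i" M using QM i by blast
    obtain z where "z \<in> carrier (Q i)" "\<rho> i u = imul (Q i) n z"
      using m unfolding multiples_def by blast
    then show ?thesis using i u by (auto simp: \<phi>(2) QM.pure_imul_left)
  qed
  have comaximal: "\<exists>u\<in>carrier ?T. \<phi> i u \<in> multiples (?S i) n \<and> \<phi> j (\<one>\<^bsub>?T\<^esub> \<ominus>\<^bsub>?T\<^esub> u) \<in> multiples (?S j) m"
    if ij: "i \<in> A" "j \<in> A" "i \<noteq> j" and nm: "n \<in> powers p" "m \<in> powers p" for i j n m
  proof -
    obtain u where u: "u \<in> carrier L" "\<rho> i u \<in> multiples (Q i) n" "\<rho> j (\<one>\<^bsub>L\<^esub> \<ominus>\<^bsub>L\<^esub> u) \<in> multiples (Q j) m"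
      using comax[OF ij] nm by (auto simp: powers_def)
    let ?u = "pure_tensor L M u \<one>\<^bsub>M\<^esub>"
    have "pure_tensor L M (\<one>\<^bsub>L\<^esub> \<ominus>\<^bsub>L\<^esub> u) \<one>\<^bsub>M\<^esub> \<oplus>\<^bsub>?T\<^esub> ?u = \<one>\<^bsub>?T\<^esub>"
      using u(1) by (simp flip: LM.pure_add_left LM.pure_one add: a_minus_def L.a_assoc L.l_neg)
    then have "\<one>\<^bsub>?T\<^esub> \<ominus>\<^bsub>?T\<^esub> ?u = pure_tensor L M (\<one>\<^bsub>L\<^esub> \<ominus>\<^bsub>L\<^esub> u) \<one>\<^bsub>M\<^esub>"
      using u(1) by (metis LM.T.add.inv_solve_right LM.pure_closed LM.T.one_closed L.minus_closed L.one_closed M.one_closed a_minus_def)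
    then show ?thesis using mult_pure ij u by (intro bexI[of _ ?u]) auto
  qed
  have separating: "x \<in> multiples ?T n"
    if n: "n \<in> powers p" and x: "x \<in> carrier ?T" and ix: "\<And>i. i \<in> A \<Longrightarrow> \<phi> i x \<in> multiples (?S i) n" for n x
  proof -
    obtain a where a: "n = int p ^ a" using n by (auto simp: powers_def)
    obtain e \<tau> where e\<tau>: "\<forall>i\<in>A. e i \<in> carrier L \<and> \<tau> i \<in> carrier (Q i) \<rightarrow> carrier L \<and>
        (\<forall>r\<in>carrier (Q i). \<forall>r'\<in>carrier (Q i). \<tau> i (r \<oplus>\<^bsub>Q i\<^esub> r') \<ominus>\<^bsub>L\<^esub> (\<tau> i r \<oplus>\<^bsub>L\<^esub> \<tau> i r') \<in> multiples L n) \<and>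
        (\<forall>b\<in>carrier L. \<tau> i (\<rho> i b) \<ominus>\<^bsub>L\<^esub> e i \<otimes>\<^bsub>L\<^esub> b \<in> multiples L n)"
      and total: "\<forall>I. ideal I L \<longrightarrow> (\<forall>i\<in>A. e i \<in> I) \<longrightarrow> imul L n \<one>\<^bsub>L\<^esub> \<in> I \<longrightarrow> \<one>\<^bsub>L\<^esub> \<in> I"
      using sections[of a] unfolding a by (elim exE conjE)
    have e: "\<And>i. i \<in> A \<Longrightarrow> e i \<in> carrier L"
      and \<tau>: "\<And>i r. i \<in> A \<Longrightarrow> r \<in> carrier (Q i) \<Longrightarrow> \<tau> i r \<in> carrier L"
        "\<And>i r r'. i \<in> A \<Longrightarrow> r \<in> carrier (Q i) \<Longrightarrow> r' \<in> carrier (Q i) \<Longrightarrow>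
          \<tau> i (r \<oplus>\<^bsub>Q i\<^esub> r') \<ominus>\<^bsub>L\<^esub> (\<tau> i r \<oplus>\<^bsub>L\<^esub> \<tau> i r') \<in> multiples L n"
        "\<And>i b. i \<in> A \<Longrightarrow> b \<in> carrier L \<Longrightarrow> \<tau> i (\<rho> i b) \<ominus>\<^bsub>L\<^esub> e i \<otimes>\<^bsub>L\<^esub> b \<in> multiples L n"
      using e\<tau> by (blast dest: funcset_mem)+
    define I where "I = multiples ?T n"
    interpret I: ideal I ?T unfolding I_def by (rule LM.T.multiples_ideal)
    \<comment> \<open>The section \<open>\<tau> i\<close> is additive only modulo \<open>n\<close>;
      it becomes additive once its values are read modulo \<open>n\<close>.\<close>
    let ?G = "?T Quot I"
    interpret G: cring ?G by (rule I.quotient_is_cring[OF LM.cring_tensor])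
    let ?c = "\<lambda>x. I +>\<^bsub>?T\<^esub> x"
    have c_hom: "?c \<in> ring_hom ?T ?G" by (rule I.rcos_ring_hom)
    have c_eq: "?c x = ?c y \<longleftrightarrow> x \<ominus>\<^bsub>?T\<^esub> y \<in> I" if "x \<in> carrier ?T" "y \<in> carrier ?T" for x y
      using LM.T.coset_eq_iff[OF I.is_ideal that] .
    have pure_cong: "?c (pure_tensor L M u m) = ?c (pure_tensor L M v m)"
      if uv: "u \<in> carrier L" "v \<in> carrier L" "m \<in> carrier M" "u \<ominus>\<^bsub>L\<^esub> v \<in> multiples L n" for u v m
    proof -
      obtain z where z: "z \<in> carrier L" "u \<ominus>\<^bsub>L\<^esub> v = imul L n z" using uv by (auto simp: multiples_def)
      have "u = imul L n z \<oplus>\<^bsub>L\<^esub> v"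
        using z uv by (metis L.add.inv_solve_right L.imul_closed a_minus_def)
      then have "pure_tensor L M u m \<ominus>\<^bsub>?T\<^esub> pure_tensor L M v m = imul ?T n (pure_tensor L M z m)"
        using z uv by (simp add: LM.pure_add_left LM.pure_imul_left a_minus_def LM.T.a_assoc LM.T.r_neg)
      then show ?thesis using c_eq uv z by (simp add: I_def multiplesI)
    qed
    have key: "pure_tensor L M (e i) \<one>\<^bsub>M\<^esub> \<otimes>\<^bsub>?T\<^esub> x \<in> I" if i: "i \<in> A" for i
    proof -
      interpret QM: tensor_pair "Q i" M using QM[OF i] .
      note c_add = additive_ring_hom(2)[OF c_hom]
      have cc: "?c x \<in> carrier ?G" if "x \<in> carrier ?T" for x using ring_hom_closed[OF c_hom that] .
      \<comment> \<open>This is \<open>\<tau> i\<close> tensored with \<open>M\<close>. Composed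
        with \<open>\<phi> i\<close> it is multiplication by e i \<otimes> 1.\<close>
      obtain h where h: "h \<in> carrier (?S i) \<rightarrow> carrier ?G"
        "\<And>x y. x \<in> carrier (?S i) \<Longrightarrow> y \<in> carrier (?S i) \<Longrightarrow> h (x \<oplus>\<^bsub>?S i\<^esub> y) = h x \<oplus>\<^bsub>?G\<^esub> h y"
        "\<And>a b. a \<in> carrier (Q i) \<Longrightarrow> b \<in> carrier M \<Longrightarrow> h (pure_tensor (Q i) M a b) = ?c (pure_tensor L M (\<tau> i a) b)"
      proof (rule QM.tensor_universal[OF G.abelian_group_axioms, of "\<lambda>r m. ?c (pure_tensor L M (\<tau> i r) m)"])
        show "?c (pure_tensor L M (\<tau> i r) m) \<in> carrier ?G" if "r \<in> carrier (Q i)" "m \<in> carrier M" for r m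
          using that \<tau>(1)[OF i] cc by blast
        show "?c (pure_tensor L M (\<tau> i (r \<oplus>\<^bsub>Q i\<^esub> r')) m) = ?c (pure_tensor L M (\<tau> i r) m) \<oplus>\<^bsub>?G\<^esub> ?c (pure_tensor L M (\<tau> i r') m)"
          if "r \<in> carrier (Q i)" "r' \<in> carrier (Q i)" "m \<in> carrier M" for r r' m
          using that \<tau>(1,2)[OF i] pure_cong[of "\<tau> i (r \<oplus>\<^bsub>Q i\<^esub> r')" "\<tau> i r \<oplus>\<^bsub>L\<^esub> \<tau> i r'" m]
          by (simp add: LM.pure_add_left c_add)
        show "?c (pure_tensor L M (\<tau> i r) (m \<oplus>\<^bsub>M\<^esub> m')) = ?c (pure_tensor L M (\<tau> i r) m) \<oplus>\<^bsub>?G\<^esub> ?c (pure_tensor L M (\<tau> i r) m')"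
          if "r \<in> carrier (Q i)" "m \<in> carrier M" "m' \<in> carrier M" for r m m'
          using that \<tau>(1)[OF i] by (simp add: LM.pure_add_right c_add)
      qed blast
      let ?e = "pure_tensor L M (e i) \<one>\<^bsub>M\<^esub>"
      have ec: "?e \<in> carrier ?T" using e[OF i] by simp
      have "h (\<phi> i x) = ?c (?e \<otimes>\<^bsub>?T\<^esub> x)"
      proof (rule LM.additive_eqI[OF G.abelian_group_axioms _ _ _ _ _ x, where h = "\<lambda>x. h (\<phi> i x)" and h' = "\<lambda>x. ?c (?e \<otimes>\<^bsub>?T\<^esub> x)"])
        note \<phi>c = additive_ring_hom[OF \<phi>(1)[OF i]]
        show "(\<lambda>x. h (\<phi> i x)) \<in> carrier ?T \<rightarrow> carrier ?G" using h(1) \<phi>c(1) by auto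
        show "(\<lambda>x. ?c (?e \<otimes>\<^bsub>?T\<^esub> x)) \<in> carrier ?T \<rightarrow> carrier ?G" using cc ec by simp
        show "h (\<phi> i (x \<oplus>\<^bsub>?T\<^esub> y)) = h (\<phi> i x) \<oplus>\<^bsub>?G\<^esub> h (\<phi> i y)" if "x \<in> carrier ?T" "y \<in> carrier ?T" for x y
          using that by (simp add: \<phi>c(2) h(2) funcset_mem[OF \<phi>c(1)])
        show "?c (?e \<otimes>\<^bsub>?T\<^esub> (x \<oplus>\<^bsub>?T\<^esub> y)) = ?c (?e \<otimes>\<^bsub>?T\<^esub> x) \<oplus>\<^bsub>?G\<^esub> ?c (?e \<otimes>\<^bsub>?T\<^esub> y)"
          if "x \<in> carrier ?T" "y \<in> carrier ?T" for x y
          using that ec c_add by (simp add: LM.T.r_distr)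
        show "h (\<phi> i (pure_tensor L M b m)) = ?c (?e \<otimes>\<^bsub>?T\<^esub> pure_tensor L M b m)"
          if bm: "b \<in> carrier L" "m \<in> carrier M" for b m
          using bm e[OF i] pure_cong[of "\<tau> i (\<rho> i b)" "e i \<otimes>\<^bsub>L\<^esub> b" m] \<tau>(3)[OF i bm(1)] \<tau>(1)[OF i rho_closed[OF i bm(1)]]
          by (simp add: \<phi>(2)[OF i] h(3) rho_closed[OF i] LM.pure_mult)
      qed
      moreover obtain z where z: "z \<in> carrier (?S i)" "\<phi> i x = imul (?S i) n z"
        using ix[OF i] by (auto simp: multiples_def)
      then have "h (\<phi> i x) = imul ?G n (h z)"
        using additive_imul[OF QM.T.abelian_group_axioms G.abelian_group_axioms h(1,2) z(1)] by simp
      moreover obtain t where t: "t \<in> carrier ?T" "h z = ?c t"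
        using h(1) z(1) by (auto simp: FactRing_def LM.T.a_rcosets_image)
      then have "imul ?G n (h z) = ?c (imul ?T n t)"
        using ring_hom_imul[OF LM.T.ring_axioms G.ring_axioms c_hom t(1), of n] by simp
      ultimately have "?e \<otimes>\<^bsub>?T\<^esub> x \<ominus>\<^bsub>?T\<^esub> imul ?T n t \<in> I" using c_eq ec x t by simp
      then show ?thesis
        using I.mem_of_minus2[of "?e \<otimes>\<^bsub>?T\<^esub> x" "imul ?T n t"] ec x t by (simp add: I_def multiplesI)
    qed
    \<comment> \<open>The elements of \<open>L\<close> that multiply \<open>x\<close> into the
      multiples of \<open>n\<close>. This ideal contains \<open>n\<close> and every
      \<open>e i\<close>, hence 1.\<close>
    define J where "J = {b \<in> carrier L. pure_tensor L M b \<one>\<^bsub>M\<^esub> \<otimes>\<^bsub>?T\<^esub> x \<in> I}"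
    have "ideal J L"
    proof (rule L.cideal_criterion)
      have "pure_tensor L M \<zero>\<^bsub>L\<^esub> \<one>\<^bsub>M\<^esub> = \<zero>\<^bsub>?T\<^esub>" using LM.pure_imul_left[of "\<zero>\<^bsub>L\<^esub>" "\<one>\<^bsub>M\<^esub>" 0] by simp
      then show "\<zero>\<^bsub>L\<^esub> \<in> J" using x by (simp add: J_def)
      show "b \<oplus>\<^bsub>L\<^esub> b' \<in> J" if "b \<in> J" "b' \<in> J" for b b'
        using that x by (auto simp: J_def LM.pure_add_left LM.T.l_distr)
      show "r \<otimes>\<^bsub>L\<^esub> b \<in> J" if "b \<in> J" "r \<in> carrier L" for b r
      proof -
        have "pure_tensor L M (r \<otimes>\<^bsub>L\<^esub> b) \<one>\<^bsub>M\<^esub> = pure_tensor L M r \<one>\<^bsub>M\<^esub> \<otimes>\<^bsub>?T\<^esub> pure_tensor L M b \<one>\<^bsub>M\<^esub>"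
          using that by (simp add: J_def LM.pure_mult)
        then show ?thesis using that x I.I_l_closed by (auto simp: J_def LM.T.m_assoc)
      qed
    qed (auto simp: J_def)
    moreover have "imul L n \<one>\<^bsub>L\<^esub> \<in> J"
      using x by (simp add: J_def LM.pure_imul_left LM.pure_one LM.T.imul_one I_def multiplesI)
    ultimately have "\<one>\<^bsub>L\<^esub> \<in> J" using total key e by (auto simp: J_def)
    then show ?thesis using x by (simp add: J_def LM.pure_one I_def)
  qed
  have "ideal_decomposition ?T ?S \<phi> A (\<lambda>_. powers p) (powers p)"
  proof (intro ideal_decomposition.intro ideal_decomposition_axioms.intro LM.cring_tensor)
    show "\<exists>k. (\<forall>i\<in>A. k i \<in> powers p) \<and>
        (\<forall>x\<in>carrier ?T. (\<forall>i\<in>A. \<phi> i x \<in> multiples (?S i) (k i)) \<longrightarrow> x \<in> multiples ?T n)" if "n \<in> powers p" for n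
      using separating[OF that] that by (intro exI[of _ "\<lambda>_. n"]) auto
    show "(\<Prod>i\<in>A. k i) \<in> powers p" if "\<And>i. i \<in> A \<Longrightarrow> k i \<in> powers p" for k
      using fin that
    proof (induction A)
      case empty
      show ?case by (auto simp: powers_def intro: range_eqI[of _ _ 0])
    qed (auto intro: powers_mult)
    show "1 \<in> powers p" by (auto simp: powers_def intro: range_eqI[of _ _ 0])
    show "cring (?S i)" if "i \<in> A" for i using tensor_pair.cring_tensor[OF QM[OF that]] by simp
  qed (use fin \<phi>(1) dense comaximal powers_mult in auto)
  then show ?thesis by (rule that)
qed

text \<open>It remains to identify the ideals of finite index in the rings over \<open>Q i\<close>.
  The part prime to \<open>p\<close> of an integer is invertible there, so an ideal of finite index
  contains a power of \<open>p\<close>. The converse cannot use generators of these rings; it goes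
  through the contraction to the finitely generated ring over \<open>L\<close>.\<close>

lemma zeta_local:
  fixes M :: "('b, 'c) ring_scheme"
  assumes M: "cring M" and gen: "generated_by (tensor L M) g N"
    and sum: "zeta_term (tensor L M) s summable_on ideals_over (tensor L M) (powers p)"
  shows "i \<in> A \<Longrightarrow> zeta_converges (tensor (Q i) M) s"
    "infsum (zeta_term (tensor L M) s) (ideals_over (tensor L M) (powers p)) = (\<Prod>i\<in>A. zeta (tensor (Q i) M) s)"
proof -
  interpret M: cring M by fact
  let ?T = "tensor L M" and ?S = "\<lambda>i. tensor (Q i) M"
  obtain \<phi> where "ideal_decomposition ?T ?S \<phi> A (\<lambda>_. powers p) (powers p)"
    by (rule decomposition[OF M])
  then interpret D: ideal_decomposition ?T ?S \<phi> A "\<lambda>_. powers p" "powers p" .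
  have *: "finite_index_ideals (?S i) = ideals_over (?S i) (powers p)" if i: "i \<in> A" for i
  proof (intro equalityI subsetI)
    fix J assume J: "J \<in> finite_index_ideals (?S i)"
    interpret QM: tensor_pair "Q i" M using cring_Q[OF i] M by (simp add: tensor_pair_def)
    interpret J: ideal J "?S i" using J by (simp add: finite_index_ideals_def)
    obtain n where n: "n > 0" "imul (?S i) n \<one>\<^bsub>?S i\<^esub> \<in> J"
      using QM.T.one_int_pigeonhole[OF J.is_ideal] J by (auto simp: finite_index_ideals_def)
    have "n \<in> coprime_to {}" using n by (simp add: coprime_to_def)
    then have "n \<in> {n * m | n m. n \<in> powers p \<and> m \<in> coprime_to {p}}"
      using coprime_to_insert[OF p, of "{}"] by simp
    then obtain a k where ak: "n = int p ^ a * k" "coprime k (int p)"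
      unfolding powers_def coprime_to_def by blast
    obtain r where r: "r \<in> carrier (Q i)" "imul (Q i) k r = \<one>\<^bsub>Q i\<^esub>" using units[OF i ak(2)] by blast
    let ?r = "pure_tensor (Q i) M r \<one>\<^bsub>M\<^esub>"
    have "imul (?S i) k ?r = \<one>\<^bsub>?S i\<^esub>" using r by (simp flip: QM.pure_imul_left add: QM.pure_one)
    then have "imul (?S i) (int p ^ a) \<one>\<^bsub>?S i\<^esub> = imul (?S i) n ?r"
      using r by (simp add: ak(1) QM.T.imul_mult)
    also have "\<dots> \<in> J" using J.multiples_subset[OF n(2)] r multiplesI[of ?r "?S i" n] by auto
    finally show "J \<in> ideals_over (?S i) (powers p)"
      using J.is_ideal by (auto simp: ideals_over_def powers_def)
  next
    fix J assume J: "J \<in> ideals_over (?S i) (powers p)"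
    \<comment> \<open>\<open>J\<close> at the place \<open>i\<close> and the unit ideal elsewhere.
      The contraction has finite index because it contains a power of \<open>p\<close>, and
      finiteness returns to \<open>J\<close> through the index formula.\<close>
    let ?F = "\<lambda>j\<in>A. if j = i then J else carrier (?S j)"
    have F: "?F \<in> D.families" using J D.carrier_mem by auto
    have "D.contract ?F \<in> ideals_over ?T (powers p)" using D.contract_mem[OF F] .
    then obtain n where n: "ideal (D.contract ?F) ?T" "n \<in> powers p" "imul ?T n \<one>\<^bsub>?T\<^esub> \<in> D.contract ?F"
      by (auto simp: ideals_over_def)
    then have "n > 0" using p by (auto simp: powers_def prime_gt_0_nat)
    then have "finite (a_rcosets\<^bsub>?T\<^esub> (D.contract ?F))"
      using D.T.finite_index_of_int[OF gen n(1) _ n(3)] by blast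
    then have "finite (a_rcosets\<^bsub>?S i\<^esub> (?F i))" using D.contract_index(2)[OF F _ i] by blast
    then show "J \<in> finite_index_ideals (?S i)"
      using J i by (simp add: finite_index_ideals_def ideals_over_def)
  qed
  show "i \<in> A \<Longrightarrow> zeta_converges (tensor (Q i) M) s"
    using D.zeta_decomposition(1)[OF sum] * by (simp add: zeta_converges_def)
  show "infsum (zeta_term (tensor L M) s) (ideals_over (tensor L M) (powers p)) = (\<Prod>i\<in>A. zeta (tensor (Q i) M) s)"
    using D.zeta_decomposition(2)[OF sum] * by (simp add: zeta_def)
qed

end

subsection \<open>Powers of ideals\<close>

context cring
begin

lemma ideal_power_0: "ideal_power R I 0 = carrier R"
  and ideal_power_Suc: "ideal_power R I (Suc n) = I \<cdot> ideal_power R I n"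
  by (simp_all add: ideal_power_def)

lemma ideal_power_ideal: "ideal I R \<Longrightarrow> ideal (ideal_power R I n) R"
  by (induction n) (simp_all add: ideal_power_0 ideal_power_Suc oneideal ideal_prod_is_ideal)

lemma ideal_power_closed: "ideal I R \<Longrightarrow> x \<in> ideal_power R I n \<Longrightarrow> x \<in> carrier R"
  using ideal.Icarr[OF ideal_power_ideal] by blast

lemma ideal_power_Suc_subset: "ideal I R \<Longrightarrow> ideal_power R I (Suc n) \<subseteq> ideal_power R I n"
  using ideal_prod_inter[OF _ ideal_power_ideal] by (auto simp: ideal_power_Suc)

lemma ideal_power_antimono: "ideal I R \<Longrightarrow> n \<le> m \<Longrightarrow> ideal_power R I m \<subseteq> ideal_power R I n"
proof (induction m)
  case (Suc m)
  then show ?case using ideal_power_Suc_subset[OF Suc.prems(1), of m] by (cases "n = Suc m") auto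
qed auto

text \<open>For a fixed \<open>i\<close> in \<open>I\<close>, the elements that \<open>i\<close>
  multiplies into \<open>W\<close> form an ideal, to which the induction hypothesis applies. Stating
  the result for every \<open>W\<close> makes this induction possible.\<close>

lemma ideal_power_add_minimal:
  assumes I: "ideal I R" and W: "ideal W R"
    and uv: "\<And>u v. u \<in> ideal_power R I a \<Longrightarrow> v \<in> ideal_power R I b \<Longrightarrow> u \<otimes> v \<in> W"
  shows "ideal_power R I (a + b) \<subseteq> W"
  using W uv
proof (induction a arbitrary: W)
  case 0
  have "v \<in> W" if "v \<in> ideal_power R I b" for v
    using 0(2)[of \<one> v] that ideal_power_closed[OF I that] by (simp add: ideal_power_0)
  then show ?case by auto
next
  case (Suc a)
  interpret W: ideal W R by fact
  have step: "i \<otimes> z \<in> W" if i: "i \<in> I" and z: "z \<in> ideal_power R I (a + b)" for i z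
  proof -
    have ic: "i \<in> carrier R" using ideal.Icarr[OF I i] .
    have "ideal {z \<in> carrier R. i \<otimes> z \<in> W} R"
      by (rule W.helper_max_prime[OF is_cring ic])
    moreover have "u \<otimes> v \<in> {z \<in> carrier R. i \<otimes> z \<in> W}" if "u \<in> ideal_power R I a" "v \<in> ideal_power R I b" for u v
    proof -
      have c: "u \<in> carrier R" "v \<in> carrier R" using ideal_power_closed[OF I] that by auto
      have "i \<otimes> u \<in> ideal_power R I (Suc a)"
        using i that by (auto simp: ideal_power_Suc intro: ideal_prod.prod)
      from Suc.prems(2)[OF this that(2)] show ?thesis using c ic by (simp add: m_assoc)
    qed
    ultimately have "ideal_power R I (a + b) \<subseteq> {z \<in> carrier R. i \<otimes> z \<in> W}" by (rule Suc.IH)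
    then show ?thesis using z by blast
  qed
  show ?case
  proof
    fix x assume "x \<in> ideal_power R I (Suc a + b)"
    then have "x \<in> I \<cdot> ideal_power R I (a + b)" by (simp add: ideal_power_Suc)
    then show "x \<in> W" by (induction x rule: ideal_prod.induct) (use step in auto)
  qed
qed

lemma pow_in_ideal_power:
  assumes "ideal I R" "x \<in> I"
  shows "x [^] (n::nat) \<in> ideal_power R I n"
proof (induction n)
  case (Suc n)
  have "x \<otimes> x [^] n \<in> ideal_power R I (Suc n)"
    using assms Suc by (auto simp: ideal_power_Suc intro: ideal_prod.prod)
  then show ?case using ideal.Icarr[OF assms] by (simp add: m_comm)
qed (simp add: ideal_power_0)

lemma one_minus_pow_dvd:
  assumes "y \<in> carrier R"
  shows "\<exists>s\<in>carrier R. \<one> \<ominus> y [^] (n::nat) = (\<one> \<ominus> y) \<otimes> s"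
proof (induction n)
  case 0
  show ?case using assms by (intro bexI[of _ \<zero>]) (auto simp: a_minus_def r_neg)
next
  case (Suc n)
  then obtain s where s: "s \<in> carrier R" "\<one> \<ominus> y [^] n = (\<one> \<ominus> y) \<otimes> s" by blast
  have c: "y [^] n \<in> carrier R" using assms by simp
  have "\<one> \<ominus> y [^] n \<otimes> y = (\<one> \<ominus> y) \<oplus> y \<otimes> (\<one> \<ominus> y [^] n)" using assms c by algebra
  also have "\<dots> = (\<one> \<ominus> y) \<otimes> (\<one> \<oplus> y \<otimes> s)" unfolding s(2) using assms s(1) by algebra
  finally show ?case using assms s by (intro bexI[of _ "\<one> \<oplus> y \<otimes> s"]) auto
qed

text \<open>The powers of \<open>x\<close> take finitely many values modulo \<open>P\<close>, so two
  of them agree; the common power cancels because \<open>P\<close> is prime. The exponent is written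
  \<open>Suc k\<close> to have it positive.\<close>

lemma finite_prime_unit:
  assumes P: "primeideal P R" and fin: "finite (a_rcosets P)" and x: "x \<in> carrier R" "x \<notin> P"
  shows "\<exists>k::nat. \<one> \<ominus> x [^] Suc k \<in> P"
proof -
  interpret P: primeideal P R by fact
  have "\<not> inj (\<lambda>i::nat. P +> x [^] i)"
  proof
    assume "inj (\<lambda>i::nat. P +> x [^] i)"
    moreover have "range (\<lambda>i::nat. P +> x [^] i) \<subseteq> a_rcosets P"
      using x by (auto simp: a_rcosets_image)
    ultimately show False using fin by (meson finite_subset infinite_UNIV_nat finite_imageD)
  qed
  then obtain i j :: nat where ij: "i < j" "P +> x [^] i = P +> x [^] j"
    unfolding inj_def by (metis linorder_neqE_nat)
  define k where "k = j - i - 1"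
  have j: "j = i + Suc k" using ij(1) by (simp add: k_def)
  have "x [^] i \<ominus> x [^] j \<in> P" using ij coset_eq_iff[OF P.is_ideal] x by simp
  moreover have "x [^] j = x [^] i \<otimes> x [^] Suc k" using nat_pow_mult[OF x(1), of i "Suc k"] by (simp only: j)
  moreover have "x [^] i \<ominus> x [^] i \<otimes> x [^] Suc k = x [^] i \<otimes> (\<one> \<ominus> x [^] Suc k)"
  proof -
    have "a \<ominus> a \<otimes> b = a \<otimes> (\<one> \<ominus> b)" if "a \<in> carrier R" "b \<in> carrier R" for a b
      using that by algebra
    then show ?thesis using x by blast
  qed
  ultimately have h: "x [^] i \<otimes> (\<one> \<ominus> x [^] Suc k) \<in> P" by simp
  have "x [^] i \<in> P \<or> \<one> \<ominus> x [^] Suc k \<in> P" using P.I_prime[OF _ _ h] x by blast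
  moreover have "x [^] i \<notin> P" for i :: nat
  proof (induction i)
    case 0
    show ?case using P.I_notcarr P.one_imp_carrier by auto
  next
    case (Suc i)
    then show ?case using P.I_prime[of "x [^] i" x] x by auto
  qed
  ultimately show ?thesis by blast
qed

text \<open>An element of \<open>P'\<close> outside \<open>P\<close> has a power congruent to 1
  modulo \<open>P\<close>, and this would put 1 into \<open>P'\<close>.\<close>

lemma finite_prime_maximal:
  assumes P: "primeideal P R" "finite (a_rcosets P)" and P': "primeideal P' R" and sub: "P \<subseteq> P'"
  shows "P = P'"
proof (rule ccontr)
  interpret P': primeideal P' R by fact
  assume "P \<noteq> P'"
  then obtain x where x: "x \<in> P'" "x \<notin> P" using sub by blast
  then obtain k :: nat where "\<one> \<ominus> x [^] Suc k \<in> P" using finite_prime_unit[OF P P'.Icarr[OF x(1)] x(2)] by blast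
  then have "\<one> \<ominus> x [^] Suc k \<in> P'" using sub by blast
  moreover have "x [^] Suc k \<in> P'" using x P'.I_l_closed[of x "x [^] k"] by simp
  ultimately have "\<one> \<in> P'" using P'.mem_of_minus2 by blast
  then show False using P'.I_notcarr P'.one_imp_carrier by auto
qed

lemma add_principal_ideal:
  assumes I: "ideal I R" and x: "x \<in> carrier R"
  shows "ideal {c \<oplus> r \<otimes> x | c r. c \<in> I \<and> r \<in> carrier R} R"
proof (rule cideal_criterion)
  interpret I: ideal I R by fact
  let ?J = "{c \<oplus> r \<otimes> x | c r. c \<in> I \<and> r \<in> carrier R}"
  show "\<zero> \<in> ?J" using x I.zero_closed by (intro CollectI exI[of _ \<zero>]) auto
  fix u v assume "u \<in> ?J" "v \<in> ?J"
  then obtain c r d s where e: "c \<in> I" "r \<in> carrier R" "d \<in> I" "s \<in> carrier R" "u = c \<oplus> r \<otimes> x" "v = d \<oplus> s \<otimes> x"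
    by blast
  have cd: "c \<in> carrier R" "d \<in> carrier R" using e I.Icarr by auto
  have "u \<oplus> v = (c \<oplus> d) \<oplus> (r \<oplus> s) \<otimes> x" unfolding e(5,6) using e(2,4) cd x by algebra
  then show "u \<oplus> v \<in> ?J" using e(1-4) I.a_closed by blast
next
  interpret I: ideal I R by fact
  let ?J = "{c \<oplus> r \<otimes> x | c r. c \<in> I \<and> r \<in> carrier R}"
  fix u t assume "u \<in> ?J" and t: "t \<in> carrier R"
  then obtain c r where e: "c \<in> I" "r \<in> carrier R" "u = c \<oplus> r \<otimes> x" by blast
  have cd: "c \<in> carrier R" using e I.Icarr by auto
  have "t \<otimes> u = (t \<otimes> c) \<oplus> (t \<otimes> r) \<otimes> x" unfolding e(3) using e(2) cd x t by algebra
  then show "t \<otimes> u \<in> ?J" using e(1,2) I.I_l_closed[OF _ t] t by blast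
qed (use x ideal.Icarr[OF I] in auto)

text \<open>
  This replaces primary decomposition: localised at \<open>P\<close>, the ideal \<open>c\<close> contains a power of \<open>P\<close>.
\<close>

lemma prime_power_annihilator:
  assumes gen: "generated_by R g n" and P: "primeideal P R" and m: "m > 0"
  shows "ideal c R \<Longrightarrow> imul R m \<one> \<in> c \<Longrightarrow>
    \<exists>N. \<exists>e\<in>carrier R - P. \<forall>x\<in>ideal_power R P N. e \<otimes> x \<in> c"
\<comment> \<open>A Noetherian induction: only finitely many ideals contain \<open>m\<close>, so
  enlarging \<open>c\<close> lowers the count.\<close>
proof (induction "card {d. ideal d R \<and> imul R m \<one> \<in> d \<and> c \<subseteq> d}" arbitrary: c rule: less_induct)
  case less
  interpret P: primeideal P R by fact
  interpret c: ideal c R by fact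
  let ?I = "\<lambda>c. {d. ideal d R \<and> imul R m \<one> \<in> d \<and> c \<subseteq> d}"
  have IH: "\<exists>N. \<exists>e\<in>carrier R - P. \<forall>x\<in>ideal_power R P N. e \<otimes> x \<in> d"
    if d: "ideal d R" "c \<subset> d" for d
  proof (rule less.hyps[OF _ d(1)])
    have "?I d \<subset> ?I c" using d less.prems by auto
    then show "card (?I d) < card (?I c)"
      using finite_subset[OF _ card_ideals_containing(1)[OF gen m], of "?I c"]
      by (intro psubset_card_mono) auto
    show "imul R m \<one> \<in> d" using d less.prems by auto
  qed
  consider "\<not> c \<subseteq> P" | "c \<subseteq> P" "primeideal c R" | "c \<subseteq> P" "\<not> primeideal c R" by blast
  then show ?case
  proof cases
    case 1
    then obtain e where "e \<in> c" "e \<notin> P" by blast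
    then show ?thesis using c.I_r_closed by (intro exI[of _ 0] bexI[of _ e]) (auto simp: ideal_power_0)
  next
    case 2
    then have "c = P"
      using finite_prime_maximal[OF 2(2) finite_index_of_int[OF gen less.prems(1) m less.prems(2)] P] by blast
    moreover have "ideal_power R P 1 = P"
    proof -
      have "P \<subseteq> ideal_power R P 1" using pow_in_ideal_power[OF P.is_ideal, of _ 1] by auto
      moreover have "ideal_power R P 1 \<subseteq> P"
        using ideal_prod_inter[OF P.is_ideal oneideal] by (simp add: ideal_power_Suc ideal_power_0)
      ultimately show ?thesis by blast
    qed
    moreover have "\<one> \<notin> P" using P.I_notcarr P.one_imp_carrier by auto
    ultimately show ?thesis by (intro exI[of _ 1] bexI[of _ \<one>]) (auto simp: P.Icarr)
  next
    case 3
    have "carrier R \<noteq> c" using 3(1) P.I_notcarr P.a_subset by blast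
    then obtain x y where xy: "x \<in> carrier R" "y \<in> carrier R" "x \<otimes> y \<in> c" "x \<notin> c" "y \<notin> c"
      using c.primeidealCE[OF is_cring 3(2)] by metis
    let ?d = "\<lambda>x. {a \<oplus> r \<otimes> x | a r. a \<in> c \<and> r \<in> carrier R}"
    have sub: "c \<subset> ?d z" if z: "z \<in> carrier R" "z \<notin> c" for z
    proof -
      have "u = u \<oplus> \<zero> \<otimes> z" if "u \<in> c" for u using z(1) c.Icarr[OF that] by simp
      then have "c \<subseteq> ?d z" using zero_closed by blast
      moreover have "z = \<zero> \<oplus> \<one> \<otimes> z" using z by simp
      then have "z \<in> ?d z" using c.zero_closed one_closed by blast
      ultimately show ?thesis using z by blast
    qed
    obtain N1 e1 where e1: "e1 \<in> carrier R - P" "\<And>z. z \<in> ideal_power R P N1 \<Longrightarrow> e1 \<otimes> z \<in> ?d x"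
      using IH[OF add_principal_ideal[OF less.prems(1) xy(1)] sub[OF xy(1,4)]] by blast
    obtain N2 e2 where e2: "e2 \<in> carrier R - P" "\<And>z. z \<in> ideal_power R P N2 \<Longrightarrow> e2 \<otimes> z \<in> ?d y"
      using IH[OF add_principal_ideal[OF less.prems(1) xy(2)] sub[OF xy(2,5)]] by blast
    have ec: "e1 \<otimes> e2 \<in> carrier R - P" using e1 e2 P.I_prime by auto
    \<comment> \<open>The product of c + (x) and c + (y) lies in \<open>c\<close>, since xy does.
      Therefore the exponents add up and the multipliers are multiplied.\<close>
    have "ideal_power R P (N1 + N2) \<subseteq> {z \<in> carrier R. e1 \<otimes> e2 \<otimes> z \<in> c}"
    proof (rule ideal_power_add_minimal[OF P.is_ideal])
      show "ideal {z \<in> carrier R. e1 \<otimes> e2 \<otimes> z \<in> c} R"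
        using ec by (intro c.helper_max_prime[OF is_cring]) auto
      fix u v assume uv: "u \<in> ideal_power R P N1" "v \<in> ideal_power R P N2"
      obtain a r b s where ab: "a \<in> c" "r \<in> carrier R" "b \<in> c" "s \<in> carrier R"
        "e1 \<otimes> u = a \<oplus> r \<otimes> x" "e2 \<otimes> v = b \<oplus> s \<otimes> y" using e1(2)[OF uv(1)] e2(2)[OF uv(2)] by blast
      have cc: "u \<in> carrier R" "v \<in> carrier R" "e1 \<in> carrier R" "e2 \<in> carrier R" "a \<in> carrier R" "b \<in> carrier R"
        using uv ideal_power_closed[OF P.is_ideal] e1 e2 ab c.Icarr by auto
      have "e1 \<otimes> e2 \<otimes> (u \<otimes> v) = (e1 \<otimes> u) \<otimes> (e2 \<otimes> v)" using cc by algebra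
      also have "\<dots> = a \<otimes> (b \<oplus> s \<otimes> y) \<oplus> (r \<otimes> x) \<otimes> b \<oplus> (r \<otimes> s) \<otimes> (x \<otimes> y)"
        unfolding ab(5,6) using cc ab(2,4) xy(1,2) by algebra
      also have "\<dots> \<in> c"
        using c.I_r_closed[OF ab(1), of "b \<oplus> s \<otimes> y"] c.I_l_closed[OF ab(3), of "r \<otimes> x"]
          c.I_l_closed[OF xy(3), of "r \<otimes> s"] ab cc xy by (intro c.a_closed) auto
      finally show "u \<otimes> v \<in> {z \<in> carrier R. e1 \<otimes> e2 \<otimes> z \<in> c}" using cc by simp
    qed
    then show ?thesis using ec by blast
  qed
qed

end

subsection \<open>Adic completions\<close>

locale adic = cring R + I: ideal I R for R :: "('a, 'm) ring_scheme" (structure) and I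
begin

abbreviation Pw :: "nat \<Rightarrow> 'a set" where "Pw n \<equiv> ideal_power R I n"
abbreviation Rh :: "(nat \<Rightarrow> 'a set) ring" where "Rh \<equiv> adic_completion R I"

text \<open>Sequences of representatives for the elements of the inverse limit. Consecutive entries
  are compared modulo the smaller power, where both classes make sense.\<close>

definition coherent :: "(nat \<Rightarrow> 'a) \<Rightarrow> bool" where
  "coherent x \<longleftrightarrow> (\<forall>n. x n \<in> carrier R \<and> x (Suc n) \<ominus> x n \<in> Pw n)"

definition limit :: "(nat \<Rightarrow> 'a) \<Rightarrow> nat \<Rightarrow> 'a set" where
  "limit x n = Pw n +> x n"

lemma Pw_ideal: "ideal (Pw n) R" by (rule ideal_power_ideal[OF I.is_ideal])

lemma coherentD: "coherent x \<Longrightarrow> x n \<in> carrier R" "coherent x \<Longrightarrow> x (Suc n) \<ominus> x n \<in> Pw n"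
  by (auto simp: coherent_def)

lemma coherent_diff:
  assumes "coherent x" "n \<le> m"
  shows "x m \<ominus> x n \<in> Pw n"
  using assms(2)
proof (induction m rule: dec_induct)
  case base
  then show ?case using coherentD(1)[OF assms(1)] additive_subgroup.zero_closed[OF ideal.axioms(1)[OF Pw_ideal]]
    by (simp add: a_minus_def r_neg)
next
  case (step m)
  interpret P: ideal "Pw n" R by (rule Pw_ideal)
  have c: "x n \<in> carrier R" "x m \<in> carrier R" "x (Suc m) \<in> carrier R" using coherentD(1)[OF assms(1)] by auto
  have "x (Suc m) \<ominus> x n = (x (Suc m) \<ominus> x m) \<oplus> (x m \<ominus> x n)" using c by algebra
  moreover have "x (Suc m) \<ominus> x m \<in> Pw n"
    using coherentD(2)[OF assms(1)] ideal_power_antimono[OF I.is_ideal step(1)] by blast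
  ultimately show ?case using step by simp
qed

lemma limit_eq_iff:
  assumes "coherent x" "coherent y"
  shows "limit x = limit y \<longleftrightarrow> (\<forall>n. x n \<ominus> y n \<in> Pw n)"
  using coset_eq_iff[OF Pw_ideal] coherentD(1)[OF assms(1)] coherentD(1)[OF assms(2)]
  by (auto simp: limit_def fun_eq_iff)

text \<open>This turns the containment of cosets by which the completion is encoded into the
  congruence of \<open>coherent\<close>.\<close>

lemma coset_Suc_subset:
  assumes "x \<in> carrier R" "y \<in> carrier R"
  shows "Pw (Suc n) +> y \<subseteq> Pw n +> x \<longleftrightarrow> y \<ominus> x \<in> Pw n"
proof -
  interpret P: ideal "Pw n" R by (rule Pw_ideal)
  interpret P': ideal "Pw (Suc n)" R by (rule Pw_ideal)
  show ?thesis
  proof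
    assume "Pw (Suc n) +> y \<subseteq> Pw n +> x"
    then have "y \<in> Pw n +> x" using P'.a_rcos_self[OF assms(2)] by blast
    then show "y \<ominus> x \<in> Pw n" using P.a_rcos_module_minus[OF ring_axioms assms] by simp
  next
    assume d: "y \<ominus> x \<in> Pw n"
    show "Pw (Suc n) +> y \<subseteq> Pw n +> x"
    proof
      fix z assume z: "z \<in> Pw (Suc n) +> y"
      then have zc: "z \<in> carrier R" using P'.a_elemrcos_carrier assms by blast
      have "z \<ominus> y \<in> Pw n"
        using P'.a_rcos_module_minus[OF ring_axioms assms(2) zc] z ideal_power_Suc_subset[OF I.is_ideal] by blast
      then have "(z \<ominus> y) \<oplus> (y \<ominus> x) \<in> Pw n" using d by simp
      moreover have "(z \<ominus> y) \<oplus> (y \<ominus> x) = z \<ominus> x" using zc assms by algebra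
      ultimately show "z \<in> Pw n +> x" using P.a_rcos_module_minus[OF ring_axioms assms(1) zc] by simp
    qed
  qed
qed

lemma limit_closed: "coherent x \<Longrightarrow> limit x \<in> carrier Rh"
  using coset_Suc_subset coherentD[of x]
  by (auto simp: adic_completion_def limit_def FactRing_def a_rcosets_image)

lemma limitE:
  assumes "f \<in> carrier Rh"
  obtains x where "coherent x" "f = limit x"
proof -
  have "\<forall>n. \<exists>y\<in>carrier R. f n = Pw n +> y"
  proof
    fix n
    have "f n \<in> (+>) (Pw n) ` carrier R"
      using assms by (auto simp: adic_completion_def FactRing_def a_rcosets_image)
    then show "\<exists>y\<in>carrier R. f n = Pw n +> y" by blast
  qed
  then obtain x where x: "\<And>n. x n \<in> carrier R" "\<And>n. f n = Pw n +> x n" by metis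
  moreover have "f (Suc n) \<subseteq> f n" for n using assms by (auto simp: adic_completion_def)
  ultimately have "coherent x" using coset_Suc_subset by (auto simp: coherent_def)
  moreover have "f = limit x" using x by (auto simp: limit_def)
  ultimately show ?thesis by (rule that)
qed

lemma coherent_add:
  assumes "coherent x" "coherent y" shows "coherent (\<lambda>n. x n \<oplus> y n)"
  unfolding coherent_def
proof (intro allI conjI)
  fix n
  interpret P: ideal "Pw n" R by (rule Pw_ideal)
  note c = coherentD[OF assms(1)] coherentD[OF assms(2)]
  have "(x (Suc n) \<oplus> y (Suc n)) \<ominus> (x n \<oplus> y n) = (x (Suc n) \<ominus> x n) \<oplus> (y (Suc n) \<ominus> y n)"
    using c(1)[of n] c(1)[of "Suc n"] c(3)[of n] c(3)[of "Suc n"] by algebra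
  then show "(x (Suc n) \<oplus> y (Suc n)) \<ominus> (x n \<oplus> y n) \<in> Pw n" using c by simp
qed (use coherentD[OF assms(1)] coherentD[OF assms(2)] in auto)

lemma coherent_mult:
  assumes "coherent x" "coherent y" shows "coherent (\<lambda>n. x n \<otimes> y n)"
  unfolding coherent_def
proof (intro allI conjI)
  fix n
  interpret P: ideal "Pw n" R by (rule Pw_ideal)
  note c = coherentD[OF assms(1)] coherentD[OF assms(2)]
  have "(x (Suc n) \<otimes> y (Suc n)) \<ominus> (x n \<otimes> y n) = (x (Suc n) \<ominus> x n) \<otimes> y (Suc n) \<oplus> x n \<otimes> (y (Suc n) \<ominus> y n)"
    using c(1)[of n] c(1)[of "Suc n"] c(3)[of n] c(3)[of "Suc n"] by algebra
  then show "(x (Suc n) \<otimes> y (Suc n)) \<ominus> (x n \<otimes> y n) \<in> Pw n"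
    using c by (simp add: P.I_l_closed P.I_r_closed)
qed (use coherentD[OF assms(1)] coherentD[OF assms(2)] in auto)

lemma coherent_const: "a \<in> carrier R \<Longrightarrow> coherent (\<lambda>_. a)"
  using additive_subgroup.zero_closed[OF ideal.axioms(1)[OF Pw_ideal]]
  by (simp add: coherent_def a_minus_def r_neg)

lemma limit_add: "coherent x \<Longrightarrow> coherent y \<Longrightarrow> limit x \<oplus>\<^bsub>Rh\<^esub> limit y = limit (\<lambda>n. x n \<oplus> y n)"
  using ideal.a_rcos_sum[OF Pw_ideal] coherentD(1)
  by (auto simp: adic_completion_def limit_def FactRing_def)

lemma limit_mult: "coherent x \<Longrightarrow> coherent y \<Longrightarrow> limit x \<otimes>\<^bsub>Rh\<^esub> limit y = limit (\<lambda>n. x n \<otimes> y n)"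
  using ideal.rcoset_mult_add[OF Pw_ideal] coherentD(1)
  by (auto simp: adic_completion_def limit_def FactRing_def)

lemma limit_one: "\<one>\<^bsub>Rh\<^esub> = limit (\<lambda>_. \<one>)"
  by (auto simp: adic_completion_def limit_def FactRing_def)

lemma limit_zero: "\<zero>\<^bsub>Rh\<^esub> = limit (\<lambda>_. \<zero>)"
proof -
  have "Pw n +> \<zero> = Pw n" for n
    using a_coset_add_zero[OF additive_subgroup.a_subset[OF ideal.axioms(1)[OF Pw_ideal]]] .
  then show ?thesis by (auto simp: adic_completion_def limit_def FactRing_def)
qed

lemma coherent_neg: "coherent x \<Longrightarrow> coherent (\<lambda>n. \<ominus> x n)"
  using coherent_mult[OF coherent_const[of "\<ominus> \<one>"], of x] coherentD(1)[of x] by (simp add: l_minus)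

lemma cring_adic: "cring Rh"
proof (rule cringI)
  show "abelian_group Rh"
  proof (rule abelian_groupI)
    show "\<zero>\<^bsub>Rh\<^esub> \<in> carrier Rh" unfolding limit_zero by (rule limit_closed[OF coherent_const]) simp
  next
    fix x y assume "x \<in> carrier Rh" "y \<in> carrier Rh"
    then obtain u v where "coherent u" "x = limit u" "coherent v" "y = limit v" by (metis limitE)
    then show "x \<oplus>\<^bsub>Rh\<^esub> y \<in> carrier Rh" "x \<oplus>\<^bsub>Rh\<^esub> y = y \<oplus>\<^bsub>Rh\<^esub> x"
      using coherentD(1) by (auto simp: limit_add intro!: limit_closed coherent_add a_comm arg_cong[of _ _ limit])
  next
    fix x y z assume "x \<in> carrier Rh" "y \<in> carrier Rh" "z \<in> carrier Rh"
    then obtain u v w where "coherent u" "x = limit u" "coherent v" "y = limit v" "coherent w" "z = limit w"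
      by (metis limitE)
    then show "x \<oplus>\<^bsub>Rh\<^esub> y \<oplus>\<^bsub>Rh\<^esub> z = x \<oplus>\<^bsub>Rh\<^esub> (y \<oplus>\<^bsub>Rh\<^esub> z)"
      using coherentD(1) by (auto simp: limit_add coherent_add a_assoc intro!: arg_cong[of _ _ limit])
  next
    fix x assume "x \<in> carrier Rh"
    then obtain u where u: "coherent u" "x = limit u" by (metis limitE)
    then show "\<zero>\<^bsub>Rh\<^esub> \<oplus>\<^bsub>Rh\<^esub> x = x"
      using coherentD(1)[OF u(1)] by (simp add: limit_zero limit_add coherent_const)
    show "\<exists>y\<in>carrier Rh. y \<oplus>\<^bsub>Rh\<^esub> x = \<zero>\<^bsub>Rh\<^esub>"
      using u coherentD(1)[OF u(1)] coherent_neg[OF u(1)]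
      by (intro bexI[of _ "limit (\<lambda>n. \<ominus> u n)"]) (auto simp: limit_zero limit_add l_neg intro: limit_closed)
  qed
  show "Group.comm_monoid Rh"
  proof (rule comm_monoidI)
    show "\<one>\<^bsub>Rh\<^esub> \<in> carrier Rh" unfolding limit_one by (rule limit_closed[OF coherent_const]) simp
  next
    fix x y assume "x \<in> carrier Rh" "y \<in> carrier Rh"
    then obtain u v where "coherent u" "x = limit u" "coherent v" "y = limit v" by (metis limitE)
    then show "x \<otimes>\<^bsub>Rh\<^esub> y \<in> carrier Rh" "x \<otimes>\<^bsub>Rh\<^esub> y = y \<otimes>\<^bsub>Rh\<^esub> x"
      using coherentD(1) by (auto simp: limit_mult intro!: limit_closed coherent_mult m_comm arg_cong[of _ _ limit])
  next
    fix x y z assume "x \<in> carrier Rh" "y \<in> carrier Rh" "z \<in> carrier Rh"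
    then obtain u v w where "coherent u" "x = limit u" "coherent v" "y = limit v" "coherent w" "z = limit w"
      by (metis limitE)
    then show "x \<otimes>\<^bsub>Rh\<^esub> y \<otimes>\<^bsub>Rh\<^esub> z = x \<otimes>\<^bsub>Rh\<^esub> (y \<otimes>\<^bsub>Rh\<^esub> z)"
      using coherentD(1) by (auto simp: limit_mult coherent_mult m_assoc intro!: arg_cong[of _ _ limit])
  next
    fix x assume "x \<in> carrier Rh"
    then obtain u where u: "coherent u" "x = limit u" by (metis limitE)
    then show "\<one>\<^bsub>Rh\<^esub> \<otimes>\<^bsub>Rh\<^esub> x = x"
      using coherentD(1)[OF u(1)] by (simp add: limit_one limit_mult coherent_const)
  qed
  fix x y z assume "x \<in> carrier Rh" "y \<in> carrier Rh" "z \<in> carrier Rh"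
  then obtain u v w where "coherent u" "x = limit u" "coherent v" "y = limit v" "coherent w" "z = limit w"
    by (metis limitE)
  then show "(x \<oplus>\<^bsub>Rh\<^esub> y) \<otimes>\<^bsub>Rh\<^esub> z = x \<otimes>\<^bsub>Rh\<^esub> z \<oplus>\<^bsub>Rh\<^esub> y \<otimes>\<^bsub>Rh\<^esub> z"
    using coherentD(1) by (auto simp: limit_mult limit_add coherent_add coherent_mult l_distr intro!: arg_cong[of _ _ limit])
qed

sublocale Rh: cring Rh by (rule cring_adic)

definition emb :: "'a \<Rightarrow> nat \<Rightarrow> 'a set" where
  "emb a = limit (\<lambda>_. a)"

lemma emb_hom: "emb \<in> ring_hom R Rh"
  unfolding emb_def
  by (rule ring_hom_memI) (auto simp: limit_closed coherent_const limit_mult limit_add limit_one)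

lemma imul_limit:
  assumes "coherent x"
  shows "imul Rh k (limit x) = limit (\<lambda>n. imul R k (x n))"
proof -
  have "imul Rh k (limit x) = imul Rh k \<one>\<^bsub>Rh\<^esub> \<otimes>\<^bsub>Rh\<^esub> limit x"
    using limit_closed[OF assms] by (simp add: Rh.imul_one)
  also have "imul Rh k \<one>\<^bsub>Rh\<^esub> = emb (imul R k \<one>)"
    using ring_hom_imul[OF ring_axioms Rh.ring_axioms emb_hom, of \<one> k] ring_hom_one[OF emb_hom] by simp
  also have "emb (imul R k \<one>) \<otimes>\<^bsub>Rh\<^esub> limit x = limit (\<lambda>n. imul R k \<one> \<otimes> x n)"
    using assms by (simp add: emb_def limit_mult coherent_const)
  finally show ?thesis using coherentD(1)[OF assms] by (simp add: imul_one)
qed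

lemma coherent_imul:
  assumes "coherent x"
  shows "coherent (\<lambda>n. imul R k (x n))"
  using coherent_mult[OF coherent_const[of "imul R k \<one>"] assms] coherentD(1)[OF assms] by (simp add: imul_one)

lemma limit_minus_emb:
  assumes "coherent x" "a \<in> carrier R"
  shows "limit x \<ominus>\<^bsub>Rh\<^esub> emb a = limit (\<lambda>n. x n \<ominus> a)" "coherent (\<lambda>n. x n \<ominus> a)"
proof -
  interpret emb: ring_hom_ring R Rh emb
    by (rule ring_hom_ringI2[OF ring_axioms Rh.ring_axioms emb_hom])
  have "emb (\<ominus> a) = \<ominus>\<^bsub>Rh\<^esub> emb a" using assms by simp
  then show "limit x \<ominus>\<^bsub>Rh\<^esub> emb a = limit (\<lambda>n. x n \<ominus> a)" "coherent (\<lambda>n. x n \<ominus> a)"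
    using assms coherent_add[OF assms(1) coherent_const[of "\<ominus> a"]]
      limit_add[OF assms(1) coherent_const[of "\<ominus> a"]]
    by (simp_all add: a_minus_def emb_def)
qed

text \<open>Bezout gives an inverse of \<open>k\<close> modulo each p^n. Inverses are unique modulo
  p^n, so these integers form a coherent sequence, and its limit is the inverse.\<close>

lemma unit_of_coprime:
  assumes p: "imul R p \<one> \<in> I" and k: "coprime k p"
  shows "\<exists>r\<in>carrier Rh. imul Rh k r = \<one>\<^bsub>Rh\<^esub>"
proof -
  have pn: "imul R (p ^ n) \<one> \<in> Pw n" for n
  proof (induction n)
    case (Suc n)
    have "imul R p \<one> \<otimes> imul R (p ^ n) \<one> \<in> Pw (Suc n)"
      using p Suc by (auto simp: ideal_power_Suc intro: ideal_prod.prod)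
    then show ?case by (simp add: imul_one imul_mult)
  qed (simp add: ideal_power_0)
  have "\<exists>u v. u * k + v * p ^ n = 1" for n
    using k by (intro coprime_bezout) auto
  then obtain u v where uv: "\<And>n. u n * k + v n * p ^ n = 1" by metis
  have pmult: "imul R (p ^ n * z) \<one> \<in> Pw n" for n z
    using ideal.multiples_subset[OF Pw_ideal pn[of n]] multiplesI[of "imul R z \<one>" R "p ^ n"]
    by (auto simp: imul_mult)
  have "coherent (\<lambda>n. imul R (u n) \<one>)"
    unfolding coherent_def
  proof (intro allI conjI)
    fix n
    have "p ^ n dvd k * (u (Suc n) - u n)"
    proof -
      have "k * (u (Suc n) - u n) = p ^ n * (v n - p * v (Suc n))"
        using uv[of n] uv[of "Suc n"] by (simp add: algebra_simps)
      then show ?thesis by simp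
    qed
    then have "p ^ n dvd u (Suc n) - u n"
      using k by (metis coprime_commute coprime_dvd_mult_right_iff coprime_power_right_iff coprime_dvd_mult_left_iff
          coprime_power_left_iff)
    then obtain z where "u (Suc n) - u n = p ^ n * z" by blast
    then show "imul R (u (Suc n)) \<one> \<ominus> imul R (u n) \<one> \<in> Pw n"
      using pmult[of n z] imul_diff[of \<one> "u (Suc n)" "u n"] by simp
  qed auto
  note coh = this
  have "imul R k (imul R (u n) \<one>) \<ominus> \<one> \<in> Pw n" for n
  proof -
    have "imul R k (imul R (u n) \<one>) \<ominus> \<one> = imul R (u n * k - 1) \<one>"
      by (simp add: imul_diff mult.commute[of "u n"] imul_mult)
    also have "u n * k - 1 = p ^ n * (- v n)" using uv[of n] by (simp add: algebra_simps)
    finally show ?thesis using pmult[of n "- v n"] by simp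
  qed
  then have "imul Rh k (limit (\<lambda>n. imul R (u n) \<one>)) = \<one>\<^bsub>Rh\<^esub>"
    unfolding imul_limit[OF coh] limit_one
    by (subst limit_eq_iff[OF coherent_imul[OF coh] coherent_const]) auto
  then show ?thesis using limit_closed[OF coh] by blast
qed

end


section \<open>Completion at a prime ideal above p\<close>

locale completion_at_prime = adic R P + P: primeideal P R for R :: "('a, 'm) ring_scheme" (structure) and P +
  fixes g :: "nat \<Rightarrow> 'a" and n :: nat and p :: nat
  assumes gen: "generated_by R g n" and p: "Factorial_Ring.prime p" and pP: "imul R (int p) \<one> \<in> P"
begin

lemma finite_index: "finite (a_rcosets P)"
  using finite_index_of_int[OF gen I.is_ideal _ pP] p prime_gt_0_nat by simp

lemma annihilator:
  "\<exists>N. \<exists>e\<in>carrier R - P. \<forall>x\<in>Pw N. e \<otimes> x \<in> multiples R (int p ^ a)"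
  by (rule prime_power_annihilator[OF gen P.primeideal, of "int p ^ a"])
    (use p prime_gt_0_nat multiples_ideal multiplesI in auto)

text \<open>The p-adic and the \<open>P\<close>-adic topology agree at \<open>P\<close>: the bound
  \<open>N\<close> does not depend on \<open>M\<close>. With \<open>e\<close> from
  \<open>annihilator\<close>, some y = 1 - e^(k+1) lies in \<open>P\<close>. Split x = y^M x + (1 -
  y^M) x; the first term is in the power \<open>M\<close>, and 1 - y^M is a multiple of 1 - y, hence
  of \<open>e\<close>, which multiplies \<open>x\<close> into the multiples of p^a.\<close>

lemma powers_stable:
  obtains N where "\<And>M x. x \<in> Pw N \<Longrightarrow> \<exists>q\<in>Pw M. \<exists>r\<in>carrier R. x = q \<oplus> imul R (int p ^ a) r"
proof -
  obtain N e where e: "e \<in> carrier R" "e \<notin> P" "\<And>x. x \<in> Pw N \<Longrightarrow> e \<otimes> x \<in> multiples R (int p ^ a)"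
    using annihilator by blast
  obtain k :: nat where k: "\<one> \<ominus> e [^] Suc k \<in> P"
    using finite_prime_unit[OF P.primeideal finite_index e(1,2)] by blast
  define y where "y = \<one> \<ominus> e [^] Suc k"
  have yc: "y \<in> carrier R" using e by (simp add: y_def)
  have "\<exists>q\<in>Pw M. \<exists>r\<in>carrier R. x = q \<oplus> imul R (int p ^ a) r" if x: "x \<in> Pw N" for M x
  proof -
    have xc: "x \<in> carrier R" using ideal_power_closed[OF I.is_ideal x] .
    have yM: "y [^] M \<in> Pw M" using pow_in_ideal_power[OF I.is_ideal] k by (simp add: y_def)
    obtain s where s: "s \<in> carrier R" "\<one> \<ominus> y [^] M = (\<one> \<ominus> y) \<otimes> s"
      using one_minus_pow_dvd[OF yc] by blast
    obtain w where w: "w \<in> carrier R" "e \<otimes> x = imul R (int p ^ a) w"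
      using e(3)[OF x] by (auto simp: multiples_def)
    have ek: "e [^] k \<in> carrier R" using e by simp
    have "\<one> \<ominus> y = e [^] k \<otimes> e" unfolding y_def nat_pow_Suc using ek e(1) by algebra
    then have *: "\<one> \<ominus> y [^] M = (e [^] k \<otimes> s) \<otimes> e" using s ek e(1) m_assoc m_comm by (simp add: m_ac)
    have "x = y [^] M \<otimes> x \<oplus> (\<one> \<ominus> y [^] M) \<otimes> x"
    proof -
      have "x = u \<otimes> x \<oplus> (\<one> \<ominus> u) \<otimes> x" if "u \<in> carrier R" for u using that xc by algebra
      then show ?thesis using yc by blast
    qed
    also have "(\<one> \<ominus> y [^] M) \<otimes> x = (e [^] k \<otimes> s) \<otimes> (e \<otimes> x)"
      unfolding * using ek s(1) e(1) xc by (simp add: m_assoc)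
    also have "\<dots> = imul R (int p ^ a) ((e [^] k \<otimes> s) \<otimes> w)"
      unfolding w(2) using ek s(1) w(1) by (simp add: imul_rdistr)
    finally show ?thesis
      using ideal.I_r_closed[OF Pw_ideal yM xc] ek s(1) w(1) by blast
  qed
  then show ?thesis by (rule that)
qed

text \<open>The quotient of the limit by p^a is built by successive approximation. Each correction
  is needed only up to arbitrarily high powers of \<open>P\<close>, and \<open>powers_stable\<close>
  supplies it with a fixed loss \<open>N\<close>.\<close>

lemma small_multiple: "\<exists>N. \<forall>x. coherent x \<longrightarrow> x N \<in> Pw N \<longrightarrow> limit x \<in> multiples Rh (int p ^ a)"
proof -
  obtain N where N: "\<And>M x. x \<in> Pw N \<Longrightarrow> \<exists>q\<in>Pw M. \<exists>r\<in>carrier R. x = q \<oplus> imul R (int p ^ a) r"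
    using powers_stable[of a] by blast
  define m where "m = int p ^ a"
  \<comment> \<open>In a product of elements of the powers \<open>N\<close> and \<open>c\<close>,
    the first is split by \<open>powers_stable\<close> and the second is kept. The cofactor of p^a
    then lies in the power \<open>c\<close>, which makes the corrections converge.\<close>
  have step: "\<exists>q\<in>Pw M. \<exists>w\<in>Pw c. x = q \<oplus> imul R m w" if x: "x \<in> Pw (N + c)" for M c x
  proof -
    interpret PM: ideal "Pw M" R by (rule Pw_ideal)
    interpret Pc: ideal "Pw c" R by (rule Pw_ideal)
    let ?W = "{q \<oplus> imul R m w | q w. q \<in> Pw M \<and> w \<in> Pw c}"
    have "Pw (N + c) \<subseteq> ?W"
    proof (rule ideal_power_add_minimal[OF I.is_ideal])
      show "ideal ?W R"
      proof (rule cideal_criterion)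
        show "\<zero> \<in> ?W" using PM.zero_closed Pc.zero_closed by (intro CollectI exI[of _ \<zero>]) auto
        fix u v assume "u \<in> ?W" "v \<in> ?W"
        then obtain q w q' w' where e: "q \<in> Pw M" "w \<in> Pw c" "u = q \<oplus> imul R m w"
          "q' \<in> Pw M" "w' \<in> Pw c" "v = q' \<oplus> imul R m w'" by blast
        then have "u \<oplus> v = (q \<oplus> q') \<oplus> imul R m (w \<oplus> w')"
          using PM.Icarr Pc.Icarr by (simp add: imul_distrib a_ac)
        then show "u \<oplus> v \<in> ?W" using e PM.a_closed Pc.a_closed by blast
      next
        fix u r assume "u \<in> ?W" and r: "r \<in> carrier R"
        then obtain q w where e: "q \<in> Pw M" "w \<in> Pw c" "u = q \<oplus> imul R m w" by blast
        then have "r \<otimes> u = r \<otimes> q \<oplus> imul R m (r \<otimes> w)"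
          using PM.Icarr Pc.Icarr r by (simp add: r_distr imul_rdistr)
        then show "r \<otimes> u \<in> ?W" using e r PM.I_l_closed Pc.I_l_closed by blast
      qed (use PM.Icarr Pc.Icarr in auto)
      fix u v assume u: "u \<in> Pw N" and v: "v \<in> Pw c"
      obtain q r where qr: "q \<in> Pw M" "r \<in> carrier R" "u = q \<oplus> imul R m r" using N[OF u, of M] unfolding m_def by blast
      have "u \<otimes> v = q \<otimes> v \<oplus> imul R m (r \<otimes> v)"
        unfolding qr(3) using qr PM.Icarr Pc.Icarr[OF v] by (simp add: l_distr imul_ldistr)
      then show "u \<otimes> v \<in> ?W" using PM.I_r_closed[OF qr(1) Pc.Icarr[OF v]] Pc.I_l_closed[OF v qr(2)] by blast
    qed
    then show ?thesis using x by blast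
  qed
  have "limit x \<in> multiples Rh m" if x: "coherent x" "x N \<in> Pw N" for x
  proof -
    \<comment> \<open>The entry f j divides x (N + j) by p^a up to the power N + j. The start 0 is
      right because x N lies in the power \<open>N\<close>.\<close>
    let ?Q = "\<lambda>j z. z \<in> carrier R \<and> x (N + j) \<ominus> imul R m z \<in> Pw (N + j)"
    have "\<exists>f. \<forall>j. ?Q j (f j) \<and> f (Suc j) \<ominus> f j \<in> Pw j"
    proof (rule dependent_nat_choice)
      have "x (N + 0) \<ominus> imul R m \<zero> = x N" using coherentD(1)[OF x(1)] by (simp add: a_minus_def)
      then show "\<exists>z. ?Q 0 z" using x(2) by (intro exI[of _ \<zero>]) auto
    next
      fix z j assume z: "?Q j z"
      interpret PM: ideal "Pw (N + j)" R by (rule Pw_ideal)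
      have c: "x (N + j) \<in> carrier R" "x (N + Suc j) \<in> carrier R" "imul R m z \<in> carrier R"
        using coherentD(1)[OF x(1)] z by auto
      have "x (N + Suc j) \<ominus> imul R m z = (x (N + Suc j) \<ominus> x (N + j)) \<oplus> (x (N + j) \<ominus> imul R m z)"
        using c by algebra
      moreover have "x (N + Suc j) \<ominus> x (N + j) \<in> Pw (N + j)" using coherentD(2)[OF x(1), of "N + j"] by simp
      ultimately have "x (N + Suc j) \<ominus> imul R m z \<in> Pw (N + j)" using z by simp
      then obtain q w where qw: "q \<in> Pw (N + Suc j)" "w \<in> Pw j" "x (N + Suc j) \<ominus> imul R m z = q \<oplus> imul R m w"
        using step by blast
      have qc: "q \<in> carrier R" "w \<in> carrier R" using qw ideal_power_closed[OF I.is_ideal] by auto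
      have mw: "imul R m w \<in> carrier R" using qc by simp
      have "x (N + Suc j) \<ominus> imul R m (z \<oplus> w) = (x (N + Suc j) \<ominus> imul R m z) \<ominus> imul R m w"
        using c z qc by (simp add: imul_distrib a_minus_def minus_add a_assoc)
      also have "\<dots> = q" unfolding qw(3) using qc mw by algebra
      finally have "?Q (Suc j) (z \<oplus> w)" using qw(1) z qc by simp
      moreover have "(z \<oplus> w) \<ominus> z = w" using z qc(2) by algebra
      ultimately show "\<exists>y. ?Q (Suc j) y \<and> y \<ominus> z \<in> Pw j" using qw(2) by auto
    qed
    then obtain f where f: "\<And>j. ?Q j (f j)" "\<And>j. f (Suc j) \<ominus> f j \<in> Pw j" by blast
    then have cf: "coherent f" by (auto simp: coherent_def)
    have "imul R m (f j) \<ominus> x j \<in> Pw j" for j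
    proof -
      interpret Pj: ideal "Pw j" R by (rule Pw_ideal)
      have c: "x (N + j) \<in> carrier R" "x j \<in> carrier R" "imul R m (f j) \<in> carrier R"
        using coherentD(1)[OF x(1)] f by auto
      have "x (N + j) \<ominus> x j \<in> Pw j" by (rule coherent_diff[OF x(1)]) simp
      moreover have "x (N + j) \<ominus> imul R m (f j) \<in> Pw j"
        using f(1)[of j] ideal_power_antimono[OF I.is_ideal, of j "N + j"] by auto
      moreover have "imul R m (f j) \<ominus> x j = (x (N + j) \<ominus> x j) \<ominus> (x (N + j) \<ominus> imul R m (f j))"
        using c by algebra
      ultimately show ?thesis using Pj.minus_closed_ideal by simp
    qed
    then have "imul Rh m (limit f) = limit x"
      unfolding imul_limit[OF cf] using limit_eq_iff[OF coherent_imul[OF cf] x(1)] by blast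
    then show ?thesis using limit_closed[OF cf] by (metis multiplesI)
  qed
  then show ?thesis unfolding m_def by blast
qed

text \<open>A sufficiently late representative of \<open>f\<close> serves as \<open>b\<close>: the
  difference is a coherent sequence that vanishes at \<open>N\<close>.\<close>

lemma approx:
  assumes "f \<in> carrier Rh"
  shows "\<exists>b\<in>carrier R. f \<ominus>\<^bsub>Rh\<^esub> emb b \<in> multiples Rh (int p ^ a)"
proof -
  obtain N where N: "\<And>x. coherent x \<Longrightarrow> x N \<in> Pw N \<Longrightarrow> limit x \<in> multiples Rh (int p ^ a)"
    using small_multiple[of a] by blast
  obtain x where x: "coherent x" "f = limit x" using limitE[OF assms] .
  have xN: "x N \<in> carrier R" using coherentD(1)[OF x(1)] .
  have "x N \<ominus> x N = \<zero>" using xN by (simp add: a_minus_def r_neg)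
  then have "x N \<ominus> x N \<in> Pw N" using additive_subgroup.zero_closed[OF ideal.axioms(1)[OF Pw_ideal]] by simp
  then have "limit (\<lambda>n. x n \<ominus> x N) \<in> multiples Rh (int p ^ a)"
    using N[OF limit_minus_emb(2)[OF x(1) xN]] by simp
  then show ?thesis using limit_minus_emb(1)[OF x(1) xN] x(2) xN by (intro bexI[of _ "x N"]) simp_all
qed

lemma emb_small:
  obtains N where "\<And>u. u \<in> Pw N \<Longrightarrow> emb u \<in> multiples Rh (int p ^ a)"
proof -
  obtain N where N: "\<And>x. coherent x \<Longrightarrow> x N \<in> Pw N \<Longrightarrow> limit x \<in> multiples Rh (int p ^ a)"
    using small_multiple[of a] by blast
  show ?thesis
    using that[of N] N[OF coherent_const] ideal_power_closed[OF I.is_ideal] by (auto simp: emb_def)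
qed

text \<open>Choose a representative modulo the power \<open>N\<close> and multiply by
  \<open>e\<close>. The choice is not additive, but its ambiguity lies in the power
  \<open>N\<close>, which \<open>e\<close> multiplies into the multiples of p^a.\<close>

lemma section_ex:
  "\<exists>e \<tau>. e \<in> carrier R - P \<and> \<tau> \<in> carrier Rh \<rightarrow> carrier R \<and> (\<forall>f\<in>carrier Rh. \<exists>b\<in>carrier R. \<tau> f = e \<otimes> b) \<and>
    (\<forall>f\<in>carrier Rh. \<forall>f'\<in>carrier Rh. \<tau> (f \<oplus>\<^bsub>Rh\<^esub> f') \<ominus> (\<tau> f \<oplus> \<tau> f') \<in> multiples R (int p ^ a)) \<and>
    (\<forall>b\<in>carrier R. \<tau> (emb b) \<ominus> e \<otimes> b \<in> multiples R (int p ^ a))"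
proof -
  obtain N e where e: "e \<in> carrier R" "e \<notin> P" "\<And>x. x \<in> Pw N \<Longrightarrow> e \<otimes> x \<in> multiples R (int p ^ a)"
    using annihilator by blast
  define b where "b = (\<lambda>f::nat \<Rightarrow> 'a set. SOME b. b \<in> carrier R \<and> f N = Pw N +> b)"
  have b: "b f \<in> carrier R" "f N = Pw N +> b f" if f: "f \<in> carrier Rh" for f
  proof -
    obtain x where "coherent x" "f = limit x" using limitE[OF f] .
    then have "\<exists>b. b \<in> carrier R \<and> f N = Pw N +> b" using coherentD(1) by (auto simp: limit_def)
    from someI_ex[OF this] show "b f \<in> carrier R" "f N = Pw N +> b f" by (auto simp: b_def)
  qed
  have diff: "e \<otimes> u \<ominus> e \<otimes> v \<in> multiples R (int p ^ a)"
    if "u \<in> carrier R" "v \<in> carrier R" "Pw N +> u = Pw N +> v" for u v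
  proof -
    have "e \<otimes> u \<ominus> e \<otimes> v = e \<otimes> (u \<ominus> v)" using that e(1) by algebra
    moreover have "u \<ominus> v \<in> Pw N" using that coset_eq_iff[OF Pw_ideal] by blast
    ultimately show ?thesis using e(3) by simp
  qed
  have add: "Pw N +> b (f \<oplus>\<^bsub>Rh\<^esub> f') = Pw N +> (b f \<oplus> b f')" if "f \<in> carrier Rh" "f' \<in> carrier Rh" for f f'
  proof -
    have "(f \<oplus>\<^bsub>Rh\<^esub> f') N = f N <+> f' N" by (simp add: adic_completion_def FactRing_def)
    then show ?thesis using b that ideal.a_rcos_sum[OF Pw_ideal] Rh.a_closed by metis
  qed
  have emb: "Pw N +> b (emb c) = Pw N +> c" if "c \<in> carrier R" for c
    using b(2)[OF ring_hom_closed[OF emb_hom that]] by (simp add: emb_def limit_def)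
  show ?thesis
  proof (intro exI[of _ e] exI[of _ "\<lambda>f. e \<otimes> b f"] conjI ballI)
    fix f f' assume f: "f \<in> carrier Rh" "f' \<in> carrier Rh"
    have "e \<otimes> b f \<oplus> e \<otimes> b f' = e \<otimes> (b f \<oplus> b f')" using e b f by (simp add: r_distr)
    then show "e \<otimes> b (f \<oplus>\<^bsub>Rh\<^esub> f') \<ominus> (e \<otimes> b f \<oplus> e \<otimes> b f') \<in> multiples R (int p ^ a)"
      using diff[OF _ _ add[OF f]] b f by simp
  next
    fix c assume "c \<in> carrier R"
    then show "e \<otimes> b (emb c) \<ominus> e \<otimes> c \<in> multiples R (int p ^ a)"
      using diff[OF _ _ emb] b(1) ring_hom_closed[OF emb_hom] by blast
  qed (use e b in auto)
qed

end

text \<open>Take x in \<open>P\<close> congruent to 1 modulo \<open>P'\<close>, and u = 1 - (1 -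
  x^N)^N'. Then \<open>u\<close> is divisible by x^N, and 1 - x^N is divisible by 1 - x, an element
  of \<open>P'\<close>.\<close>

lemma (in cring) comaximal_powers:
  assumes P: "primeideal P R" "finite (a_rcosets P)" and P': "primeideal P' R" "finite (a_rcosets P')" and ne: "P \<noteq> P'"
  shows "\<exists>u. u \<in> ideal_power R P N \<and> \<one> \<ominus> u \<in> ideal_power R P' N'"
proof -
  interpret P: primeideal P R by fact
  interpret P': primeideal P' R by fact
  obtain y where y: "y \<in> P" "y \<notin> P'" using finite_prime_maximal[OF P P'(1)] ne by blast
  then have yc: "y \<in> carrier R" using P.Icarr by blast
  obtain k :: nat where k: "\<one> \<ominus> y [^] Suc k \<in> P'" using finite_prime_unit[OF P' yc y(2)] by blast
  define x where "x = y [^] Suc k"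
  have x: "x \<in> P" "\<one> \<ominus> x \<in> P'" "x \<in> carrier R"
    using k y yc P.I_l_closed[of y "y [^] k"] by (simp_all add: x_def)
  define z where "z = \<one> \<ominus> x [^] N"
  have xN: "x [^] N \<in> ideal_power R P N" using pow_in_ideal_power[OF P.is_ideal x(1)] .
  have xNc: "x [^] N \<in> carrier R" using x by simp
  have zc: "z \<in> carrier R" using xNc by (simp add: z_def)
  obtain s where "s \<in> carrier R" "z = (\<one> \<ominus> x) \<otimes> s" using one_minus_pow_dvd[OF x(3)] by (auto simp: z_def)
  then have "z \<in> P'" using x(2) P'.I_r_closed by blast
  then have zN: "z [^] N' \<in> ideal_power R P' N'" using pow_in_ideal_power[OF P'.is_ideal] by blast
  have zNc: "z [^] N' \<in> carrier R" using zc by simp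
  obtain t where t: "t \<in> carrier R" "\<one> \<ominus> z [^] N' = (\<one> \<ominus> z) \<otimes> t" using one_minus_pow_dvd[OF zc] by blast
  have "\<one> \<ominus> z = x [^] N" unfolding z_def using xNc by algebra
  then have "\<one> \<ominus> z [^] N' \<in> ideal_power R P N"
    using t ideal.I_r_closed[OF ideal_power_ideal[OF P.is_ideal] xN t(1)] by simp
  moreover have "\<one> \<ominus> (\<one> \<ominus> z [^] N') = z [^] N'" using zNc by algebra
  ultimately show ?thesis using zN by (intro exI[of _ "\<one> \<ominus> z [^] N'"]) simp
qed

subsection \<open>Bases of finitely generated torsion-free groups\<close>

definition int_independent :: "('a, 'm) ring_scheme \<Rightarrow> (nat \<Rightarrow> 'a) \<Rightarrow> nat \<Rightarrow> bool" where
  "int_independent R g n \<longleftrightarrow> (\<forall>c. lincomb R g n c = \<zero>\<^bsub>R\<^esub> \<longrightarrow> (\<forall>i<n. c i = 0))"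

context abelian_group
begin

lemma lincomb_gen_cong: "(\<And>i. i < n \<Longrightarrow> g i = h i) \<Longrightarrow> lincomb G g n c = lincomb G h n c"
  by (induction n) auto

lemma lincomb_upd_coeff:
  assumes "\<And>i. i < n \<Longrightarrow> g i \<in> carrier G" "i < n"
    and c': "c' i = c i + k" "\<And>j. j \<noteq> i \<Longrightarrow> c' j = c j"
  shows "lincomb G g n c' = lincomb G g n c \<oplus> imul G k (g i)"
proof -
  have "lincomb G g n c' = lincomb G g n (\<lambda>j. c j + k * (if j = i then 1 else 0))"
    by (rule lincomb_cong) (simp add: c')
  then show ?thesis using assms by (simp add: lincomb_add lincomb_imul lincomb_unit)
qed

lemma lincomb_upd_gen:
  assumes "\<And>i. i < n \<Longrightarrow> g i \<in> carrier G" "j < n" "y \<in> carrier G"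
    and g': "g' j = g j \<oplus> y" "\<And>i. i \<noteq> j \<Longrightarrow> g' i = g i"
  shows "lincomb G g' n c = lincomb G g n c \<oplus> imul G (c j) y"
  using assms(1-3)
proof (induction n)
  case (Suc n)
  have gc: "\<And>i. i < n \<Longrightarrow> g i \<in> carrier G" "g n \<in> carrier G" using Suc.prems by auto
  show ?case
  proof (cases "j = n")
    case True
    have "lincomb G g' n c = lincomb G g n c"
      using True by (intro lincomb_gen_cong) (simp add: g')
    then show ?thesis using True gc Suc.prems(3) g'(1) by (simp add: imul_distrib a_assoc)
  next
    case False
    then have "lincomb G g' n c = lincomb G g n c \<oplus> imul G (c j) y" using Suc by simp
    then show ?thesis using False gc Suc.prems(3) by (simp add: a_ac g')
  qed
qed auto

text \<open>An elementary operation on the generators is undone by the dual operation on the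
  coefficients.\<close>

lemma lincomb_elementary:
  assumes g: "\<And>i. i < n \<Longrightarrow> g i \<in> carrier G" and ij: "i < n" "j < n" "i \<noteq> j"
    and g': "g' j = g j \<oplus> imul G s (g i)" "\<And>k. k \<noteq> j \<Longrightarrow> g' k = g k"
    and c': "c' i = c i + - (s * c j)" "\<And>k. k \<noteq> i \<Longrightarrow> c' k = c k"
  shows "lincomb G g' n c' = lincomb G g n c"
proof -
  have "lincomb G g' n c' = lincomb G g n c' \<oplus> imul G (c' j) (imul G s (g i))"
    by (rule lincomb_upd_gen) (use g ij g' in auto)
  also have "lincomb G g n c' = lincomb G g n c \<oplus> imul G (- (s * c j)) (g i)"
    by (rule lincomb_upd_coeff) (use g ij c' in auto)
  also have "imul G (c' j) (imul G s (g i)) = imul G (s * c j) (g i)"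
    using g ij c' by (simp add: mult.commute[of s] flip: imul_mult)
  finally show ?thesis using g ij by (simp add: a_assoc imul_neg l_neg)
qed

lemma lincomb_skip:
  assumes "\<And>i. i < Suc n \<Longrightarrow> g i \<in> carrier G" "i < Suc n" "g i = \<zero>"
  shows "lincomb G g (Suc n) c = lincomb G (\<lambda>k. g (if k < i then k else Suc k)) n (\<lambda>k. c (if k < i then k else Suc k))"
  using assms
proof (induction n)
  case (Suc n)
  let ?s = "\<lambda>k. if k < i then k else Suc k"
  have gc: "\<And>k. k < Suc n \<Longrightarrow> g k \<in> carrier G" "g (Suc n) \<in> carrier G" using Suc.prems by auto
  show ?case
  proof (cases "i = Suc n")
    case True
    have "lincomb G (\<lambda>k. g (?s k)) (Suc n) (\<lambda>k. c (?s k)) = lincomb G g (Suc n) c"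
    proof -
      have "lincomb G (\<lambda>k. g (?s k)) (Suc n) (\<lambda>k. c (?s k)) = lincomb G (\<lambda>k. g (?s k)) (Suc n) c"
        by (rule lincomb_cong) (simp add: True)
      also have "\<dots> = lincomb G g (Suc n) c" by (rule lincomb_gen_cong) (simp add: True)
      finally show ?thesis .
    qed
    then show ?thesis using True Suc.prems gc by simp
  next
    case False
    then have "lincomb G g (Suc n) c = lincomb G (\<lambda>k. g (?s k)) n (\<lambda>k. c (?s k))"
      using Suc by simp
    then show ?thesis using False Suc.prems(2) by simp
  qed
qed auto

text \<open>A generating system of minimal length is independent. In a relation with two nonzero
  coefficients the Euclidean step lowers the sum of absolute values; a relation with one nonzero
  coefficient makes a generator zero, as there is no torsion, and that generator could be
  dropped.\<close>

lemma basis_exists: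
  assumes tf: "\<And>k x. x \<in> carrier G \<Longrightarrow> imul G k x = \<zero> \<Longrightarrow> k = 0 \<or> x = \<zero>"
    and gen: "\<exists>g n. generated_by G g n"
  shows "\<exists>g n. generated_by G g n \<and> int_independent G g n"
proof -
  define n where "n = (LEAST n. \<exists>g. generated_by G g n)"
  have ex: "\<exists>g. generated_by G g n" unfolding n_def by (rule LeastI_ex) (use gen in blast)
  have min: "n \<le> m" if "generated_by G g m" for g m
    unfolding n_def using that by (intro Least_le) blast
  have "\<forall>i<n. c i = 0" if "generated_by G g n" "lincomb G g n c = \<zero>" for g c
    using that
  proof (induction "\<Sum>i<n. nat \<bar>c i\<bar>" arbitrary: g c rule: less_induct)
    case less
    have gc: "\<And>i. i < n \<Longrightarrow> g i \<in> carrier G" using less.prems(1) by (simp add: generated_by_def)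
    show ?case
    proof (rule ccontr)
      assume "\<not> (\<forall>i<n. c i = 0)"
      then obtain i0 where i0: "i0 < n" "c i0 \<noteq> 0" by blast
      show False
      proof (cases "\<exists>j<n. j \<noteq> i0 \<and> c j \<noteq> 0")
        case False
        have "lincomb G g n c = lincomb G g n (\<lambda>i. c i0 * (if i = i0 then 1 else 0))"
          using False by (intro lincomb_cong) auto
        then have "imul G (c i0) (g i0) = \<zero>"
          using less.prems(2) gc i0 by (simp add: lincomb_imul lincomb_unit)
        then have z: "g i0 = \<zero>" using tf gc i0 by blast
        obtain m where m: "n = Suc m" using i0 by (cases n) auto
        have "generated_by G (\<lambda>k. g (if k < i0 then k else Suc k)) m"
          unfolding generated_by_def
        proof (intro conjI allI impI ballI)
          show "g (if k < i0 then k else Suc k) \<in> carrier G" if "k < m" for k using that gc m by auto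
          fix x assume "x \<in> carrier G"
          then obtain d where "x = lincomb G g n d" using less.prems(1) by (auto simp: generated_by_def)
          then show "\<exists>d. x = lincomb G (\<lambda>k. g (if k < i0 then k else Suc k)) m d"
            using lincomb_skip[of m g i0 d] gc i0 m z by auto
        qed
        then show False using min m by fastforce
      next
        case True
        then obtain j0 where j0: "j0 < n" "j0 \<noteq> i0" "c j0 \<noteq> 0" by blast
        have red: False if ij: "i < n" "j < n" "i \<noteq> j" "c j \<noteq> 0" "\<bar>c i\<bar> \<ge> \<bar>c j\<bar>" for i j
        proof -
          \<comment> \<open>With this sign, \<open>s * c j\<close> has the sign of
            \<open>c i\<close> and the size of \<open>c j\<close>, so the subtraction lowers the
            absolute value of \<open>c i\<close>.\<close>
          define s where "s = sgn (c i) * sgn (c j)"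
          define g' where "g' k = (if k = j then g j \<oplus> imul G s (g i) else g k)" for k
          define u where "u d k = (if k = i then d i + - (s * d j) else d k)" for d k
          have eq: "lincomb G g' n (u d) = lincomb G g n d" for d
            by (rule lincomb_elementary[where i = i and j = j and s = s]) (use gc ij in \<open>auto simp: g'_def u_def\<close>)
          have "\<bar>c i - s * c j\<bar> < \<bar>c i\<bar>"
            using ij(4,5) by (auto simp: s_def sgn_if split: if_splits)
          then have "(\<Sum>k<n. nat \<bar>u c k\<bar>) < (\<Sum>k<n. nat \<bar>c k\<bar>)"
            using ij(1) by (intro sum_strict_mono_ex1) (auto simp: u_def)
          moreover have "generated_by G g' n"
            unfolding generated_by_def
          proof (intro conjI allI impI ballI)
            show "g' k \<in> carrier G" if "k < n" for k using that gc ij by (auto simp: g'_def)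
            fix x assume "x \<in> carrier G"
            then obtain d where "x = lincomb G g n d" using less.prems(1) unfolding generated_by_def by blast
            then show "\<exists>d. x = lincomb G g' n d" using eq[of d] by metis
          qed
          moreover have "lincomb G g' n (u c) = \<zero>" using eq less.prems(2) by simp
          ultimately have "\<forall>k<n. u c k = 0" by (rule less.hyps)
          then show False using ij by (auto simp: u_def)
        qed
        show False
          using red[of i0 j0] red[of j0 i0] i0 j0 by linarith
      qed
    qed
  qed
  then show ?thesis using ex unfolding int_independent_def by blast
qed

lemma independent_eq:
  assumes "generated_by G g n" "int_independent G g n" "lincomb G g n c = lincomb G g n d" "i < n"
  shows "c i = d i"
proof -
  have gc: "\<And>i. i < n \<Longrightarrow> g i \<in> carrier G" using assms(1) by (simp add: generated_by_def)
  have "lincomb G g n (\<lambda>i. c i - d i) = \<zero>"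
    using lincomb_diff[of n g c d] gc assms(3) by (simp add: a_minus_def r_neg)
  then show ?thesis using assms(2,4) unfolding int_independent_def by fastforce
qed

text \<open>Each coordinate in a basis is divisible by all powers of 2, in particular by 2^k with k
  its own absolute value.\<close>

lemma infinitely_divisible_zero:
  assumes g: "generated_by G g n" "int_independent G g n"
    and x: "x \<in> carrier G" "\<And>k. \<exists>y\<in>carrier G. x = imul G (2 ^ k) y"
  shows "x = \<zero>"
proof -
  have gc: "\<And>i. i < n \<Longrightarrow> g i \<in> carrier G" using g by (simp add: generated_by_def)
  obtain c where c: "x = lincomb G g n c" using g x by (auto simp: generated_by_def)
  have "c i = 0" if i: "i < n" for i
  proof (rule ccontr)
    assume nz: "c i \<noteq> 0"
    define k where "k = nat \<bar>c i\<bar>"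
    obtain y where y: "y \<in> carrier G" "x = imul G (2 ^ k) y" using x by blast
    obtain d where "y = lincomb G g n d" using g y by (auto simp: generated_by_def)
    then have "lincomb G g n c = lincomb G g n (\<lambda>i. 2 ^ k * d i)" using y c gc by (simp add: lincomb_imul)
    then have "c i = 2 ^ k * d i" using independent_eq[OF g] i by blast
    then have "(2::int) ^ k dvd c i" by simp
    then have "2 ^ k \<le> \<bar>c i\<bar>" using nz zdvd_imp_le[of "2 ^ k" "\<bar>c i\<bar>"] by simp
    moreover have "int k < 2 ^ k" using of_nat_less_two_power[of k] by simp
    ultimately show False by (simp add: k_def)
  qed
  then show ?thesis using c lincomb_0 by simp
qed

text \<open>The functional is read off from a subgroup containing \<open>L\<close> that is maximal for avoiding a
  given generator.\<close>

lemma separating_functional: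
  assumes g: "generated_by G g n" "int_independent G g n" and L: "additive_subgroup L G"
    and p: "Factorial_Ring.prime (p::nat)" and y: "y \<in> carrier G" "\<And>l z. l \<in> L \<Longrightarrow> z \<in> carrier G \<Longrightarrow> y \<noteq> l \<oplus> imul G (int p) z"
  shows "\<exists>\<psi>. (\<forall>u\<in>carrier G. \<forall>v\<in>carrier G. \<psi> (u \<oplus> v) = \<psi> u + (\<psi> v :: int)) \<and> (\<forall>l\<in>L. int p dvd \<psi> l) \<and>
    (\<exists>x\<in>carrier G. \<not> int p dvd \<psi> x)"
proof -
  interpret L: additive_subgroup L G by fact
  have pp: "Factorial_Ring.prime (int p)" using p by simp
  have gc: "\<And>i. i < n \<Longrightarrow> g i \<in> carrier G" using g by (simp add: generated_by_def)
  define Lp where "Lp = {l \<oplus> imul G (int p) z | l z. l \<in> L \<and> z \<in> carrier G}"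
  have Lp_sub: "Lp \<subseteq> carrier G" using L.a_Hcarr by (auto simp: Lp_def)
  define S where "S = {M. additive_subgroup M G \<and> Lp \<subseteq> M \<and> y \<notin> M}"
  have as: "additive_subgroup M G" if "M \<subseteq> carrier G" "\<zero> \<in> M" "\<And>u v. u \<in> M \<Longrightarrow> v \<in> M \<Longrightarrow> u \<ominus> v \<in> M" for M
  proof (intro additive_subgroup.intro subgroup.intro)
    have neg: "\<ominus> u \<in> M" if "u \<in> M" for u using that \<open>\<And>u v. u \<in> M \<Longrightarrow> v \<in> M \<Longrightarrow> u \<ominus> v \<in> M\<close>[OF \<open>\<zero> \<in> M\<close> that] \<open>M \<subseteq> carrier G\<close>
      by (auto simp: a_minus_def)
    then show "inv\<^bsub>add_monoid G\<^esub> u \<in> M" if "u \<in> M" for u using that by (simp add: a_inv_def)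
    show "u \<otimes>\<^bsub>add_monoid G\<^esub> v \<in> M" if "u \<in> M" "v \<in> M" for u v
      using \<open>\<And>u v. u \<in> M \<Longrightarrow> v \<in> M \<Longrightarrow> u \<ominus> v \<in> M\<close>[OF that(1) neg[OF that(2)]] that \<open>M \<subseteq> carrier G\<close>
      by (auto simp: a_minus_def subset_iff)
  qed (use that in auto)
  have "Lp \<in> S"
  proof -
    have "u \<ominus> v \<in> Lp" if "u \<in> Lp" "v \<in> Lp" for u v
    proof -
      obtain l z l' z' where e: "l \<in> L" "z \<in> carrier G" "l' \<in> L" "z' \<in> carrier G"
        "u = l \<oplus> imul G (int p) z" "v = l' \<oplus> imul G (int p) z'" using \<open>u \<in> Lp\<close> \<open>v \<in> Lp\<close> unfolding Lp_def by blast
      have "u \<ominus> v = (l \<ominus> l') \<oplus> imul G (int p) (z \<ominus> z')"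
        using e L.a_Hcarr by (simp add: a_minus_def minus_add imul_distrib imul_minus a_ac)
      moreover have "l \<ominus> l' \<in> L" using e by (simp add: a_minus_def)
      ultimately show ?thesis using e unfolding Lp_def by blast
    qed
    moreover have "\<zero> \<in> Lp" unfolding Lp_def using L.zero_closed by (intro CollectI exI[of _ \<zero>]) auto
    ultimately have "additive_subgroup Lp G" using as Lp_sub by blast
    moreover have "y \<notin> Lp" using y(2) by (auto simp: Lp_def)
    ultimately show ?thesis by (simp add: S_def)
  qed
  have "\<exists>M\<in>S. \<forall>W\<in>S. M \<subseteq> W \<longrightarrow> W = M"
  proof (rule subset_Zorn_nonempty)
    fix C assume C: "C \<noteq> {}" "subset.chain S C"
    then have CS: "C \<subseteq> S" by (simp add: subset.chain_def)
    have "u \<ominus> v \<in> \<Union> C" if uv: "u \<in> \<Union> C" "v \<in> \<Union> C" for u v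
    proof -
      obtain M N where MN: "M \<in> C" "u \<in> M" "N \<in> C" "v \<in> N" using uv by blast
      then have "M \<subseteq> N \<or> N \<subseteq> M" using C(2) by (meson subset_chain_def)
      then obtain W where W: "W \<in> C" "u \<in> W" "v \<in> W" using MN by blast
      then have "additive_subgroup W G" using CS by (auto simp: S_def)
      then have "u \<ominus> v \<in> W" using W by (simp add: a_minus_def additive_subgroup.a_closed additive_subgroup.a_inv_closed abelian_group_axioms)
      then show ?thesis using W by blast
    qed
    moreover have "\<Union> C \<subseteq> carrier G" "\<zero> \<in> \<Union> C" "Lp \<subseteq> \<Union> C" "y \<notin> \<Union> C"
      using CS C(1) additive_subgroup.a_subset additive_subgroup.zero_closed by (fastforce simp: S_def)+
    ultimately show "\<Union> C \<in> S" using as[of "\<Union> C"] unfolding S_def by blast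
  qed (use \<open>Lp \<in> S\<close> in auto)
  then obtain M where M: "additive_subgroup M G" "Lp \<subseteq> M" "y \<notin> M" and
    max: "\<And>W. additive_subgroup W G \<Longrightarrow> M \<subseteq> W \<Longrightarrow> y \<notin> W \<Longrightarrow> W = M"
    unfolding S_def by auto
  interpret M: additive_subgroup M G by fact
  have pM: "imul G (int p * k) z \<in> M" if "z \<in> carrier G" for z k
  proof -
    have "\<zero> \<oplus> imul G (int p) (imul G k z) \<in> Lp" unfolding Lp_def using that L.zero_closed by blast
    then show ?thesis using M(2) that by (auto simp: imul_mult)
  qed
  have mulM: "imul G k z \<in> M" if "z \<in> M" for k z
    using add.subgroup_int_pow_closed[OF M.a_subgroup that, of k] by (simp add: add_pow_def)
  \<comment> \<open>Modulo \<open>M\<close> the group is generated by \<open>y\<close>. For z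
    outside \<open>M\<close>, maximality puts \<open>y\<close> into M + Zz; the coefficient of
    \<open>z\<close> is prime to \<open>p\<close>, because pz lies in \<open>M\<close>, and can be
    inverted.\<close>
  have class_ex: "\<exists>c::int. z \<ominus> imul G c y \<in> M" if z: "z \<in> carrier G" for z
  proof (cases "z \<in> M")
    case True
    then show ?thesis using z by (intro exI[of _ 0]) (simp add: a_minus_def)
  next
    case False
    define W where "W = {u \<oplus> imul G k z | u k. u \<in> M}"
    have "additive_subgroup W G"
    proof (rule as)
      show "W \<subseteq> carrier G" using z M.a_Hcarr by (auto simp: W_def)
      show "\<zero> \<in> W" unfolding W_def using z M.zero_closed by (intro CollectI exI[of _ \<zero>] exI[of _ 0]) auto
      fix a b assume "a \<in> W" "b \<in> W"
      then obtain u k v l where e: "u \<in> M" "v \<in> M" "a = u \<oplus> imul G k z" "b = v \<oplus> imul G l z" unfolding W_def by blast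
      have "a \<ominus> b = (u \<ominus> v) \<oplus> imul G (k - l) z"
        using e z M.a_Hcarr by (simp add: a_minus_def minus_add imul_diff a_ac)
      moreover have "u \<ominus> v \<in> M" using e by (simp add: a_minus_def)
      ultimately show "a \<ominus> b \<in> W" unfolding W_def by blast
    qed
    moreover have "M \<subseteq> W"
    proof
      fix u assume u: "u \<in> M"
      then have "u = u \<oplus> imul G 0 z" using M.a_Hcarr by simp
      then show "u \<in> W" using u unfolding W_def by blast
    qed
    moreover have "z \<in> W"
    proof -
      have "z = \<zero> \<oplus> imul G 1 z" using z by simp
      then show ?thesis using M.zero_closed unfolding W_def by blast
    qed
    ultimately have "y \<in> W" using max[of W] False by blast
    then obtain u k where uk: "u \<in> M" "y = u \<oplus> imul G k z" unfolding W_def by blast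
    have "\<not> int p dvd k"
    proof
      assume "int p dvd k"
      then have "imul G k z \<in> M" using pM[OF z] by (auto elim: dvdE)
      then show False using uk M(3) M.a_closed by simp
    qed
    then have "coprime k (int p)"
      using prime_imp_coprime[OF pp] by (simp add: coprime_commute)
    then obtain c d where cd: "c * k + d * int p = 1" using coprime_bezout by blast
    have uc: "u \<in> carrier G" using uk M.a_Hcarr by blast
    have "z = imul G (c * k + int p * d) z" using cd z by (simp add: mult.commute[of "int p"])
    also have "\<dots> = imul G (c * k) z \<oplus> imul G (int p * d) z" using z by (simp only: imul_add)
    finally have zz: "z = imul G c (imul G k z) \<oplus> imul G (int p * d) z" using z by (simp only: imul_mult[of _ c k])
    have "imul G c y = imul G c u \<oplus> imul G c (imul G k z)" using uk(2) uc z by (simp add: imul_distrib)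
    then have "z \<ominus> imul G c y = imul G (int p * d) z \<ominus> imul G c u"
      using zz uc z by (smt (verit) a_assoc a_comm a_minus_def imul_closed minus_add r_neg1 a_inv_closed r_neg2 minus_minus)
    then have "z \<ominus> imul G c y \<in> M" using pM[OF z, of d] mulM[OF uk(1), of c] by (simp add: a_minus_def)
    then show ?thesis by blast
  qed
  have yM: "imul G k y \<in> M \<longleftrightarrow> int p dvd k" for k
  proof
    assume "int p dvd k"
    then show "imul G k y \<in> M" using pM[OF y(1)] by (auto elim: dvdE)
  next
    assume k: "imul G k y \<in> M"
    show "int p dvd k"
    proof (rule ccontr)
      assume "\<not> int p dvd k"
      then have "coprime k (int p)" using prime_imp_coprime[OF pp] by (simp add: coprime_commute)
      then obtain c d where cd: "c * k + d * int p = 1" using coprime_bezout by blast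
      have "y = imul G (c * k + int p * d) y" using cd y(1) by (simp add: mult.commute[of "int p"])
      also have "\<dots> = imul G c (imul G k y) \<oplus> imul G (int p * d) y"
        using y(1) by (simp only: imul_add imul_mult[of _ c k])
      also have "\<dots> \<in> M" using mulM[OF k, of c] pM[OF y(1), of d] by simp
      finally show False using M(3) by simp
    qed
  qed
  \<comment> \<open>The class of each basis element as a multiple of \<open>y\<close>. Extending
    these integers linearly lifts the map to the quotient of order \<open>p\<close> from residues to
    integers, so that membership in \<open>M\<close> is divisibility of \<open>\<psi>\<close> by
    \<open>p\<close>.\<close>
  define cl where "cl i = (SOME c. g i \<ominus> imul G c y \<in> M)" for i
  have cl: "g i \<ominus> imul G (cl i) y \<in> M" if "i < n" for i
    unfolding cl_def using class_ex[OF gc[OF that]] by (rule someI_ex)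
  define \<psi> where "\<psi> x = (\<Sum>i<n. (SOME c. x = lincomb G g n c) i * cl i)" for x
  have \<psi>: "\<psi> (lincomb G g n c) = (\<Sum>i<n. c i * cl i)" for c
  proof -
    let ?d = "SOME d. lincomb G g n c = lincomb G g n d"
    have "lincomb G g n c = lincomb G g n ?d"
      using someI[of "\<lambda>d. lincomb G g n c = lincomb G g n d" c] by simp
    then have "?d i = c i" if "i < n" for i using independent_eq[OF g _ that] by metis
    then show ?thesis by (simp add: \<psi>_def)
  qed
  have congr: "lincomb G g n c \<ominus> imul G (\<Sum>i<n. c i * cl i) y \<in> M" for c
  proof -
    have "lincomb G g m c \<ominus> imul G (\<Sum>i<m. c i * cl i) y \<in> M" if "m \<le> n" for m
      using that
    proof (induction m)
      case (Suc m)
      have 1: "lincomb G g m c \<in> carrier G" using Suc.prems gc by (intro lincomb_closed) auto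
      have 2: "g m \<in> carrier G" "g m \<ominus> imul G (cl m) y \<in> M" using gc cl Suc.prems by auto
      have "lincomb G g (Suc m) c \<ominus> imul G (\<Sum>i<Suc m. c i * cl i) y =
        (lincomb G g m c \<ominus> imul G (\<Sum>i<m. c i * cl i) y) \<oplus> imul G (c m) (g m \<ominus> imul G (cl m) y)"
        using 1 2(1) y(1) by (simp add: a_minus_def minus_add imul_add imul_distrib imul_minus imul_mult a_ac)
      then show ?case using Suc mulM[OF 2(2)] by simp
    qed (simp add: a_minus_def)
    then show ?thesis by blast
  qed
  show ?thesis
  proof (intro exI[of _ \<psi>] conjI ballI)
    fix u v assume "u \<in> carrier G" "v \<in> carrier G"
    then obtain c d where "u = lincomb G g n c" "v = lincomb G g n d" using g(1) unfolding generated_by_def by blast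
    then show "\<psi> (u \<oplus> v) = \<psi> u + \<psi> v"
      using \<psi>[of "\<lambda>i. c i + d i"] gc by (simp add: \<psi> lincomb_add distrib_right sum.distrib)
  next
    have key: "x \<in> M \<longleftrightarrow> int p dvd \<psi> x" if x: "x \<in> carrier G" for x
    proof -
      obtain c where c: "x = lincomb G g n c" using g(1) x unfolding generated_by_def by blast
      have m: "x \<ominus> imul G (\<psi> x) y \<in> M" using congr[of c] c \<psi> by simp
      have eq: "x = (x \<ominus> imul G (\<psi> x) y) \<oplus> imul G (\<psi> x) y"
        "imul G (\<psi> x) y = x \<oplus> \<ominus> (x \<ominus> imul G (\<psi> x) y)"
        using x y(1) by (simp_all add: a_minus_def minus_add a_assoc l_neg r_neg r_neg1 r_neg2)
      have "x \<in> M \<longleftrightarrow> imul G (\<psi> x) y \<in> M"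
        using m M.a_closed M.a_inv_closed eq by metis
      then show ?thesis using yM by simp
    qed
    have "l \<in> M" if "l \<in> L" for l
    proof -
      have "l = l \<oplus> imul G (int p) \<zero>" using that L.a_Hcarr by simp
      then show ?thesis using M(2) that unfolding Lp_def by blast
    qed
    then show "int p dvd \<psi> l" if "l \<in> L" for l using key that L.a_Hcarr by blast
    show "\<exists>x\<in>carrier G. \<not> int p dvd \<psi> x" using key[OF y(1)] M(3) y(1) by blast
  qed
qed

lemma lincomb_finsum:
  assumes "\<And>i. i < n \<Longrightarrow> g i \<in> carrier G"
  shows "finsum G (\<lambda>i. imul G (c i) (g i)) {..<n} = lincomb G g n c"
  using assms by (induction n) (simp_all add: lessThan_Suc a_comm)

lemma lincomb_subgroup: "(\<And>i. i < n \<Longrightarrow> g i \<in> carrier G) \<Longrightarrow> additive_subgroup (range (lincomb G g n)) G"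
proof (intro additive_subgroup.intro subgroup.intro)
  assume gc: "\<And>i. i < n \<Longrightarrow> g i \<in> carrier G"
  show "range (lincomb G g n) \<subseteq> carrier (add_monoid G)" using gc by auto
  show "\<one>\<^bsub>add_monoid G\<^esub> \<in> range (lincomb G g n)"
    using lincomb_0[of n "\<lambda>_. 0" g] by (auto intro: range_eqI[of _ _ "\<lambda>_. 0"])
  show "x \<otimes>\<^bsub>add_monoid G\<^esub> y \<in> range (lincomb G g n)" if "x \<in> range (lincomb G g n)" "y \<in> range (lincomb G g n)" for x y
    using that gc by (auto simp flip: lincomb_add)
  show "inv\<^bsub>add_monoid G\<^esub> x \<in> range (lincomb G g n)" if x: "x \<in> range (lincomb G g n)" for x
  proof -
    obtain c where "x = lincomb G g n c" using x by blast
    then have "\<ominus> x = lincomb G g n (\<lambda>i. -1 * c i)" using gc lincomb_imul[of n g "-1" c] by (simp add: imul_neg)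
    then show ?thesis by (simp add: a_inv_def)
  qed
qed

end

text \<open>The subgroups generated by the first powers of \<open>x\<close> form a stationary chain.\<close>

lemma (in cring) integral_relation:
  assumes gen: "generated_by R g n" and x: "x \<in> carrier R"
  shows "\<exists>d c. x [^] (d::nat) = lincomb R (\<lambda>i. x [^] i) d c"
proof -
  let ?H = "\<lambda>d. range (lincomb R (\<lambda>i. x [^] (i::nat)) d)"
  have xp: "x [^] (i::nat) \<in> carrier R" for i using x by simp
  have mono: "?H d \<subseteq> ?H d'" if "d \<le> d'" for d d'
    using that
  proof (induction d' rule: dec_induct)
    case (step m)
    have "lincomb R (\<lambda>i. x [^] i) m c = lincomb R (\<lambda>i. x [^] i) (Suc m) (\<lambda>i. if i < m then c i else 0)" for c
      using xp lincomb_cong[of m c "\<lambda>i. if i < m then c i else 0"] by simp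
    then have "?H m \<subseteq> ?H (Suc m)" by blast
    then show ?case using step by blast
  qed auto
  define H where "H = (\<Union>d. ?H d)"
  have sg: "additive_subgroup (?H d) R" for d using lincomb_subgroup xp by blast
  have "additive_subgroup H R"
  proof (intro additive_subgroup.intro subgroup.intro)
    show "H \<subseteq> carrier (add_monoid R)" using additive_subgroup.a_subset[OF sg] by (auto simp: H_def)
    show "\<one>\<^bsub>add_monoid R\<^esub> \<in> H" using additive_subgroup.zero_closed[OF sg] by (auto simp: H_def)
    show "inv\<^bsub>add_monoid R\<^esub> a \<in> H" if "a \<in> H" for a
      using additive_subgroup.a_inv_closed[OF sg] that unfolding H_def a_inv_def by blast
    fix a b assume "a \<in> H" "b \<in> H"
    then obtain d d' where dd: "a \<in> ?H d" "b \<in> ?H d'" by (auto simp: H_def)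
    then have "a \<in> ?H (max d d')" "b \<in> ?H (max d d')" using mono[of d "max d d'"] mono[of d' "max d d'"] by auto
    then have "a \<oplus> b \<in> ?H (max d d')" using additive_subgroup.a_closed[OF sg] by blast
    then show "a \<otimes>\<^bsub>add_monoid R\<^esub> b \<in> H" by (auto simp: H_def)
  qed
  then obtain v where v: "\<And>j. j < n \<Longrightarrow> lincomb R g n (v j) \<in> H"
    "\<And>h. h \<in> H \<Longrightarrow> \<exists>a. h = lincomb R (\<lambda>j. lincomb R g n (v j)) n a"
    using subgroup_generators[OF gen, of H 0] additive_subgroup.zero_closed[of H R] by auto
  then have "\<forall>j. \<exists>d. j < n \<longrightarrow> lincomb R g n (v j) \<in> ?H d" by (auto simp: H_def)
  then obtain d where d: "\<And>j. j < n \<Longrightarrow> lincomb R g n (v j) \<in> ?H (d j)" by metis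
  \<comment> \<open>The union \<open>H\<close> of the chain is finitely generated, so one stage
    contains all its generators and the chain stops there.\<close>
  define D where "D = Max (insert 0 (d ` {..<n}))"
  have "lincomb R g n (v j) \<in> ?H D" if "j < n" for j
    using d[OF that] mono[of "d j" D] that by (auto simp: D_def)
  then have HD: "h \<in> ?H D" if "h \<in> H" for h
    using v(2)[OF that] lincomb_in_subgroup[OF sg[of D], of n "\<lambda>j. lincomb R g n (v j)"] by auto
  have "x [^] D = lincomb R (\<lambda>i. x [^] i) (Suc D) (\<lambda>i. if i = D then 1 else 0)"
    by (rule lincomb_unit[symmetric]) (use xp in auto)
  then have "x [^] D \<in> ?H (Suc D)" by (metis rangeI)
  then have "x [^] D \<in> H" unfolding H_def by blast
  then show ?thesis using HD by blast
qed

subsection \<open>Orders in rational algebras\<close>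

lemma lin_span_least: "submodule N R V \<Longrightarrow> S \<subseteq> N \<Longrightarrow> lin_span R V S \<subseteq> N"
  by (auto simp: lin_span_def)

lemma lin_span_superset: "S \<subseteq> lin_span R V S"
  by (auto simp: lin_span_def)

lemma lin_span_mono: "S \<subseteq> S' \<Longrightarrow> lin_span R V S \<subseteq> lin_span R V S'"
  by (auto simp: lin_span_def)

text \<open>Subrings are allowed to have their own identity element, as for the components of an algebra.\<close>

abbreviation subring_with_one :: "('a, 'm) ring_scheme \<Rightarrow> 'a set \<Rightarrow> 'a \<Rightarrow> ('a, 'm) ring_scheme" where
  "subring_with_one R W e \<equiv> R\<lparr>carrier := W, one := e\<rparr>"

lemma subring_with_own_one: "R\<lparr>carrier := W\<rparr> = subring_with_one R W \<one>\<^bsub>R\<^esub>"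
  by simp

context cring
begin

lemma abelian_group_sub:
  assumes "additive_subgroup W R"
  shows "abelian_group (subring_with_one R W e)"
proof -
  interpret W: additive_subgroup W R by fact
  show ?thesis
    by (rule abelian_groupI)
      (auto simp: a_ac intro!: bexI[of _ "\<ominus> _"] r_neg)
qed

lemma cring_sub:
  assumes "additive_subgroup W R" and "e \<in> W" "\<And>x. x \<in> W \<Longrightarrow> e \<otimes> x = x"
    "\<And>x y. x \<in> W \<Longrightarrow> y \<in> W \<Longrightarrow> x \<otimes> y \<in> W"
  shows "cring (subring_with_one R W e)"
proof -
  interpret W: additive_subgroup W R by fact
  show ?thesis
  proof (rule cringI)
    show "abelian_group (subring_with_one R W e)" using assms(1) by (rule abelian_group_sub)
    show "Group.comm_monoid (subring_with_one R W e)"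
    proof (rule comm_monoidI)
      fix x y assume "x \<in> carrier (subring_with_one R W e)" "y \<in> carrier (subring_with_one R W e)"
      then show "x \<otimes>\<^bsub>subring_with_one R W e\<^esub> y \<in> carrier (subring_with_one R W e)"
        "x \<otimes>\<^bsub>subring_with_one R W e\<^esub> y = y \<otimes>\<^bsub>subring_with_one R W e\<^esub> x"
        using assms(4)[of x y] m_comm[of x y] W.a_Hcarr by simp_all
    next
      fix x assume "x \<in> carrier (subring_with_one R W e)"
      then show "\<one>\<^bsub>subring_with_one R W e\<^esub> \<otimes>\<^bsub>subring_with_one R W e\<^esub> x = x" using assms(3)[of x] by simp
    qed (use assms(2) W.a_Hcarr in \<open>simp_all add: m_assoc\<close>)
  next
    fix x y z assume "x \<in> carrier (subring_with_one R W e)" "y \<in> carrier (subring_with_one R W e)" "z \<in> carrier (subring_with_one R W e)"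
    then show "(x \<oplus>\<^bsub>subring_with_one R W e\<^esub> y) \<otimes>\<^bsub>subring_with_one R W e\<^esub> z =
      x \<otimes>\<^bsub>subring_with_one R W e\<^esub> z \<oplus>\<^bsub>subring_with_one R W e\<^esub> y \<otimes>\<^bsub>subring_with_one R W e\<^esub> z"
      using W.a_Hcarr by (simp add: l_distr)
  qed
qed

lemma sub_a_inv:
  assumes "additive_subgroup W R" "x \<in> W"
  shows "\<ominus>\<^bsub>subring_with_one R W e\<^esub> x = \<ominus> x"
proof -
  interpret W: additive_subgroup W R by fact
  interpret S: abelian_group "subring_with_one R W e" using assms(1) by (rule abelian_group_sub)
  have "\<ominus> x \<oplus>\<^bsub>subring_with_one R W e\<^esub> x = \<zero>\<^bsub>subring_with_one R W e\<^esub>" using assms by (simp add: l_neg)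
  then show ?thesis using S.minus_equality[of "\<ominus> x" x] assms by simp
qed

lemma sub_minus:
  "additive_subgroup W R \<Longrightarrow> x \<in> W \<Longrightarrow> y \<in> W \<Longrightarrow> x \<ominus>\<^bsub>subring_with_one R W e\<^esub> y = x \<ominus> y"
  by (simp add: a_minus_def sub_a_inv)

lemma sub_imul:
  assumes "additive_subgroup W R" "x \<in> W"
  shows "imul (subring_with_one R W e) k x = imul R k x"
proof -
  interpret W: additive_subgroup W R by fact
  have "group (add_monoid R)" by (rule a_group)
  from group.int_pow_consistent[OF this W.a_subgroup assms(2), of k] show ?thesis
    by (simp add: add_pow_def int_pow_def nat_pow_def m_inv_def)
qed

lemma sub_lincomb:
  assumes "additive_subgroup W R" "\<And>i. i < n \<Longrightarrow> g i \<in> W"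
  shows "lincomb (subring_with_one R W e) g n c = lincomb R g n c"
  using assms(2) by (induction n) (simp_all add: sub_imul[OF assms(1)])

lemma imul_in_additive_subgroup:
  assumes "additive_subgroup H R" "x \<in> H"
  shows "imul R k x \<in> H"
proof -
  interpret H: additive_subgroup H R by fact
  show ?thesis using add.subgroup_int_pow_closed[OF H.a_subgroup assms(2), of k] by (simp add: add_pow_def)
qed

lemma additive_subgroupI':
  assumes "M \<subseteq> carrier R" "\<zero> \<in> M" "\<And>u v. u \<in> M \<Longrightarrow> v \<in> M \<Longrightarrow> u \<oplus> v \<in> M" "\<And>u. u \<in> M \<Longrightarrow> \<ominus> u \<in> M"
  shows "additive_subgroup M R"
  by (intro additive_subgroup.intro subgroup.intro) (use assms in \<open>auto simp: a_inv_def\<close>)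

end

text \<open>The algebra axioms with the arithmetic of type \<open>rat\<close> in place of the
  operations of the record \<open>rat_ring\<close>.\<close>

locale rat_alg = cring A for A :: "(rat, 'a, 'm) module_scheme" (structure) +
  assumes sm_closed: "x \<in> carrier A \<Longrightarrow> q \<odot> x \<in> carrier A"
    and sm_add_l: "x \<in> carrier A \<Longrightarrow> (q + r) \<odot> x = q \<odot> x \<oplus> r \<odot> x"
    and sm_add_r: "x \<in> carrier A \<Longrightarrow> y \<in> carrier A \<Longrightarrow> q \<odot> (x \<oplus> y) = q \<odot> x \<oplus> q \<odot> y"
    and sm_assoc: "x \<in> carrier A \<Longrightarrow> (q * r) \<odot> x = q \<odot> (r \<odot> x)"
    and sm_one: "x \<in> carrier A \<Longrightarrow> 1 \<odot> x = x"
begin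

lemma sm_nat: "x \<in> carrier A \<Longrightarrow> of_nat n \<odot> x = imul A (int n) x"
proof (induction n)
  case 0
  have "0 \<odot> x \<oplus> 0 \<odot> x = 0 \<odot> x" using sm_add_l[OF 0, of 0 0] by simp
  then have "0 \<odot> x = \<zero>" using sm_closed[OF 0, of 0] by (metis add.l_cancel_one)
  then show ?case by simp
next
  case (Suc n)
  have "of_nat (Suc n) \<odot> x = 1 \<odot> x \<oplus> of_nat n \<odot> x" using sm_add_l[OF Suc.prems, of 1 "of_nat n"] by simp
  moreover have "imul A (int (Suc n)) x = imul A 1 x \<oplus> imul A (int n) x"
    using imul_add[OF Suc.prems, of 1 "int n"] by simp
  ultimately show ?case using Suc by (simp add: sm_one)
qed

lemma sm_int: 
  assumes x: "x \<in> carrier A" shows "of_int k \<odot> x = imul A k x"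
proof (cases k rule: int_cases2)
  case (nonneg n)
  then show ?thesis using sm_nat[OF x, of n] by simp
next
  case (nonpos n)
  have "of_int k \<odot> x \<oplus> of_nat n \<odot> x = \<zero>"
    using sm_add_l[OF x, of "of_int k" "of_nat n"] sm_nat[OF x, of 0] nonpos by simp
  then have "of_int k \<odot> x \<oplus> imul A (int n) x = \<zero>" using sm_nat[OF x, of n] by simp
  then have "of_int k \<odot> x = \<ominus> (imul A (int n) x)" using sm_closed[OF x] x by (metis imul_closed minus_equality minus_minus)
  then show ?thesis using nonpos x by (simp add: imul_neg)
qed

lemma torsion_free:
  assumes "x \<in> carrier A" "imul A k x = \<zero>"
  shows "k = 0 \<or> x = \<zero>"
proof (rule disjCI)
  assume k: "x \<noteq> \<zero>"
  show "k = 0"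
  proof (rule ccontr)
    assume nz: "k \<noteq> 0"
    have z: "q \<odot> \<zero> = \<zero>" for q
    proof -
      have "q \<odot> \<zero> \<oplus> q \<odot> \<zero> = q \<odot> \<zero>" using sm_add_r[of \<zero> \<zero> q] by simp
      then show ?thesis using sm_closed[of \<zero> q] by (metis add.l_cancel_one zero_closed)
    qed
    have "x = (inverse (of_int k) * of_int k) \<odot> x" using nz assms by (simp add: sm_one)
    also have "\<dots> = inverse (of_int k) \<odot> (of_int k \<odot> x)" using assms(1) by (rule sm_assoc)
    also have "\<dots> = \<zero>" using assms z by (simp add: sm_int)
    finally show False using k by simp
  qed
qed

lemma int_submodule:
  assumes "additive_subgroup N A"
  shows "submodule N (rat_ring\<lparr>carrier := \<int>\<rparr>) A"
proof -
  interpret N: additive_subgroup N A by fact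
  show ?thesis
    by (intro submodule.intro submodule_axioms.intro N.a_subgroup)
      (auto elim!: Ints_cases simp: sm_int imul_in_additive_subgroup[OF assms])
qed

lemma submodule_int_additive:
  assumes "submodule N (rat_ring\<lparr>carrier := \<int>\<rparr>) A"
  shows "additive_subgroup N A"
  using assms by (simp add: submodule_def additive_subgroup.intro)

lemma int_order_generated:
  assumes "is_int_order A L"
  shows "\<exists>g n. generated_by (A\<lparr>carrier := L\<rparr>) g n"
proof -
  obtain S where S: "finite S" "S \<subseteq> carrier A" "lin_span (rat_ring\<lparr>carrier := \<int>\<rparr>) A S = L" and sub: "subring L A"
    using assms by (auto simp: is_int_order_def is_order_def)
  obtain xs where xs: "set xs = S" using S(1) finite_list by blast
  let ?g = "\<lambda>i. xs ! i" and ?n = "length xs"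
  have as: "additive_subgroup L A" using sub by (simp add: subring_def additive_subgroup.intro)
  have gL: "?g i \<in> L" if "i < ?n" for i using that xs S(3) lin_span_superset by fastforce
  have gA: "?g i \<in> carrier A" if "i < ?n" for i using that xs S(2) by auto
  have "L \<subseteq> range (lincomb A ?g ?n)"
    unfolding S(3)[symmetric]
  proof (rule lin_span_least[OF int_submodule])
    show "additive_subgroup (range (lincomb A ?g ?n)) A" using lincomb_subgroup gA by blast
    show "S \<subseteq> range (lincomb A ?g ?n)"
    proof
      fix x assume "x \<in> S"
      then obtain i where i: "i < ?n" "x = ?g i" using xs by (metis in_set_conv_nth)
      then show "x \<in> range (lincomb A ?g ?n)" using lincomb_unit[of ?n ?g i] gA by (metis rangeI)
    qed
  qed
  then have "generated_by (A\<lparr>carrier := L\<rparr>) ?g ?n"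
    unfolding generated_by_def using gL sub_lincomb[OF as gL, of ?n "\<lambda>i. i" "\<one>"] sub_lincomb[OF as, of ?n ?g "\<one>"]
    by auto
  then show ?thesis by blast
qed

text \<open>The elements with a positive multiple in \<open>L\<close> form a rational subspace: a
  scalar a/b only multiplies the required integer by b.\<close>

lemma int_order_span:
  assumes "is_int_order A L" "x \<in> carrier A"
  shows "\<exists>k>0. imul A k x \<in> L"
proof -
  have as: "additive_subgroup L A" using assms by (simp add: is_int_order_def is_order_def subring_def additive_subgroup.intro)
  interpret L: additive_subgroup L A by fact
  let ?N = "{x \<in> carrier A. \<exists>k>0. imul A k x \<in> L}"
  have "submodule ?N rat_ring A"
  proof (intro submodule.intro submodule_axioms.intro additive_subgroup.a_subgroup additive_subgroupI')
    show "\<zero> \<in> ?N" by (auto intro: exI[of _ 1])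
    show "\<ominus> u \<in> ?N" if "u \<in> ?N" for u using that by (auto simp: imul_minus)
    show "u \<oplus> v \<in> ?N" if uv: "u \<in> ?N" "v \<in> ?N" for u v
    proof -
      obtain k l where kl: "k > 0" "imul A k u \<in> L" "l > 0" "imul A l v \<in> L" "u \<in> carrier A" "v \<in> carrier A" using uv by blast
      have "imul A (l * k) (u \<oplus> v) = imul A l (imul A k u) \<oplus> imul A k (imul A l v)"
        using kl by (simp add: imul_distrib mult.commute[of l] flip: imul_mult)
      also have "\<dots> \<in> L" using kl imul_in_additive_subgroup[OF as] by simp
      finally show ?thesis using kl by (auto intro!: exI[of _ "l * k"])
    qed
    fix q :: rat and u assume "u \<in> ?N"
    then obtain k where k: "k > 0" "imul A k u \<in> L" and u: "u \<in> carrier A" by blast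
    obtain a b where ab: "quotient_of q = (a, b)" by (cases "quotient_of q")
    have b: "b > 0" "q = of_int a / of_int b" using ab quotient_of_denom_pos quotient_of_div by auto
    have "imul A (b * k) (q \<odot> u) = of_int (b * k) \<odot> (q \<odot> u)" using sm_int[OF sm_closed[OF u]] by metis
    also have "\<dots> = (of_int (b * k) * q) \<odot> u" using sm_assoc u by simp
    also have "of_int (b * k) * q = of_int (a * k)" using b by simp
    also have "of_int (a * k) \<odot> u = imul A a (imul A k u)" using u sm_int by (simp add: imul_mult del: of_int_mult)
    also have "\<dots> \<in> L" using k imul_in_additive_subgroup[OF as] by simp
    finally show "q \<odot> u \<in> ?N" using b k u sm_closed by (auto intro!: exI[of _ "b * k"])
  qed auto
  moreover have "L \<subseteq> ?N" using L.a_Hcarr by (auto intro: exI[of _ 1])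
  ultimately have "lin_span rat_ring A L \<subseteq> ?N" by (rule lin_span_least)
  then show ?thesis using assms by (auto simp: is_int_order_def is_order_def)
qed

lemma int_order_overring:
  assumes L: "is_int_order A L" and sub: "subring L' A" "L \<subseteq> L'"
    and h: "\<And>i. i < N \<Longrightarrow> h i \<in> carrier A" "L' = range (lincomb A h N)"
  shows "is_int_order A L'"
proof -
  let ?Z = "rat_ring\<lparr>carrier := \<int>\<rparr>"
  have as: "additive_subgroup L' A" using sub by (simp add: subring_def additive_subgroup.intro)
  have hL: "h i \<in> L'" if "i < N" for i using lincomb_unit[of N h i] h that by (metis rangeI)
  have "lin_span ?Z A (h ` {..<N}) = L'"
  proof
    show "lin_span ?Z A (h ` {..<N}) \<subseteq> L'" using hL by (intro lin_span_least[OF int_submodule[OF as]]) auto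
    show "L' \<subseteq> lin_span ?Z A (h ` {..<N})"
      unfolding lin_span_def h(2) using lincomb_in_subgroup[OF submodule_int_additive] by (fastforce simp: image_subset_iff)
  qed
  moreover have "lin_span rat_ring A L' = carrier A"
  proof
    have "submodule (carrier A) rat_ring A"
      by (intro submodule.intro submodule_axioms.intro additive_subgroup.a_subgroup additive_subgroupI') (auto simp: sm_closed)
    then show "lin_span rat_ring A L' \<subseteq> carrier A" using additive_subgroup.a_subset[OF as] by (rule lin_span_least)
    show "carrier A \<subseteq> lin_span rat_ring A L'"
      using L lin_span_mono[OF sub(2), of rat_ring A] by (auto simp: is_int_order_def is_order_def)
  qed
  ultimately show ?thesis
    unfolding is_int_order_def is_order_def using sub(1) h(1) by (auto intro!: exI[of _ "h ` {..<N}"])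
qed

text \<open>The ring \<Gamma>[x] is generated as a group by the products of the generators of
  \<Gamma> with the powers of \<open>x\<close> below \<open>d\<close>. It is an order that contains
  \<Gamma>, hence equals it.\<close>

lemma integral_in_maximal_order:
  assumes G: "is_maximal_int_order A \<Gamma>" and x: "x \<in> carrier A"
    and rel: "x [^] (d::nat) = lincomb A (\<lambda>i. x [^] i) d c"
  shows "x \<in> \<Gamma>"
proof -
  have ord: "is_int_order A \<Gamma>" using G by (simp add: is_maximal_int_order_def is_maximal_order_def is_int_order_def)
  then have sub: "subring \<Gamma> A" by (simp add: is_int_order_def is_order_def)
  interpret \<Gamma>: subring \<Gamma> A by fact
  have as: "additive_subgroup \<Gamma> A" using sub by (simp add: subring_def additive_subgroup.intro)
  have one\<Gamma>: "\<one> \<in> \<Gamma>" using sub by (simp add: subring_def submonoid.one_closed)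
  have mult\<Gamma>: "a \<otimes> b \<in> \<Gamma>" if "a \<in> \<Gamma>" "b \<in> \<Gamma>" for a b using sub that by (simp add: subring_def submonoid.m_closed)
  have \<Gamma>A: "a \<in> carrier A" if "a \<in> \<Gamma>" for a using additive_subgroup.a_Hcarr[OF as that] .
  obtain g n where gen: "generated_by (A\<lparr>carrier := \<Gamma>\<rparr>) g n" using int_order_generated[OF ord] by blast
  then have g\<Gamma>: "\<And>i. i < n \<Longrightarrow> g i \<in> \<Gamma>" by (simp add: generated_by_def)
  have gen\<Gamma>: "\<exists>c. a = lincomb A g n c" if "a \<in> \<Gamma>" for a
    using gen that sub_lincomb[OF as g\<Gamma>, of n "\<lambda>i. i" \<one>] by (auto simp: generated_by_def)
  have xp: "x [^] (i::nat) \<in> carrier A" for i using x by simp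
  \<comment> \<open>The index k = i * d + j stands for the product of the generator \<open>i\<close>
    with the power \<open>j\<close> of \<open>x\<close>.\<close>
  define h where "h k = g (k div d) \<otimes> x [^] (k mod d)" for k
  have hA: "h k \<in> carrier A" if "k < n * d" for k
    using g\<Gamma>[of "k div d"] that \<Gamma>A xp by (auto simp: h_def less_mult_imp_div_less)
  define V where "V = range (lincomb A h (n * d))"
  have V: "additive_subgroup V A" unfolding V_def using lincomb_subgroup hA by blast
  interpret V: additive_subgroup V A by fact
  have hV: "h k \<in> V" if "k < n * d" for k
    unfolding V_def using lincomb_unit[of "n * d" h k] hA that by (metis rangeI)
  have sg: "additive_subgroup {a \<in> carrier A. a \<otimes> b \<in> V} A" if "b \<in> carrier A" for b
    by (rule additive_subgroupI') (use that in \<open>auto simp: l_distr l_minus\<close>)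
  have small: "a \<otimes> x [^] i \<in> V" if a: "a \<in> \<Gamma>" and i: "i < d" for a i
  proof -
    have "g j \<in> {a \<in> carrier A. a \<otimes> x [^] i \<in> V}" if j: "j < n" for j
    proof -
      have "j * d + i < n * d" using i j by (metis add_less_cancel_left add.commute less_le_trans mult_Suc mult_le_mono1 Suc_leI)
      then have "h (j * d + i) \<in> V" by (rule hV)
      then show ?thesis using i j g\<Gamma> \<Gamma>A by (simp add: h_def)
    qed
    then have "lincomb A g n e \<in> {a \<in> carrier A. a \<otimes> x [^] i \<in> V}" for e
      using lincomb_in_subgroup[OF sg[OF xp]] by blast
    then show ?thesis using gen\<Gamma>[OF a] by auto
  qed
  \<comment> \<open>Powers from \<open>d\<close> on are lowered with the integral relation, whence
    the strong induction on the exponent.\<close>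
  have all: "a \<otimes> x [^] i \<in> V" if a: "a \<in> \<Gamma>" for a and i :: nat
  proof (induction i rule: less_induct)
    case (less i)
    show ?case
    proof (cases "i < d")
      case False
      then obtain j where j: "i = j + d" by (metis add.commute le_Suc_ex not_less)
      have aA: "a \<in> carrier A" using \<Gamma>A a .
      have "a \<otimes> x [^] i = (a \<otimes> x [^] j) \<otimes> x [^] d" using aA xp x by (simp add: j m_assoc nat_pow_mult)
      also have "\<dots> = (a \<otimes> x [^] j) \<otimes> lincomb A (\<lambda>i. x [^] i) d c" by (simp add: rel)
      also have "\<dots> \<in> V"
      proof -
        have sg2: "additive_subgroup {b \<in> carrier A. (a \<otimes> x [^] j) \<otimes> b \<in> V} A"
          by (rule additive_subgroupI') (use aA xp in \<open>auto simp: r_distr r_minus\<close>)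
        have "x [^] k \<in> {b \<in> carrier A. (a \<otimes> x [^] j) \<otimes> b \<in> V}" if "k < d" for k
          using less.IH[of "j + k"] that aA xp x j by (simp add: m_assoc nat_pow_mult)
        then show ?thesis using lincomb_in_subgroup[OF sg2, of d "\<lambda>i. x [^] i" c] by blast
      qed
      finally show ?thesis .
    qed (use small a in auto)
  qed
  have prod: "u \<otimes> v \<in> V" if u: "u \<in> V" and v: "v \<in> V" for u v
  proof -
    have hh: "h k \<otimes> h l \<in> V" if kl: "k < n * d" "l < n * d" for k l
    proof -
      have c: "g (k div d) \<in> \<Gamma>" "g (l div d) \<in> \<Gamma>" using kl g\<Gamma> by (auto simp: less_mult_imp_div_less)
      have "h k \<otimes> h l = (g (k div d) \<otimes> g (l div d)) \<otimes> (x [^] (k mod d) \<otimes> x [^] (l mod d))"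
        unfolding h_def using \<Gamma>A[OF c(1)] \<Gamma>A[OF c(2)] xp by (simp add: m_ac)
      also have "\<dots> = (g (k div d) \<otimes> g (l div d)) \<otimes> x [^] (k mod d + l mod d)" using x by (simp add: nat_pow_mult)
      also have "\<dots> \<in> V" using all mult\<Gamma> c by blast
      finally show ?thesis .
    qed
    have hv: "u \<otimes> h l \<in> V" if l: "l < n * d" for l
    proof -
      have "u \<in> {a \<in> carrier A. a \<otimes> h l \<in> V}"
        using u hh[OF _ l] hA lincomb_in_subgroup[OF sg[OF hA[OF l]], of "n * d" h] by (auto simp: V_def)
      then show ?thesis by simp
    qed
    have uA: "u \<in> carrier A" using u V.a_Hcarr by blast
    have "additive_subgroup {b \<in> carrier A. u \<otimes> b \<in> V} A"
      by (rule additive_subgroupI') (use uA in \<open>auto simp: r_distr r_minus\<close>)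
    then have "v \<in> {b \<in> carrier A. u \<otimes> b \<in> V}"
      using v hv hA lincomb_in_subgroup[of "{b \<in> carrier A. u \<otimes> b \<in> V}" "n * d" h] by (auto simp: V_def)
    then show ?thesis by simp
  qed
  have \<Gamma>V: "\<Gamma> \<subseteq> V" using all[of _ 0] \<Gamma>A by auto
  have "subring V A"
    by (rule subringI) (use V.a_subset \<Gamma>V one\<Gamma> prod in auto)
  then have "is_int_order A V" using int_order_overring[OF ord _ \<Gamma>V hA] by (simp add: V_def)
  then have "V = \<Gamma>" using G \<Gamma>V by (simp add: is_maximal_int_order_def is_maximal_order_def is_int_order_def)
  moreover have "x \<in> V" using all[OF one\<Gamma>, of 1] x by simp
  ultimately show ?thesis by simp
qed

end

lemma rat_algI:
  assumes "semisimple_comm_rat_algebra A"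
  shows "rat_alg A"
proof -
  interpret Module.algebra rat_ring A using assms by (simp add: semisimple_comm_rat_algebra_def)
  show ?thesis
  proof (intro rat_alg.intro rat_alg_axioms.intro M_cring)
    fix q r :: rat and x y assume x: "x \<in> carrier A"
    show "q \<odot>\<^bsub>A\<^esub> x \<in> carrier A" using smult_closed[of q x] x by (simp add: ring_of_type_algebra_def)
    show "(q + r) \<odot>\<^bsub>A\<^esub> x = q \<odot>\<^bsub>A\<^esub> x \<oplus>\<^bsub>A\<^esub> r \<odot>\<^bsub>A\<^esub> x"
      using smult_l_distr[of q r x] x by (simp add: ring_of_type_algebra_def)
    show "(q * r) \<odot>\<^bsub>A\<^esub> x = q \<odot>\<^bsub>A\<^esub> (r \<odot>\<^bsub>A\<^esub> x)"
      using smult_assoc1[of q r x] x by (simp add: ring_of_type_algebra_def)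
    show "1 \<odot>\<^bsub>A\<^esub> x = x" using smult_one[of x] x by (simp add: ring_of_type_algebra_def)
    assume y: "y \<in> carrier A"
    show "q \<odot>\<^bsub>A\<^esub> (x \<oplus>\<^bsub>A\<^esub> y) = q \<odot>\<^bsub>A\<^esub> x \<oplus>\<^bsub>A\<^esub> q \<odot>\<^bsub>A\<^esub> y"
      using smult_r_distr[of q x y] x y by (simp add: ring_of_type_algebra_def)
  qed
qed

lemma (in abelian_group) lincomb_shift:
  assumes "\<And>i. i < Suc n \<Longrightarrow> g i \<in> carrier G" "c 0 = 0"
  shows "lincomb G g (Suc n) c = lincomb G (\<lambda>i. g (Suc i)) n (\<lambda>i. c (Suc i))"
  using assms by (induction n) auto

lemma (in ring) lincomb_rdistr:
  assumes "\<And>i. i < n \<Longrightarrow> g i \<in> carrier R" "a \<in> carrier R"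
  shows "a \<otimes> lincomb R g n c = lincomb R (\<lambda>i. a \<otimes> g i) n c"
  using assms by (induction n) (simp_all add: r_distr imul_rdistr)

section \<open>Maximal orders: idempotents and simple components\<close>

locale max_order = rat_alg A for A :: "(rat, 'a, 'm) module_scheme" (structure) +
  fixes \<Gamma> :: "'a set"
  assumes complement: "ideal I A \<Longrightarrow> \<exists>J. ideal J A \<and> I \<inter> J = {\<zero>} \<and> I <+> J = carrier A"
    and maximal: "is_maximal_int_order A \<Gamma>"
begin

lemma order: "is_int_order A \<Gamma>"
  using maximal by (simp add: is_maximal_int_order_def is_maximal_order_def is_int_order_def)

lemma subring_\<Gamma>: "subring \<Gamma> A"
  using order by (simp add: is_int_order_def is_order_def)

lemma additive_\<Gamma>: "additive_subgroup \<Gamma> A"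
  using subring_\<Gamma> by (simp add: subring_def additive_subgroup.intro)

lemma one_\<Gamma>: "\<one> \<in> \<Gamma>"
  using subring_\<Gamma> by (simp add: subring_def submonoid.one_closed)

lemma mult_\<Gamma>: "a \<in> \<Gamma> \<Longrightarrow> b \<in> \<Gamma> \<Longrightarrow> a \<otimes> b \<in> \<Gamma>"
  using subring_\<Gamma> by (simp add: subring_def submonoid.m_closed)

lemma \<Gamma>_carr: "a \<in> \<Gamma> \<Longrightarrow> a \<in> carrier A"
  using additive_subgroup.a_Hcarr[OF additive_\<Gamma>] .

abbreviation GR :: "(rat, 'a, 'm) module_scheme" where "GR \<equiv> A\<lparr>carrier := \<Gamma>\<rparr>"

lemma cring_GR: "cring GR"
  by (rule cring_sub[OF additive_\<Gamma> one_\<Gamma>, folded subring_with_own_one]) (auto simp: \<Gamma>_carr mult_\<Gamma>)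

sublocale GR: cring GR by (rule cring_GR)

lemma GR_minus: "x \<in> \<Gamma> \<Longrightarrow> y \<in> \<Gamma> \<Longrightarrow> x \<ominus>\<^bsub>GR\<^esub> y = x \<ominus> y"
  by (rule sub_minus[OF additive_\<Gamma>, of x y \<one>, folded subring_with_own_one])

lemma GR_imul: "x \<in> \<Gamma> \<Longrightarrow> imul GR k x = imul A k x"
  by (rule sub_imul[OF additive_\<Gamma>, of x \<one> k, folded subring_with_own_one])

lemma GR_lincomb: "(\<And>i. i < n \<Longrightarrow> g i \<in> \<Gamma>) \<Longrightarrow> lincomb GR g n c = lincomb A g n c"
  by (rule sub_lincomb[OF additive_\<Gamma>, of n g \<one> c, folded subring_with_own_one])

lemma generated_GR: "\<exists>g n. generated_by GR g n"
  using int_order_generated[OF order] .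

lemma GR_torsion_free: "x \<in> carrier GR \<Longrightarrow> imul GR k x = \<zero>\<^bsub>GR\<^esub> \<Longrightarrow> k = 0 \<or> x = \<zero>\<^bsub>GR\<^esub>"
  using torsion_free[of x k] by (simp add: GR_imul \<Gamma>_carr)

lemma GR_basis: "\<exists>g n. generated_by GR g n \<and> int_independent GR g n"
  by (rule GR.basis_exists[OF GR_torsion_free generated_GR])

text \<open>An idempotent is integral by the relation x^2 = x, written with coefficients 0 and 1 in
  degrees 0 and 1.\<close>

lemma idempotent_mem:
  assumes "e \<in> carrier A" "e \<otimes> e = e"
  shows "e \<in> \<Gamma>"
  by (rule integral_in_maximal_order[OF maximal assms(1), of 2 "\<lambda>i. if i = 1 then 1 else 0"])
    (use assms in \<open>simp add: numeral_2_eq_2\<close>)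

text \<open>The difference \<open>d\<close> of two idempotents satisfies \<open>d^3 = d\<close>, so it is infinitely
  divisible by 2 as soon as it is divisible by 2.\<close>

lemma idempotent_cong:
  assumes e: "e \<in> carrier A" "e \<otimes> e = e" and f: "f \<in> carrier A" "f \<otimes> f = f"
    and d: "e \<ominus> f \<in> multiples GR 2"
  shows "e = f"
proof -
  define d where "d = e \<ominus> f"
  have dA: "d \<in> carrier A" using e f by (simp add: d_def)
  have "d \<otimes> (d \<otimes> d) = e \<otimes> (e \<otimes> e) \<ominus> f \<otimes> (f \<otimes> f) \<ominus> (e \<otimes> e) \<otimes> f \<ominus> (e \<otimes> e) \<otimes> f \<ominus> (e \<otimes> e) \<otimes> f \<oplus> e \<otimes> (f \<otimes> f) \<oplus> e \<otimes> (f \<otimes> f) \<oplus> e \<otimes> (f \<otimes> f)"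
    unfolding d_def using e(1) f(1) by algebra
  also have "\<dots> = d" unfolding e(2) f(2) d_def using e(1) f(1) by algebra
  finally have cube: "d \<otimes> (d \<otimes> d) = d" .
  have d\<Gamma>: "d \<in> \<Gamma>"
    using idempotent_mem[OF e] idempotent_mem[OF f] GR.minus_closed[of e f] by (simp add: d_def GR_minus)
  have "\<exists>y\<in>\<Gamma>. d = imul A (2 ^ k) y" for k
  proof (induction k)
    case 0
    then show ?case using d\<Gamma> \<Gamma>_carr by auto
  next
    case (Suc k)
    obtain z where z: "z \<in> \<Gamma>" "d = imul A 2 z" using d by (auto simp: multiples_def d_def GR_imul)
    obtain y where y: "y \<in> \<Gamma>" "d = imul A (2 ^ k) y" using Suc by blast
    \<comment> \<open>In d = d^3 one factor contributes 2^k and another one 2, so the exponent grows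
      by one.\<close>
    have "d \<otimes> (d \<otimes> d) = imul A (2 ^ k) y \<otimes> (imul A 2 z \<otimes> d)" using y z by simp
    also have "\<dots> = imul A (2 ^ Suc k) (y \<otimes> (z \<otimes> d))"
      using y(1) z(1) dA \<Gamma>_carr by (simp add: imul_ldistr imul_rdistr mult.commute flip: imul_mult)
    finally have "d = imul A (2 ^ Suc k) (y \<otimes> (z \<otimes> d))" using cube by simp
    then show ?case using y z d\<Gamma> mult_\<Gamma> by blast
  qed
  then have "\<And>k. \<exists>y\<in>carrier GR. d = imul GR (2 ^ k) y" using GR_imul by fastforce
  then have "d = \<zero>" using GR.infinitely_divisible_zero d\<Gamma> GR_basis by fastforce
  then show ?thesis using e f by (simp add: d_def)
qed

text \<open>The component of 1 in the decomposition of \<open>A\<close> into \<open>I\<close> and a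
  complement.\<close>

lemma ideal_identity:
  assumes "ideal I A"
  shows "\<exists>e\<in>I. \<forall>x\<in>I. e \<otimes> x = x"
proof -
  obtain J where J: "ideal J A" "I \<inter> J = {\<zero>}" "I <+> J = carrier A" using complement[OF assms] by blast
  interpret I: ideal I A by fact
  interpret J: ideal J A by fact
  have "\<one> \<in> I <+> J" using J by simp
  then obtain e f where ef: "e \<in> I" "f \<in> J" "\<one> = e \<oplus> f" unfolding set_add_def' by auto
  have "e \<otimes> x = x" if x: "x \<in> I" for x
  proof -
    have c: "e \<in> carrier A" "f \<in> carrier A" "x \<in> carrier A" using ef x I.Icarr J.Icarr by auto
    have "f \<otimes> x \<in> I \<inter> J" using ef x c I.I_l_closed J.I_r_closed by auto
    then have "f \<otimes> x = \<zero>" using J by blast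
    moreover have "(e \<oplus> f) \<otimes> x = x" using ef(3)[symmetric] c by simp
    ultimately show ?thesis using c by (simp add: l_distr)
  qed
  then show ?thesis using ef by blast
qed

text \<open>The same description by which \<open>component_ring\<close> fixes its identity element;
  it makes sense for every ideal, and all ideals are needed for
  \<open>finite_ideals\<close>.\<close>

definition ident :: "'a set \<Rightarrow> 'a" where
  "ident I = (THE e. e \<in> I \<and> (\<forall>x\<in>I. e \<otimes> x = x))"

lemma ident:
  assumes "ideal I A"
  shows "ident I \<in> I" "x \<in> I \<Longrightarrow> ident I \<otimes> x = x"
proof -
  interpret I: ideal I A by fact
  obtain e where e: "e \<in> I" "\<And>x. x \<in> I \<Longrightarrow> e \<otimes> x = x" using ideal_identity[OF assms] by blast
  have "f = e" if "f \<in> I \<and> (\<forall>x\<in>I. f \<otimes> x = x)" for f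
    using e that I.Icarr m_comm by metis
  then have "ident I = e" unfolding ident_def using e by (intro the_equality) auto
  then show "ident I \<in> I" "x \<in> I \<Longrightarrow> ident I \<otimes> x = x" using e by auto
qed

lemma ident_carr: "ideal I A \<Longrightarrow> ident I \<in> carrier A"
  by (rule ideal.Icarr[OF _ ident(1)])

lemma ident_idem: "ideal I A \<Longrightarrow> ident I \<otimes> ident I = ident I"
  by (rule ident(2)[OF _ ident(1)])

lemma ident_\<Gamma>: "ideal I A \<Longrightarrow> ident I \<in> \<Gamma>"
  by (rule idempotent_mem[OF ident_carr ident_idem])

text \<open>An ideal is determined by its identity, which is an idempotent of \<Gamma>; idempotents
  congruent modulo 2 are equal, and \<Gamma>/2\<Gamma> is finite. No dimension theory is
  involved.\<close>

lemma finite_ideals: "finite {I. ideal I A}"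
proof -
  obtain g n where gen: "generated_by GR g n" using generated_GR by blast
  have M: "ideal (multiples GR 2) GR" by (rule GR.multiples_ideal)
  have fin: "finite (a_rcosets\<^bsub>GR\<^esub> (multiples GR 2))"
    by (rule GR.finite_index_of_int[OF gen M _ multiplesI[OF GR.one_closed]]) simp
  have "inj_on (\<lambda>I. multiples GR 2 +>\<^bsub>GR\<^esub> ident I) {I. ideal I A}"
  proof (rule inj_onI, clarify)
    fix I J assume I: "ideal I A" and J: "ideal J A"
      and eq: "multiples GR 2 +>\<^bsub>GR\<^esub> ident I = multiples GR 2 +>\<^bsub>GR\<^esub> ident J"
    have "ident I \<ominus>\<^bsub>GR\<^esub> ident J \<in> multiples GR 2"
      using eq GR.coset_eq_iff[OF M, of "ident I" "ident J"] ident_\<Gamma>[OF I] ident_\<Gamma>[OF J] by simp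
    then have e: "ident I = ident J"
      using idempotent_cong[OF ident_carr[OF I] ident_idem[OF I] ident_carr[OF J] ident_idem[OF J]]
        ident_\<Gamma>[OF I] ident_\<Gamma>[OF J] by (simp add: GR_minus)
    have "I = {x \<in> carrier A. ident I \<otimes> x = x}" if I: "ideal I A" for I
    proof (intro equalityI subsetI)
      show "x \<in> {x \<in> carrier A. ident I \<otimes> x = x}" if "x \<in> I" for x
        using ident(2)[OF I that] ideal.Icarr[OF I that] by simp
      show "x \<in> I" if "x \<in> {x \<in> carrier A. ident I \<otimes> x = x}" for x
        using ideal.I_r_closed[OF I ident(1)[OF I], of x] that by simp
    qed
    then show "I = J" using I J e by metis
  qed
  moreover have "(\<lambda>I. multiples GR 2 +>\<^bsub>GR\<^esub> ident I) ` {I. ideal I A} \<subseteq> a_rcosets\<^bsub>GR\<^esub> (multiples GR 2)"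
    using ident_\<Gamma> by (auto simp: GR.a_rcosets_image)
  ultimately show ?thesis using fin by (meson finite_subset finite_imageD)
qed

lemma finite_components: "finite (simple_components A)"
  by (rule finite_subset[OF _ finite_ideals]) (auto simp: simple_components_def)

lemma component_ideal: "C \<in> simple_components A \<Longrightarrow> ideal C A"
  by (simp add: simple_components_def)

lemma ident_orthogonal:
  assumes "C \<in> simple_components A" "D \<in> simple_components A" "C \<noteq> D"
  shows "ident C \<otimes> ident D = \<zero>"
proof -
  have CD: "ideal C A" "ideal D A" using assms component_ideal by auto
  have id: "ideal (C \<inter> D) A" using i_intersect CD by blast
  have "C \<inter> D = {\<zero>}"
  proof (rule ccontr)
    assume n: "C \<inter> D \<noteq> {\<zero>}"
    have "C \<inter> D = C" using n assms(1) id unfolding simple_components_def by blast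
    moreover have "C \<inter> D = D" using n assms(2) id unfolding simple_components_def by blast
    ultimately show False using assms(3) by blast
  qed
  moreover have "ident C \<otimes> ident D \<in> C \<inter> D"
    using ident(1)[OF CD(1)] ident(1)[OF CD(2)] ident_carr CD ideal.I_r_closed[OF CD(1)] ideal.I_l_closed[OF CD(2)] by blast
  ultimately show ?thesis by blast
qed

text \<open>This replaces the statement that the identities of the components add up to 1. If all of
  them were in \<open>M\<close>, the product f of all 1 - \<open>ident C\<close> would be congruent
  to 1 modulo \<open>M\<close> while annihilating every \<open>ident C\<close>; such an f is zero,
  and then 1 is in \<open>M\<close>.\<close>

lemma some_ident_notin_prime:
  assumes M: "ideal M GR" "\<one> \<notin> M"
  shows "\<exists>C\<in>simple_components A. ident C \<notin> M"
proof (rule ccontr)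
  assume "\<not> ?thesis"
  then have all: "ident C \<in> M" if "C \<in> simple_components A" for C using that by blast
  interpret M: ideal M GR by fact
  have "\<exists>f\<in>\<Gamma>. \<one> \<ominus> f \<in> M \<and> (\<forall>C\<in>F. f \<otimes> ident C = \<zero>)" if "F \<subseteq> simple_components A" for F
    using finite_subset[OF that finite_components] that
  proof (induction F)
    case empty
    have "\<one> \<ominus> \<one> \<in> M" using M.zero_closed by (simp add: a_minus_def r_neg)
    then show ?case using one_\<Gamma> by blast
  next
    case (insert D F)
    then obtain f where f: "f \<in> \<Gamma>" "\<one> \<ominus> f \<in> M" "\<And>C. C \<in> F \<Longrightarrow> f \<otimes> ident C = \<zero>" by blast
    have D: "D \<in> simple_components A" using insert by blast
    define e where "e = ident D"
    have e: "e \<in> M" "e \<in> \<Gamma>" "e \<in> carrier A" "e \<otimes> e = e"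
      using all[OF D] ident_\<Gamma> ident_carr ident_idem component_ideal[OF D] by (auto simp: e_def)
    have fA: "f \<in> carrier A" using f \<Gamma>_carr by blast
    have oe: "\<one> \<ominus> e \<in> \<Gamma>" using GR.minus_closed[of \<one> e] one_\<Gamma> e by (simp add: GR_minus)
    have "\<one> \<ominus> f \<otimes> (\<one> \<ominus> e) = (\<one> \<ominus> f) \<oplus> f \<otimes> e" using fA e(3) by algebra
    moreover have "(\<one> \<ominus> f) \<oplus> f \<otimes> e \<in> M" using f e M.I_l_closed[OF e(1), of f] M.a_closed by simp
    moreover have "f \<otimes> (\<one> \<ominus> e) \<otimes> ident C = \<zero>" if C: "C \<in> insert D F" for C
    proof (cases "C = D")
      case True
      have "f \<otimes> (\<one> \<ominus> e) \<otimes> e = f \<otimes> (e \<ominus> e \<otimes> e)" using fA e(3) by algebra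
      also have "\<dots> = \<zero>" using e fA by (simp add: a_minus_def r_neg)
      finally show ?thesis using True by (simp add: e_def)
    next
      case False
      have c: "ident C \<in> carrier A" using C insert ident_carr component_ideal by blast
      have "f \<otimes> (\<one> \<ominus> e) \<otimes> ident C = (\<one> \<ominus> e) \<otimes> (f \<otimes> ident C)" using fA e(3) c by algebra
      then show ?thesis using False C f(3) e(3) by simp
    qed
    ultimately show ?case using mult_\<Gamma>[OF f(1) oe] by (intro bexI[of _ "f \<otimes> (\<one> \<ominus> e)"]) auto
  qed
  then obtain f where f: "f \<in> \<Gamma>" "\<one> \<ominus> f \<in> M" "\<And>C. C \<in> simple_components A \<Longrightarrow> f \<otimes> ident C = \<zero>" by blast
  have fA: "f \<in> carrier A" using f \<Gamma>_carr by blast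
  have "f = \<zero>"
  proof (rule ccontr)
    assume nz: "f \<noteq> \<zero>"
    \<comment> \<open>A minimal nonzero ideal inside the one generated by \<open>f\<close> is a
      component \<open>C\<close>. Its identity is f a for some a, and squaring gives
      \<open>ident C\<close> = a (f \<open>ident C\<close>) = 0.\<close>
    let ?J = "{f \<otimes> a | a. a \<in> carrier A}"
    have J: "ideal ?J A"
    proof (rule cideal_criterion)
      show "\<zero> \<in> ?J" using fA by (intro CollectI exI[of _ \<zero>]) auto
      show "x \<oplus> y \<in> ?J" if "x \<in> ?J" "y \<in> ?J" for x y
        using that fA by (auto simp flip: r_distr)
      show "r \<otimes> x \<in> ?J" if "x \<in> ?J" "r \<in> carrier A" for x r
        using that fA by (auto simp: m_lcomm)
    qed (use fA in auto)
    have "f \<in> ?J" using fA by (intro CollectI exI[of _ \<one>]) auto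
    then have "?J \<noteq> {\<zero>}" using nz by blast
    then have "?J \<in> {I. ideal I A \<and> I \<noteq> {\<zero>} \<and> I \<subseteq> ?J}" using J by blast
    moreover have "finite {I. ideal I A \<and> I \<noteq> {\<zero>} \<and> I \<subseteq> ?J}" using finite_ideals by (rule rev_finite_subset) auto
    ultimately have "\<exists>C\<in>{I. ideal I A \<and> I \<noteq> {\<zero>} \<and> I \<subseteq> ?J}. C \<subseteq> ?J \<and>
      (\<forall>I\<in>{I. ideal I A \<and> I \<noteq> {\<zero>} \<and> I \<subseteq> ?J}. I \<subseteq> C \<longrightarrow> C = I)"
      by (intro finite_has_minimal2)
    then obtain C where C': "C \<in> {I. ideal I A \<and> I \<noteq> {\<zero>} \<and> I \<subseteq> ?J}"
      and min': "\<forall>I\<in>{I. ideal I A \<and> I \<noteq> {\<zero>} \<and> I \<subseteq> ?J}. I \<subseteq> C \<longrightarrow> C = I" by (elim bexE conjE)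
    have C: "ideal C A" "C \<noteq> {\<zero>}" "C \<subseteq> ?J" using C' by simp_all
    have min: "C = I" if "ideal I A" "I \<noteq> {\<zero>}" "I \<subseteq> ?J" "I \<subseteq> C" for I
      using bspec[OF min', of I] that by simp
    have "C \<in> simple_components A"
      unfolding simple_components_def using C min subset_trans[OF _ C(3)] by blast
    then have 0: "f \<otimes> ident C = \<zero>" using f by blast
    have idC: "ident C \<in> C" "ident C \<in> carrier A" using ident(1)[OF C(1)] ident_carr[OF C(1)] by auto
    then obtain a where a: "a \<in> carrier A" "ident C = f \<otimes> a" using C(3) by blast
    have "ident C = ident C \<otimes> ident C" using ident_idem[OF C(1)] by simp
    also have "\<dots> = (f \<otimes> a) \<otimes> ident C" by (simp only: a(2)[symmetric])
    also have "\<dots> = a \<otimes> (f \<otimes> ident C)" using a(1) fA idC(2) by algebra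
    finally have "ident C = \<zero>" using 0 a by simp
    then have "x = \<zero>" if "x \<in> C" for x using ident(2)[OF C(1) that] ideal.Icarr[OF C(1) that] by simp
    then show False using C(2) additive_subgroup.zero_closed[OF ideal.axioms(1)[OF C(1)]] by blast
  qed
  then show False using f(2) M(2) by (simp add: a_minus_def)
qed

subsection \<open>The components of a maximal order\<close>

abbreviation RC :: "'a set \<Rightarrow> (rat, 'a, 'm) module_scheme" where "RC C \<equiv> component_integers A C"

context
  fixes C assumes C: "C \<in> simple_components A"
begin

lemma C_ideal: "ideal C A" using component_ideal[OF C] .

interpretation C: ideal C A by (rule C_ideal)

lemma component_ring_eq: "component_ring A C = subring_with_one A C (ident C)"
  by (simp add: component_ring_def ident_def)

interpretation CR: cring "subring_with_one A C (ident C)"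
  by (rule cring_sub[OF C.is_additive_subgroup]) (use ident[OF C_ideal] C.I_l_closed C.Icarr in auto)

lemma GC_additive: "additive_subgroup (\<Gamma> \<inter> C) A"
proof -
  interpret \<Gamma>: additive_subgroup \<Gamma> A by (rule additive_\<Gamma>)
  show ?thesis by (rule additive_subgroupI') (use C.Icarr in auto)
qed

lemma GC_one: "ident C \<in> \<Gamma> \<inter> C" "x \<in> \<Gamma> \<inter> C \<Longrightarrow> ident C \<otimes> x = x"
  using ident[OF C_ideal] ident_\<Gamma>[OF C_ideal] by auto

lemma GC_mult: "x \<in> \<Gamma> \<Longrightarrow> y \<in> \<Gamma> \<inter> C \<Longrightarrow> x \<otimes> y \<in> \<Gamma> \<inter> C"
  using mult_\<Gamma> C.I_l_closed \<Gamma>_carr by auto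

lemma GC_cring: "cring (subring_with_one A (\<Gamma> \<inter> C) (ident C))"
  by (rule cring_sub[OF GC_additive]) (use GC_one GC_mult in auto)

interpretation GC: cring "subring_with_one A (\<Gamma> \<inter> C) (ident C)" by (rule GC_cring)

lemma GC_generated:
  assumes "generated_by GR g n"
  shows "generated_by (subring_with_one A (\<Gamma> \<inter> C) (ident C)) (\<lambda>i. ident C \<otimes> g i) n"
proof -
  have g: "\<And>i. i < n \<Longrightarrow> g i \<in> \<Gamma>" using assms by (simp add: generated_by_def)
  have eg: "\<And>i. i < n \<Longrightarrow> ident C \<otimes> g i \<in> \<Gamma> \<inter> C"
    using GC_mult[OF g GC_one(1)] m_comm \<Gamma>_carr g ident_carr[OF C_ideal] by metis
  have "\<exists>c. x = lincomb (subring_with_one A (\<Gamma> \<inter> C) (ident C)) (\<lambda>i. ident C \<otimes> g i) n c" if x: "x \<in> \<Gamma> \<inter> C" for x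
  proof -
    obtain c where "x = lincomb GR g n c" using assms x by (auto simp: generated_by_def)
    then have c: "x = lincomb A g n c" using GR_lincomb[of n g c] g by simp
    have "x = ident C \<otimes> x" using GC_one(2)[OF x] by simp
    also have "\<dots> = lincomb A (\<lambda>i. ident C \<otimes> g i) n c"
      unfolding c using g \<Gamma>_carr ident_carr[OF C_ideal] by (intro lincomb_rdistr) auto
    also have "\<dots> = lincomb (subring_with_one A (\<Gamma> \<inter> C) (ident C)) (\<lambda>i. ident C \<otimes> g i) n c"
      using sub_lincomb[OF GC_additive, of n "\<lambda>i. ident C \<otimes> g i" "ident C" c] eg by simp
    finally show ?thesis by blast
  qed
  then show ?thesis using eg by (simp add: generated_by_def)
qed

text \<open>Powers in the component start with \<open>ident C\<close> instead of 1 and so differ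
  from those of \<open>A\<close> in exponent 0. One additional factor \<open>x\<close> removes the
  difference.\<close>

lemma pow_CR:
  assumes "x \<in> C"
  shows "x \<otimes> x [^]\<^bsub>subring_with_one A C (ident C)\<^esub> (i::nat) = x [^] Suc i"
proof (induction i)
  case 0
  then show ?case using ident(2)[OF C_ideal assms] m_comm ident_carr[OF C_ideal] C.Icarr[OF assms] by simp
next
  case (Suc i)
  have c: "x [^]\<^bsub>subring_with_one A C (ident C)\<^esub> i \<in> carrier A"
    using CR.nat_pow_closed[of x i] assms C.Icarr by auto
  have "x \<otimes> x [^]\<^bsub>subring_with_one A C (ident C)\<^esub> Suc i = (x \<otimes> x [^]\<^bsub>subring_with_one A C (ident C)\<^esub> i) \<otimes> x"
    using c C.Icarr[OF assms] by (simp add: m_assoc)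
  then show ?case using Suc by simp
qed

text \<open>An integral equation in the component, multiplied by \<open>x\<close>, becomes an
  integral equation in \<open>A\<close>, so its root lies in the maximal order. Conversely, \<Gamma>
  \<inter> C is finitely generated, so each of its elements satisfies an integral equation.\<close>

lemma integral_closure_component: "integral_closure (subring_with_one A C (ident C)) = \<Gamma> \<inter> C"
proof -
  let ?R = "subring_with_one A C (ident C)" and ?S = "subring_with_one A (\<Gamma> \<inter> C) (ident C)"
  have pw: "x [^]\<^bsub>?R\<^esub> (i::nat) \<in> C" if "x \<in> C" for x i using CR.nat_pow_closed[of x i] that by simp
  have fs: "finsum ?R (\<lambda>i. imul ?R (Polynomial.coeff f i) (x [^]\<^bsub>?R\<^esub> i)) {..Polynomial.degree f} =
    lincomb ?R (\<lambda>i. x [^]\<^bsub>?R\<^esub> i) (Suc (Polynomial.degree f)) (Polynomial.coeff f)" if "x \<in> C" for x f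
    using CR.lincomb_finsum[of "Suc (Polynomial.degree f)" "\<lambda>i. x [^]\<^bsub>?R\<^esub> i" "Polynomial.coeff f"] pw[OF that]
    by (simp add: lessThan_Suc_atMost)
  show ?thesis
  proof (intro equalityI subsetI)
    fix x assume "x \<in> integral_closure ?R"
    then obtain f where x: "x \<in> C" and f: "Polynomial.lead_coeff f = 1"
      and eq: "lincomb ?R (\<lambda>i. x [^]\<^bsub>?R\<^esub> i) (Suc (Polynomial.degree f)) (Polynomial.coeff f) = \<zero>"
      unfolding integral_closure_def by (auto simp: fs simp del: lincomb.simps)
    define d where "d = Polynomial.degree f"
    have xA: "x \<in> carrier A" using C.Icarr[OF x] .
    have xp: "x [^] (i::nat) \<in> carrier A" for i using xA by simp
    have z: "lincomb A (\<lambda>i. x [^]\<^bsub>?R\<^esub> i) (Suc d) (Polynomial.coeff f) = \<zero>"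
      using eq sub_lincomb[OF C.is_additive_subgroup, of "Suc d" "\<lambda>i. x [^]\<^bsub>?R\<^esub> i" "ident C" "Polynomial.coeff f"] pw[OF x]
      by (simp add: d_def del: lincomb.simps)
    have "\<zero> = x \<otimes> lincomb A (\<lambda>i. x [^]\<^bsub>?R\<^esub> i) (Suc d) (Polynomial.coeff f)"
      unfolding z using xA by simp
    also have "\<dots> = lincomb A (\<lambda>i. x \<otimes> x [^]\<^bsub>?R\<^esub> i) (Suc d) (Polynomial.coeff f)"
      using pw[OF x] C.Icarr xA by (intro lincomb_rdistr) auto
    also have "(\<lambda>i::nat. x \<otimes> x [^]\<^bsub>?R\<^esub> i) = (\<lambda>i. x [^] Suc i)" using pow_CR[OF x] by auto
    finally have "\<zero> = lincomb A (\<lambda>i. x [^] Suc i) d (Polynomial.coeff f) \<oplus> x [^] Suc d"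
      using f xp[of "Suc d"] by (simp add: d_def del: nat_pow_Suc)
    then have "x [^] Suc d = \<ominus> lincomb A (\<lambda>i. x [^] Suc i) d (Polynomial.coeff f)"
      using xp by (metis (no_types, lifting) a_comm lincomb_closed minus_equality minus_minus)
    also have "\<dots> = imul A (-1) (lincomb A (\<lambda>i. x [^] Suc i) d (Polynomial.coeff f))"
    proof -
      have lc: "lincomb A (\<lambda>i. x [^] Suc i) d (Polynomial.coeff f) \<in> carrier A"
        by (rule lincomb_closed) (rule xp)
      show ?thesis using imul_neg[OF lc, of 1] imul_1[OF lc] by metis
    qed
    also have "\<dots> = lincomb A (\<lambda>i. x [^] Suc i) d (\<lambda>i. -1 * Polynomial.coeff f i)"
      by (rule lincomb_imul[symmetric]) (rule xp)
    \<comment> \<open>The extra factor \<open>x\<close> shifts all exponents by one; the constant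
      coefficient is 0.\<close>
    also have "\<dots> = lincomb A (\<lambda>i. x [^] i) (Suc d) (\<lambda>i. case i of 0 \<Rightarrow> 0 | Suc j \<Rightarrow> -1 * Polynomial.coeff f j)"
      by (subst lincomb_shift[OF xp]) simp_all
    finally have "x \<in> \<Gamma>" by (rule integral_in_maximal_order[OF maximal xA])
    then show "x \<in> \<Gamma> \<inter> C" using x by blast
  next
    fix x assume x: "x \<in> \<Gamma> \<inter> C"
    obtain g n where "generated_by GR g n" using generated_GR by blast
    then obtain d c where rel: "x [^]\<^bsub>?S\<^esub> (d::nat) = lincomb ?S (\<lambda>i. x [^]\<^bsub>?S\<^esub> i) d c"
      using GC.integral_relation[OF GC_generated, of g n x] x by auto
    have pS: "x [^]\<^bsub>?S\<^esub> (i::nat) = x [^]\<^bsub>?R\<^esub> i" for i by (simp add: nat_pow_def)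
    have pSc: "x [^]\<^bsub>?R\<^esub> (i::nat) \<in> \<Gamma> \<inter> C" for i
      using GC.nat_pow_closed[of x i] x by (simp add: pS)
    have rel': "x [^]\<^bsub>?R\<^esub> d = lincomb ?R (\<lambda>i. x [^]\<^bsub>?R\<^esub> i) d c"
      using rel sub_lincomb[OF GC_additive, of d "\<lambda>i. x [^]\<^bsub>?R\<^esub> i" "ident C" c]
        sub_lincomb[OF C.is_additive_subgroup, of d "\<lambda>i. x [^]\<^bsub>?R\<^esub> i" "ident C" c] pSc by (simp add: pS)
    \<comment> \<open>The relation x^d = sum of c i x^i rewritten as a monic polynomial. Terms of
      \<open>c\<close> from \<open>d\<close> on are left out, so the degree is exactly
      \<open>d\<close>.\<close>
    define f where "f = Polynomial.monom 1 d - (\<Sum>i<d. Polynomial.monom (c i) i)"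
    have cf: "Polynomial.coeff f k = (if k = d then 1 else if k < d then - c k else 0)" for k
    proof -
      have "(\<Sum>i<d. Polynomial.coeff (Polynomial.monom (c i) i) k) = (\<Sum>i<d. if i = k then c i else 0)"
        by (rule sum.cong) simp_all
      then show ?thesis by (simp add: f_def coeff_sum sum.delta)
    qed
    have deg: "Polynomial.degree f = d"
      by (rule antisym) (auto intro!: degree_le le_degree simp: cf)
    have "lincomb ?R (\<lambda>i. x [^]\<^bsub>?R\<^esub> i) (Suc d) (Polynomial.coeff f) =
      lincomb ?R (\<lambda>i. x [^]\<^bsub>?R\<^esub> i) d (\<lambda>i. -1 * c i) \<oplus>\<^bsub>?R\<^esub> x [^]\<^bsub>?R\<^esub> d"
      using CR.lincomb_cong[of d "Polynomial.coeff f" "\<lambda>i. -1 * c i" "\<lambda>i. x [^]\<^bsub>?R\<^esub> i"] pw[of x d] x CR.imul_1[of "x [^]\<^bsub>?R\<^esub> d"]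
      by (simp add: cf)
    also have "\<dots> = \<ominus>\<^bsub>?R\<^esub> (x [^]\<^bsub>?R\<^esub> d) \<oplus>\<^bsub>?R\<^esub> x [^]\<^bsub>?R\<^esub> d"
    proof -
      have xd: "x [^]\<^bsub>?R\<^esub> (i::nat) \<in> carrier ?R" for i using pw[of x] x by simp
      have "lincomb ?R (\<lambda>i. x [^]\<^bsub>?R\<^esub> i) d (\<lambda>i. -1 * c i) = imul ?R (-1) (x [^]\<^bsub>?R\<^esub> d)"
        unfolding rel' by (rule CR.lincomb_imul) (rule xd)
      also have "\<dots> = \<ominus>\<^bsub>?R\<^esub> (x [^]\<^bsub>?R\<^esub> d)"
        using CR.imul_neg[OF xd, of 1 d] CR.imul_1[OF xd, of d] by metis
      finally show ?thesis by simp
    qed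
    also have "\<dots> = \<zero>" using CR.l_neg[of "x [^]\<^bsub>?R\<^esub> d"] pw[of x d] x by simp
    finally show "x \<in> integral_closure ?R"
      unfolding integral_closure_def using x cf deg fs[of x f]
      by (auto intro!: exI[of _ f] simp del: lincomb.simps)
  qed
qed

lemma RC_eq: "RC C = subring_with_one A (\<Gamma> \<inter> C) (ident C)"
  by (simp add: component_integers_def component_ring_eq integral_closure_component)

lemma RC_cring: "cring (RC C)"
  unfolding RC_eq by (rule GC_cring)

lemma RC_simps [simp]: "carrier (RC C) = \<Gamma> \<inter> C" "\<one>\<^bsub>RC C\<^esub> = ident C" "x \<otimes>\<^bsub>RC C\<^esub> y = x \<otimes> y"
   "x \<oplus>\<^bsub>RC C\<^esub> y = x \<oplus> y" "\<zero>\<^bsub>RC C\<^esub> = \<zero>"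
  by (simp_all add: RC_eq)

lemma RC_minus: "x \<in> \<Gamma> \<inter> C \<Longrightarrow> y \<in> \<Gamma> \<inter> C \<Longrightarrow> x \<ominus>\<^bsub>RC C\<^esub> y = x \<ominus> y"
  unfolding RC_eq by (rule sub_minus[OF GC_additive])

lemma RC_imul: "x \<in> \<Gamma> \<inter> C \<Longrightarrow> imul (RC C) k x = imul A k x"
  unfolding RC_eq by (rule sub_imul[OF GC_additive])

lemma RC_generated: "\<exists>g n. generated_by (RC C) g n"
  using generated_GR GC_generated unfolding RC_eq by blast

lemma proj_hom: "(\<lambda>x. ident C \<otimes> x) \<in> ring_hom GR (RC C)"
proof (rule ring_hom_memI)
  fix x y assume x: "x \<in> carrier GR" and y: "y \<in> carrier GR"
  have c: "ident C \<in> carrier A" "x \<in> carrier A" "y \<in> carrier A" using ident_carr[OF C_ideal] x y \<Gamma>_carr by simp_all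
  have "x \<otimes> ident C \<in> \<Gamma> \<inter> C" using GC_mult[of x "ident C"] GC_one(1) x by simp
  then show "ident C \<otimes> x \<in> carrier (RC C)" using m_comm[OF c(1,2)] by simp
  have "(ident C \<otimes> ident C) \<otimes> (x \<otimes> y) = (ident C \<otimes> x) \<otimes> (ident C \<otimes> y)" using c by algebra
  then show "ident C \<otimes> (x \<otimes>\<^bsub>GR\<^esub> y) = ident C \<otimes> x \<otimes>\<^bsub>RC C\<^esub> (ident C \<otimes> y)"
    using ident_idem[OF C_ideal] by simp
  show "ident C \<otimes> (x \<oplus>\<^bsub>GR\<^esub> y) = ident C \<otimes> x \<oplus>\<^bsub>RC C\<^esub> ident C \<otimes> y" using c by (simp add: r_distr)
qed (use ident_carr[OF C_ideal] in simp)

end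

end

section \<open>The completions of a maximal order at the primes above p\<close>

lemma primes_above_iff:
  assumes "P \<in> primes_above R p"
  shows "imul R n \<one>\<^bsub>R\<^esub> \<in> P \<longleftrightarrow> int p dvd n"
proof -
  have "{n. imul R n \<one>\<^bsub>R\<^esub> \<in> P} = {n. int p dvd n}" using assms by (simp add: primes_above_def)
  then show ?thesis by (simp only: set_eq_iff mem_Collect_eq)
qed

context max_order
begin

text \<open>The indices j and k of the double product merged into one finite index set.\<close>

definition local_index :: "nat \<Rightarrow> ('a set \<times> 'a set) set" where
  "local_index p = (SIGMA C:simple_components A. primes_above (RC C) p)"

definition local_ring :: "'a set \<times> 'a set \<Rightarrow> (nat \<Rightarrow> 'a set) ring" where
  "local_ring i = completed_component A (fst i) (snd i)"

definition local_map :: "'a set \<times> 'a set \<Rightarrow> 'a \<Rightarrow> nat \<Rightarrow> 'a set" where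
  "local_map i x = adic.emb (RC (fst i)) (snd i) (ident (fst i) \<otimes> x)"

lemma local_indexD:
  assumes "i \<in> local_index p"
  shows "fst i \<in> simple_components A" "snd i \<in> primes_above (RC (fst i)) p"
  using assms by (auto simp: local_index_def)

lemma completion:
  assumes p: "Factorial_Ring.prime p" and i: "i \<in> local_index p"
  shows "\<exists>g n. completion_at_prime (RC (fst i)) (snd i) g n p"
proof -
  note C = local_indexD[OF i]
  obtain g n where gen: "generated_by (RC (fst i)) g n" using RC_generated[OF C(1)] by blast
  have P: "primeideal (snd i) (RC (fst i))" using C(2) by (simp add: primes_above_def)
  have "imul (RC (fst i)) (int p) \<one>\<^bsub>RC (fst i)\<^esub> \<in> snd i"
    using primes_above_iff[OF C(2)] by simp
  then have "completion_at_prime (RC (fst i)) (snd i) g n p"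
    using adic.intro[OF RC_cring[OF C(1)] primeideal.axioms(1)[OF P]] P gen p
    by (intro completion_at_prime.intro completion_at_prime_axioms.intro) simp_all
  then show ?thesis by blast
qed

lemma finite_primes_above:
  assumes "C \<in> simple_components A" "Factorial_Ring.prime p"
  shows "finite (primes_above (RC C) p)"
proof -
  obtain g n where gen: "generated_by (RC C) g n" using RC_generated[OF assms(1)] by blast
  have "int p > 0" using prime_gt_0_nat[OF assms(2)] by simp
  note fin = cring.card_ideals_containing(1)[OF RC_cring[OF assms(1)] gen this]
  show ?thesis
  proof (rule finite_subset[OF _ fin], rule subsetI)
    fix P assume P: "P \<in> primes_above (RC C) p"
    have "primeideal P (RC C)" using P by (simp add: primes_above_def)
    then show "P \<in> {I. ideal I (RC C) \<and> imul (RC C) (int p) \<one>\<^bsub>RC C\<^esub> \<in> I}"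
      using primes_above_iff[OF P, of "int p"] primeideal.axioms(1) by simp
  qed
qed

lemma finite_local_index: "Factorial_Ring.prime p \<Longrightarrow> finite (local_index p)"
  unfolding local_index_def using finite_components finite_primes_above by blast

lemma local_cring:
  assumes "Factorial_Ring.prime p" "i \<in> local_index p"
  shows "cring (local_ring i)"
proof -
  obtain g n where "completion_at_prime (RC (fst i)) (snd i) g n p" using completion[OF assms] by blast
  then interpret c: completion_at_prime "RC (fst i)" "snd i" g n p .
  show ?thesis unfolding local_ring_def completed_component_def by (rule c.cring_adic)
qed

lemma local_map_hom:
  assumes "Factorial_Ring.prime p" "i \<in> local_index p"
  shows "local_map i \<in> ring_hom GR (local_ring i)"
proof -
  obtain g n where "completion_at_prime (RC (fst i)) (snd i) g n p" using completion[OF assms] by blast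
  then interpret c: completion_at_prime "RC (fst i)" "snd i" g n p .
  show ?thesis
    using ring_hom_trans[OF proj_hom[OF local_indexD(1)[OF assms(2)]] c.emb_hom]
    by (simp add: local_ring_def completed_component_def local_map_def[abs_def] o_def)
qed

lemma local_map_component:
  assumes "i \<in> local_index p" "b \<in> \<Gamma> \<inter> fst i"
  shows "local_map i b = adic.emb (RC (fst i)) (snd i) b"
  using ident(2)[OF component_ideal[OF local_indexD(1)[OF assms(1)]]] assms(2) by (simp add: local_map_def)

lemma local_approx:
  assumes "Factorial_Ring.prime p" "i \<in> local_index p" "r \<in> carrier (local_ring i)"
  shows "\<exists>b\<in>carrier GR. r \<ominus>\<^bsub>local_ring i\<^esub> local_map i b \<in> multiples (local_ring i) (int p ^ a)"
proof -
  obtain g n where "completion_at_prime (RC (fst i)) (snd i) g n p" using completion[OF assms(1,2)] by blast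
  then interpret c: completion_at_prime "RC (fst i)" "snd i" g n p .
  obtain b where b: "b \<in> carrier (RC (fst i))"
    "r \<ominus>\<^bsub>local_ring i\<^esub> c.emb b \<in> multiples (local_ring i) (int p ^ a)"
    using c.approx[of r a] assms(3) by (auto simp: local_ring_def completed_component_def)
  have "b \<in> \<Gamma> \<inter> fst i" using b(1) local_indexD(1)[OF assms(2)] by simp
  then show ?thesis using b(2) local_map_component[OF assms(2), of b] by (intro bexI[of _ b]) simp_all
qed

lemma local_map_zero:
  assumes p: "Factorial_Ring.prime p" "i \<in> local_index p" and x: "ident (fst i) \<otimes> x = \<zero>"
  shows "local_map i x \<in> multiples (local_ring i) k"
proof -
  obtain g n where "completion_at_prime (RC (fst i)) (snd i) g n p" using completion[OF p] by blast
  then interpret c: completion_at_prime "RC (fst i)" "snd i" g n p .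
  interpret Q: cring "local_ring i" by (rule local_cring[OF p])
  have "c.emb \<zero>\<^bsub>RC (fst i)\<^esub> = \<zero>\<^bsub>local_ring i\<^esub>"
    using ring_hom_zero[OF c.emb_hom c.ring_axioms c.Rh.ring_axioms] by (simp add: local_ring_def completed_component_def)
  then have "local_map i x = imul (local_ring i) k \<zero>\<^bsub>local_ring i\<^esub>"
    using x local_indexD(1)[OF p(2)] by (simp add: local_map_def)
  then show ?thesis using multiplesI[OF Q.zero_closed, of k] by simp
qed

text \<open>In different components u = 1 - \<open>ident (fst i)\<close> is mapped to 0 at
  \<open>i\<close>, and 1 - u to 0 at \<open>j\<close> by orthogonality. In the same component
  comaximal powers of the two primes are used, with exponents large enough to give multiples of p^a
  and p^b in the completions.\<close>

lemma local_comaximal: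
  assumes p: "Factorial_Ring.prime p" and i: "i \<in> local_index p" and j: "j \<in> local_index p" and ne: "i \<noteq> j"
  shows "\<exists>u\<in>carrier GR. local_map i u \<in> multiples (local_ring i) (int p ^ a) \<and>
    local_map j (\<one>\<^bsub>GR\<^esub> \<ominus>\<^bsub>GR\<^esub> u) \<in> multiples (local_ring j) (int p ^ b)"
proof (cases "fst i = fst j")
  case False
  let ?e = "ident (fst i)" and ?f = "ident (fst j)"
  note C = component_ideal[OF local_indexD(1)[OF i]] and D = component_ideal[OF local_indexD(1)[OF j]]
  have e: "?e \<in> carrier A" "?e \<in> \<Gamma>" "?f \<in> carrier A" using ident_carr[OF C] ident_\<Gamma>[OF C] ident_carr[OF D] by auto
  have u: "\<one> \<ominus>\<^bsub>GR\<^esub> ?e \<in> carrier GR" using GR.minus_closed[of \<one> ?e] e one_\<Gamma> by simp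
  have u': "\<one> \<ominus>\<^bsub>GR\<^esub> ?e = \<one> \<ominus> ?e" using GR_minus one_\<Gamma> e by blast
  have "?e \<otimes> (\<one> \<ominus> ?e) = ?e \<ominus> ?e \<otimes> ?e" using e(1) by algebra
  also have "\<dots> = \<zero>" using ident_idem[OF C] e(1) by (simp add: minus_eq r_neg)
  finally have 1: "?e \<otimes> (\<one> \<ominus>\<^bsub>GR\<^esub> ?e) = \<zero>" using u' by simp
  have "\<one>\<^bsub>GR\<^esub> \<ominus>\<^bsub>GR\<^esub> (\<one> \<ominus>\<^bsub>GR\<^esub> ?e) = \<one> \<ominus> (\<one> \<ominus> ?e)"
    using GR_minus[OF one_\<Gamma>, of "\<one> \<ominus>\<^bsub>GR\<^esub> ?e"] u u' by simp
  also have "\<dots> = ?e" using e(1) by algebra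
  finally have "?f \<otimes> (\<one>\<^bsub>GR\<^esub> \<ominus>\<^bsub>GR\<^esub> (\<one> \<ominus>\<^bsub>GR\<^esub> ?e)) = \<zero>"
    using ident_orthogonal[OF local_indexD(1)[OF j] local_indexD(1)[OF i]] False by simp
  then show ?thesis using local_map_zero[OF p i 1] local_map_zero[OF p j] u by blast
next
  case True
  obtain g n where "completion_at_prime (RC (fst i)) (snd i) g n p" using completion[OF p i] by blast
  then interpret c: completion_at_prime "RC (fst i)" "snd i" g n p .
  obtain g' n' where "completion_at_prime (RC (fst i)) (snd j) g' n' p" using completion[OF p j] unfolding True by blast
  then interpret c': completion_at_prime "RC (fst i)" "snd j" g' n' p .
  note Ci = local_indexD(1)[OF i]
  note C = component_ideal[OF Ci]
  obtain N where N: "\<And>u. u \<in> c.Pw N \<Longrightarrow> c.emb u \<in> multiples c.Rh (int p ^ a)" using c.emb_small by blast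
  obtain N' where N': "\<And>u. u \<in> c'.Pw N' \<Longrightarrow> c'.emb u \<in> multiples c'.Rh (int p ^ b)" using c'.emb_small by blast
  have ne': "snd i \<noteq> snd j" using ne True by (simp add: prod_eq_iff)
  obtain u where u: "u \<in> c.Pw N" "\<one>\<^bsub>RC (fst i)\<^esub> \<ominus>\<^bsub>RC (fst i)\<^esub> u \<in> c'.Pw N'"
    using c.comaximal_powers[OF c.P.primeideal_axioms c.finite_index c'.P.primeideal_axioms c'.finite_index ne'] by blast
  have uG: "u \<in> \<Gamma> \<inter> fst i" using c.ideal_power_closed[OF c.I.is_ideal u(1)] Ci by simp
  have e: "ident (fst i) \<in> \<Gamma> \<inter> fst i" using GC_one(1)[OF Ci] .
  have eA: "ident (fst i) \<in> carrier A" "u \<in> carrier A" using e uG \<Gamma>_carr by auto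
  have m: "\<one>\<^bsub>RC (fst i)\<^esub> \<ominus>\<^bsub>RC (fst i)\<^esub> u = ident (fst i) \<ominus> u"
    using RC_minus[OF Ci e uG] Ci by simp
  have "local_map j (\<one>\<^bsub>GR\<^esub> \<ominus>\<^bsub>GR\<^esub> u) = c'.emb (ident (fst i) \<otimes> (\<one> \<ominus> u))"
    using GR_minus[OF one_\<Gamma>, of u] uG by (simp add: local_map_def True)
  also have "ident (fst i) \<otimes> (\<one> \<ominus> u) = ident (fst i) \<ominus> ident (fst i) \<otimes> u" using eA by algebra
  also have "ident (fst i) \<otimes> u = u" using ident(2)[OF C] uG by simp
  finally have "local_map j (\<one>\<^bsub>GR\<^esub> \<ominus>\<^bsub>GR\<^esub> u) \<in> multiples (local_ring j) (int p ^ b)"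
    using N'[OF u(2)] m by (simp add: local_ring_def completed_component_def True)
  moreover have "local_map i u \<in> multiples (local_ring i) (int p ^ a)"
    using N[OF u(1)] local_map_component[OF i uG] by (simp add: local_ring_def completed_component_def)
  ultimately show ?thesis using uG by auto
qed

lemma local_units:
  assumes "Factorial_Ring.prime p" "i \<in> local_index p" "coprime k (int p)"
  shows "\<exists>r\<in>carrier (local_ring i). imul (local_ring i) k r = \<one>\<^bsub>local_ring i\<^esub>"
proof -
  obtain g n where "completion_at_prime (RC (fst i)) (snd i) g n p" using completion[OF assms(1,2)] by blast
  then interpret c: completion_at_prime "RC (fst i)" "snd i" g n p .
  show ?thesis using c.unit_of_coprime[OF c.pP assms(3)] by (simp add: local_ring_def completed_component_def)
qed

text \<open>Because \<open>M\<close> misses the identity of \<open>C\<close>, its trace on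
  \<open>C\<close> remains a proper ideal; primality is inherited.\<close>

lemma prime_restrict:
  assumes M: "primeideal M GR" and C: "C \<in> simple_components A" and e: "ident C \<notin> M"
  shows "primeideal (M \<inter> C) (RC C)"
proof -
  interpret M: primeideal M GR by (rule M)
  interpret RC: cring "RC C" by (rule RC_cring[OF C])
  interpret C: ideal C A by (rule component_ideal[OF C])
  have MG: "M \<subseteq> \<Gamma>" using M.a_subset by simp
  show ?thesis
  proof (rule primeidealI)
    show "ideal (M \<inter> C) (RC C)"
    proof (rule RC.cideal_criterion)
      fix x y assume "x \<in> M \<inter> C" "y \<in> M \<inter> C"
      then show "x \<oplus>\<^bsub>RC C\<^esub> y \<in> M \<inter> C" using M.a_closed C.a_closed by (simp add: C)
    next
      fix x r assume x: "x \<in> M \<inter> C" and r: "r \<in> carrier (RC C)"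
      then show "r \<otimes>\<^bsub>RC C\<^esub> x \<in> M \<inter> C"
        using M.I_l_closed[of x r] C.I_l_closed[of x r] \<Gamma>_carr by (simp add: C)
    qed (use MG M.zero_closed C.zero_closed C in auto)
    show "cring (RC C)" by (rule RC.is_cring)
    show "carrier (RC C) \<noteq> M \<inter> C" using e GC_one(1)[OF C] C by auto
    fix x y assume "x \<in> carrier (RC C)" "y \<in> carrier (RC C)" "x \<otimes>\<^bsub>RC C\<^esub> y \<in> M \<inter> C"
    then show "x \<in> M \<inter> C \<or> y \<in> M \<inter> C" using M.I_prime[of x y] by (auto simp: C)
  qed
qed

lemma prime_power_in_prime:
  assumes M: "primeideal M GR"
  shows "imul GR (int p ^ a) \<one> \<in> M \<Longrightarrow> imul GR (int p) \<one> \<in> M"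
proof (induction a)
  case 0
  interpret M: primeideal M GR by (rule M)
  have "\<one>\<^bsub>GR\<^esub> \<in> M" using 0 GR.imul_1[OF GR.one_closed] by simp
  then show ?case using M.one_imp_carrier M.I_notcarr by simp
next
  case (Suc a)
  interpret M: primeideal M GR by (rule M)
  have o: "\<one> \<in> carrier GR" using one_\<Gamma> by simp
  have "imul GR (int p ^ Suc a) \<one> = imul GR (int p) \<one> \<otimes>\<^bsub>GR\<^esub> imul GR (int p ^ a) \<one>"
    using GR.imul_mult[OF o, of "int p" "int p ^ a"] GR.imul_one[of "imul GR (int p ^ a) \<one>" "int p"] GR.imul_closed[OF o] by simp
  then have "imul GR (int p) \<one> \<otimes>\<^bsub>GR\<^esub> imul GR (int p ^ a) \<one> \<in> M" using Suc.prems by simp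
  then have "imul GR (int p) \<one> \<in> M \<or> imul GR (int p ^ a) \<one> \<in> M"
    by (rule M.I_prime[OF GR.imul_closed[OF o] GR.imul_closed[OF o]])
  then show ?case using Suc.IH by blast
qed

lemma prime_restrict_above:
  assumes p: "Factorial_Ring.prime p" and M: "primeideal M GR" and C: "C \<in> simple_components A"
    and e: "ident C \<notin> M" and pM: "imul GR (int p) \<one> \<in> M"
  shows "M \<inter> C \<in> primes_above (RC C) p"
proof -
  interpret M: primeideal M GR by (rule M)
  interpret C: ideal C A by (rule component_ideal[OF C])
  have eG: "ident C \<in> \<Gamma> \<inter> C" by (rule GC_one(1)[OF C])
  have eA: "ident C \<in> carrier A" using eG \<Gamma>_carr by blast
  have eGR: "ident C \<in> carrier GR" using eG by simp
  have o: "\<one> \<in> carrier GR" using one_\<Gamma> by simp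
  have im: "imul (RC C) n \<one>\<^bsub>RC C\<^esub> = imul GR n (ident C)" for n
    using RC_imul[OF C eG] GR_imul[of "ident C"] eG C by simp
  have inC: "imul GR n (ident C) \<in> C" for n
    using imul_in_additive_subgroup[OF C.is_additive_subgroup, of "ident C" n] GR_imul[of "ident C"] eG by simp
  have pe: "imul GR (int p) (ident C) \<in> M"
  proof -
    have "imul GR (int p) (ident C) = imul GR (int p) \<one> \<otimes>\<^bsub>GR\<^esub> ident C"
      using GR.imul_one[OF eGR, of "int p"] by simp
    then show ?thesis using M.I_r_closed[OF pM eGR] by simp
  qed
  have mul: "imul GR n x \<in> M" if "x \<in> M" for n x
    using GR.imul_in_additive_subgroup[OF M.is_additive_subgroup that] .
  have "imul GR n (ident C) \<in> M \<longleftrightarrow> int p dvd n" for n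
  proof
    assume "int p dvd n"
    then obtain k where "n = k * int p" by (metis dvd_def mult.commute)
    then show "imul GR n (ident C) \<in> M" using GR.imul_mult[OF eGR, of k "int p"] mul[OF pe] by simp
  next
    assume n: "imul GR n (ident C) \<in> M"
    show "int p dvd n"
    proof (rule ccontr)
      assume "\<not> int p dvd n"
      then have "coprime (int p) n" using p prime_imp_coprime by (metis prime_int_nat_transfer nat_int of_nat_0_le_iff)
      then obtain u v where uv: "u * int p + v * n = 1" using coprime_bezout by blast
      have "ident C = imul GR (u * int p + v * n) (ident C)" using uv GR.imul_1[OF eGR] by simp
      also have "\<dots> = imul GR u (imul GR (int p) (ident C)) \<oplus>\<^bsub>GR\<^esub> imul GR v (imul GR n (ident C))"
        using GR.imul_add[OF eGR] GR.imul_mult[OF eGR] by simp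
      also have "\<dots> \<in> M" using M.a_closed[OF mul[OF pe] mul[OF n]] .
      finally show False using e by blast
    qed
  qed
  then show ?thesis using prime_restrict[OF M C e] inC by (simp add: primes_above_def im)
qed

text \<open>Only finitely many ideals contain \<open>m\<close>, so a maximal proper one among those
  above \<open>I\<close> exists without Zorn's lemma.\<close>

lemma maximal_ideal_above:
  assumes I: "ideal I GR" and m: "imul GR m \<one> \<in> I" "m > 0" and one: "\<one> \<notin> I"
  shows "\<exists>M. primeideal M GR \<and> I \<subseteq> M"
proof -
  obtain g n where gen: "generated_by GR g n" using generated_GR by blast
  let ?X = "{J. ideal J GR \<and> imul GR m \<one> \<in> J \<and> I \<subseteq> J \<and> \<one> \<notin> J}"
  have fin: "finite ?X"
    by (rule finite_subset[OF _ GR.card_ideals_containing(1)[OF gen m(2)]]) auto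
  have "I \<in> ?X" using I m one by simp
  from finite_has_maximal2[OF fin this] obtain M
    where M: "M \<in> ?X" "I \<subseteq> M" and max: "\<forall>J\<in>?X. M \<subseteq> J \<longrightarrow> M = J"
    by (elim bexE conjE) (rule that)
  have "maximalideal M GR"
  proof (rule maximalidealI)
    show "ideal M GR" using M(1) by simp
    show "carrier GR \<noteq> M" using M(1) one_\<Gamma> by auto
    fix J assume J: "ideal J GR" "M \<subseteq> J" "J \<subseteq> carrier GR"
    show "J = M \<or> J = carrier GR"
    proof (cases "\<one> \<in> J")
      case True
      then show ?thesis using ideal.one_imp_carrier[OF J(1)] by simp
    next
      case False
      then have "J \<in> ?X" using J M(1,2) by auto
      from bspec[OF max this] show ?thesis using J(2) by simp
    qed
  qed
  then show ?thesis using GR.maximalideal_prime M(2) by blast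
qed

lemma multiples_RC_subset:
  assumes "C \<in> simple_components A" "x \<in> multiples (RC C) k"
  shows "x \<in> multiples GR k"
proof -
  obtain y where y: "y \<in> \<Gamma> \<inter> C" "x = imul (RC C) k y" using assms by (auto simp: multiples_def)
  then have "x = imul GR k y" using RC_imul[OF assms(1)] GR_imul by simp
  then show ?thesis using multiplesI[of y GR k] y(1) by simp
qed

text \<open>The sections of the completions of the components serve unchanged, because
  \<open>e i\<close> lies in its component and absorbs the projection. For the last clause, a prime
  \<open>M\<close> containing all \<open>e i\<close> and p^a contains \<open>p\<close> and misses
  the identity of some component \<open>C\<close>; then M \<inter> C is a prime above
  \<open>p\<close>, and the element \<open>e i\<close> for this very pair is not in
  \<open>M\<close>.\<close>

lemma local_sections:
  assumes p: "Factorial_Ring.prime p"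
  shows "\<exists>e \<tau>. (\<forall>i\<in>local_index p. e i \<in> carrier GR \<and> \<tau> i \<in> carrier (local_ring i) \<rightarrow> carrier GR \<and>
        (\<forall>r\<in>carrier (local_ring i). \<forall>r'\<in>carrier (local_ring i).
          \<tau> i (r \<oplus>\<^bsub>local_ring i\<^esub> r') \<ominus>\<^bsub>GR\<^esub> (\<tau> i r \<oplus>\<^bsub>GR\<^esub> \<tau> i r') \<in> multiples GR (int p ^ a)) \<and>
        (\<forall>b\<in>carrier GR. \<tau> i (local_map i b) \<ominus>\<^bsub>GR\<^esub> e i \<otimes>\<^bsub>GR\<^esub> b \<in> multiples GR (int p ^ a))) \<and>
      (\<forall>I. ideal I GR \<longrightarrow> (\<forall>i\<in>local_index p. e i \<in> I) \<longrightarrow> imul GR (int p ^ a) \<one>\<^bsub>GR\<^esub> \<in> I \<longrightarrow> \<one>\<^bsub>GR\<^esub> \<in> I)"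
proof -
  have "\<forall>i\<in>local_index p. \<exists>s. fst s \<in> \<Gamma> \<inter> fst i - snd i \<and> snd s \<in> carrier (local_ring i) \<rightarrow> \<Gamma> \<inter> fst i \<and>
    (\<forall>r\<in>carrier (local_ring i). \<forall>r'\<in>carrier (local_ring i).
      snd s (r \<oplus>\<^bsub>local_ring i\<^esub> r') \<ominus>\<^bsub>RC (fst i)\<^esub> (snd s r \<oplus> snd s r') \<in> multiples (RC (fst i)) (int p ^ a)) \<and>
    (\<forall>b\<in>\<Gamma> \<inter> fst i. snd s (adic.emb (RC (fst i)) (snd i) b) \<ominus>\<^bsub>RC (fst i)\<^esub> (fst s \<otimes> b) \<in> multiples (RC (fst i)) (int p ^ a))"
  proof
    fix i assume i: "i \<in> local_index p"
    obtain g n where "completion_at_prime (RC (fst i)) (snd i) g n p" using completion[OF p i] by blast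
    then interpret c: completion_at_prime "RC (fst i)" "snd i" g n p .
    note Ci = local_indexD(1)[OF i]
    obtain e \<tau> where "e \<in> carrier (RC (fst i)) - snd i \<and> \<tau> \<in> carrier c.Rh \<rightarrow> carrier (RC (fst i)) \<and>
      (\<forall>f\<in>carrier c.Rh. \<forall>f'\<in>carrier c.Rh. \<tau> (f \<oplus>\<^bsub>c.Rh\<^esub> f') \<ominus>\<^bsub>RC (fst i)\<^esub> (\<tau> f \<oplus>\<^bsub>RC (fst i)\<^esub> \<tau> f') \<in> multiples (RC (fst i)) (int p ^ a)) \<and>
      (\<forall>b\<in>carrier (RC (fst i)). \<tau> (c.emb b) \<ominus>\<^bsub>RC (fst i)\<^esub> e \<otimes>\<^bsub>RC (fst i)\<^esub> b \<in> multiples (RC (fst i)) (int p ^ a))"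
      using c.section_ex[of a] by (elim exE conjE) blast
    then show "\<exists>s. fst s \<in> \<Gamma> \<inter> fst i - snd i \<and> snd s \<in> carrier (local_ring i) \<rightarrow> \<Gamma> \<inter> fst i \<and>
    (\<forall>r\<in>carrier (local_ring i). \<forall>r'\<in>carrier (local_ring i).
      snd s (r \<oplus>\<^bsub>local_ring i\<^esub> r') \<ominus>\<^bsub>RC (fst i)\<^esub> (snd s r \<oplus> snd s r') \<in> multiples (RC (fst i)) (int p ^ a)) \<and>
    (\<forall>b\<in>\<Gamma> \<inter> fst i. snd s (adic.emb (RC (fst i)) (snd i) b) \<ominus>\<^bsub>RC (fst i)\<^esub> (fst s \<otimes> b) \<in> multiples (RC (fst i)) (int p ^ a))"
      unfolding local_ring_def completed_component_def RC_simps[OF Ci] 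
      by (intro exI[of _ "(e, \<tau>)"]) simp
  qed
  then obtain s where s: "\<forall>i\<in>local_index p. fst (s i) \<in> \<Gamma> \<inter> fst i - snd i \<and> snd (s i) \<in> carrier (local_ring i) \<rightarrow> \<Gamma> \<inter> fst i \<and>
    (\<forall>r\<in>carrier (local_ring i). \<forall>r'\<in>carrier (local_ring i).
      snd (s i) (r \<oplus>\<^bsub>local_ring i\<^esub> r') \<ominus>\<^bsub>RC (fst i)\<^esub> (snd (s i) r \<oplus> snd (s i) r') \<in> multiples (RC (fst i)) (int p ^ a)) \<and>
    (\<forall>b\<in>\<Gamma> \<inter> fst i. snd (s i) (adic.emb (RC (fst i)) (snd i) b) \<ominus>\<^bsub>RC (fst i)\<^esub> (fst (s i) \<otimes> b) \<in> multiples (RC (fst i)) (int p ^ a))"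
    by (rule bchoice[THEN exE])
  define e where "e i = fst (s i)" for i
  define \<tau> where "\<tau> i = snd (s i)" for i
  have e: "e i \<in> \<Gamma> \<inter> fst i" "e i \<notin> snd i" if "i \<in> local_index p" for i
    using s that by (auto simp: e_def)
  have \<tau>: "\<tau> i r \<in> \<Gamma> \<inter> fst i" if "i \<in> local_index p" "r \<in> carrier (local_ring i)" for i r
    using s that by (auto simp: \<tau>_def)
  have \<tau>_add: "\<tau> i (r \<oplus>\<^bsub>local_ring i\<^esub> r') \<ominus>\<^bsub>RC (fst i)\<^esub> (\<tau> i r \<oplus> \<tau> i r') \<in> multiples (RC (fst i)) (int p ^ a)"
    if "i \<in> local_index p" "r \<in> carrier (local_ring i)" "r' \<in> carrier (local_ring i)" for i r r'
    using s that by (simp add: \<tau>_def)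
  have \<tau>_emb: "\<tau> i (adic.emb (RC (fst i)) (snd i) b) \<ominus>\<^bsub>RC (fst i)\<^esub> (e i \<otimes> b) \<in> multiples (RC (fst i)) (int p ^ a)"
    if "i \<in> local_index p" "b \<in> \<Gamma> \<inter> fst i" for i b
    using s that by (simp add: \<tau>_def e_def)
  have minus: "x \<ominus>\<^bsub>GR\<^esub> y \<in> multiples GR k"
    if "i \<in> local_index p" "x \<in> \<Gamma> \<inter> fst i" "y \<in> \<Gamma> \<inter> fst i" "x \<ominus>\<^bsub>RC (fst i)\<^esub> y \<in> multiples (RC (fst i)) k" for i x y k
    using multiples_RC_subset[OF local_indexD(1)[OF that(1)] that(4)]
      RC_minus[OF local_indexD(1)[OF that(1)] that(2,3)] GR_minus[of x y] that(2,3) by simp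
  show ?thesis
  proof (intro exI[of _ e] exI[of _ \<tau>] conjI ballI allI impI)
    fix i assume i: "i \<in> local_index p"
    interpret Q: cring "local_ring i" by (rule local_cring[OF p i])
    note C = component_ideal[OF local_indexD(1)[OF i]]
    interpret C: ideal "fst i" A by (rule C)
    show "e i \<in> carrier GR" using e[OF i] by simp
    show "\<tau> i \<in> carrier (local_ring i) \<rightarrow> carrier GR" using \<tau>[OF i] by auto
    { fix r r' assume r: "r \<in> carrier (local_ring i)" "r' \<in> carrier (local_ring i)"
      have "\<tau> i r \<oplus> \<tau> i r' \<in> \<Gamma> \<inter> fst i"
        using additive_subgroup.a_closed[OF GC_additive[OF local_indexD(1)[OF i]] \<tau>[OF i r(1)] \<tau>[OF i r(2)]] .
      then show "\<tau> i (r \<oplus>\<^bsub>local_ring i\<^esub> r') \<ominus>\<^bsub>GR\<^esub> (\<tau> i r \<oplus>\<^bsub>GR\<^esub> \<tau> i r') \<in> multiples GR (int p ^ a)"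
        using minus[OF i \<tau>[OF i Q.a_closed[OF r]] _ \<tau>_add[OF i r]] by simp }
    fix b assume b: "b \<in> carrier GR"
    let ?b = "ident (fst i) \<otimes> b"
    have bA: "b \<in> carrier A" "ident (fst i) \<in> carrier A" "e i \<in> carrier A"
      using b \<Gamma>_carr ident_carr[OF C] e[OF i] by auto
    have b': "?b \<in> \<Gamma> \<inter> fst i"
      using GC_mult[OF local_indexD(1)[OF i], of b "ident (fst i)"] b GC_one(1)[OF local_indexD(1)[OF i]] m_comm[OF bA(1,2)] by simp
    have "e i \<otimes> ?b = (ident (fst i) \<otimes> e i) \<otimes> b" using bA by algebra
    also have "ident (fst i) \<otimes> e i = e i" using ident(2)[OF C] e[OF i] by blast
    finally have eb: "e i \<otimes> ?b = e i \<otimes> b" .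
    have lm: "local_map i b \<in> carrier (local_ring i)" using ring_hom_closed[OF local_map_hom[OF p i] b] .
    have "e i \<otimes> ?b \<in> \<Gamma> \<inter> fst i" using GC_mult[OF local_indexD(1)[OF i], of "e i" ?b] e[OF i] b' by blast
    then show "\<tau> i (local_map i b) \<ominus>\<^bsub>GR\<^esub> e i \<otimes>\<^bsub>GR\<^esub> b \<in> multiples GR (int p ^ a)"
      using minus[OF i \<tau>[OF i lm], of "e i \<otimes> ?b"] \<tau>_emb[OF i b'] unfolding eb local_map_def by simp
  next
    fix I assume I: "ideal I GR" "\<forall>i\<in>local_index p. e i \<in> I" "imul GR (int p ^ a) \<one>\<^bsub>GR\<^esub> \<in> I"
    show "\<one>\<^bsub>GR\<^esub> \<in> I"
    proof (rule ccontr)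
      assume "\<one>\<^bsub>GR\<^esub> \<notin> I"
      then obtain M where M: "primeideal M GR" "I \<subseteq> M"
        using maximal_ideal_above[OF I(1), of "int p ^ a"] I(3) prime_gt_0_nat[OF p] by auto
      interpret M: primeideal M GR by (rule M)
      have "\<one> \<notin> M" using M.one_imp_carrier M.I_notcarr by auto
      then obtain C where C: "C \<in> simple_components A" "ident C \<notin> M"
        using some_ident_notin_prime[OF M.is_ideal] by blast
      have "imul GR (int p) \<one> \<in> M" using prime_power_in_prime[OF M(1)] I(3) M(2) by auto
      then have "M \<inter> C \<in> primes_above (RC C) p" using prime_restrict_above[OF p M(1) C] by blast
      then have i: "(C, M \<inter> C) \<in> local_index p" using C by (simp add: local_index_def)
      then show False using e[OF i] I(2) M(2) by auto
    qed
  qed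
qed

theorem maximal_order_local_presentation:
  assumes "Factorial_Ring.prime p"
  shows "local_presentation GR local_ring local_map (local_index p) p"
  using assms finite_local_index local_cring local_map_hom local_approx local_comaximal local_sections local_units cring_GR
  by (intro local_presentation.intro local_presentation_axioms.intro) simp_all

end

subsection \<open>Fraction fields and \<open>p\<close>-adic numbers\<close>

context domain
begin

lemma frac_class_transfer:
  assumes "a \<in> carrier R" "b \<in> carrier R - {\<zero>}" "c \<in> carrier R" "d \<in> carrier R" "x \<in> carrier R" "y \<in> carrier R"
    and "a \<otimes> d = c \<otimes> b" "a \<otimes> y = x \<otimes> b"
  shows "c \<otimes> y = x \<otimes> d"
proof -
  have b: "b \<in> carrier R" "b \<noteq> \<zero>" using assms(2) by auto
  have "b \<otimes> (c \<otimes> y) = (c \<otimes> b) \<otimes> y" using assms(1,3-6) b(1) by algebra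
  also have "\<dots> = (a \<otimes> d) \<otimes> y" using assms(7) by simp
  also have "\<dots> = (a \<otimes> y) \<otimes> d" using assms(1,3-6) b(1) by algebra
  also have "\<dots> = (x \<otimes> b) \<otimes> d" using assms(8) by simp
  also have "\<dots> = b \<otimes> (x \<otimes> d)" using assms(1,3-6) b(1) by algebra
  finally show ?thesis using m_lcancel[OF b(2,1)] assms by simp
qed

lemma frac_class_subset:
  assumes "a \<in> carrier R" "b \<in> carrier R - {\<zero>}" "c \<in> carrier R" "d \<in> carrier R - {\<zero>}" and e: "a \<otimes> d = c \<otimes> b"
  shows "frac_class R a b \<subseteq> frac_class R c d"
proof (rule subrelI)
  fix x y assume "(x, y) \<in> frac_class R a b"
  then have h: "x \<in> carrier R" "y \<in> carrier R - {\<zero>}" "a \<otimes> y = x \<otimes> b" by (simp_all add: frac_class_def)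
  have "c \<otimes> y = x \<otimes> d" by (rule frac_class_transfer[OF assms(1-3) _ h(1) _ e h(3)]) (use h(2) assms(4) in simp_all)
  then show "(x, y) \<in> frac_class R c d" using h by (simp add: frac_class_def)
qed

lemma frac_class_self: "a \<in> carrier R \<Longrightarrow> b \<in> carrier R - {\<zero>} \<Longrightarrow> (a, b) \<in> frac_class R a b"
  by (simp add: frac_class_def)

lemma frac_class_eq_iff:
  assumes "a \<in> carrier R" "b \<in> carrier R - {\<zero>}" "c \<in> carrier R" "d \<in> carrier R - {\<zero>}"
  shows "frac_class R a b = frac_class R c d \<longleftrightarrow> a \<otimes> d = c \<otimes> b"
proof
  assume "frac_class R a b = frac_class R c d"
  then have "(c, d) \<in> frac_class R a b" using frac_class_self[OF assms(3,4)] by simp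
  then show "a \<otimes> d = c \<otimes> b" by (simp add: frac_class_def)
next
  assume e: "a \<otimes> d = c \<otimes> b"
  show "frac_class R a b = frac_class R c d"
    by (rule equalityI[OF frac_class_subset[OF assms e] frac_class_subset[OF assms(3,4,1,2) e[symmetric]]])
qed

lemma nonzero_mult_closed: "b \<in> carrier R - {\<zero>} \<Longrightarrow> d \<in> carrier R - {\<zero>} \<Longrightarrow> b \<otimes> d \<in> carrier R - {\<zero>}"
  using integral by auto

text \<open>The union in the definition runs over all representatives. It is a union of equal sets
  over nonempty classes, which is the independence of the choice of representatives.\<close>

lemma frac_class_mult:
  assumes "a \<in> carrier R" "b \<in> carrier R - {\<zero>}" "c \<in> carrier R" "d \<in> carrier R - {\<zero>}"
  shows "frac_class R a b \<otimes>\<^bsub>fraction_field R\<^esub> frac_class R c d = frac_class R (a \<otimes> c) (b \<otimes> d)"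
proof -
  have *: "frac_class R (a' \<otimes> c') (b' \<otimes> d') = frac_class R (a \<otimes> c) (b \<otimes> d)"
    if "(a', b') \<in> frac_class R a b" "(c', d') \<in> frac_class R c d" for a' b' c' d'
  proof -
    have h: "a' \<in> carrier R" "b' \<in> carrier R - {\<zero>}" "a \<otimes> b' = a' \<otimes> b" "c' \<in> carrier R" "d' \<in> carrier R - {\<zero>}" "c \<otimes> d' = c' \<otimes> d"
      using that by (auto simp: frac_class_def)
    have "(a' \<otimes> c') \<otimes> (b \<otimes> d) = (a' \<otimes> b) \<otimes> (c' \<otimes> d)" using h(1,4) assms by (simp add: m_ac)
    also have "\<dots> = (a \<otimes> b') \<otimes> (c \<otimes> d')" using h by simp
    also have "\<dots> = (a \<otimes> c) \<otimes> (b' \<otimes> d')" using h(2,5) assms by (simp add: m_ac)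
    finally show ?thesis using h(1,2,4,5) assms nonzero_mult_closed by (subst frac_class_eq_iff) simp_all
  qed
  have ne: "frac_class R a b \<noteq> {}" "frac_class R c d \<noteq> {}" using frac_class_self assms by blast+
  show ?thesis
    unfolding fraction_field_def monoid.simps
    by (intro SUP_eq_const[OF ne(1)]) (auto intro!: SUP_eq_const[OF ne(2)] *)
qed

lemma frac_class_add:
  assumes "a \<in> carrier R" "b \<in> carrier R - {\<zero>}" "c \<in> carrier R" "d \<in> carrier R - {\<zero>}"
  shows "frac_class R a b \<oplus>\<^bsub>fraction_field R\<^esub> frac_class R c d = frac_class R (a \<otimes> d \<oplus> c \<otimes> b) (b \<otimes> d)"
proof -
  have *: "frac_class R (a' \<otimes> d' \<oplus> c' \<otimes> b') (b' \<otimes> d') = frac_class R (a \<otimes> d \<oplus> c \<otimes> b) (b \<otimes> d)"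
    if "(a', b') \<in> frac_class R a b" "(c', d') \<in> frac_class R c d" for a' b' c' d'
  proof -
    have h: "a' \<in> carrier R" "b' \<in> carrier R - {\<zero>}" "a \<otimes> b' = a' \<otimes> b" "c' \<in> carrier R" "d' \<in> carrier R - {\<zero>}" "c \<otimes> d' = c' \<otimes> d"
      using that by (auto simp: frac_class_def)
    have c: "a \<in> carrier R" "b \<in> carrier R" "c \<in> carrier R" "d \<in> carrier R" "b' \<in> carrier R" "d' \<in> carrier R"
      using assms h by auto
    have "(a' \<otimes> d' \<oplus> c' \<otimes> b') \<otimes> (b \<otimes> d) = (a' \<otimes> b) \<otimes> (d \<otimes> d') \<oplus> (c' \<otimes> d) \<otimes> (b \<otimes> b')" using h(1,4) c by algebra
    also have "\<dots> = (a \<otimes> b') \<otimes> (d \<otimes> d') \<oplus> (c \<otimes> d') \<otimes> (b \<otimes> b')" using h by simp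
    also have "\<dots> = (a \<otimes> d \<oplus> c \<otimes> b) \<otimes> (b' \<otimes> d')" using c by algebra
    finally show ?thesis using h(1,2,4,5) assms nonzero_mult_closed by (subst frac_class_eq_iff) simp_all
  qed
  have ne: "frac_class R a b \<noteq> {}" "frac_class R c d \<noteq> {}" using frac_class_self assms by blast+
  show ?thesis
    unfolding fraction_field_def ring_record_simps
    by (intro SUP_eq_const[OF ne(1)]) (auto intro!: SUP_eq_const[OF ne(2)] *)
qed

lemma frac_class_closed:
  "a \<in> carrier R \<Longrightarrow> b \<in> carrier R - {\<zero>} \<Longrightarrow> frac_class R a b \<in> carrier (fraction_field R)"
  by (auto simp: fraction_field_def)

lemma fraction_fieldE:
  assumes "x \<in> carrier (fraction_field R)"
  obtains a b where "a \<in> carrier R" "b \<in> carrier R - {\<zero>}" "x = frac_class R a b"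
  using assms by (auto simp: fraction_field_def)

lemma one_nonzero: "\<one> \<in> carrier R - {\<zero>}"
  by simp

lemma fraction_field_one: "\<one>\<^bsub>fraction_field R\<^esub> = frac_class R \<one> \<one>"
  and fraction_field_zero: "\<zero>\<^bsub>fraction_field R\<^esub> = frac_class R \<zero> \<one>"
  by (simp_all add: fraction_field_def)

lemma cring_fraction_field: "cring (fraction_field R)"
proof (rule cringI)
  note ops = frac_class_add frac_class_mult fraction_field_one fraction_field_zero
  show "abelian_group (fraction_field R)"
  proof (rule abelian_groupI)
    fix x y z assume "x \<in> carrier (fraction_field R)" "y \<in> carrier (fraction_field R)" "z \<in> carrier (fraction_field R)"
    then obtain a b c d e f where h: "a \<in> carrier R" "b \<in> carrier R - {\<zero>}" "c \<in> carrier R" "d \<in> carrier R - {\<zero>}"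
        "e \<in> carrier R" "f \<in> carrier R - {\<zero>}"
      and x: "x = frac_class R a b" "y = frac_class R c d" "z = frac_class R e f"
      by (elim fraction_fieldE)
    have k: "b \<in> carrier R" "d \<in> carrier R" "f \<in> carrier R" using h by auto
    have n: "b \<otimes> d \<in> carrier R - {\<zero>}" "d \<otimes> f \<in> carrier R - {\<zero>}" using nonzero_mult_closed h by auto
    have "x \<oplus>\<^bsub>fraction_field R\<^esub> y \<oplus>\<^bsub>fraction_field R\<^esub> z =
      frac_class R ((a \<otimes> d \<oplus> c \<otimes> b) \<otimes> f \<oplus> e \<otimes> (b \<otimes> d)) ((b \<otimes> d) \<otimes> f)"
      using h n k x by (simp add: frac_class_add)
    also have "(a \<otimes> d \<oplus> c \<otimes> b) \<otimes> f \<oplus> e \<otimes> (b \<otimes> d) = a \<otimes> (d \<otimes> f) \<oplus> (c \<otimes> f \<oplus> e \<otimes> d) \<otimes> b"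
      using h(1,3,5) k by algebra
    also have "(b \<otimes> d) \<otimes> f = b \<otimes> (d \<otimes> f)" using k by algebra
    also have "frac_class R (a \<otimes> (d \<otimes> f) \<oplus> (c \<otimes> f \<oplus> e \<otimes> d) \<otimes> b) (b \<otimes> (d \<otimes> f)) =
       x \<oplus>\<^bsub>fraction_field R\<^esub> (y \<oplus>\<^bsub>fraction_field R\<^esub> z)"
      using h n k x by (simp add: frac_class_add)
    finally show "x \<oplus>\<^bsub>fraction_field R\<^esub> y \<oplus>\<^bsub>fraction_field R\<^esub> z = x \<oplus>\<^bsub>fraction_field R\<^esub> (y \<oplus>\<^bsub>fraction_field R\<^esub> z)" .
  next
    fix x y assume "x \<in> carrier (fraction_field R)" "y \<in> carrier (fraction_field R)"
    then obtain a b c d where h: "a \<in> carrier R" "b \<in> carrier R - {\<zero>}" "c \<in> carrier R" "d \<in> carrier R - {\<zero>}"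
      and x: "x = frac_class R a b" "y = frac_class R c d"
      by (elim fraction_fieldE)
    have k: "b \<in> carrier R" "d \<in> carrier R" using h by auto
    have n: "b \<otimes> d \<in> carrier R - {\<zero>}" using nonzero_mult_closed h by auto
    show "x \<oplus>\<^bsub>fraction_field R\<^esub> y \<in> carrier (fraction_field R)"
      using h k x frac_class_closed[OF _ n] by (simp add: frac_class_add)
    have "a \<otimes> d \<oplus> c \<otimes> b = c \<otimes> b \<oplus> a \<otimes> d" "b \<otimes> d = d \<otimes> b" using h k by algebra+
    then show "x \<oplus>\<^bsub>fraction_field R\<^esub> y = y \<oplus>\<^bsub>fraction_field R\<^esub> x" using h x by (simp add: frac_class_add)
  next
    show "\<zero>\<^bsub>fraction_field R\<^esub> \<in> carrier (fraction_field R)"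
      using frac_class_closed[OF zero_closed one_nonzero] by (simp add: fraction_field_zero)
  next
    fix x assume "x \<in> carrier (fraction_field R)"
    then obtain a b where h: "a \<in> carrier R" "b \<in> carrier R - {\<zero>}" and x: "x = frac_class R a b"
      by (elim fraction_fieldE)
    have k: "b \<in> carrier R" using h by auto
    show "\<zero>\<^bsub>fraction_field R\<^esub> \<oplus>\<^bsub>fraction_field R\<^esub> x = x"
      using h k x one_nonzero by (simp add: frac_class_add fraction_field_zero)
    have "(\<ominus> a) \<otimes> b \<oplus> a \<otimes> b = \<zero>" using h k by algebra
    then have "frac_class R (\<ominus> a) b \<oplus>\<^bsub>fraction_field R\<^esub> x = frac_class R \<zero> (b \<otimes> b)"
      using h k x by (simp add: frac_class_add)
    also have "\<dots> = \<zero>\<^bsub>fraction_field R\<^esub>"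
      unfolding fraction_field_zero using nonzero_mult_closed[OF h(2) h(2)] one_nonzero k by (subst frac_class_eq_iff) simp_all
    finally show "\<exists>y\<in>carrier (fraction_field R). y \<oplus>\<^bsub>fraction_field R\<^esub> x = \<zero>\<^bsub>fraction_field R\<^esub>"
      using frac_class_closed[OF a_inv_closed[OF h(1)] h(2)] by blast
  qed
  show "comm_monoid (fraction_field R)"
  proof (rule comm_monoidI)
    fix x y z assume "x \<in> carrier (fraction_field R)" "y \<in> carrier (fraction_field R)" "z \<in> carrier (fraction_field R)"
    then obtain a b c d e f where h: "a \<in> carrier R" "b \<in> carrier R - {\<zero>}" "c \<in> carrier R" "d \<in> carrier R - {\<zero>}"
        "e \<in> carrier R" "f \<in> carrier R - {\<zero>}"
      and x: "x = frac_class R a b" "y = frac_class R c d" "z = frac_class R e f"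
      by (elim fraction_fieldE)
    have n: "b \<otimes> d \<in> carrier R - {\<zero>}" "d \<otimes> f \<in> carrier R - {\<zero>}" using nonzero_mult_closed h by auto
    show "x \<otimes>\<^bsub>fraction_field R\<^esub> y \<otimes>\<^bsub>fraction_field R\<^esub> z = x \<otimes>\<^bsub>fraction_field R\<^esub> (y \<otimes>\<^bsub>fraction_field R\<^esub> z)"
      using h n x by (simp add: frac_class_mult m_assoc)
  next
    fix x y assume "x \<in> carrier (fraction_field R)" "y \<in> carrier (fraction_field R)"
    then obtain a b c d where h: "a \<in> carrier R" "b \<in> carrier R - {\<zero>}" "c \<in> carrier R" "d \<in> carrier R - {\<zero>}"
      and x: "x = frac_class R a b" "y = frac_class R c d"
      by (elim fraction_fieldE)
    have n: "b \<otimes> d \<in> carrier R - {\<zero>}" using nonzero_mult_closed h by auto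
    show "x \<otimes>\<^bsub>fraction_field R\<^esub> y \<in> carrier (fraction_field R)"
      using h x frac_class_closed[OF _ n] by (simp add: frac_class_mult)
    show "x \<otimes>\<^bsub>fraction_field R\<^esub> y = y \<otimes>\<^bsub>fraction_field R\<^esub> x"
      using h x by (simp add: frac_class_mult m_comm)
  next
    show "\<one>\<^bsub>fraction_field R\<^esub> \<in> carrier (fraction_field R)"
      using frac_class_closed[OF one_closed one_nonzero] by (simp add: fraction_field_one)
    fix x assume "x \<in> carrier (fraction_field R)"
    then obtain a b where h: "a \<in> carrier R" "b \<in> carrier R - {\<zero>}" and x: "x = frac_class R a b"
      by (elim fraction_fieldE)
    show "\<one>\<^bsub>fraction_field R\<^esub> \<otimes>\<^bsub>fraction_field R\<^esub> x = x"
      using h x one_nonzero by (simp add: frac_class_mult fraction_field_one)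
  qed
  fix x y z assume "x \<in> carrier (fraction_field R)" "y \<in> carrier (fraction_field R)" "z \<in> carrier (fraction_field R)"
  then obtain a b c d e f where h: "a \<in> carrier R" "b \<in> carrier R - {\<zero>}" "c \<in> carrier R" "d \<in> carrier R - {\<zero>}"
      "e \<in> carrier R" "f \<in> carrier R - {\<zero>}"
    and x: "x = frac_class R a b" "y = frac_class R c d" "z = frac_class R e f"
    by (elim fraction_fieldE)
  have k: "b \<in> carrier R" "d \<in> carrier R" "f \<in> carrier R" using h by auto
  have n: "b \<otimes> d \<in> carrier R - {\<zero>}" "b \<otimes> f \<in> carrier R - {\<zero>}" "d \<otimes> f \<in> carrier R - {\<zero>}"
    using nonzero_mult_closed h by auto
  have l: "(x \<oplus>\<^bsub>fraction_field R\<^esub> y) \<otimes>\<^bsub>fraction_field R\<^esub> z = frac_class R ((a \<otimes> d \<oplus> c \<otimes> b) \<otimes> e) ((b \<otimes> d) \<otimes> f)"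
    using h n k x by (simp add: frac_class_mult frac_class_add)
  have r: "x \<otimes>\<^bsub>fraction_field R\<^esub> z \<oplus>\<^bsub>fraction_field R\<^esub> y \<otimes>\<^bsub>fraction_field R\<^esub> z =
      frac_class R ((a \<otimes> e) \<otimes> (d \<otimes> f) \<oplus> (c \<otimes> e) \<otimes> (b \<otimes> f)) ((b \<otimes> f) \<otimes> (d \<otimes> f))"
    using h n k x by (simp add: frac_class_mult frac_class_add)
  have eq: "((a \<otimes> d \<oplus> c \<otimes> b) \<otimes> e) \<otimes> ((b \<otimes> f) \<otimes> (d \<otimes> f)) =
    ((a \<otimes> e) \<otimes> (d \<otimes> f) \<oplus> (c \<otimes> e) \<otimes> (b \<otimes> f)) \<otimes> ((b \<otimes> d) \<otimes> f)"
    using h(1,3,5) k by algebra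
  show "(x \<oplus>\<^bsub>fraction_field R\<^esub> y) \<otimes>\<^bsub>fraction_field R\<^esub> z =
    x \<otimes>\<^bsub>fraction_field R\<^esub> z \<oplus>\<^bsub>fraction_field R\<^esub> y \<otimes>\<^bsub>fraction_field R\<^esub> z"
    unfolding l r using h(1,3,5) k eq nonzero_mult_closed[OF n(1) h(6)] nonzero_mult_closed[OF n(2,3)]
    by (subst frac_class_eq_iff) simp_all
qed

lemma fraction_field_emb: "(\<lambda>a. frac_class R a \<one>) \<in> ring_hom R (fraction_field R)"
  using frac_class_closed one_nonzero
  by (intro ring_hom_memI) (simp_all add: frac_class_mult frac_class_add fraction_field_one)

lemma fraction_field_emb_inj:
  "a \<in> carrier R \<Longrightarrow> b \<in> carrier R \<Longrightarrow> frac_class R a \<one> = frac_class R b \<one> \<longleftrightarrow> a = b"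
  using one_nonzero by (subst frac_class_eq_iff) simp_all

end

text \<open>\<open>K\<close> and \<open>D\<close> stand for \<open>\<rat>\<^sub>p\<close> and \<open>\<int>\<^sub>p\<close>.\<close>

locale local_subring = K: cring K for K :: "('k, 'm) ring_scheme" +
  fixes D :: "'k set" and p :: nat
  assumes subring_D: "subring D K"
    and prime_p: "Factorial_Ring.prime p"
    and inverse_D: "coprime k (int p) \<Longrightarrow> \<exists>d\<in>D. imul K k d = \<one>\<^bsub>K\<^esub>"
    and nonunit: "d \<in> D \<Longrightarrow> imul K (int p) d \<noteq> \<one>\<^bsub>K\<^esub>"
    and inverse_K: "k \<noteq> 0 \<Longrightarrow> \<exists>z\<in>carrier K. imul K k z = \<one>\<^bsub>K\<^esub>"

section \<open>The p-adic integers and their fraction field\<close>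

lemma imul_int_ring: "imul \<Z> k x = k * x"
proof -
  have Z: "abelian_group \<Z>" using int_is_cring by (simp add: cring_def ring_def)
  show ?thesis
  proof (induction k rule: int_induct[where k = 0])
    case base
    then show ?case using abelian_group.imul_0[OF Z] by simp
  next
    case (step1 i)
    then show ?case using abelian_group.imul_add[OF Z, of x i 1] abelian_group.imul_1[OF Z, of x] by (simp add: algebra_simps)
  next
    case (step2 i)
    have "x + \<ominus>\<^bsub>\<Z>\<^esub> x = 0" using abelian_group.r_neg[OF Z, of x] by simp
    with step2 show ?case
      using abelian_group.imul_diff[OF Z, of x i 1] abelian_group.imul_1[OF Z, of x] by (simp add: a_minus_def algebra_simps)
  qed
qed

lemma ideal_power_int: "ideal_power \<Z> (Idl\<^bsub>\<Z>\<^esub> {a}) n = {x. a ^ n dvd x}"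
proof (induction n)
  case 0
  show ?case by (simp add: cring.ideal_power_0[OF int_is_cring])
next
  case (Suc n)
  have I: "Idl\<^bsub>\<Z>\<^esub> {a} = {x. a dvd x}" by (auto simp: int_Idl dvd_def mult.commute)
  show ?case unfolding cring.ideal_power_Suc[OF int_is_cring] Suc
  proof (intro equalityI subsetI)
    fix x assume "x \<in> ideal_prod \<Z> (Idl\<^bsub>\<Z>\<^esub> {a}) {x. a ^ n dvd x}"
    then show "x \<in> {x. a ^ Suc n dvd x}"
      by (induction rule: ideal_prod.induct) (auto simp: I intro: mult_dvd_mono)
  next
    fix x assume "x \<in> {x. a ^ Suc n dvd x}"
    then obtain y where "x = a ^ Suc n * y" by blast
    then have "x = a * (a ^ n * y)" by simp
    then show "x \<in> ideal_prod \<Z> (Idl\<^bsub>\<Z>\<^esub> {a}) {x. a ^ n dvd x}"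
      using ideal_prod.prod[of a "Idl\<^bsub>\<Z>\<^esub> {a}" "a ^ n * y" "{x. a ^ n dvd x}" \<Z>] by (simp add: I)
  qed
qed

lemma adic_int: "adic \<Z> (Idl\<^bsub>\<Z>\<^esub> {a})"
  using ring.genideal_ideal[OF cring.axioms(1)[OF int_is_cring], of "{a}"] int_is_cring
  by (intro adic.intro) simp_all

lemma padic_coherent_cong:
  assumes "adic.coherent \<Z> (Idl\<^bsub>\<Z>\<^esub> {a}) x" "n \<le> m"
  shows "a ^ n dvd x n \<longleftrightarrow> a ^ n dvd x m"
proof -
  interpret adic \<Z> "Idl\<^bsub>\<Z>\<^esub> {a}" by (rule adic_int)
  have "a ^ n dvd x m - x n" using coherent_diff[OF assms] by (simp add: ideal_power_int)
  then show ?thesis by (metis dvd_diff_right_iff dvd_diff_left_iff)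
qed

lemma prime_power_dvd_mult_cases:
  fixes x y :: int
  assumes p: "Factorial_Ring.prime p" and d: "p ^ (a + b) dvd x * y"
  shows "p ^ a dvd x \<or> p ^ b dvd y"
proof (cases "x = 0 \<or> y = 0")
  case False
  have pe: "prime_elem p" by (rule prime_imp_prime_elem[OF p])
  have nu: "\<not> is_unit p" using p not_prime_unit by blast
  have "a + b \<le> multiplicity p (x * y)"
    using d False nu by (subst (asm) power_dvd_iff_le_multiplicity) auto
  also have "\<dots> = multiplicity p x + multiplicity p y"
    using prime_elem_multiplicity_mult_distrib[OF pe] False by simp
  finally have "a \<le> multiplicity p x \<or> b \<le> multiplicity p y" by arith
  then show ?thesis using multiplicity_dvd' by blast
qed auto

text \<open>If x is not divisible by p^a at level a and y not by p^b at level b, neither is at level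
  a + b; but there the product is divisible by p^(a+b), which is impossible for a prime.\<close>

lemma domain_padic_int_ring:
  assumes p: "Factorial_Ring.prime p"
  shows "domain (padic_int_ring p)"
proof -
  interpret adic \<Z> "Idl\<^bsub>\<Z>\<^esub> {int p}" by (rule adic_int)
  have pi: "Factorial_Ring.prime (int p)" using p by simp
  have zero_iff: "limit x = \<zero>\<^bsub>Rh\<^esub> \<longleftrightarrow> (\<forall>n. int p ^ n dvd x n)" if "coherent x" for x
    using limit_eq_iff[OF that coherent_const[of 0]] by (simp add: limit_zero ideal_power_int)
  show ?thesis
    unfolding padic_int_ring_def
  proof (rule domainI)
    show "cring Rh" by (rule cring_adic)
    have "\<not> (\<forall>n. int p ^ n dvd 1)" using not_prime_unit[of "int p"] pi by (metis power_one_right)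
    then show "\<one>\<^bsub>Rh\<^esub> \<noteq> \<zero>\<^bsub>Rh\<^esub>" using zero_iff[OF coherent_const[of 1]] by (simp add: limit_one)
    fix f g assume "f \<otimes>\<^bsub>Rh\<^esub> g = \<zero>\<^bsub>Rh\<^esub>" "f \<in> carrier Rh" "g \<in> carrier Rh"
    then obtain x y where x: "coherent x" "f = limit x" and y: "coherent y" "g = limit y" and 0: "limit x \<otimes>\<^bsub>Rh\<^esub> limit y = \<zero>\<^bsub>Rh\<^esub>"
      by (elim limitE) auto
    have xy: "int p ^ n dvd x n * y n" for n
      using 0 zero_iff[OF coherent_mult[OF x(1) y(1)]] limit_mult[OF x(1) y(1)] by simp
    show "f = \<zero>\<^bsub>Rh\<^esub> \<or> g = \<zero>\<^bsub>Rh\<^esub>"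
    proof (rule ccontr)
      assume "\<not> ?thesis"
      then obtain a b where "\<not> int p ^ a dvd x a" "\<not> int p ^ b dvd y b"
        using zero_iff[OF x(1)] zero_iff[OF y(1)] x(2) y(2) by blast
      then have "\<not> int p ^ a dvd x (a + b)" "\<not> int p ^ b dvd y (a + b)"
        using padic_coherent_cong[OF x(1), of a "a + b"] padic_coherent_cong[OF y(1), of b "a + b"] by simp_all
      then show False using prime_power_dvd_mult_cases[OF pi xy[of "a + b"]] by blast
    qed
  qed
qed

text \<open>Integers prime to \<open>p\<close> are invertible in the completion, while
  \<open>p\<close> is not, as is seen at level 1. Nonzero integers are invertible in the fraction
  field because only 0 is divisible by all powers of \<open>p\<close>.\<close>

lemma local_subring_padic:
  assumes p: "Factorial_Ring.prime p"
  shows "local_subring (padic_field p) (padic_integers p) p"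
proof -
  interpret adic \<Z> "Idl\<^bsub>\<Z>\<^esub> {int p}" by (rule adic_int)
  let ?R = "padic_int_ring p" and ?K = "padic_field p"
  have R: "?R = Rh" by (simp add: padic_int_ring_def)
  interpret R: domain ?R by (rule domain_padic_int_ring[OF p])
  have K: "?K = fraction_field ?R" by (simp add: padic_field_def)
  interpret K: cring ?K unfolding K by (rule R.cring_fraction_field)
  define \<iota> where "\<iota> a = frac_class ?R a \<one>\<^bsub>?R\<^esub>" for a
  have hom: "\<iota> \<in> ring_hom ?R ?K" unfolding \<iota>_def[abs_def] K by (rule R.fraction_field_emb)
  have inj: "\<iota> a = \<iota> b \<longleftrightarrow> a = b" if "a \<in> carrier ?R" "b \<in> carrier ?R" for a b
    unfolding \<iota>_def by (rule R.fraction_field_emb_inj[OF that])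
  have D: "padic_integers p = \<iota> ` carrier ?R" by (simp add: padic_integers_def \<iota>_def[abs_def])
  have im: "imul ?K k (\<iota> r) = \<iota> (imul ?R k r)" if "r \<in> carrier ?R" for k r
    using ring_hom_imul[OF R.ring_axioms K.ring_axioms hom that] by simp
  have one: "\<iota> \<one>\<^bsub>?R\<^esub> = \<one>\<^bsub>?K\<^esub>" by (rule ring_hom_one[OF hom])
  have lim1: "imul ?R k \<one>\<^bsub>?R\<^esub> = limit (\<lambda>_. k)" for k
    unfolding R limit_one using imul_limit[OF coherent_const[of 1]] by (simp add: imul_int_ring)
  have pI: "imul \<Z> (int p) 1 \<in> Idl\<^bsub>\<Z>\<^esub> {int p}"
    by (simp add: imul_int_ring int_Idl)
  have pi: "\<not> int p dvd 1" using prime_gt_1_nat[OF p] by simp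
  have char0: "imul ?R k \<one>\<^bsub>?R\<^esub> \<noteq> \<zero>\<^bsub>?R\<^esub>" if "k \<noteq> 0" for k
  proof
    assume "imul ?R k \<one>\<^bsub>?R\<^esub> = \<zero>\<^bsub>?R\<^esub>"
    then have "\<forall>n. int p ^ n dvd k"
      using limit_eq_iff[OF coherent_const[of k] coherent_const[of 0]] lim1 by (simp add: R limit_zero ideal_power_int)
    moreover have "finite {n. int p ^ n dvd k}"
      by (rule finite_divisor_powers) (use that pi in auto)
    ultimately show False by simp
  qed
  show ?thesis
  proof (intro local_subring.intro local_subring_axioms.intro)
    show "cring ?K" by (rule K.is_cring)
    show "Factorial_Ring.prime p" by (rule p)
    interpret h: ring_hom_ring ?R ?K \<iota>
      by (intro ring_hom_ringI2 R.ring_axioms K.ring_axioms hom)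
    show "subring (padic_integers p) ?K"
      unfolding D by (rule h.img_is_subring[OF R.carrier_is_subring])
  next
    fix k assume "coprime k (int p)"
    then obtain r where r: "r \<in> carrier ?R" "imul ?R k r = \<one>\<^bsub>?R\<^esub>"
      using unit_of_coprime[OF pI] unfolding R by blast
    then have "imul ?K k (\<iota> r) = \<one>\<^bsub>?K\<^esub>" using im[OF r(1)] one by simp
    then show "\<exists>d\<in>padic_integers p. imul ?K k d = \<one>\<^bsub>?K\<^esub>" using r(1) unfolding D by blast
  next
    fix d assume "d \<in> padic_integers p"
    then obtain r where r: "r \<in> carrier ?R" "d = \<iota> r" unfolding D by blast
    show "imul ?K (int p) d \<noteq> \<one>\<^bsub>?K\<^esub>"
    proof
      assume "imul ?K (int p) d = \<one>\<^bsub>?K\<^esub>"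
      then have e: "imul ?R (int p) r = \<one>\<^bsub>?R\<^esub>"
        using r im[OF r(1)] one inj[OF R.imul_closed[OF r(1)] R.one_closed] by simp
      obtain x where x: "coherent x" "r = limit x" using r(1) limitE unfolding R by blast
      have "limit (\<lambda>n. int p * x n) = limit (\<lambda>_. 1)"
        using e x(2) imul_limit[OF x(1), of "int p"] by (simp add: R limit_one imul_int_ring)
      then have "\<forall>n. int p ^ n dvd int p * x n - 1"
        using limit_eq_iff[OF coherent_imul[OF x(1), of "int p"] coherent_const[of 1]]
        by (simp add: imul_int_ring ideal_power_int)
      then have "int p ^ 1 dvd int p * x 1 - 1" by (rule spec)
      then have "int p dvd 1" by (metis dvd_diff_right_iff dvd_triv_left power_one_right)
      then show False using pi by blast
    qed
  next
    fix k :: int assume "k \<noteq> 0"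
    let ?k = "imul ?R k \<one>\<^bsub>?R\<^esub>"
    have k: "?k \<in> carrier ?R - {\<zero>\<^bsub>?R\<^esub>}" using char0[OF \<open>k \<noteq> 0\<close>] by simp
    have z: "frac_class ?R \<one>\<^bsub>?R\<^esub> ?k \<in> carrier ?K" unfolding K by (rule R.frac_class_closed[OF R.one_closed k])
    have "imul ?K k (frac_class ?R \<one>\<^bsub>?R\<^esub> ?k) = imul ?K k \<one>\<^bsub>?K\<^esub> \<otimes>\<^bsub>?K\<^esub> frac_class ?R \<one>\<^bsub>?R\<^esub> ?k"
      using K.imul_one[OF z] by simp
    also have "imul ?K k \<one>\<^bsub>?K\<^esub> = frac_class ?R ?k \<one>\<^bsub>?R\<^esub>"
      using im[OF R.one_closed, of k] one by (simp add: \<iota>_def)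
    also have "\<dots> \<otimes>\<^bsub>?K\<^esub> frac_class ?R \<one>\<^bsub>?R\<^esub> ?k = frac_class ?R (?k \<otimes>\<^bsub>?R\<^esub> \<one>\<^bsub>?R\<^esub>) (\<one>\<^bsub>?R\<^esub> \<otimes>\<^bsub>?R\<^esub> ?k)"
      unfolding K using k R.one_nonzero by (intro R.frac_class_mult) auto
    also have "\<dots> = \<one>\<^bsub>?K\<^esub>"
      unfolding K R.fraction_field_one using k R.one_nonzero by (subst R.frac_class_eq_iff) simp_all
    finally show "\<exists>z\<in>carrier ?K. imul ?K k z = \<one>\<^bsub>?K\<^esub>" using z by blast
  qed
qed

subsection \<open>Bad primes\<close>

lemma lin_spanI: "(\<And>N. submodule N R V \<Longrightarrow> S \<subseteq> N \<Longrightarrow> x \<in> N) \<Longrightarrow> x \<in> lin_span R V S"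
  by (auto simp: lin_span_def)

lemma base_change_simps:
  "carrier (base_change K L) = carrier (tensor K L)"
  "x \<otimes>\<^bsub>base_change K L\<^esub> y = x \<otimes>\<^bsub>tensor K L\<^esub> y"
  "\<one>\<^bsub>base_change K L\<^esub> = \<one>\<^bsub>tensor K L\<^esub>"
  "k \<odot>\<^bsub>base_change K L\<^esub> x = pure_tensor K L k \<one>\<^bsub>L\<^esub> \<otimes>\<^bsub>tensor K L\<^esub> x"
  by (simp_all add: base_change_def)

lemma subgroup_base_change:
  "subgroup H (add_monoid (base_change K L)) \<longleftrightarrow> subgroup H (add_monoid (tensor K L))"
  by (simp add: base_change_def subgroup_def m_inv_def)

lemma subring_base_change: "subring H (base_change K L) \<longleftrightarrow> subring H (tensor K L)"
  unfolding subring_def submonoid_def subgroup_base_change by (simp add: base_change_simps)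

lemma submodule_base_change:
  "submodule N (K\<lparr>carrier := E\<rparr>) (base_change K L) \<longleftrightarrow> additive_subgroup N (tensor K L) \<and>
    (\<forall>d\<in>E. \<forall>v\<in>N. pure_tensor K L d \<one>\<^bsub>L\<^esub> \<otimes>\<^bsub>tensor K L\<^esub> v \<in> N)"
  unfolding submodule_def submodule_axioms_def additive_subgroup_def subgroup_base_change
  by (auto simp: base_change_simps)

section \<open>Spans and linear functionals over the local subring\<close>

locale local_algebra = local_subring K D p + tensor_pair K L
  for K :: "('k, 'm) ring_scheme" and D p and L :: "('b, 'n) ring_scheme"
begin

abbreviation sm :: "'k \<Rightarrow> ('k \<times> 'b \<Rightarrow>\<^sub>0 int) set \<Rightarrow> ('k \<times> 'b \<Rightarrow>\<^sub>0 int) set" where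
  "sm d v \<equiv> pure_tensor K L d \<one>\<^bsub>L\<^esub> \<otimes>\<^bsub>tensor K L\<^esub> v"

abbreviation dspan :: "('k \<times> 'b \<Rightarrow>\<^sub>0 int) set set \<Rightarrow> ('k \<times> 'b \<Rightarrow>\<^sub>0 int) set set" where
  "dspan W \<equiv> lin_span (K\<lparr>carrier := D\<rparr>) (base_change K L) W"

lemma D_sub: "d \<in> D \<Longrightarrow> d \<in> carrier K" "\<one>\<^bsub>K\<^esub> \<in> D" "d \<in> D \<Longrightarrow> e \<in> D \<Longrightarrow> d \<otimes>\<^bsub>K\<^esub> e \<in> D"
  "additive_subgroup D K"
  using subringE[OF subring_D] subring.axioms(1)[OF subring_D] by (auto simp: additive_subgroup_def)

lemma sm_closed: "d \<in> carrier K \<Longrightarrow> v \<in> carrier (tensor K L) \<Longrightarrow> sm d v \<in> carrier (tensor K L)"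
  by simp

lemma sm_pure: "d \<in> carrier K \<Longrightarrow> z \<in> carrier K \<Longrightarrow> x \<in> carrier L \<Longrightarrow>
    sm d (pure_tensor K L z x) = pure_tensor K L (d \<otimes>\<^bsub>K\<^esub> z) x"
  by (simp add: pure_mult)

lemma carrier_submodule:
  assumes "E \<subseteq> carrier K"
  shows "submodule (carrier (tensor K L)) (K\<lparr>carrier := E\<rparr>) (base_change K L)"
  unfolding submodule_base_change using assms
  by (auto intro!: sm_closed T.additive_subgroupI')

lemma dspan_least:
  assumes "additive_subgroup N (tensor K L)" "\<And>d v. d \<in> D \<Longrightarrow> v \<in> N \<Longrightarrow> sm d v \<in> N" "W \<subseteq> N"
  shows "dspan W \<subseteq> N"
  using assms by (intro lin_span_least) (auto simp: submodule_base_change)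

lemma dspan_submodule:
  assumes "W \<subseteq> carrier (tensor K L)"
  shows "additive_subgroup (dspan W) (tensor K L)" "\<And>d v. d \<in> D \<Longrightarrow> v \<in> dspan W \<Longrightarrow> sm d v \<in> dspan W"
proof -
  let ?N = "{N. submodule N (K\<lparr>carrier := D\<rparr>) (base_change K L) \<and> W \<subseteq> N}"
  have c: "carrier (tensor K L) \<in> ?N" using carrier_submodule D_sub(1) assms by blast
  have a: "additive_subgroup N (tensor K L)" if "N \<in> ?N" for N
    using that unfolding submodule_base_change by blast
  show "additive_subgroup (dspan W) (tensor K L)"
    unfolding lin_span_def
  proof (rule T.additive_subgroupI')
    show "\<Inter>?N \<subseteq> carrier (tensor K L)" using c by blast
    show "\<zero>\<^bsub>tensor K L\<^esub> \<in> \<Inter>?N" using additive_subgroup.zero_closed[OF a] by (intro InterI)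
    show "u \<oplus>\<^bsub>tensor K L\<^esub> v \<in> \<Inter>?N" if "u \<in> \<Inter>?N" "v \<in> \<Inter>?N" for u v
      using additive_subgroup.a_closed[OF a] that by (intro InterI) (simp only: Inter_iff)
    show "\<ominus>\<^bsub>tensor K L\<^esub> u \<in> \<Inter>?N" if "u \<in> \<Inter>?N" for u
      using T.imul_in_additive_subgroup[OF a, of _ u "-1"] T.imul_neg[of u 1] T.imul_1[of u] that c
      by (intro InterI) (simp only: Inter_iff)
  qed
  show "sm d v \<in> dspan W" if "d \<in> D" "v \<in> dspan W" for d v
    using that unfolding lin_span_def submodule_base_change by blast
qed

lemma dspan_closed: "W \<subseteq> carrier (tensor K L) \<Longrightarrow> v \<in> dspan W \<Longrightarrow> v \<in> carrier (tensor K L)"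
  using additive_subgroup.a_subset[OF dspan_submodule(1)] by blast

text \<open>Bilinearity in two passes: one factor in \<open>W\<close> is held fixed while the other
  runs through the span, and then the roles are exchanged.\<close>

lemma dspan_mult:
  assumes W: "W \<subseteq> carrier (tensor K L)" and WW: "\<And>u v. u \<in> W \<Longrightarrow> v \<in> W \<Longrightarrow> u \<otimes>\<^bsub>tensor K L\<^esub> v \<in> dspan W"
    and u: "u \<in> dspan W" and v: "v \<in> dspan W"
  shows "u \<otimes>\<^bsub>tensor K L\<^esub> v \<in> dspan W"
proof -
  note S = dspan_submodule[OF W]
  interpret S: additive_subgroup "dspan W" "tensor K L" by (rule S(1))
  have ideal: "additive_subgroup {u \<in> carrier (tensor K L). u \<otimes>\<^bsub>tensor K L\<^esub> w \<in> dspan W} (tensor K L)"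
    "\<And>d u. d \<in> D \<Longrightarrow> u \<in> {u \<in> carrier (tensor K L). u \<otimes>\<^bsub>tensor K L\<^esub> w \<in> dspan W} \<Longrightarrow>
      sm d u \<in> {u \<in> carrier (tensor K L). u \<otimes>\<^bsub>tensor K L\<^esub> w \<in> dspan W}"
    if w: "w \<in> carrier (tensor K L)" for w
  proof -
    show "additive_subgroup {u \<in> carrier (tensor K L). u \<otimes>\<^bsub>tensor K L\<^esub> w \<in> dspan W} (tensor K L)"
      by (rule T.additive_subgroupI') (auto simp: T.l_distr T.l_minus w)
    fix d u assume "d \<in> D" "u \<in> {u \<in> carrier (tensor K L). u \<otimes>\<^bsub>tensor K L\<^esub> w \<in> dspan W}"
    then show "sm d u \<in> {u \<in> carrier (tensor K L). u \<otimes>\<^bsub>tensor K L\<^esub> w \<in> dspan W}"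
      using S(2)[of d "u \<otimes>\<^bsub>tensor K L\<^esub> w"] D_sub(1) w by (simp add: T.m_assoc)
  qed
  have 1: "u' \<otimes>\<^bsub>tensor K L\<^esub> w \<in> dspan W" if "w \<in> W" "u' \<in> dspan W" for u' w
    using dspan_least[OF ideal, of w W] that W WW by blast
  have uc: "u \<in> carrier (tensor K L)" using dspan_closed[OF W u] .
  have "w \<otimes>\<^bsub>tensor K L\<^esub> u \<in> dspan W" if w: "w \<in> W" for w
    using 1[OF w u] T.m_comm[OF uc, of w] W w by auto
  then have "v \<otimes>\<^bsub>tensor K L\<^esub> u \<in> dspan W"
    using dspan_least[OF ideal[OF uc], of W] v W by blast
  then show ?thesis using T.m_comm[OF dspan_closed[OF W u] dspan_closed[OF W v]] by simp
qed

text \<open>The \<open>K\<close>-linear extension of an integer-valued functional from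
  \<open>L\<close> to K \<otimes> L.\<close>

lemma functional:
  assumes \<psi>: "\<And>x y. x \<in> carrier L \<Longrightarrow> y \<in> carrier L \<Longrightarrow> \<psi> (x \<oplus>\<^bsub>L\<^esub> y) = \<psi> x + (\<psi> y :: int)"
  obtains F where "\<And>v. v \<in> carrier (tensor K L) \<Longrightarrow> F v \<in> carrier K"
    "\<And>v w. v \<in> carrier (tensor K L) \<Longrightarrow> w \<in> carrier (tensor K L) \<Longrightarrow> F (v \<oplus>\<^bsub>tensor K L\<^esub> w) = F v \<oplus>\<^bsub>K\<^esub> F w"
    "\<And>z x. z \<in> carrier K \<Longrightarrow> x \<in> carrier L \<Longrightarrow> F (pure_tensor K L z x) = imul K (\<psi> x) z"
    "\<And>d v. d \<in> carrier K \<Longrightarrow> v \<in> carrier (tensor K L) \<Longrightarrow> F (sm d v) = d \<otimes>\<^bsub>K\<^esub> F v"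
proof -
  obtain F where F: "F \<in> carrier (tensor K L) \<rightarrow> carrier K"
    "\<And>v w. v \<in> carrier (tensor K L) \<Longrightarrow> w \<in> carrier (tensor K L) \<Longrightarrow> F (v \<oplus>\<^bsub>tensor K L\<^esub> w) = F v \<oplus>\<^bsub>K\<^esub> F w"
    "\<And>z x. z \<in> carrier K \<Longrightarrow> x \<in> carrier L \<Longrightarrow> F (pure_tensor K L z x) = imul K (\<psi> x) z"
    by (rule tensor_universal[of K "\<lambda>z x. imul K (\<psi> x) z"])
      (auto simp: K.abelian_group_axioms K.imul_distrib K.imul_add \<psi>)
  have "F (sm d v) = d \<otimes>\<^bsub>K\<^esub> F v" if d: "d \<in> carrier K" and v: "v \<in> carrier (tensor K L)" for d v
  proof (rule additive_eqI[OF K.abelian_group_axioms _ _ _ _ _ v])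
    show "(\<lambda>v. F (sm d v)) \<in> carrier (tensor K L) \<rightarrow> carrier K" using F(1) d by auto
    show "(\<lambda>v. d \<otimes>\<^bsub>K\<^esub> F v) \<in> carrier (tensor K L) \<rightarrow> carrier K" using F(1) d by auto
  next
    fix x y assume x: "x \<in> carrier (tensor K L)" "y \<in> carrier (tensor K L)"
    show "F (sm d (x \<oplus>\<^bsub>tensor K L\<^esub> y)) = F (sm d x) \<oplus>\<^bsub>K\<^esub> F (sm d y)" using x d F(2) by (simp add: T.r_distr)
    have "F x \<in> carrier K" "F y \<in> carrier K" using F(1) x by auto
    then show "d \<otimes>\<^bsub>K\<^esub> F (x \<oplus>\<^bsub>tensor K L\<^esub> y) = d \<otimes>\<^bsub>K\<^esub> F x \<oplus>\<^bsub>K\<^esub> d \<otimes>\<^bsub>K\<^esub> F y"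
      using x d F(2) by (simp add: K.r_distr)
  next
    fix a b assume a: "a \<in> carrier K" "b \<in> carrier L"
    show "F (sm d (pure_tensor K L a b)) = d \<otimes>\<^bsub>K\<^esub> F (pure_tensor K L a b)"
      using a d by (simp add: sm_pure F(3) K.imul_rdistr)
  qed
  then show ?thesis using that[of F] F by auto
qed

lemma dspan_functional:
  assumes F: "\<And>v. v \<in> carrier (tensor K L) \<Longrightarrow> F v \<in> carrier K"
    "\<And>v w. v \<in> carrier (tensor K L) \<Longrightarrow> w \<in> carrier (tensor K L) \<Longrightarrow> F (v \<oplus>\<^bsub>tensor K L\<^esub> w) = F v \<oplus>\<^bsub>K\<^esub> F w"
    "\<And>d v. d \<in> carrier K \<Longrightarrow> v \<in> carrier (tensor K L) \<Longrightarrow> F (sm d v) = d \<otimes>\<^bsub>K\<^esub> F v"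
    and N: "additive_subgroup N K" "\<And>d x. d \<in> D \<Longrightarrow> x \<in> N \<Longrightarrow> d \<otimes>\<^bsub>K\<^esub> x \<in> N"
    and W: "W \<subseteq> carrier (tensor K L)" "\<And>w. w \<in> W \<Longrightarrow> F w \<in> N" and v: "v \<in> dspan W"
  shows "F v \<in> N"
proof -
  interpret N: additive_subgroup N K by (rule N(1))
  have F_imul: "F (imul (tensor K L) k v) = imul K k (F v)" if "v \<in> carrier (tensor K L)" for k v
    by (rule additive_imul[OF T.abelian_group_axioms K.abelian_group_axioms _ F(2) that]) (use F(1) in auto)
  have "dspan W \<subseteq> {v \<in> carrier (tensor K L). F v \<in> N}"
  proof (rule dspan_least)
    show "additive_subgroup {v \<in> carrier (tensor K L). F v \<in> N} (tensor K L)"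
    proof (rule T.additive_subgroupI')
      show "\<zero>\<^bsub>tensor K L\<^esub> \<in> {v \<in> carrier (tensor K L). F v \<in> N}"
        using F_imul[of "\<zero>\<^bsub>tensor K L\<^esub>" 0] F(1)[of "\<zero>\<^bsub>tensor K L\<^esub>"] N.zero_closed by simp
      fix u assume u: "u \<in> {v \<in> carrier (tensor K L). F v \<in> N}"
      have "\<ominus>\<^bsub>tensor K L\<^esub> u = imul (tensor K L) (-1) u" using T.imul_neg[of u 1] T.imul_1[of u] u by simp
      then show "\<ominus>\<^bsub>tensor K L\<^esub> u \<in> {v \<in> carrier (tensor K L). F v \<in> N}"
        using F_imul[of u "-1"] K.imul_in_additive_subgroup[OF N(1), of "F u" "-1"] u by simp
    qed (auto simp: F(2))
    show "sm d v \<in> {v \<in> carrier (tensor K L). F v \<in> N}" if "d \<in> D" "v \<in> {v \<in> carrier (tensor K L). F v \<in> N}" for d v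
      using that N(2) D_sub(1) F(3) by simp
    show "W \<subseteq> {v \<in> carrier (tensor K L). F v \<in> N}" using W by blast
  qed
  then show ?thesis using v by blast
qed

lemma pure_one_subset: "Y \<subseteq> carrier L \<Longrightarrow> pure_tensor K L \<one>\<^bsub>K\<^esub> ` Y \<subseteq> carrier (tensor K L)"
  by auto

text \<open>An integer \<open>m\<close> prime to \<open>p\<close> is a unit of \<open>D\<close>, so
  that 1 \<otimes> x is the multiple by 1/m of 1 \<otimes> mx.\<close>

lemma dspan_coprime_index:
  assumes Y: "Y \<subseteq> carrier L" and m: "coprime m (int p)" "\<And>x. x \<in> carrier L \<Longrightarrow> imul L m x \<in> Y"
  shows "dspan (pure_tensor K L \<one>\<^bsub>K\<^esub> ` Y) = dspan (pure_tensor K L \<one>\<^bsub>K\<^esub> ` carrier L)"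
proof (rule equalityI)
  show "dspan (pure_tensor K L \<one>\<^bsub>K\<^esub> ` Y) \<subseteq> dspan (pure_tensor K L \<one>\<^bsub>K\<^esub> ` carrier L)"
    using Y by (intro lin_span_mono image_mono)
  note S = dspan_submodule[OF pure_one_subset[OF Y]]
  show "dspan (pure_tensor K L \<one>\<^bsub>K\<^esub> ` carrier L) \<subseteq> dspan (pure_tensor K L \<one>\<^bsub>K\<^esub> ` Y)"
  proof (rule dspan_least[OF S])
    show "pure_tensor K L \<one>\<^bsub>K\<^esub> ` carrier L \<subseteq> dspan (pure_tensor K L \<one>\<^bsub>K\<^esub> ` Y)"
    proof (rule image_subsetI)
      fix x assume x: "x \<in> carrier L"
      obtain d where d: "d \<in> D" "imul K m d = \<one>\<^bsub>K\<^esub>" using inverse_D[OF m(1)] by blast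
      have "pure_tensor K L \<one>\<^bsub>K\<^esub> (imul L m x) \<in> dspan (pure_tensor K L \<one>\<^bsub>K\<^esub> ` Y)"
        by (rule subsetD[OF lin_span_superset imageI[OF m(2)[OF x]]])
      then have "sm d (pure_tensor K L \<one>\<^bsub>K\<^esub> (imul L m x)) \<in> dspan (pure_tensor K L \<one>\<^bsub>K\<^esub> ` Y)"
        by (rule S(2)[OF d(1)])
      also have "sm d (pure_tensor K L \<one>\<^bsub>K\<^esub> (imul L m x)) = pure_tensor K L (imul K m d) x"
      proof -
        have "pure_tensor K L \<one>\<^bsub>K\<^esub> (imul L m x) = pure_tensor K L (imul K m \<one>\<^bsub>K\<^esub>) x"
          using pure_imul_left[OF K.one_closed x, of m] pure_imul_right[OF K.one_closed x, of m] by simp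
        then show ?thesis
          using sm_pure[OF D_sub(1)[OF d(1)] K.imul_closed[OF K.one_closed] x, of m]
            K.imul_rdistr[OF D_sub(1)[OF d(1)] K.one_closed, of m] D_sub(1)[OF d(1)] by simp
      qed
      finally show "pure_tensor K L \<one>\<^bsub>K\<^esub> x \<in> dspan (pure_tensor K L \<one>\<^bsub>K\<^esub> ` Y)" by (simp add: d(2))
    qed
  qed
qed

lemma imul_one_D: "imul K k \<one>\<^bsub>K\<^esub> \<in> D"
  using K.imul_in_additive_subgroup[OF D_sub(4,2)] .

text \<open>If an integer prime to \<open>p\<close> were in pD, Bezout would make \<open>p\<close>
  invertible in \<open>D\<close>.\<close>

lemma not_multiple_of_p:
  assumes k: "\<not> int p dvd k" and d: "d \<in> D"
  shows "imul K k \<one>\<^bsub>K\<^esub> \<noteq> imul K (int p) d"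
proof
  assume e: "imul K k \<one>\<^bsub>K\<^esub> = imul K (int p) d"
  have "coprime (int p) k" using k prime_p prime_imp_coprime by (metis prime_int_nat_transfer nat_int of_nat_0_le_iff)
  then obtain u v where uv: "u * int p + v * k = 1" using coprime_bezout by blast
  have dK: "d \<in> carrier K" "imul K u \<one>\<^bsub>K\<^esub> \<in> carrier K" "imul K v d \<in> carrier K" using D_sub(1)[OF d] by auto
  have "\<one>\<^bsub>K\<^esub> = imul K (int p * u + v * k) \<one>\<^bsub>K\<^esub>" using uv by (simp add: mult.commute)
  also have "\<dots> = imul K (int p) (imul K u \<one>\<^bsub>K\<^esub>) \<oplus>\<^bsub>K\<^esub> imul K v (imul K (int p) d)"
    using K.imul_add[OF K.one_closed] K.imul_mult[OF K.one_closed] e by simp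
  also have "imul K v (imul K (int p) d) = imul K (int p) (imul K v d)"
    using K.imul_mult[OF dK(1), of v "int p"] K.imul_mult[OF dK(1), of "int p" v] by (simp add: mult.commute)
  also have "imul K (int p) (imul K u \<one>\<^bsub>K\<^esub>) \<oplus>\<^bsub>K\<^esub> imul K (int p) (imul K v d) =
      imul K (int p) (imul K u \<one>\<^bsub>K\<^esub> \<oplus>\<^bsub>K\<^esub> imul K v d)"
    using K.imul_distrib[OF dK(2,3)] by simp
  finally have "imul K (int p) (imul K u \<one>\<^bsub>K\<^esub> \<oplus>\<^bsub>K\<^esub> imul K v d) = \<one>\<^bsub>K\<^esub>" by simp
  moreover have "imul K u \<one>\<^bsub>K\<^esub> \<oplus>\<^bsub>K\<^esub> imul K v d \<in> D"
    using additive_subgroup.a_closed[OF D_sub(4) imul_one_D K.imul_in_additive_subgroup[OF D_sub(4) d]] .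
  ultimately show False using nonunit by blast
qed

text \<open>The extended functional maps the span of \<open>Y\<close> into pD, but the value at 1
  \<otimes> x is the integer \<open>\<psi> x\<close>, which is not in pD.\<close>

lemma dspan_proper:
  assumes Y: "Y \<subseteq> carrier L" and \<psi>: "\<And>x y. x \<in> carrier L \<Longrightarrow> y \<in> carrier L \<Longrightarrow> \<psi> (x \<oplus>\<^bsub>L\<^esub> y) = \<psi> x + (\<psi> y :: int)"
    and Y0: "\<And>y. y \<in> Y \<Longrightarrow> int p dvd \<psi> y" and x: "x \<in> carrier L" "\<not> int p dvd \<psi> x"
  shows "dspan (pure_tensor K L \<one>\<^bsub>K\<^esub> ` Y) \<noteq> dspan (pure_tensor K L \<one>\<^bsub>K\<^esub> ` carrier L)"
proof
  assume e: "dspan (pure_tensor K L \<one>\<^bsub>K\<^esub> ` Y) = dspan (pure_tensor K L \<one>\<^bsub>K\<^esub> ` carrier L)"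
  obtain F where F: "\<And>v. v \<in> carrier (tensor K L) \<Longrightarrow> F v \<in> carrier K"
    "\<And>v w. v \<in> carrier (tensor K L) \<Longrightarrow> w \<in> carrier (tensor K L) \<Longrightarrow> F (v \<oplus>\<^bsub>tensor K L\<^esub> w) = F v \<oplus>\<^bsub>K\<^esub> F w"
    "\<And>z x. z \<in> carrier K \<Longrightarrow> x \<in> carrier L \<Longrightarrow> F (pure_tensor K L z x) = imul K (\<psi> x) z"
    "\<And>d v. d \<in> carrier K \<Longrightarrow> v \<in> carrier (tensor K L) \<Longrightarrow> F (sm d v) = d \<otimes>\<^bsub>K\<^esub> F v"
    using functional[OF \<psi>] by blast
  let ?N = "imul K (int p) ` D"
  interpret D: additive_subgroup D K by (rule D_sub(4))
  have "F (pure_tensor K L \<one>\<^bsub>K\<^esub> x) \<in> ?N"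
  proof (rule dspan_functional[OF F(1,2,4)])
    show "additive_subgroup ?N K"
    proof (rule K.additive_subgroupI')
      show "?N \<subseteq> carrier K" using D_sub(1) by auto
      show "\<zero>\<^bsub>K\<^esub> \<in> ?N" using D.zero_closed K.imul_zero by (metis image_eqI)
      fix u assume u: "u \<in> ?N"
      then obtain d where d: "d \<in> D" "u = imul K (int p) d" by blast
      have "\<ominus>\<^bsub>K\<^esub> u = imul K (int p) (\<ominus>\<^bsub>K\<^esub> d)" using K.imul_minus[OF D_sub(1)[OF d(1)]] d(2) by simp
      then show "\<ominus>\<^bsub>K\<^esub> u \<in> ?N" using D.a_inv_closed[OF d(1)] by blast
      fix v assume "v \<in> ?N"
      then obtain d' where d': "d' \<in> D" "v = imul K (int p) d'" by blast
      have "u \<oplus>\<^bsub>K\<^esub> v = imul K (int p) (d \<oplus>\<^bsub>K\<^esub> d')"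
        using K.imul_distrib[OF D_sub(1)[OF d(1)] D_sub(1)[OF d'(1)]] d(2) d'(2) by simp
      then show "u \<oplus>\<^bsub>K\<^esub> v \<in> ?N" using D.a_closed[OF d(1) d'(1)] by blast
    qed
    show "d \<otimes>\<^bsub>K\<^esub> u \<in> ?N" if d: "d \<in> D" and u: "u \<in> ?N" for d u
    proof -
      obtain d' where d': "d' \<in> D" "u = imul K (int p) d'" using u by blast
      have "d \<otimes>\<^bsub>K\<^esub> u = imul K (int p) (d \<otimes>\<^bsub>K\<^esub> d')"
        using K.imul_rdistr[OF D_sub(1)[OF d] D_sub(1)[OF d'(1)]] d'(2) by simp
      then show ?thesis using D_sub(3)[OF d d'(1)] by blast
    qed
    show "pure_tensor K L \<one>\<^bsub>K\<^esub> ` Y \<subseteq> carrier (tensor K L)" by (rule pure_one_subset[OF Y])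
    show "F w \<in> ?N" if "w \<in> pure_tensor K L \<one>\<^bsub>K\<^esub> ` Y" for w
    proof -
      obtain y where y: "y \<in> Y" "w = pure_tensor K L \<one>\<^bsub>K\<^esub> y" using \<open>w \<in> _\<close> by blast
      obtain k where k: "\<psi> y = int p * k" using Y0[OF y(1)] by blast
      have "F w = imul K (int p) (imul K k \<one>\<^bsub>K\<^esub>)" using F(3)[OF K.one_closed, of y] y Y k K.imul_mult[OF K.one_closed, of "int p" k] by auto
      then show ?thesis using imul_one_D by blast
    qed
    show "pure_tensor K L \<one>\<^bsub>K\<^esub> x \<in> dspan (pure_tensor K L \<one>\<^bsub>K\<^esub> ` Y)"
      unfolding e by (rule subsetD[OF lin_span_superset imageI[OF x(1)]])
  qed
  then show False using F(3)[OF K.one_closed x(1)] not_multiple_of_p[OF x(2)] by auto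
qed

end

text \<open>
  The witness against maximality is the order spanned by \<open>m\<^sup>-\<^sup>1 \<otimes> mx\<close> for \<open>x\<close> in \<open>G\<close>, that is,
  \<open>D \<otimes> G\<close> seen inside \<open>K \<otimes> Y\<close>.
\<close>

lemma (in local_subring) not_maximal_order:
  fixes G :: "('b, 'n) ring_scheme"
  assumes G: "cring G" and Y: "subring Y G" and gen: "generated_by G g n"
    and m: "m \<noteq> 0" "\<And>x. x \<in> carrier G \<Longrightarrow> imul G m x \<in> Y"
    and \<psi>: "\<And>x y. x \<in> carrier G \<Longrightarrow> y \<in> carrier G \<Longrightarrow> \<psi> (x \<oplus>\<^bsub>G\<^esub> y) = \<psi> x + (\<psi> y :: int)"
    and Y0: "\<And>y. y \<in> Y \<Longrightarrow> int p dvd \<psi> y" and x: "x \<in> carrier G" "\<not> int p dvd \<psi> x"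
  shows "\<not> is_maximal_order K D (base_change K (G\<lparr>carrier := Y\<rparr>))
    (lin_span (K\<lparr>carrier := D\<rparr>) (base_change K (G\<lparr>carrier := Y\<rparr>)) (pure_tensor K (G\<lparr>carrier := Y\<rparr>) \<one>\<^bsub>K\<^esub> ` Y))"
proof
  let ?L = "G\<lparr>carrier := Y\<rparr>"
  interpret G: cring G by (rule G)
  note Ys = subringE[OF Y]
  have Ya: "additive_subgroup Y G" using subring.axioms(1)[OF Y] by (simp add: additive_subgroup_def)
  have "cring ?L"
    using G.cring_sub[OF Ya Ys(3) _ Ys(6), folded subring_with_own_one] G.l_one subsetD[OF Ys(1)] by blast
  then interpret tensor_pair K ?L by (intro tensor_pair.intro K.is_cring)
  interpret local_algebra K D p ?L by unfold_locales
  let ?T = "tensor K ?L" and ?V = "base_change K ?L"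
  have Yc: "y \<in> carrier G" if "y \<in> Y" for y using Ys(1) that by blast
  have Limul: "imul ?L k y = imul G k y" if "y \<in> Y" for k y
    using G.sub_imul[OF Ya that, of "\<one>\<^bsub>G\<^esub>", folded subring_with_own_one] .
  obtain z where z: "z \<in> carrier K" "imul K m z = \<one>\<^bsub>K\<^esub>" using inverse_K[OF m(1)] by blast
  \<comment> \<open>With z = 1/m this is the element 1 \<otimes> c of K \<otimes> G, written with
    entries from \<open>Y\<close>. It allows \<open>G\<close> to be treated as a subring without
    comparing the two tensor products.\<close>
  define \<tau> where "\<tau> c = pure_tensor K ?L z (imul G m c)" for c
  have \<tau>_closed: "\<tau> c \<in> carrier ?T" if "c \<in> carrier G" for c
    using z(1) m(2)[OF that] by (simp add: \<tau>_def)
  have \<tau>_add: "\<tau> (c \<oplus>\<^bsub>G\<^esub> d) = \<tau> c \<oplus>\<^bsub>?T\<^esub> \<tau> d" if "c \<in> carrier G" "d \<in> carrier G" for c d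
    using pure_add_right[of z "imul G m c" "imul G m d"] z(1) m(2) that by (simp add: \<tau>_def G.imul_distrib)
  have \<tau>_imul: "\<tau> (imul G k c) = imul ?T k (\<tau> c)" if "c \<in> carrier G" for k c
    by (rule additive_imul[OF G.abelian_group_axioms T.abelian_group_axioms _ \<tau>_add that]) (use \<tau>_closed in auto)
  have move: "pure_tensor K ?L w (imul G m y) = pure_tensor K ?L (imul K m w) y" if "w \<in> carrier K" "y \<in> Y" for w y
    using pure_imul_left[of w y m] pure_imul_right[of w y m] Limul[OF that(2)] that by simp
  have \<tau>_Y: "\<tau> y = pure_tensor K ?L \<one>\<^bsub>K\<^esub> y" if "y \<in> Y" for y
    using move[OF z(1) that] z(2) by (simp add: \<tau>_def)
  have \<tau>_mult: "\<tau> c \<otimes>\<^bsub>?T\<^esub> \<tau> d = \<tau> (c \<otimes>\<^bsub>G\<^esub> d)" if c: "c \<in> carrier G" "d \<in> carrier G" for c d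
  proof -
    have "imul G m c \<otimes>\<^bsub>G\<^esub> imul G m d = imul G m (imul G m (c \<otimes>\<^bsub>G\<^esub> d))"
      using c by (simp add: G.imul_ldistr G.imul_rdistr)
    then have "\<tau> c \<otimes>\<^bsub>?T\<^esub> \<tau> d = pure_tensor K ?L (z \<otimes>\<^bsub>K\<^esub> z) (imul G m (imul G m (c \<otimes>\<^bsub>G\<^esub> d)))"
      using pure_mult[of z "imul G m c" z "imul G m d"] z(1) m(2) c by (simp add: \<tau>_def)
    also have "\<dots> = pure_tensor K ?L (imul K m z \<otimes>\<^bsub>K\<^esub> z) (imul G m (c \<otimes>\<^bsub>G\<^esub> d))"
      using move[of "z \<otimes>\<^bsub>K\<^esub> z" "imul G m (c \<otimes>\<^bsub>G\<^esub> d)"] m(2) c z(1) by (simp add: K.imul_ldistr)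
    finally show ?thesis using z by (simp add: \<tau>_def)
  qed
  let ?W = "\<tau> ` carrier G"
  have W: "?W \<subseteq> carrier ?T" using \<tau>_closed by auto
  note S = dspan_submodule[OF W]
  have Y1: "pure_tensor K ?L \<one>\<^bsub>K\<^esub> ` Y \<subseteq> ?W" using \<tau>_Y Yc by force
  have "is_order K D ?V (dspan ?W)"
    unfolding is_order_def
  proof (intro conjI)
    show "subring (dspan ?W) ?V"
      unfolding subring_base_change
    proof (rule T.subringI)
      show "dspan ?W \<subseteq> carrier ?T" using dspan_closed[OF W] by blast
      have "\<one>\<^bsub>?T\<^esub> = \<tau> \<one>\<^bsub>G\<^esub>" using \<tau>_Y[of "\<one>\<^bsub>G\<^esub>"] pure_one Ys(3) by simp
      then have "\<one>\<^bsub>?T\<^esub> \<in> ?W" using G.one_closed by (rule image_eqI)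
      then show "\<one>\<^bsub>?T\<^esub> \<in> dspan ?W" by (rule subsetD[OF lin_span_superset])
      show "\<ominus>\<^bsub>?T\<^esub> h \<in> dspan ?W" if "h \<in> dspan ?W" for h using additive_subgroup.a_inv_closed[OF S(1) that] .
      show "h1 \<oplus>\<^bsub>?T\<^esub> h2 \<in> dspan ?W" if "h1 \<in> dspan ?W" "h2 \<in> dspan ?W" for h1 h2
        using additive_subgroup.a_closed[OF S(1) that] .
      show "h1 \<otimes>\<^bsub>?T\<^esub> h2 \<in> dspan ?W" if "h1 \<in> dspan ?W" "h2 \<in> dspan ?W" for h1 h2
      proof (rule dspan_mult[OF W _ that])
        fix u v assume "u \<in> ?W" "v \<in> ?W"
        then obtain c d where "c \<in> carrier G" "d \<in> carrier G" "u = \<tau> c" "v = \<tau> d" by blast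
        then have "u \<otimes>\<^bsub>?T\<^esub> v \<in> ?W" using \<tau>_mult by simp
        then show "u \<otimes>\<^bsub>?T\<^esub> v \<in> dspan ?W" by (rule subsetD[OF lin_span_superset])
      qed
    qed
    have g: "g i \<in> carrier G" if "i < n" for i using gen that by (simp add: generated_by_def)
    \<comment> \<open>An order must have a finite generating set over \<open>D\<close>; since
      \<open>\<tau>\<close> is additive, the images of the generators of \<open>G\<close>
      suffice.\<close>
    let ?W' = "(\<lambda>i. \<tau> (g i)) ` {..<n}"
    have W': "?W' \<subseteq> carrier ?T" "?W' \<subseteq> ?W" using g \<tau>_closed by auto
    note S' = dspan_submodule[OF W'(1)]
    interpret S': additive_subgroup "dspan ?W'" ?T by (rule S'(1))
    have "additive_subgroup {c \<in> carrier G. \<tau> c \<in> dspan ?W'} G"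
    proof (rule G.additive_subgroupI')
      show "\<zero>\<^bsub>G\<^esub> \<in> {c \<in> carrier G. \<tau> c \<in> dspan ?W'}"
        using \<tau>_imul[OF G.zero_closed, of 0] \<tau>_closed[OF G.zero_closed] S'.zero_closed by simp
      fix u assume u: "u \<in> {c \<in> carrier G. \<tau> c \<in> dspan ?W'}"
      have "\<ominus>\<^bsub>G\<^esub> u = imul G (-1) u" using G.imul_neg[of u 1] G.imul_1[of u] u by simp
      then show "\<ominus>\<^bsub>G\<^esub> u \<in> {c \<in> carrier G. \<tau> c \<in> dspan ?W'}"
        using \<tau>_imul[of u "-1"] T.imul_in_additive_subgroup[OF S'(1), of "\<tau> u" "-1"] u by simp
    qed (auto simp: \<tau>_add)
    then have "lincomb G g n c \<in> {c \<in> carrier G. \<tau> c \<in> dspan ?W'}" for c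
      using lin_span_superset[of ?W' "K\<lparr>carrier := D\<rparr>" ?V] g by (intro G.lincomb_in_subgroup) auto
    then have "?W \<subseteq> dspan ?W'" using gen unfolding generated_by_def by fastforce
    then have "dspan ?W = dspan ?W'"
      using dspan_least[OF S'] lin_span_mono[OF W'(2)] by blast
    then show "\<exists>U. finite U \<and> U \<subseteq> carrier ?V \<and> dspan U = dspan ?W"
      using W'(1) by (intro exI[of _ ?W']) (simp add: base_change_simps)
    show "lin_span K ?V (dspan ?W) = carrier ?V"
    proof (rule equalityI)
      have "submodule (carrier ?T) K ?V" using carrier_submodule[of "carrier K"] by simp
      then show "lin_span K ?V (dspan ?W) \<subseteq> carrier ?V"
        unfolding base_change_simps by (rule lin_span_least) (use dspan_closed[OF W] in blast)
      show "carrier ?V \<subseteq> lin_span K ?V (dspan ?W)"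
      proof (rule subsetI)
        fix v assume v: "v \<in> carrier ?V"
        show "v \<in> lin_span K ?V (dspan ?W)"
        proof (rule lin_spanI)
          fix N assume "submodule N K ?V" and N: "dspan ?W \<subseteq> N"
          then have Na: "additive_subgroup N ?T" and Ns: "\<And>d v. d \<in> carrier K \<Longrightarrow> v \<in> N \<Longrightarrow> sm d v \<in> N"
            using submodule_base_change[where N = N and K = K and E = "carrier K" and L = ?L] by auto
          interpret N: additive_subgroup N ?T by (rule Na)
          have v': "v \<in> carrier ?T" using v by (simp add: base_change_simps)
          then show "v \<in> N"
          proof (induction rule: tensor_induct)
            case (pure a b)
            have "pure_tensor K ?L \<one>\<^bsub>K\<^esub> b \<in> ?W" using Y1 pure(2) by auto
            then have "pure_tensor K ?L \<one>\<^bsub>K\<^esub> b \<in> dspan ?W" by (rule subsetD[OF lin_span_superset])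
            then have "pure_tensor K ?L \<one>\<^bsub>K\<^esub> b \<in> N" using N by blast
            then show ?case using Ns[OF pure(1)] sm_pure[OF pure(1) K.one_closed pure(2)] pure(1) by force
          next
            case (diff x y)
            then show ?case using N.a_closed[OF _ N.a_inv_closed] by (simp add: a_minus_def)
          qed
        qed
      qed
    qed
  qed
  moreover have "dspan (pure_tensor K ?L \<one>\<^bsub>K\<^esub> ` Y) \<subseteq> dspan ?W" by (rule lin_span_mono[OF Y1])
  moreover assume "is_maximal_order K D ?V (dspan (pure_tensor K ?L \<one>\<^bsub>K\<^esub> ` Y))"
  ultimately have eq: "dspan ?W = dspan (pure_tensor K ?L \<one>\<^bsub>K\<^esub> ` Y)" unfolding is_maximal_order_def by blast
  \<comment> \<open>On \<open>Y\<close> the functional is divisible by \<open>p\<close>, so the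
    quotient is an additive integer-valued functional there. Its extension takes values in
    \<open>D\<close> on the span of 1 \<otimes> Y.\<close>
  have "\<psi> (u \<oplus>\<^bsub>?L\<^esub> v) div int p = \<psi> u div int p + \<psi> v div int p" if "u \<in> carrier ?L" "v \<in> carrier ?L" for u v
    using \<psi>[of u v] Y0[of u] that Yc by (simp add: div_plus_div_distrib_dvd_left)
  then obtain F where F: "\<And>v. v \<in> carrier ?T \<Longrightarrow> F v \<in> carrier K"
    "\<And>v w. v \<in> carrier ?T \<Longrightarrow> w \<in> carrier ?T \<Longrightarrow> F (v \<oplus>\<^bsub>?T\<^esub> w) = F v \<oplus>\<^bsub>K\<^esub> F w"
    "\<And>z x. z \<in> carrier K \<Longrightarrow> x \<in> carrier ?L \<Longrightarrow> F (pure_tensor K ?L z x) = imul K (\<psi> x div int p) z"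
    "\<And>d v. d \<in> carrier K \<Longrightarrow> v \<in> carrier ?T \<Longrightarrow> F (sm d v) = d \<otimes>\<^bsub>K\<^esub> F v"
    using functional[of "\<lambda>x. \<psi> x div int p"] by blast
  have "F (\<tau> x) \<in> D"
  proof (rule dspan_functional[OF F(1,2,4) D_sub(4,3)])
    show "pure_tensor K ?L \<one>\<^bsub>K\<^esub> ` Y \<subseteq> carrier ?T" using pure_one_subset[of Y] by simp
    show "\<tau> x \<in> dspan (pure_tensor K ?L \<one>\<^bsub>K\<^esub> ` Y)" unfolding eq[symmetric] by (rule subsetD[OF lin_span_superset imageI[OF x(1)]])
    show "F w \<in> D" if "w \<in> pure_tensor K ?L \<one>\<^bsub>K\<^esub> ` Y" for w
      using that F(3)[OF K.one_closed] imul_one_D by auto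
  qed
  \<comment> \<open>The value at \<open>\<tau> x\<close> is \<open>\<psi> x\<close> divided by
    \<open>p\<close>: mx is in \<open>Y\<close>, and the factor \<open>m\<close> cancels against
    \<open>z\<close>. As \<open>p\<close> does not divide \<open>\<psi> x\<close>, this value is
    outside \<open>D\<close>.\<close>
  moreover have "imul K (int p) (F (\<tau> x)) = imul K (\<psi> x) \<one>\<^bsub>K\<^esub>"
  proof -
    have mx: "imul G m x \<in> Y" by (rule m(2)[OF x(1)])
    have "\<psi> (imul G m x) = imul \<Z> m (\<psi> x)"
      by (rule additive_imul[OF G.abelian_group_axioms _ _ _ x(1)]) (use int_is_cring \<psi> in \<open>auto simp: cring_def ring_def\<close>)
    then have \<psi>m: "\<psi> (imul G m x) = \<psi> x * m" by (simp add: imul_int_ring)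
    have "imul K (int p) (F (\<tau> x)) = imul K (int p * (\<psi> (imul G m x) div int p)) z"
      using F(3)[OF z(1), of "imul G m x"] mx K.imul_mult[OF z(1)] by (simp add: \<tau>_def)
    also have "int p * (\<psi> (imul G m x) div int p) = \<psi> x * m" using Y0[OF mx] \<psi>m by simp
    finally show ?thesis using K.imul_mult[OF z(1), of "\<psi> x" m] z(2) by simp
  qed
  ultimately show False using not_multiple_of_p[OF x(2)] by metis
qed

context max_order
begin

text \<open>The product of the integers that carry the single generators of \<Gamma> into \<Lambda>
  works for all of them.\<close>

lemma order_finite_index:
  assumes \<Lambda>: "is_int_order A \<Lambda>"
  shows "\<exists>m>0::nat. \<forall>x\<in>\<Gamma>. imul A (int m) x \<in> \<Lambda>"
proof -
  have a\<Lambda>: "additive_subgroup \<Lambda> A"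
    using \<Lambda> subring.axioms(1) by (auto simp: is_int_order_def is_order_def additive_subgroup_def)
  obtain g n where gen: "generated_by GR g n" using generated_GR by blast
  have g: "g i \<in> \<Gamma>" if "i < n" for i using gen that by (simp add: generated_by_def)
  have "\<forall>i\<in>{..<n}. \<exists>k>0. imul A k (g i) \<in> \<Lambda>" using int_order_span[OF \<Lambda>] g \<Gamma>_carr by simp
  then obtain k where k: "\<forall>i\<in>{..<n}. k i > 0 \<and> imul A (k i) (g i) \<in> \<Lambda>" by (rule bchoice[THEN exE])
  define m where "m = (\<Prod>i<n. k i)"
  have m: "m > 0" unfolding m_def using k by (intro prod_pos) simp
  have gm: "imul A m (g i) \<in> \<Lambda>" if i: "i < n" for i
  proof -
    have "m = (\<Prod>j\<in>{..<n} - {i}. k j) * k i" using i by (simp add: m_def prod.remove[of _ i] mult.commute)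
    then show ?thesis
      using imul_mult[OF \<Gamma>_carr[OF g[OF i]], of "\<Prod>j\<in>{..<n} - {i}. k j" "k i"] k i
        imul_in_additive_subgroup[OF a\<Lambda>] by simp
  qed
  interpret \<Lambda>: additive_subgroup \<Lambda> A by (rule a\<Lambda>)
  have "additive_subgroup {x \<in> carrier A. imul A m x \<in> \<Lambda>} A"
    by (rule additive_subgroupI') (auto simp: imul_distrib imul_minus)
  then have l: "lincomb A g n c \<in> {x \<in> carrier A. imul A m x \<in> \<Lambda>}" for c
    using gm g \<Gamma>_carr by (intro lincomb_in_subgroup) auto
  have "imul A m x \<in> \<Lambda>" if "x \<in> \<Gamma>" for x
  proof -
    have "\<exists>c. x = lincomb GR g n c" using gen that unfolding generated_by_def by simp
    then obtain c where "x = lincomb GR g n c" ..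
    then show ?thesis using l[of c] GR_lincomb[OF g, where n = n and c = c] by auto
  qed
  then show ?thesis using m by (intro exI[of _ "nat m"]) simp
qed

theorem bad_primes_of_order:
  assumes \<Lambda>: "is_int_order A \<Lambda>" and sub: "\<Lambda> \<subseteq> \<Gamma>"
  shows "\<exists>m>0::nat. (\<forall>x\<in>\<Gamma>. imul A (int m) x \<in> \<Lambda>) \<and>
    bad_primes GR \<Lambda> = {p. Factorial_Ring.prime p \<and> p dvd m} \<and>
    (\<forall>p. Factorial_Ring.prime p \<longrightarrow> p dvd m \<longrightarrow> \<not> padically_maximal p (A\<lparr>carrier := \<Lambda>\<rparr>))"
proof -
  define m where "m = (LEAST m::nat. m > 0 \<and> (\<forall>x\<in>\<Gamma>. imul A (int m) x \<in> \<Lambda>))"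
  have m: "m > 0" "\<And>x. x \<in> \<Gamma> \<Longrightarrow> imul A (int m) x \<in> \<Lambda>"
    using LeastI_ex[OF order_finite_index[OF \<Lambda>]] by (simp_all add: m_def)
  have least: "m \<le> m'" if "m' > 0" "\<forall>x\<in>\<Gamma>. imul A (int m') x \<in> \<Lambda>" for m'
    unfolding m_def using that by (intro Least_le) simp
  have s\<Lambda>: "subring \<Lambda> A" using \<Lambda> by (simp add: is_int_order_def is_order_def)
  note \<Lambda>E = subringE[OF s\<Lambda>]
  have a\<Lambda>: "additive_subgroup \<Lambda> A" using subring.axioms(1)[OF s\<Lambda>] by (simp add: additive_subgroup_def)
  interpret a\<Lambda>: additive_subgroup \<Lambda> A by (rule a\<Lambda>)
  have inv_GR: "\<ominus>\<^bsub>GR\<^esub> x = \<ominus> x" if "x \<in> \<Gamma>" for x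
    using sub_a_inv[OF additive_\<Gamma> that, of \<one>, folded subring_with_own_one] .
  have s\<Lambda>': "subring \<Lambda> GR"
    using \<Lambda>E sub inv_GR by (intro GR.subringI) (auto simp: subset_iff)
  have a\<Lambda>': "additive_subgroup \<Lambda> GR" using subring.axioms(1)[OF s\<Lambda>'] by (simp add: additive_subgroup_def)
  have rec: "GR\<lparr>carrier := \<Lambda>\<rparr> = A\<lparr>carrier := \<Lambda>\<rparr>" by simp
  have mGR: "imul GR (int m) x \<in> \<Lambda>" if "x \<in> carrier GR" for x using m(2)[of x] GR_imul[of x] that by simp
  have good: "p \<notin> bad_primes GR \<Lambda>" if p: "Factorial_Ring.prime p" "\<not> p dvd m" for p
  proof -
    interpret L: local_subring "padic_field p" "padic_integers p" p by (rule local_subring_padic[OF p(1)])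
    interpret L: local_algebra "padic_field p" "padic_integers p" p GR
      by (rule local_algebra.intro[OF L.local_subring_axioms tensor_pair.intro[OF L.K.is_cring cring_GR]])
    have "coprime (int m) (int p)" using prime_imp_coprime[OF p] coprime_commute coprime_int_iff by metis
    then show ?thesis
      using L.dspan_coprime_index[of \<Lambda> "int m"] sub mGR by (simp add: bad_primes_def padic_span_def)
  qed
  have bad: "p \<in> bad_primes GR \<Lambda> \<and> \<not> padically_maximal p (A\<lparr>carrier := \<Lambda>\<rparr>)"
    if p: "Factorial_Ring.prime p" "p dvd m" for p
  proof -
    obtain m' where m': "m = p * m'" using p(2) by blast
    have m'0: "0 < m'" "m' < m" using m(1) m' prime_gt_1_nat[OF p(1)] by auto
    \<comment> \<open>Otherwise \<Gamma> = \<Lambda> + p\<Gamma>, and m/p would already carry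
      \<Gamma> into \<Lambda>, against the minimality of \<open>m\<close>. The element
      \<open>y\<close> outside \<Lambda> + p\<Gamma> feeds the construction of the
      functional.\<close>
    have "\<exists>y\<in>carrier GR. \<forall>l\<in>\<Lambda>. \<forall>z\<in>carrier GR. y \<noteq> l \<oplus>\<^bsub>GR\<^esub> imul GR (int p) z"
    proof (rule ccontr)
      assume n: "\<not> ?thesis"
      have "imul A (int m') y \<in> \<Lambda>" if y: "y \<in> \<Gamma>" for y
      proof -
        obtain l z where lz: "l \<in> \<Lambda>" "z \<in> carrier GR" "y = l \<oplus>\<^bsub>GR\<^esub> imul GR (int p) z" using n y by auto
        have c: "l \<in> carrier A" "z \<in> carrier A" "z \<in> \<Gamma>" using lz sub \<Gamma>_carr by auto
        have "imul A (int m') y = imul A (int m') l \<oplus> imul A (int m') (imul A (int p) z)"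
          using lz(3) GR_imul[OF c(3)] imul_distrib[OF c(1) imul_closed[OF c(2)]] by simp
        also have "imul A (int m') (imul A (int p) z) = imul A (int m) z"
          using imul_mult[OF c(2), of "int m'" "int p"] m' by (simp add: mult.commute)
        finally show ?thesis
          using a\<Lambda>.a_closed[OF imul_in_additive_subgroup[OF a\<Lambda> lz(1)] m(2)[OF c(3)]] by simp
      qed
      then show False using least[OF m'0(1)] m'0(2) by simp
    qed
    then obtain y where y: "y \<in> carrier GR" "\<And>l z. l \<in> \<Lambda> \<Longrightarrow> z \<in> carrier GR \<Longrightarrow> y \<noteq> l \<oplus>\<^bsub>GR\<^esub> imul GR (int p) z"
      by auto
    obtain g n where g: "generated_by GR g n" "int_independent GR g n" using GR_basis by blast
    obtain \<psi> x where \<psi>: "\<And>u v. u \<in> carrier GR \<Longrightarrow> v \<in> carrier GR \<Longrightarrow> \<psi> (u \<oplus>\<^bsub>GR\<^esub> v) = \<psi> u + (\<psi> v :: int)"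
      "\<And>l. l \<in> \<Lambda> \<Longrightarrow> int p dvd \<psi> l" "x \<in> carrier GR" "\<not> int p dvd \<psi> x"
    proof -
      have "\<exists>\<psi>. (\<forall>u\<in>carrier GR. \<forall>v\<in>carrier GR. \<psi> (u \<oplus>\<^bsub>GR\<^esub> v) = \<psi> u + (\<psi> v :: int)) \<and>
        (\<forall>l\<in>\<Lambda>. int p dvd \<psi> l) \<and> (\<exists>x\<in>carrier GR. \<not> int p dvd \<psi> x)"
        by (rule GR.separating_functional[OF g a\<Lambda>' p(1) y(1)]) (rule y(2))
      then show ?thesis by (elim exE conjE bexE) (rule that, simp_all)
    qed
    interpret L: local_subring "padic_field p" "padic_integers p" p by (rule local_subring_padic[OF p(1)])
    interpret L: local_algebra "padic_field p" "padic_integers p" p GR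
      by (rule local_algebra.intro[OF L.local_subring_axioms tensor_pair.intro[OF L.K.is_cring cring_GR]])
    have "\<Lambda> \<subseteq> carrier GR" using sub by simp
    from L.dspan_proper[OF this \<psi>] have "p \<in> bad_primes GR \<Lambda>" using p(1) by (simp add: bad_primes_def padic_span_def)
    moreover have "\<not> padically_maximal p (A\<lparr>carrier := \<Lambda>\<rparr>)"
      using L.not_maximal_order[OF cring_GR s\<Lambda>' g(1) _ mGR \<psi>] m(1) by (simp add: padically_maximal_def padic_span_def)
    ultimately show ?thesis by blast
  qed
  have "bad_primes GR \<Lambda> = {p. Factorial_Ring.prime p \<and> p dvd m}"
    using good bad unfolding bad_primes_def by blast
  then show ?thesis using m bad by blast
qed

end

subsection \<open>The correction factors\<close>

text \<open>A ring homomorphism that is invertible up to \<open>m\<close>. The map back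
  \<open>t\<close> is merely additive; for \<Lambda> in \<Gamma> it is multiplication by an integer
  carrying \<Gamma> into \<Lambda>.\<close>

definition isogeny :: "('a, 'm) ring_scheme \<Rightarrow> ('b, 'n) ring_scheme \<Rightarrow> int \<Rightarrow> bool" where
  "isogeny L G m \<longleftrightarrow> (\<exists>f t. f \<in> ring_hom L G \<and> t \<in> carrier G \<rightarrow> carrier L \<and>
    (\<forall>x\<in>carrier G. \<forall>y\<in>carrier G. t (x \<oplus>\<^bsub>G\<^esub> y) = t x \<oplus>\<^bsub>L\<^esub> t y) \<and>
    (\<forall>x\<in>carrier L. t (f x) = imul L m x) \<and> (\<forall>x\<in>carrier G. f (t x) = imul G m x))"

lemma (in cring) isogeny_refl: "isogeny R R 1"
  unfolding isogeny_def
  by (intro exI[of _ "\<lambda>x. x"]) (auto simp: ring_hom_def)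

lemma zeta_isogeny:
  assumes L: "tensor_pair L1 L2" and G: "tensor_pair G1 G2" and iso: "isogeny L1 G1 m1" "isogeny L2 G2 m2"
    and one: "1 \<in> E" and mult: "\<And>n m. n \<in> E \<Longrightarrow> m \<in> E \<Longrightarrow> n * m \<in> E"
    and cop: "\<And>n. n \<in> E \<Longrightarrow> coprime (m1 * m2) n"
    and sum: "zeta_term (tensor L1 L2) s summable_on ideals_over (tensor L1 L2) E"
  shows "infsum (zeta_term (tensor L1 L2) s) (ideals_over (tensor L1 L2) E) =
      infsum (zeta_term (tensor G1 G2) s) (ideals_over (tensor G1 G2) E)"
    "zeta_term (tensor G1 G2) s summable_on ideals_over (tensor G1 G2) E"
proof -
  obtain f1 t1 where 1: "f1 \<in> ring_hom L1 G1" "t1 \<in> carrier G1 \<rightarrow> carrier L1"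
    "\<forall>x\<in>carrier G1. \<forall>y\<in>carrier G1. t1 (x \<oplus>\<^bsub>G1\<^esub> y) = t1 x \<oplus>\<^bsub>L1\<^esub> t1 y"
    "\<forall>x\<in>carrier L1. t1 (f1 x) = imul L1 m1 x" "\<forall>x\<in>carrier G1. f1 (t1 x) = imul G1 m1 x"
    using iso(1) unfolding isogeny_def by (elim exE conjE) (rule that)
  obtain f2 t2 where 2: "f2 \<in> ring_hom L2 G2" "t2 \<in> carrier G2 \<rightarrow> carrier L2"
    "\<forall>x\<in>carrier G2. \<forall>y\<in>carrier G2. t2 (x \<oplus>\<^bsub>G2\<^esub> y) = t2 x \<oplus>\<^bsub>L2\<^esub> t2 y"
    "\<forall>x\<in>carrier L2. t2 (f2 x) = imul L2 m2 x" "\<forall>x\<in>carrier G2. f2 (t2 x) = imul G2 m2 x"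
    using iso(2) unfolding isogeny_def by (elim exE conjE) (rule that)
  note c = zeta_tensor_change[OF L G 1(1) 2(1) 1(2) bspec[OF bspec[OF 1(3)]] bspec[OF 1(4)] bspec[OF 1(5)]
      2(2) bspec[OF bspec[OF 2(3)]] bspec[OF 2(4)] bspec[OF 2(5)] one mult cop sum]
  show "infsum (zeta_term (tensor L1 L2) s) (ideals_over (tensor L1 L2) E) =
      infsum (zeta_term (tensor G1 G2) s) (ideals_over (tensor G1 G2) E)" by (rule c(1))
  show "zeta_term (tensor G1 G2) s summable_on ideals_over (tensor G1 G2) E" by (rule c(2))
qed

lemma one_powers: "1 \<in> powers p"
  unfolding powers_def by (rule range_eqI[of _ _ 0]) simp

lemma coprime_powers: "coprime k (int p) \<Longrightarrow> n \<in> powers p \<Longrightarrow> coprime k n"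
  by (auto simp: powers_def)

text \<open>At a prime not dividing \<open>m\<close> the right factor \<open>L2\<close> may be
  replaced by \<open>G2\<close>. The flip brings \<open>G2\<close> to the left, where its local
  presentation applies.\<close>

lemma zeta_local_left:
  assumes L: "cring L1" "cring L2" "cring G2" and iso: "isogeny L2 G2 m"
    and gen: "generated_by L1 g1 n1" "generated_by G2 g2 n2"
    and pres: "local_presentation G2 Q \<rho> I p" and cop: "coprime m (int p)"
    and sum: "zeta_term (tensor L1 L2) s summable_on ideals_over (tensor L1 L2) (powers p)"
  shows "i \<in> I \<Longrightarrow> zeta_converges (tensor (Q i) L1) s"
    "infsum (zeta_term (tensor L1 L2) s) (ideals_over (tensor L1 L2) (powers p)) = (\<Prod>i\<in>I. zeta (tensor (Q i) L1) s)"
proof -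
  interpret P: local_presentation G2 Q \<rho> I p by (rule pres)
  have LG: "tensor_pair L1 G2" by (intro tensor_pair.intro L)
  have cop': "coprime (1 * m) n" if "n \<in> powers p" for n using coprime_powers[OF cop that] by simp
  note 1 = zeta_isogeny[OF tensor_pair.intro[OF L(1,2)] LG cring.isogeny_refl[OF L(1)] iso one_powers powers_mult cop' sum]
  note 2 = zeta_tensor_swap[OF LG one_powers powers_mult 1(2)]
  note 3 = P.zeta_local[OF L(1) tensor_pair.generated_tensor[OF tensor_pair.intro[OF L(3,1)] gen(2,1)] 2(2)]
  show "zeta_converges (tensor (Q i) L1) s" if "i \<in> I" by (rule 3(1)) (assumption | rule that)+
  show "infsum (zeta_term (tensor L1 L2) s) (ideals_over (tensor L1 L2) (powers p)) = (\<Prod>i\<in>I. zeta (tensor (Q i) L1) s)"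
    using 1(1) 2(1) 3(2) by simp
qed

lemma zeta_local_right:
  assumes L: "cring L1" "cring L2" "cring G1" and iso: "isogeny L1 G1 m"
    and gen: "generated_by G1 g1 n1" "generated_by L2 g2 n2"
    and pres: "local_presentation G1 Q \<rho> I p" and cop: "coprime m (int p)"
    and sum: "zeta_term (tensor L1 L2) s summable_on ideals_over (tensor L1 L2) (powers p)"
  shows "i \<in> I \<Longrightarrow> zeta_converges (tensor (Q i) L2) s"
    "infsum (zeta_term (tensor L1 L2) s) (ideals_over (tensor L1 L2) (powers p)) = (\<Prod>i\<in>I. zeta (tensor (Q i) L2) s)"
proof -
  interpret P: local_presentation G1 Q \<rho> I p by (rule pres)
  have GL: "tensor_pair G1 L2" by (intro tensor_pair.intro L)
  have cop': "coprime (m * 1) n" if "n \<in> powers p" for n using coprime_powers[OF cop that] by simp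
  note 1 = zeta_isogeny[OF tensor_pair.intro[OF L(1,2)] GL iso cring.isogeny_refl[OF L(2)] one_powers powers_mult cop' sum]
  note 3 = P.zeta_local[OF L(2) tensor_pair.generated_tensor[OF GL gen] 1(2)]
  show "zeta_converges (tensor (Q i) L2) s" if "i \<in> I" by (rule 3(1)) (assumption | rule that)+
  show "infsum (zeta_term (tensor L1 L2) s) (ideals_over (tensor L1 L2) (powers p)) = (\<Prod>i\<in>I. zeta (tensor (Q i) L2) s)"
    using 1(1) 3(2) by simp
qed

text \<open>The orders \<open>L1\<close>, \<open>L2\<close> are kept general so that the result can
  be used for the given orders and for the maximal ones, the latter with isogenies of degree 1. The
  last factor is written with \<open>G1\<close>, \<open>G2\<close> and is therefore literally the
  same in both uses and cancels.\<close>

lemma zeta_factorization: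
  assumes cr: "cring L1" "cring L2" "cring G1" "cring G2"
    and gen: "generated_by L1 g1 n1" "generated_by L2 g2 n2" "generated_by G1 h1 k1" "generated_by G2 h2 k2"
    and iso: "isogeny L1 G1 m1" "isogeny L2 G2 m2"
    and B: "finite B1" "finite B2" "B1 \<inter> B2 = {}" "\<And>p. p \<in> B1 \<union> B2 \<Longrightarrow> Factorial_Ring.prime p"
    and pres: "\<And>p. p \<in> B2 \<Longrightarrow> local_presentation G1 Q1 \<rho>1 (I1 p) p" "\<And>p. p \<in> B1 \<Longrightarrow> local_presentation G2 Q2 \<rho>2 (I2 p) p"
    and cop: "\<And>p. p \<in> B2 \<Longrightarrow> coprime m1 (int p)" "\<And>p. p \<in> B1 \<Longrightarrow> coprime m2 (int p)"
      "\<And>n. n \<in> coprime_to (B1 \<union> B2) \<Longrightarrow> coprime (m1 * m2) n"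
    and conv: "zeta_converges (tensor L1 L2) s"
  shows "p \<in> B1 \<Longrightarrow> i \<in> I2 p \<Longrightarrow> zeta_converges (tensor (Q2 i) L1) s"
    "p \<in> B2 \<Longrightarrow> j \<in> I1 p \<Longrightarrow> zeta_converges (tensor (Q1 j) L2) s"
    "zeta (tensor L1 L2) s =
      (\<Prod>p\<in>B1. \<Prod>i\<in>I2 p. zeta (tensor (Q2 i) L1) s) * (\<Prod>p\<in>B2. \<Prod>i\<in>I1 p. zeta (tensor (Q1 i) L2) s) *
      infsum (zeta_term (tensor G1 G2) s) (ideals_over (tensor G1 G2) (coprime_to (B1 \<union> B2)))"
proof -
  have L: "tensor_pair L1 L2" and G: "tensor_pair G1 G2" by (intro tensor_pair.intro cr)+
  interpret T: cring "tensor L1 L2" by (rule tensor_pair.cring_tensor[OF L])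
  note fi = T.finite_index_ideals_eq[OF tensor_pair.generated_tensor[OF L gen(1,2)]]
  have sum: "zeta_term (tensor L1 L2) s summable_on ideals_over (tensor L1 L2) {0<..}"
    using conv by (simp add: zeta_converges_def fi)
  have fB: "finite (B1 \<union> B2)" using B by simp
  note euler = T.zeta_euler[OF fB B(4) sum]
  have one: "1 \<in> coprime_to (B1 \<union> B2)" by (simp add: coprime_to_def)
  note 0 = zeta_isogeny(1)[OF L G iso one coprime_to_mult cop(3) euler(1)]
  have s1: "zeta_term (tensor L1 L2) s summable_on ideals_over (tensor L1 L2) (powers p)" if "p \<in> B1" for p
    using euler(2) that by blast
  have s2: "zeta_term (tensor L1 L2) s summable_on ideals_over (tensor L1 L2) (powers p)" if "p \<in> B2" for p
    using euler(2) that by blast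
  note l = zeta_local_left[OF cr(1,2,4) iso(2) gen(1,4) pres(2) cop(2) s1]
  note r = zeta_local_right[OF cr(1,2,3) iso(1) gen(3,2) pres(1) cop(1) s2]
  show "zeta_converges (tensor (Q2 i) L1) s" if "p \<in> B1" "i \<in> I2 p"
    by (rule l(1)[OF that(1) that(1) that(1) that(2)])
  show "zeta_converges (tensor (Q1 j) L2) s" if "p \<in> B2" "j \<in> I1 p"
    by (rule r(1)[OF that(1) that(1) that(1) that(2)])
  have "zeta (tensor L1 L2) s =
      (\<Prod>p\<in>B1 \<union> B2. infsum (zeta_term (tensor L1 L2) s) (ideals_over (tensor L1 L2) (powers p))) *
      infsum (zeta_term (tensor G1 G2) s) (ideals_over (tensor G1 G2) (coprime_to (B1 \<union> B2)))"
    using euler(3) 0 by (simp add: zeta_def fi)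
  also have "(\<Prod>p\<in>B1 \<union> B2. infsum (zeta_term (tensor L1 L2) s) (ideals_over (tensor L1 L2) (powers p))) =
    (\<Prod>p\<in>B1. infsum (zeta_term (tensor L1 L2) s) (ideals_over (tensor L1 L2) (powers p))) *
    (\<Prod>p\<in>B2. infsum (zeta_term (tensor L1 L2) s) (ideals_over (tensor L1 L2) (powers p)))"
    by (rule prod.union_disjoint[OF B(1-3)])
  also have "(\<Prod>p\<in>B1. infsum (zeta_term (tensor L1 L2) s) (ideals_over (tensor L1 L2) (powers p))) =
      (\<Prod>p\<in>B1. \<Prod>i\<in>I2 p. zeta (tensor (Q2 i) L1) s)"
    by (rule prod.cong[OF refl l(2)])
  also have "(\<Prod>p\<in>B2. infsum (zeta_term (tensor L1 L2) s) (ideals_over (tensor L1 L2) (powers p))) =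
      (\<Prod>p\<in>B2. \<Prod>i\<in>I1 p. zeta (tensor (Q1 i) L2) s)"
    by (rule prod.cong[OF refl r(2)])
  finally show "zeta (tensor L1 L2) s =
      (\<Prod>p\<in>B1. \<Prod>i\<in>I2 p. zeta (tensor (Q2 i) L1) s) * (\<Prod>p\<in>B2. \<Prod>i\<in>I1 p. zeta (tensor (Q1 i) L2) s) *
      infsum (zeta_term (tensor G1 G2) s) (ideals_over (tensor G1 G2) (coprime_to (B1 \<union> B2)))" .
qed

section \<open>Assembly of the correction factors\<close>

lemma finite_common_bound:
  assumes "finite S" "\<And>x. x \<in> S \<Longrightarrow> \<exists>t::real. \<forall>s. t < Re s \<longrightarrow> P x s"
  shows "\<exists>t::real. \<forall>s. t < Re s \<longrightarrow> (\<forall>x\<in>S. P x s)"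
  using assms
proof (induction S rule: finite_induct)
  case (insert y S)
  obtain t where t: "\<forall>s. t < Re s \<longrightarrow> P y s" using insert.prems[of y] by blast
  obtain t' where t': "\<forall>s. t' < Re s \<longrightarrow> (\<forall>x\<in>S. P x s)" using insert.IH insert.prems by blast
  show ?case using t t' by (intro exI[of _ "max t t'"]) simp
qed simp

context max_order
begin

lemma cring_order:
  assumes "is_int_order A \<Lambda>"
  shows "cring (A\<lparr>carrier := \<Lambda>\<rparr>)"
proof -
  have s: "subring \<Lambda> A" using assms by (simp add: is_int_order_def is_order_def)
  show ?thesis using subcringI'[OF s] subcring_iff[OF subringE(1)[OF s]] by simp
qed

lemma isogeny_order:
  assumes \<Lambda>: "is_int_order A \<Lambda>" "\<Lambda> \<subseteq> \<Gamma>" and m: "\<And>x. x \<in> \<Gamma> \<Longrightarrow> imul A m x \<in> \<Lambda>"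
  shows "isogeny (A\<lparr>carrier := \<Lambda>\<rparr>) GR m"
proof -
  have s: "subring \<Lambda> A" using \<Lambda>(1) by (simp add: is_int_order_def is_order_def)
  have a: "additive_subgroup \<Lambda> A" using subring.axioms(1)[OF s] by (simp add: additive_subgroup_def)
  have i: "imul (A\<lparr>carrier := \<Lambda>\<rparr>) m x = imul A m x" if "x \<in> \<Lambda>" for x
    using sub_imul[OF a that, of \<one> m, folded subring_with_own_one] .
  have h: "(\<lambda>x. x) \<in> ring_hom (A\<lparr>carrier := \<Lambda>\<rparr>) GR" using \<Lambda>(2) by (intro ring_hom_memI) auto
  show ?thesis
    unfolding isogeny_def using h m i GR_imul imul_distrib \<Gamma>_carr
    by (intro exI[of _ "\<lambda>x. x"] exI[of _ "imul A m"]) simp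
qed

lemma prod_local_index:
  assumes "Factorial_Ring.prime p"
  shows "(\<Prod>C\<in>simple_components A. \<Prod>P\<in>primes_above (RC C) p. f (completed_component A C P)) =
    (\<Prod>i\<in>local_index p. f (local_ring i) :: complex)"
  unfolding local_index_def local_ring_def
  using finite_components finite_primes_above assms by (subst prod.Sigma) (auto simp: split_def)

lemma zeta_delta_eq:
  assumes "\<And>p. p \<in> bad_primes G L \<Longrightarrow> Factorial_Ring.prime p"
  shows "zeta_delta G L A s = (\<Prod>p\<in>bad_primes G L. \<Prod>i\<in>local_index p. zeta (tensor (local_ring i) (G\<lparr>carrier := L\<rparr>)) s) /
    (\<Prod>p\<in>bad_primes G L. \<Prod>i\<in>local_index p. zeta (tensor (local_ring i) G) s)"
proof -
  have "zeta_delta G L A s = (\<Prod>p\<in>bad_primes G L. \<Prod>i\<in>local_index p.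
      zeta (tensor (local_ring i) (G\<lparr>carrier := L\<rparr>)) s / zeta (tensor (local_ring i) G) s)"
    unfolding zeta_delta_def using assms by (intro prod.cong[OF refl] prod_local_index)
  then show ?thesis by (simp add: prod_dividef)
qed

lemma zeta_delta_convergesI:
  assumes "\<And>p i. p \<in> bad_primes G L \<Longrightarrow> i \<in> local_index p \<Longrightarrow> zeta_converges (tensor (local_ring i) (G\<lparr>carrier := L\<rparr>)) s"
    "\<And>p i. p \<in> bad_primes G L \<Longrightarrow> i \<in> local_index p \<Longrightarrow> zeta_converges (tensor (local_ring i) G) s"
  shows "zeta_delta_converges G L A s"
  unfolding zeta_delta_converges_def
proof (intro ballI)
  fix p C P assume p: "p \<in> bad_primes G L" and C: "C \<in> simple_components A" "P \<in> primes_above (RC C) p"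
  have i: "(C, P) \<in> local_index p" using C by (simp add: local_index_def)
  show "zeta_converges (tensor (completed_component A C P) (G\<lparr>carrier := L\<rparr>)) s \<and>
      zeta_converges (tensor (completed_component A C P) G) s"
    using assms(1)[OF p i] assms(2)[OF p i] by (simp add: local_ring_def)
qed

end

lemma max_orderI:
  assumes "semisimple_comm_rat_algebra A" "is_maximal_int_order A \<Gamma>"
  shows "max_order A \<Gamma>"
proof -
  have "\<forall>I. ideal I A \<longrightarrow> (\<exists>J. ideal J A \<and> I \<inter> J = {\<zero>\<^bsub>A\<^esub>} \<and> I <+>\<^bsub>A\<^esub> J = carrier A)"
    using assms(1) by (simp add: semisimple_comm_rat_algebra_def)
  then show ?thesis using rat_algI[OF assms(1)] assms(2) by (intro max_order.intro max_order_axioms.intro) simp_all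
qed

lemma coprime_to_coprime:
  assumes m: "m > 0" and B: "{p. Factorial_Ring.prime p \<and> p dvd m} \<subseteq> B" and n: "n \<in> coprime_to B"
  shows "coprime (int m) n"
proof (rule ccontr)
  assume "\<not> coprime (int m) n"
  then have "\<not> coprime m (nat n)" using n by (simp add: coprime_to_def flip: coprime_int_iff)
  then obtain p where p: "Factorial_Ring.prime p" "p dvd m" "p dvd nat n"
    using prime_factor_nat[of "gcd m (nat n)"] by (auto simp: coprime_iff_gcd_eq_1)
  have "int p dvd int (nat n)" using p(3) by (simp only: int_dvd_int_iff)
  then have "int p dvd n" using n by (simp add: coprime_to_def)
  moreover have "coprime n (int p)" using n subsetD[OF B, of p] p(1,2) by (simp add: coprime_to_def)
  ultimately have "is_unit (int p)" using coprime_common_divisor[of n "int p" "int p"] by simp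
  then show False using prime_gt_1_nat[OF p(1)] by simp
qed

theorem theorem3:
  fixes A1 :: "(rat, 'a) module" and A2 :: "(rat, 'b) module"
    and \<Lambda>1 \<Gamma>1 :: "'a set" and \<Lambda>2 \<Gamma>2 :: "'b set"
  assumes "semisimple_comm_rat_algebra A1" and "semisimple_comm_rat_algebra A2"
    and "is_int_order A1 \<Lambda>1" and "is_int_order A2 \<Lambda>2"
    and "locally_coprime (A1\<lparr>carrier := \<Lambda>1\<rparr>) (A2\<lparr>carrier := \<Lambda>2\<rparr>)"
    and "is_maximal_int_order A1 \<Gamma>1" and "\<Lambda>1 \<subseteq> \<Gamma>1"
    and "is_maximal_int_order A2 \<Gamma>2" and "\<Lambda>2 \<subseteq> \<Gamma>2"
  shows "\<exists>\<sigma> :: real. \<forall>s :: complex. \<sigma> < Re s \<longrightarrow>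
    zeta_converges (tensor (A1\<lparr>carrier := \<Lambda>1\<rparr>) (A2\<lparr>carrier := \<Lambda>2\<rparr>)) s \<and>
    zeta_converges (tensor (A1\<lparr>carrier := \<Gamma>1\<rparr>) (A2\<lparr>carrier := \<Gamma>2\<rparr>)) s \<and>
    zeta_delta_converges (A1\<lparr>carrier := \<Gamma>1\<rparr>) \<Lambda>1 A2 s \<and>
    zeta_delta_converges (A2\<lparr>carrier := \<Gamma>2\<rparr>) \<Lambda>2 A1 s \<and>
    zeta (tensor (A1\<lparr>carrier := \<Lambda>1\<rparr>) (A2\<lparr>carrier := \<Lambda>2\<rparr>)) s =
      zeta (tensor (A1\<lparr>carrier := \<Gamma>1\<rparr>) (A2\<lparr>carrier := \<Gamma>2\<rparr>)) s *
      zeta_delta (A1\<lparr>carrier := \<Gamma>1\<rparr>) \<Lambda>1 A2 s *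
      zeta_delta (A2\<lparr>carrier := \<Gamma>2\<rparr>) \<Lambda>2 A1 s"
proof -
  interpret M1: max_order A1 \<Gamma>1 by (rule max_orderI[OF assms(1,6)])
  interpret M2: max_order A2 \<Gamma>2 by (rule max_orderI[OF assms(2,8)])
  let ?L1 = "A1\<lparr>carrier := \<Lambda>1\<rparr>" and ?L2 = "A2\<lparr>carrier := \<Lambda>2\<rparr>"
    and ?G1 = "A1\<lparr>carrier := \<Gamma>1\<rparr>" and ?G2 = "A2\<lparr>carrier := \<Gamma>2\<rparr>"
  define B1 where "B1 = bad_primes ?G1 \<Lambda>1"
  define B2 where "B2 = bad_primes ?G2 \<Lambda>2"
  obtain m1 :: nat where m1: "m1 > 0" "\<forall>x\<in>\<Gamma>1. imul A1 (int m1) x \<in> \<Lambda>1"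
    "B1 = {p. Factorial_Ring.prime p \<and> p dvd m1}"
    "\<forall>p. Factorial_Ring.prime p \<longrightarrow> p dvd m1 \<longrightarrow> \<not> padically_maximal p ?L1"
    using M1.bad_primes_of_order[OF assms(3,7), folded B1_def] by (elim exE conjE) (rule that)
  obtain m2 :: nat where m2: "m2 > 0" "\<forall>x\<in>\<Gamma>2. imul A2 (int m2) x \<in> \<Lambda>2"
    "B2 = {p. Factorial_Ring.prime p \<and> p dvd m2}"
    "\<forall>p. Factorial_Ring.prime p \<longrightarrow> p dvd m2 \<longrightarrow> \<not> padically_maximal p ?L2"
    using M2.bad_primes_of_order[OF assms(4,9), folded B2_def] by (elim exE conjE) (rule that)
  have disj: "B1 \<inter> B2 = {}"
    using assms(5) m1(3,4) m2(3,4) unfolding locally_coprime_def by blast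
  have fin: "finite B1" "finite B2"
    unfolding m1(3) m2(3) using m1(1) m2(1) by (auto intro: finite_subset[OF _ finite_divisors_nat])
  have pr: "Factorial_Ring.prime p" if "p \<in> B1 \<union> B2" for p using that m1(3) m2(3) by blast
  have cop1: "coprime (int m1) (int p)" if "p \<in> B2" for p
    using that disj prime_imp_coprime[of p m1] m1(3) m2(3) by (auto simp: coprime_commute)
  have cop2: "coprime (int m2) (int p)" if "p \<in> B1" for p
    using that disj prime_imp_coprime[of p m2] m1(3) m2(3) by (auto simp: coprime_commute)
  have cop: "coprime (int m1 * int m2) n" if "n \<in> coprime_to (B1 \<union> B2)" for n
    using coprime_to_coprime[OF m1(1) _ that] coprime_to_coprime[OF m2(1) _ that] m1(3) m2(3) by auto
  note L1 = M1.cring_order[OF assms(3)] and L2 = M2.cring_order[OF assms(4)]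
  obtain g1 n1 where g1: "generated_by ?L1 g1 n1" using M1.int_order_generated[OF assms(3)] by blast
  obtain g2 n2 where g2: "generated_by ?L2 g2 n2" using M2.int_order_generated[OF assms(4)] by blast
  obtain h1 k1 where h1: "generated_by ?G1 h1 k1" using M1.generated_GR by blast
  obtain h2 k2 where h2: "generated_by ?G2 h2 k2" using M2.generated_GR by blast
  note iso1 = M1.isogeny_order[OF assms(3,7) bspec[OF m1(2)]] and iso2 = M2.isogeny_order[OF assms(4,9) bspec[OF m2(2)]]
  have pres1: "local_presentation ?G1 M1.local_ring M1.local_map (M1.local_index p) p" if "p \<in> B2" for p
    using M1.maximal_order_local_presentation pr that by blast
  have pres2: "local_presentation ?G2 M2.local_ring M2.local_map (M2.local_index p) p" if "p \<in> B1" for p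
    using M2.maximal_order_local_presentation pr that by blast
  \<comment> \<open>The tensor products of the given and of the maximal orders have n1 * n2 and k1 *
    k2 additive generators; adding both squares gives one half-plane in which the two zeta functions
    converge.\<close>
  define N where "N = real ((n1 * n2) * (n1 * n2)) + real ((k1 * k2) * (k1 * k2)) + 3"
  have N: "real ((n1 * n2) * (n1 * n2)) + 3 \<le> N" "real ((k1 * k2) * (k1 * k2)) + 3 \<le> N"
    unfolding N_def using of_nat_0_le_iff[of "(n1 * n2) * (n1 * n2)"] of_nat_0_le_iff[of "(k1 * k2) * (k1 * k2)"] by linarith+
  have convL: "zeta_converges (tensor ?L1 ?L2) s" if "N < Re s" for s
    using cring.zeta_converges_of_generated[OF tensor_pair.cring_tensor[OF tensor_pair.intro[OF L1 L2]]
        tensor_pair.generated_tensor[OF tensor_pair.intro[OF L1 L2] g1 g2], of s] that N(1) by linarith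
  have convG: "zeta_converges (tensor ?G1 ?G2) s" if "N < Re s" for s
    using cring.zeta_converges_of_generated[OF tensor_pair.cring_tensor[OF tensor_pair.intro[OF M1.cring_GR M2.cring_GR]]
        tensor_pair.generated_tensor[OF tensor_pair.intro[OF M1.cring_GR M2.cring_GR] h1 h2], of s] that N(2) by linarith
  \<comment> \<open>The factorization is recorded for the given orders here and for the maximal
    orders next, over the same bad primes and completions.\<close>
  note facL = zeta_factorization[OF L1 L2 M1.cring_GR M2.cring_GR g1 g2 h1 h2 iso1 iso2 fin disj pr pres1 pres2 cop1 cop2 cop convL]
  note facG = zeta_factorization[OF M1.cring_GR M2.cring_GR M1.cring_GR M2.cring_GR h1 h2 h1 h2
      M1.GR.isogeny_refl M2.GR.isogeny_refl fin disj pr pres1 pres2 _ _ _ convG]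
  have L1c: "zeta_converges (tensor (M2.local_ring i) ?L1) s" if "N < Re s" "p \<in> B1" "i \<in> M2.local_index p" for s p i
    using facL(1) that by simp
  have G1c: "zeta_converges (tensor (M2.local_ring i) ?G1) s" if "N < Re s" "p \<in> B1" "i \<in> M2.local_index p" for s p i
    using facG(1) that by simp
  have L2c: "zeta_converges (tensor (M1.local_ring i) ?L2) s" if "N < Re s" "p \<in> B2" "i \<in> M1.local_index p" for s p i
    using facL(2) that by simp
  have G2c: "zeta_converges (tensor (M1.local_ring i) ?G2) s" if "N < Re s" "p \<in> B2" "i \<in> M1.local_index p" for s p i
    using facG(2) that by simp
  define W where "W s = infsum (zeta_term (tensor ?G1 ?G2) s) (ideals_over (tensor ?G1 ?G2) (coprime_to (B1 \<union> B2)))" for s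
  define PL1 where "PL1 s = (\<Prod>p\<in>B1. \<Prod>i\<in>M2.local_index p. zeta (tensor (M2.local_ring i) ?L1) s)" for s
  define PG1 where "PG1 s = (\<Prod>p\<in>B1. \<Prod>i\<in>M2.local_index p. zeta (tensor (M2.local_ring i) ?G1) s)" for s
  define PL2 where "PL2 s = (\<Prod>p\<in>B2. \<Prod>i\<in>M1.local_index p. zeta (tensor (M1.local_ring i) ?L2) s)" for s
  define PG2 where "PG2 s = (\<Prod>p\<in>B2. \<Prod>i\<in>M1.local_index p. zeta (tensor (M1.local_ring i) ?G2) s)" for s
  have zL: "zeta (tensor ?L1 ?L2) s = PL1 s * PL2 s * W s" if "N < Re s" for s
    using facL(3) that by (simp add: PL1_def PL2_def W_def)
  have zG: "zeta (tensor ?G1 ?G2) s = PG1 s * PG2 s * W s" if "N < Re s" for s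
    using facG(3) that by (simp add: PG1_def PG2_def W_def)
  \<comment> \<open>Any real point of the common half-plane serves as starting point for the
    nonvanishing of the denominators.\<close>
  define s0 where "s0 = N + 1"
  have s0: "N < Re (of_real s0)" by (simp add: s0_def)
  have nz1: "\<exists>t. \<forall>s. t < Re s \<longrightarrow> zeta (tensor (M2.local_ring (snd x)) ?G1) s \<noteq> 0"
    if "x \<in> (SIGMA p:B1. M2.local_index p)" for x
  proof -
    have x: "fst x \<in> B1" "snd x \<in> M2.local_index (fst x)" using that by auto
    have "cring (tensor (M2.local_ring (snd x)) ?G1)"
      using tensor_pair.cring_tensor[OF tensor_pair.intro[OF M2.local_cring[OF pr x(2)] M1.cring_GR]] x(1) by blast
    from cring.zeta_nonzero[OF this G1c[OF s0 x]] show ?thesis by blast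
  qed
  have nz2: "\<exists>t. \<forall>s. t < Re s \<longrightarrow> zeta (tensor (M1.local_ring (snd x)) ?G2) s \<noteq> 0"
    if "x \<in> (SIGMA p:B2. M1.local_index p)" for x
  proof -
    have x: "fst x \<in> B2" "snd x \<in> M1.local_index (fst x)" using that by auto
    have "cring (tensor (M1.local_ring (snd x)) ?G2)"
      using tensor_pair.cring_tensor[OF tensor_pair.intro[OF M1.local_cring[OF pr x(2)] M2.cring_GR]] x(1) by blast
    from cring.zeta_nonzero[OF this G2c[OF s0 x]] show ?thesis by blast
  qed
  have f1: "finite (SIGMA p:B1. M2.local_index p)" using fin pr M2.finite_local_index by (intro finite_SigmaI) auto
  have f2: "finite (SIGMA p:B2. M1.local_index p)" using fin pr M1.finite_local_index by (intro finite_SigmaI) auto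
  have "\<exists>t. \<forall>s. t < Re s \<longrightarrow> (\<forall>x\<in>SIGMA p:B1. M2.local_index p. zeta (tensor (M2.local_ring (snd x)) ?G1) s \<noteq> 0)"
    by (rule finite_common_bound[OF f1 nz1])
  then obtain t1 where t1: "\<forall>s. t1 < Re s \<longrightarrow> (\<forall>x\<in>SIGMA p:B1. M2.local_index p. zeta (tensor (M2.local_ring (snd x)) ?G1) s \<noteq> 0)" ..
  have "\<exists>t. \<forall>s. t < Re s \<longrightarrow> (\<forall>x\<in>SIGMA p:B2. M1.local_index p. zeta (tensor (M1.local_ring (snd x)) ?G2) s \<noteq> 0)"
    by (rule finite_common_bound[OF f2 nz2])
  then obtain t2 where t2: "\<forall>s. t2 < Re s \<longrightarrow> (\<forall>x\<in>SIGMA p:B2. M1.local_index p. zeta (tensor (M1.local_ring (snd x)) ?G2) s \<noteq> 0)" ..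
  have d1: "zeta_delta ?G1 \<Lambda>1 A2 s = PL1 s / PG1 s" for s
    using M2.zeta_delta_eq[of ?G1 \<Lambda>1 s] pr by (simp add: B1_def PL1_def PG1_def)
  have d2: "zeta_delta ?G2 \<Lambda>2 A1 s = PL2 s / PG2 s" for s
    using M1.zeta_delta_eq[of ?G2 \<Lambda>2 s] pr by (simp add: B2_def PL2_def PG2_def)
  show ?thesis
  proof (intro exI[of _ "max N (max t1 t2)"] allI impI conjI)
    fix s :: complex assume "max N (max t1 t2) < Re s"
    then have s: "N < Re s" "t1 < Re s" "t2 < Re s" by auto
    show "zeta_converges (tensor ?L1 ?L2) s" "zeta_converges (tensor ?G1 ?G2) s" using convL convG s(1) by auto
    show "zeta_delta_converges ?G1 \<Lambda>1 A2 s"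
      using L1c[OF s(1)] G1c[OF s(1)] by (intro M2.zeta_delta_convergesI) (simp_all add: B1_def)
    show "zeta_delta_converges ?G2 \<Lambda>2 A1 s"
      using L2c[OF s(1)] G2c[OF s(1)] by (intro M1.zeta_delta_convergesI) (simp_all add: B2_def)
    \<comment> \<open>Without nonvanishing the quotients in the correction factors would not cancel
      against the factorization for the maximal orders.\<close>
    have "PG1 s \<noteq> 0" using t1 s(2) fin f1 pr M2.finite_local_index by (force simp: PG1_def prod_zero_iff)
    moreover have "PG2 s \<noteq> 0" using t2 s(3) fin f2 pr M1.finite_local_index by (force simp: PG2_def prod_zero_iff)
    ultimately show "zeta (tensor ?L1 ?L2) s =
        zeta (tensor ?G1 ?G2) s * zeta_delta ?G1 \<Lambda>1 A2 s * zeta_delta ?G2 \<Lambda>2 A1 s"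
      by (simp add: zL[OF s(1)] zG[OF s(1)] d1 d2 field_simps)
  qed
qed

end
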